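(* Let $\mathcal{X}$ be a torsion free Noetherian $\mathbb{F}_1$-scheme, let $X_{\mathfrak{M}_0}$ be the geometric realisation of $\mathcal{X}|_{\mathfrak{M}_0}$ and $X_{\mathbb{Z}}$ the geometric realisation of $\mathcal{X}|_{\mathfrak{CRing}}$, and let $N(t)\in\mathbb{Z}[t]$ be the counting function of $\mathcal{X}$. For $x\in X_{\mathfrak{M}_0}$ put $r(x):=\operatorname{rank}\mathcal{O}_{X_{\mathfrak{M}_0},x}^\times$, for $j\in\mathbb{Z}$, $n\in\mathbb{N}$ put $\kappa_j(n):=\frac1n\sum_{m\mid n}\mu\left(\frac nm\right)j^m$ ($\mu$ the Möbius function), and put \[\kappa(n,X_{\mathfrak{M}_0}):=\sum_{x\in X_{\mathfrak{M}_0}}\sum_{j=0}^{r(x)}(-1)^{r(x)-j}\binom{r(x)}{j}\kappa_j(n).\] Then \[\zeta_{\mathcal{X}/\mathbb{F}_1}(s)=\left(\frac1s\right)^{N(1)}\prod_{n=1}^\infty \left(1-\left(\frac1s\right)^n\right)^{-\kappa(n,X_{\mathfrak{M}_0})}.\] Moreover, if $X_{\mathbb{Z}}$ is of finite type over $\mathbb{Z}$, this infinite product converges absolutely for $|s|>\operatorname{reldim} X_{\mathbb{Z}}/\mathbb{Z}$, the relative dimension of $X_{\mathbb{Z}}$ over $\operatorname{Spec}\mathbb{Z}$.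
   Context: A monoid is a commutative multiplicative monoid with identity $1$ and an absorbing element $0$; $\mathfrak{M}_0$ is the category of monoids, $\mathfrak{CRing}$ that of commutative rings. For a monoid $M$, a prime ideal is a proper subset $\mathfrak{p}\subsetneq M$ with $\mathfrak{p}M\subset\mathfrak{p}$ and $M\setminus\mathfrak{p}$ multiplicatively closed; $\operatorname{spec}M$ is the set of prime ideals with the Zariski topology and the structure sheaf of localisations (as for rings). A monoid scheme (Deitmar) is a space with a sheaf of monoids locally isomorphic to some $\operatorname{spec}M$; for a point $x$, $\mathcal{O}_{X,x}^\times$ is the unit group of the stalk. The category $\mathfrak{MR}$ has objects those of $\mathfrak{M}_0$ and of $\mathfrak{CRing}$, morphisms within $\mathfrak{M}_0$ and within $\mathfrak{CRing}$ as usual, $\operatorname{Hom}(M,R):=\operatorname{Hom}_{\mathfrak{CRing}}(\mathbb{Z}[M],R)\cong\operatorname{Hom}_{\mathfrak{M}_0}(M,R)$ ($R$ viewed as multiplicative monoid), and $\operatorname{Hom}(R,M)=\emptyset$. An $\mathbb{F}_1$-scheme (Connes–Consani) is a functor $\mathcal{X}:\mathfrak{MR}\to\mathfrak{Set}$ such that $\mathcal{X}|_{\mathfrak{M}_0}\cong\operatorname{Hom}(\operatorname{spec}(\cdot),X_{\mathfrak{M}_0})$ for a monoid scheme $X_{\mathfrak{M}_0}$ (equivalently it admits an open covering by representable functors), $\mathcal{X}|_{\mathfrak{CRing}}\cong\operatorname{Hom}(\operatorname{Spec}(\cdot),X_{\mathbb{Z}})$ for a scheme $X_{\mathbb{Z}}$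 (these are the geometric realisations), and for every field $K$ the map $\mathcal{X}(K \text{ as monoid})\to\mathcal{X}(K)$ induced by the morphism corresponding to the identity of $K$ is bijective. It is Noetherian if $\mathcal{X}|_{\mathfrak{M}_0}$ is covered by finitely many open subfunctors $\operatorname{Hom}_{\mathfrak{M}_0}(M_i,\cdot)$ with $M_i$ finitely generated, and $X_{\mathbb{Z}}$ is covered similarly by finitely many spectra of Noetherian rings; it is torsion free if $\mathcal{O}_{X_{\mathfrak{M}_0},x}^\times$ is torsion free for all $x$. For such $\mathcal{X}$, $X_{\mathfrak{M}_0}$ is finite and the counting function is the polynomial $N(t)=\sum_{x\in X_{\mathfrak{M}_0}}(t-1)^{r(x)}\in\mathbb{Z}[t]$; it satisfies $\#\mathcal{X}|_{\mathfrak{M}_0}(\mathbb{F}_1[C_n])=N(n+1)$ ($C_n$ cyclic of order $n$, $\mathbb{F}_1[C_n]=C_n\cup\{0\}$) and $\#X_{\mathbb{Z}}(\mathbb{F}_q)=N(q)$ for all prime powers $q$. The absolute zeta function is $\zeta_{\mathcal{X}/\mathbb{F}_1}(s):=\lim_{p\to1}(p-1)^{N(1)}\exp\left(\sum_{m\ge1}\frac{N(p^m)}{m}p^{-sm}\right)$; if $N(t)=\sum_k a_kt^k$ this equals $\prod_k(s-k)^{-a_k}$. *)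

theory Defs
  imports
    "HOL-Complex_Analysis.Complex_Analysis"
    "HOL-Algebra.Generated_Rings"
    "HOL-Algebra.Ring_Divisibility"
    "HOL-Algebra.IntRing"
    "HOL-Computational_Algebra.Squarefree"
    "HOL-Number_Theory.Number_Theory"
begin

text \<open>
  The categories of monoids and of commutative rings consist of the structures whose carrier is
  a subset of a fixed type \<open>'u\<close>, which plays the role of the universe.  Structures are considered
  on their carrier only, and all morphisms are extensional functions, so that equality of
  morphisms is equality in HOL.
\<close>

section \<open>Monoids with an absorbing element\<close>

definition absorbing :: "('a, 'e) monoid_scheme \<Rightarrow> 'a \<Rightarrow> bool" where
  "absorbing M z \<longleftrightarrow> z \<in> carrier M \<and> (\<forall>x\<in>carrier M. z \<otimes>\<^bsub>M\<^esub> x = z \<and> x \<otimes>\<^bsub>M\<^esub> z = z)"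

definition mzero :: "('a, 'e) monoid_scheme \<Rightarrow> 'a" where
  "mzero M = (THE z. absorbing M z)"

definition mon0 :: "('a, 'e) monoid_scheme \<Rightarrow> bool" where
  "mon0 M \<longleftrightarrow> comm_monoid M \<and> (\<exists>z. absorbing M z)"

definition mon0_hom :: "('a, 'e) monoid_scheme \<Rightarrow> ('b, 'f) monoid_scheme \<Rightarrow> ('a \<Rightarrow> 'b) set" where
  "mon0_hom M N = {h \<in> hom M N. h \<one>\<^bsub>M\<^esub> = \<one>\<^bsub>N\<^esub> \<and> h (mzero M) = mzero N}"

text \<open>
  Ideals contain the absorbing element.  This matters: the empty set is closed under
  multiplication by elements of \<open>M\<close> and its complement is multiplicatively closed.
\<close>

definition mon_ideal :: "('a, 'e) monoid_scheme \<Rightarrow> 'a set \<Rightarrow> bool" where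
  "mon_ideal M I \<longleftrightarrow>
     I \<subseteq> carrier M \<and> mzero M \<in> I \<and> (\<forall>a\<in>I. \<forall>x\<in>carrier M. a \<otimes>\<^bsub>M\<^esub> x \<in> I)"

definition mon_prime :: "('a, 'e) monoid_scheme \<Rightarrow> 'a set \<Rightarrow> bool" where
  "mon_prime M p \<longleftrightarrow> mon_ideal M p \<and> p \<noteq> carrier M \<and>
     (\<forall>x\<in>carrier M - p. \<forall>y\<in>carrier M - p. x \<otimes>\<^bsub>M\<^esub> y \<in> carrier M - p)"

definition mon_fin_gen :: "('a, 'e) monoid_scheme \<Rightarrow> bool" where
  "mon_fin_gen M \<longleftrightarrow> (\<exists>S. finite S \<and> S \<subseteq> carrier M \<and>
     carrier M = \<Inter>{N. N \<subseteq> carrier M \<and> S \<subseteq> N \<and> \<one>\<^bsub>M\<^esub> \<in> N \<and> mzero M \<in> N \<and>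
                       (\<forall>x\<in>N. \<forall>y\<in>N. x \<otimes>\<^bsub>M\<^esub> y \<in> N)})"

text \<open>The monoids obtained from an abelian group by adjoining \<open>0\<close>.\<close>

definition group_with_zero :: "('a, 'e) monoid_scheme \<Rightarrow> bool" where
  "group_with_zero H \<longleftrightarrow> mon0 H \<and> Units H = carrier H - {mzero H}"

definition ring_fin_gen :: "('a, 'e) ring_scheme \<Rightarrow> bool" where
  "ring_fin_gen R \<longleftrightarrow> (\<exists>S. finite S \<and> S \<subseteq> carrier R \<and> generate_ring R S = carrier R)"

definition torsion_free_group :: "('a, 'e) monoid_scheme \<Rightarrow> bool" where
  "torsion_free_group G \<longleftrightarrow>
     (\<forall>g\<in>carrier G. \<forall>n::nat. n > 0 \<and> g [^]\<^bsub>G\<^esub> n = \<one>\<^bsub>G\<^esub> \<longrightarrow> g = \<one>\<^bsub>G\<^esub>)"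

definition int_independent :: "('a, 'e) monoid_scheme \<Rightarrow> 'a set \<Rightarrow> bool" where
  "int_independent G S \<longleftrightarrow> S \<subseteq> carrier G \<and> finite S \<and>
     (\<forall>c :: 'a \<Rightarrow> int. finprod G (\<lambda>g. g [^]\<^bsub>G\<^esub> c g) S = \<one>\<^bsub>G\<^esub> \<longrightarrow> (\<forall>g\<in>S. c g = 0))"

definition group_rank :: "('a, 'e) monoid_scheme \<Rightarrow> nat" where
  "group_rank G = (GREATEST n. \<exists>S. int_independent G S \<and> card S = n)"


section \<open>Spaces with a structure sheaf\<close>

text \<open>
  Both sheaves of monoids (\<open>'e = unit\<close>) and sheaves of rings are covered, since the record of
  rings extends that of monoids.  The parameters \<open>obj\<close> and \<open>H\<close> below are the objects and the
  homomorphisms of the category in which the sheaf takes its values.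
\<close>

record ('p, 's, 'e) sheafed_space =
  sp_top :: "'p topology"
  sections :: "'p set \<Rightarrow> ('s, 'e) monoid_scheme"
  res :: "'p set \<Rightarrow> 'p set \<Rightarrow> 's \<Rightarrow> 's"

type_synonym ('p, 's) mon_space = "('p, 's, unit) sheafed_space"
type_synonym ('p, 's) ring_space = "('p, 's, ('s, unit) ring_ext) sheafed_space"

abbreviation points :: "('p, 's, 'e) sheafed_space \<Rightarrow> 'p set" where
  "points X \<equiv> topspace (sp_top X)"

abbreviation opens :: "('p, 's, 'e) sheafed_space \<Rightarrow> 'p set set" where
  "opens X \<equiv> {U. openin (sp_top X) U}"

definition is_sheaf ::
  "(('s, 'e) monoid_scheme \<Rightarrow> bool)
   \<Rightarrow> (('s, 'e) monoid_scheme \<Rightarrow> ('s, 'e) monoid_scheme \<Rightarrow> ('s \<Rightarrow> 's) set)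
   \<Rightarrow> ('p, 's, 'e) sheafed_space \<Rightarrow> bool" where
  "is_sheaf obj H X \<longleftrightarrow>
     (\<forall>U\<in>opens X. obj (sections X U)) \<and>
     (\<forall>U\<in>opens X. \<forall>V\<in>opens X. V \<subseteq> U \<longrightarrow> res X U V \<in> H (sections X U) (sections X V)) \<and>
     (\<forall>U\<in>opens X. \<forall>s\<in>carrier (sections X U). res X U U s = s) \<and>
     (\<forall>U\<in>opens X. \<forall>V\<in>opens X. \<forall>W\<in>opens X. W \<subseteq> V \<and> V \<subseteq> U \<longrightarrow>
        (\<forall>s\<in>carrier (sections X U). res X V W (res X U V s) = res X U W s)) \<and>
     (\<forall>\<U> s. \<U> \<subseteq> opens X \<and> (\<forall>U\<in>\<U>. s U \<in> carrier (sections X U)) \<and>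
        (\<forall>U\<in>\<U>. \<forall>V\<in>\<U>. res X U (U \<inter> V) (s U) = res X V (U \<inter> V) (s V)) \<longrightarrow>
        (\<exists>!t. t \<in> carrier (sections X (\<Union>\<U>)) \<and> (\<forall>U\<in>\<U>. res X (\<Union>\<U>) U t = s U)))"

definition germ :: "('p, 's, 'e) sheafed_space \<Rightarrow> 'p \<Rightarrow> 'p set \<Rightarrow> 's \<Rightarrow> ('p set \<times> 's) set" where
  "germ X x U s = {(V, t). V \<in> opens X \<and> x \<in> V \<and> t \<in> carrier (sections X V) \<and>
     (\<exists>W\<in>opens X. x \<in> W \<and> W \<subseteq> U \<inter> V \<and> res X U W s = res X V W t)}"

text \<open>The multiplicative monoid of the stalk, also for sheaves of rings.\<close>

definition stalk :: "('p, 's, 'e) sheafed_space \<Rightarrow> 'p \<Rightarrow> ('p set \<times> 's) set monoid" where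
  "stalk X x =
     \<lparr>carrier = {germ X x U s | U s. U \<in> opens X \<and> x \<in> U \<and> s \<in> carrier (sections X U)},
      mult = (\<lambda>g h. \<Union>(U, s)\<in>g. \<Union>(V, t)\<in>h.
        germ X x (U \<inter> V) (res X U (U \<inter> V) s \<otimes>\<^bsub>sections X (U \<inter> V)\<^esub> res X V (U \<inter> V) t)),
      one = germ X x (points X) \<one>\<^bsub>sections X (points X)\<^esub>\<rparr>"

definition restrict_space_to :: "('p, 's, 'e) sheafed_space \<Rightarrow> 'p set \<Rightarrow> ('p, 's, 'e) sheafed_space" where
  "restrict_space_to X U = X\<lparr>sp_top := subtopology (sp_top X) U\<rparr>"

type_synonym ('p, 's, 'q, 't) space_map = "('p \<Rightarrow> 'q) \<times> ('q set \<Rightarrow> 't \<Rightarrow> 's)"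

definition preim :: "('p, 's, 'e) sheafed_space \<Rightarrow> ('p \<Rightarrow> 'q) \<Rightarrow> 'q set \<Rightarrow> 'p set" where
  "preim X f V = {x \<in> points X. f x \<in> V}"

text \<open>
  Morphisms from \<open>X\<close> to \<open>Y\<close>.  The last condition says that the maps induced on the stalks are
  local; for local rings this is the usual notion, as the maximal ideal consists of the non-units.
\<close>

definition space_homs ::
  "(('t, 'f) monoid_scheme \<Rightarrow> ('s, 'e) monoid_scheme \<Rightarrow> ('t \<Rightarrow> 's) set)
   \<Rightarrow> ('p, 's, 'e) sheafed_space \<Rightarrow> ('q, 't, 'f) sheafed_space \<Rightarrow> ('p, 's, 'q, 't) space_map set" where
  "space_homs H X Y = {(f, \<phi>).
     f \<in> extensional (points X) \<and> continuous_map (sp_top X) (sp_top Y) f \<and>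
     \<phi> \<in> extensional (opens Y) \<and>
     (\<forall>V\<in>opens Y. \<phi> V \<in> extensional (carrier (sections Y V)) \<and>
                   \<phi> V \<in> H (sections Y V) (sections X (preim X f V))) \<and>
     (\<forall>V\<in>opens Y. \<forall>W\<in>opens Y. W \<subseteq> V \<longrightarrow> (\<forall>t\<in>carrier (sections Y V).
        \<phi> W (res Y V W t) = res X (preim X f V) (preim X f W) (\<phi> V t))) \<and>
     (\<forall>V\<in>opens Y. \<forall>x\<in>preim X f V. \<forall>t\<in>carrier (sections Y V).
        germ X x (preim X f V) (\<phi> V t) \<in> Units (stalk X x) \<longrightarrow>
        germ Y (f x) V t \<in> Units (stalk Y (f x)))}"

definition comp_morphism ::
  "('p, 's, 'e) sheafed_space \<Rightarrow> ('q, 't, 'f) sheafed_space \<Rightarrow> ('r, 'w, 'g) sheafed_space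
   \<Rightarrow> ('q, 't, 'r, 'w) space_map \<Rightarrow> ('p, 's, 'q, 't) space_map \<Rightarrow> ('p, 's, 'r, 'w) space_map" where
  "comp_morphism X Y Z n m =
     (compose (points X) (fst n) (fst m),
      \<lambda>V\<in>opens Z. \<lambda>t\<in>carrier (sections Z V). snd m (preim Y (fst n) V) (snd n V t))"

definition isomorphic_spaces ::
  "(('t, 'f) monoid_scheme \<Rightarrow> ('s, 'e) monoid_scheme \<Rightarrow> ('t \<Rightarrow> 's) set)
   \<Rightarrow> ('p, 's, 'e) sheafed_space \<Rightarrow> ('q, 't, 'f) sheafed_space \<Rightarrow> bool" where
  "isomorphic_spaces H X Y \<longleftrightarrow> (\<exists>(f, \<phi>)\<in>space_homs H X Y.
     homeomorphic_map (sp_top X) (sp_top Y) f \<and>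
     (\<forall>V\<in>opens Y. bij_betw (\<phi> V) (carrier (sections Y V)) (carrier (sections X (preim X f V)))))"


section \<open>Spectra\<close>

definition zariski :: "'a set \<Rightarrow> 'a set set \<Rightarrow> 'a set topology" where
  "zariski A P = topology (\<lambda>U. \<exists>E\<subseteq>A. U = P - {p\<in>P. E \<subseteq> p})"

text \<open>
  The fraction \<open>a/f\<close> in the localisation at \<open>p\<close>.  In a ring the equivalence
  \<open>h(ag - bf) = 0\<close> is the same multiplicative condition as in a monoid.
\<close>

definition mk_frac :: "('a, 'e) monoid_scheme \<Rightarrow> 'a set \<Rightarrow> 'a \<Rightarrow> 'a \<Rightarrow> ('a \<times> 'a) set" where
  "mk_frac A p a f = {(b, g). b \<in> carrier A \<and> g \<in> carrier A - p \<and>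
     (\<exists>h\<in>carrier A - p. h \<otimes>\<^bsub>A\<^esub> (a \<otimes>\<^bsub>A\<^esub> g) = h \<otimes>\<^bsub>A\<^esub> (b \<otimes>\<^bsub>A\<^esub> f))}"

definition loc_mult ::
  "('a, 'e) monoid_scheme \<Rightarrow> 'a set \<Rightarrow> ('a \<times> 'a) set \<Rightarrow> ('a \<times> 'a) set \<Rightarrow> ('a \<times> 'a) set" where
  "loc_mult A p x y = (\<Union>(a, f)\<in>x. \<Union>(b, g)\<in>y. mk_frac A p (a \<otimes>\<^bsub>A\<^esub> b) (f \<otimes>\<^bsub>A\<^esub> g))"

definition loc_add ::
  "('a, 'e) ring_scheme \<Rightarrow> 'a set \<Rightarrow> ('a \<times> 'a) set \<Rightarrow> ('a \<times> 'a) set \<Rightarrow> ('a \<times> 'a) set" where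
  "loc_add A p x y =
     (\<Union>(a, f)\<in>x. \<Union>(b, g)\<in>y. mk_frac A p ((a \<otimes>\<^bsub>A\<^esub> g) \<oplus>\<^bsub>A\<^esub> (b \<otimes>\<^bsub>A\<^esub> f)) (f \<otimes>\<^bsub>A\<^esub> g))"

type_synonym 'a spec_section = "'a set \<Rightarrow> ('a \<times> 'a) set"

text \<open>Sections over \<open>U\<close>: families of elements of the localisations which are locally a fraction.\<close>

definition loc_sections ::
  "('a, 'e) monoid_scheme \<Rightarrow> 'a set topology \<Rightarrow> 'a set set \<Rightarrow> 'a spec_section set" where
  "loc_sections A T U = {s \<in> extensional U. \<forall>p\<in>U. \<exists>V. openin T V \<and> p \<in> V \<and> V \<subseteq> U \<and>
     (\<exists>a\<in>carrier A. \<exists>f\<in>carrier A. \<forall>q\<in>V. f \<notin> q \<and> s q = mk_frac A q a f)}"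

definition mspec :: "('a, 'e) monoid_scheme \<Rightarrow> ('a set, 'a spec_section) mon_space" where
  "mspec M = (let T = zariski (carrier M) {p. mon_prime M p} in
     \<lparr>sp_top = T,
      sections = (\<lambda>U. \<lparr>carrier = loc_sections M T U,
                       mult = (\<lambda>s t. \<lambda>p\<in>U. loc_mult M p (s p) (t p)),
                       one = (\<lambda>p\<in>U. mk_frac M p \<one>\<^bsub>M\<^esub> \<one>\<^bsub>M\<^esub>)\<rparr>),
      res = (\<lambda>U V s. restrict s V)\<rparr>)"

definition rspec :: "('a, 'e) ring_scheme \<Rightarrow> ('a set, 'a spec_section) ring_space" where
  "rspec R = (let T = zariski (carrier R) {p. primeideal p R} in
     \<lparr>sp_top = T,
      sections = (\<lambda>U. \<lparr>carrier = loc_sections R T U,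
                       mult = (\<lambda>s t. \<lambda>p\<in>U. loc_mult R p (s p) (t p)),
                       one = (\<lambda>p\<in>U. mk_frac R p \<one>\<^bsub>R\<^esub> \<one>\<^bsub>R\<^esub>),
                       zero = (\<lambda>p\<in>U. mk_frac R p \<zero>\<^bsub>R\<^esub> \<one>\<^bsub>R\<^esub>),
                       add = (\<lambda>s t. \<lambda>p\<in>U. loc_add R p (s p) (t p))\<rparr>),
      res = (\<lambda>U V s. restrict s V)\<rparr>)"

text \<open>
  The morphism from \<open>SB\<close>, the spectrum of \<open>B\<close>, to \<open>SA\<close>, the spectrum of \<open>A\<close>, induced by a
  homomorphism \<open>f\<close> from \<open>A\<close> to \<open>B\<close>.
\<close>

definition spec_map ::
  "('a set, 'a spec_section, 'e) sheafed_space \<Rightarrow> ('b set, 'b spec_section, 'f) sheafed_space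
   \<Rightarrow> ('a, 'g) monoid_scheme \<Rightarrow> ('b, 'h) monoid_scheme \<Rightarrow> ('a \<Rightarrow> 'b)
   \<Rightarrow> ('b set, 'b spec_section, 'a set, 'a spec_section) space_map" where
  "spec_map SA SB A B f = (let c = (\<lambda>q\<in>points SB. {a\<in>carrier A. f a \<in> q}) in
     (c, \<lambda>V\<in>opens SA. \<lambda>t\<in>carrier (sections SA V). \<lambda>q\<in>preim SB c V.
           \<Union>(a, g)\<in>t (c q). mk_frac B q (f a) (f g)))"


section \<open>Monoid schemes and schemes\<close>

abbreviation mon_affine :: "('p, 's) mon_space \<Rightarrow> 'p set \<Rightarrow> 's monoid \<Rightarrow> bool" where
  "mon_affine X U M \<equiv>
     openin (sp_top X) U \<and> mon0 M \<and> isomorphic_spaces mon0_hom (restrict_space_to X U) (mspec M)"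

definition mon_scheme :: "('p, 's) mon_space \<Rightarrow> bool" where
  "mon_scheme X \<longleftrightarrow> is_sheaf mon0 mon0_hom X \<and> (\<forall>x\<in>points X. \<exists>U M. x \<in> U \<and> mon_affine X U M)"

abbreviation ring_affine :: "('p, 's) ring_space \<Rightarrow> 'p set \<Rightarrow> 's ring \<Rightarrow> bool" where
  "ring_affine X U R \<equiv>
     openin (sp_top X) U \<and> cring R \<and> isomorphic_spaces ring_hom (restrict_space_to X U) (rspec R)"

definition scheme :: "('p, 's) ring_space \<Rightarrow> bool" where
  "scheme X \<longleftrightarrow> is_sheaf cring ring_hom X \<and> (\<forall>x\<in>points X. \<exists>U R. x \<in> U \<and> ring_affine X U R)"

definition finite_type_over_int :: "('p, 's) ring_space \<Rightarrow> bool" where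
  "finite_type_over_int X \<longleftrightarrow> (\<exists>\<U>. finite \<U> \<and> \<Union>\<U> = points X \<and>
     (\<forall>U\<in>\<U>. \<exists>R. ring_affine X U R \<and> ring_fin_gen R))"

definition irreducible_closed :: "'a topology \<Rightarrow> 'a set \<Rightarrow> bool" where
  "irreducible_closed T Z \<longleftrightarrow> closedin T Z \<and> Z \<noteq> {} \<and>
     (\<forall>A B. closedin T A \<and> closedin T B \<and> Z = A \<union> B \<longrightarrow> Z = A \<or> Z = B)"

text \<open>The Krull dimension; it is \<open>-\<infinity>\<close> for the empty space.\<close>

definition krull_dim :: "'a topology \<Rightarrow> ereal" where
  "krull_dim T = Sup {ereal (real n) | n. \<exists>Z. (\<forall>i\<le>n. irreducible_closed T (Z i)) \<and>
                                            (\<forall>i<n. Z i \<subset> Z (Suc i))}"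

text \<open>
  The relative dimension of a morphism: the supremum of the dimensions of its fibres.  The space
  underlying the fibre over \<open>y\<close> is the preimage of \<open>y\<close> with the subspace topology.
\<close>

definition rel_dim ::
  "('p, 's, 'e) sheafed_space \<Rightarrow> ('q, 't, 'f) sheafed_space \<Rightarrow> ('p, 's, 'q, 't) space_map \<Rightarrow> ereal" where
  "rel_dim X Y m = (SUP y\<in>points Y. krull_dim (subtopology (sp_top X) (preim X (fst m) {y})))"


section \<open>Functors on the category of monoids and rings\<close>

datatype 'u mr = Mon "'u monoid" | Rng "'u ring"

fun mr_obj :: "'u mr \<Rightarrow> bool" where
  "mr_obj (Mon M) = mon0 M"
| "mr_obj (Rng R) = cring R"

fun mr_carrier :: "'u mr \<Rightarrow> 'u set" where
  "mr_carrier (Mon M) = carrier M"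
| "mr_carrier (Rng R) = carrier R"

text \<open>
  A homomorphism from the ring of \<open>M\<close> over the integers to \<open>R\<close> is identified with its restriction
  to \<open>M\<close>, a monoid homomorphism to the multiplicative monoid of \<open>R\<close>.
\<close>

fun mr_hom :: "'u mr \<Rightarrow> 'u mr \<Rightarrow> ('u \<Rightarrow> 'u) set" where
  "mr_hom (Mon M) (Mon N) = mon0_hom M N \<inter> extensional (carrier M)"
| "mr_hom (Rng R) (Rng S) = ring_hom R S \<inter> extensional (carrier R)"
| "mr_hom (Mon M) (Rng R) = mon0_hom M R \<inter> extensional (carrier M)"
| "mr_hom (Rng R) (Mon M) = {}"

definition mult_monoid :: "'u ring \<Rightarrow> 'u monoid" where
  "mult_monoid R = \<lparr>carrier = carrier R, mult = mult R, one = one R\<rparr>"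

record ('u, 'v) mr_functor =
  fobj :: "'u mr \<Rightarrow> 'v set"
  fmap :: "'u mr \<Rightarrow> 'u mr \<Rightarrow> ('u \<Rightarrow> 'u) \<Rightarrow> 'v \<Rightarrow> 'v"

definition is_functor :: "('u, 'v) mr_functor \<Rightarrow> bool" where
  "is_functor F \<longleftrightarrow>
     (\<forall>A B. mr_obj A \<and> mr_obj B \<longrightarrow> (\<forall>f\<in>mr_hom A B. fmap F A B f \<in> fobj F A \<rightarrow> fobj F B)) \<and>
     (\<forall>A. mr_obj A \<longrightarrow> (\<forall>a\<in>fobj F A. fmap F A A (\<lambda>u\<in>mr_carrier A. u) a = a)) \<and>
     (\<forall>A B C. mr_obj A \<and> mr_obj B \<and> mr_obj C \<longrightarrow>
        (\<forall>f\<in>mr_hom A B. \<forall>g\<in>mr_hom B C. \<forall>a\<in>fobj F A.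
           fmap F A C (compose (mr_carrier A) g f) a = fmap F B C g (fmap F A B f a)))"

definition mon_realisation :: "('u, 'v) mr_functor \<Rightarrow> ('p, 'u) mon_space \<Rightarrow> bool" where
  "mon_realisation F X \<longleftrightarrow> (\<exists>\<eta>.
     (\<forall>M. mon0 M \<longrightarrow> bij_betw (\<eta> M) (fobj F (Mon M)) (space_homs mon0_hom (mspec M) X)) \<and>
     (\<forall>M N. mon0 M \<and> mon0 N \<longrightarrow> (\<forall>f\<in>mr_hom (Mon M) (Mon N). \<forall>a\<in>fobj F (Mon M).
        \<eta> N (fmap F (Mon M) (Mon N) f a) =
          comp_morphism (mspec N) (mspec M) X (\<eta> M a) (spec_map (mspec M) (mspec N) M N f))))"

definition ring_realisation :: "('u, 'v) mr_functor \<Rightarrow> ('q, 'u) ring_space \<Rightarrow> bool" where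
  "ring_realisation F X \<longleftrightarrow> (\<exists>\<eta>.
     (\<forall>R. cring R \<longrightarrow> bij_betw (\<eta> R) (fobj F (Rng R)) (space_homs ring_hom (rspec R) X)) \<and>
     (\<forall>R S. cring R \<and> cring S \<longrightarrow> (\<forall>f\<in>mr_hom (Rng R) (Rng S). \<forall>a\<in>fobj F (Rng R).
        \<eta> S (fmap F (Rng R) (Rng S) f a) =
          comp_morphism (rspec S) (rspec R) X (\<eta> R a) (spec_map (rspec R) (rspec S) R S f))))"

text \<open>\<open>F\<close> is an \<open>\<bbbF>\<^sub>1\<close>-scheme with geometric realisations \<open>XM\<close> and \<open>XZ\<close>.\<close>

definition F1_scheme ::
  "('u, 'v) mr_functor \<Rightarrow> ('p, 'u) mon_space \<Rightarrow> ('q, 'u) ring_space \<Rightarrow> bool" where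
  "F1_scheme F XM XZ \<longleftrightarrow> is_functor F \<and>
     mon_scheme XM \<and> mon_realisation F XM \<and>
     scheme XZ \<and> ring_realisation F XZ \<and>
     (\<forall>K. field K \<longrightarrow>
        bij_betw (fmap F (Mon (mult_monoid K)) (Rng K) (\<lambda>u\<in>carrier K. u))
          (fobj F (Mon (mult_monoid K))) (fobj F (Rng K)))"

text \<open>
  Open subfunctors and open coverings of functors on monoids are those of Connes and Consani.
  By Yoneda, a transformation from the functor represented by \<open>M\<close> is an element \<open>a\<close> of the value
  at \<open>M\<close>.  As for functors on rings, a covering is tested on fields, which for monoids are the
  abelian groups with zero.
\<close>

definition open_subfunctor :: "('u, 'v) mr_functor \<Rightarrow> ('u monoid \<Rightarrow> 'v set) \<Rightarrow> bool" where
  "open_subfunctor F G \<longleftrightarrow>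
     (\<forall>M. mon0 M \<longrightarrow> G M \<subseteq> fobj F (Mon M)) \<and>
     (\<forall>M N. mon0 M \<and> mon0 N \<longrightarrow>
        (\<forall>f\<in>mr_hom (Mon M) (Mon N). \<forall>a\<in>G M. fmap F (Mon M) (Mon N) f a \<in> G N)) \<and>
     (\<forall>M. mon0 M \<longrightarrow> (\<forall>a\<in>fobj F (Mon M). \<exists>I. mon_ideal M I \<and>
        (\<forall>N. mon0 N \<longrightarrow> (\<forall>f\<in>mr_hom (Mon M) (Mon N).
           fmap F (Mon M) (Mon N) f a \<in> G N \<longleftrightarrow>
           {f i \<otimes>\<^bsub>N\<^esub> n | i n. i \<in> I \<and> n \<in> carrier N} = carrier N))))"

definition represented_by :: "('u, 'v) mr_functor \<Rightarrow> ('u monoid \<Rightarrow> 'v set) \<Rightarrow> 'u monoid \<Rightarrow> bool" where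
  "represented_by F G M \<longleftrightarrow> (\<exists>\<eta>.
     (\<forall>N. mon0 N \<longrightarrow> bij_betw (\<eta> N) (mr_hom (Mon M) (Mon N)) (G N)) \<and>
     (\<forall>N L. mon0 N \<and> mon0 L \<longrightarrow>
        (\<forall>f\<in>mr_hom (Mon M) (Mon N). \<forall>g\<in>mr_hom (Mon N) (Mon L).
           \<eta> L (compose (carrier M) g f) = fmap F (Mon N) (Mon L) g (\<eta> N f))))"

definition F1_noetherian :: "('u, 'v) mr_functor \<Rightarrow> ('q, 'u) ring_space \<Rightarrow> bool" where
  "F1_noetherian F XZ \<longleftrightarrow>
     (\<exists>\<G>. finite \<G> \<and>
        (\<forall>G\<in>\<G>. open_subfunctor F G \<and> (\<exists>M. mon0 M \<and> mon_fin_gen M \<and> represented_by F G M)) \<and>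
        (\<forall>H. group_with_zero H \<longrightarrow> fobj F (Mon H) = (\<Union>G\<in>\<G>. G H))) \<and>
     (\<exists>\<U>. finite \<U> \<and> \<Union>\<U> = points XZ \<and>
        (\<forall>U\<in>\<U>. \<exists>R. ring_affine XZ U R \<and> noetherian_ring R))"

definition F1_torsion_free :: "('p, 'u) mon_space \<Rightarrow> bool" where
  "F1_torsion_free XM \<longleftrightarrow> (\<forall>x\<in>points XM. torsion_free_group (units_of (stalk XM x)))"


section \<open>Counting function, zeta function, and exponents\<close>

definition pt_rank :: "('p, 'u) mon_space \<Rightarrow> 'p \<Rightarrow> nat" where
  "pt_rank X x = group_rank (units_of (stalk X x))"

definition counting_function :: "('p, 'u) mon_space \<Rightarrow> int poly" where
  "counting_function X = (\<Sum>x\<in>points X. [:-1, 1:] ^ pt_rank X x)"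

text \<open>
  For \<open>p > 1\<close> the series in the definition converges only if the real part of \<open>s\<close> exceeds the
  degree of \<open>N\<close>; elsewhere the zeta function is the meromorphic continuation.  At a pole it has,
  as is usual in HOL, the value \<open>0\<close>.
\<close>

definition absolute_zeta :: "int poly \<Rightarrow> complex \<Rightarrow> complex" where
  "absolute_zeta N = (THE Z. Z nicely_meromorphic_on UNIV \<and>
     (\<forall>s. Re s > real (degree N) \<longrightarrow>
        ((\<lambda>p::real. of_real (p - 1) powi poly N 1 *
            exp (\<Sum>i. let m = Suc i in
                   poly (map_poly of_int N) (of_real (p ^ m)) / of_nat m * of_real p powr (- s * of_nat m)))
          \<longlongrightarrow> Z s) (at_right 1)))"

definition moebius_mu :: "nat \<Rightarrow> int" where
  "moebius_mu n = (if squarefree n then (- 1) ^ card (prime_factors n) else 0)"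

definition kappa :: "int \<Rightarrow> nat \<Rightarrow> rat" where
  "kappa j n = 1 / of_nat n * (\<Sum>m | m dvd n. of_int (moebius_mu (n div m) * j ^ m))"

definition kappa_scheme :: "nat \<Rightarrow> ('p, 'u) mon_space \<Rightarrow> rat" where
  "kappa_scheme n X = (\<Sum>x\<in>points X. \<Sum>j=0..pt_rank X x.
     (- 1) ^ (pt_rank X x - j) * of_nat (pt_rank X x choose j) * kappa (int j) n)"

text \<open>
  The factors of the product, indexed from \<open>0\<close>.  The numbers \<open>kappa_scheme n X\<close> are integers (see
  below), so that the floor only converts the type of the exponent.
\<close>

definition zeta_factor :: "('p, 'u) mon_space \<Rightarrow> complex \<Rightarrow> nat \<Rightarrow> complex" where
  "zeta_factor X s i = (1 - (1 / s) ^ Suc i) powi (- \<lfloor>kappa_scheme (Suc i) X\<rfloor>)"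

text \<open>Integrality of the exponents.\<close>

lemma cong_pow_prime_lift:
  fixes x y :: int and p :: nat
  assumes "[x = y] (mod int p ^ k)" "k > 0"
  shows "[x ^ p = y ^ p] (mod int p ^ Suc k)"
proof -
  have xy: "[x = y] (mod int p)"
    using assms by (meson cong_dvd_modulus dvd_power)
  have "[(\<Sum>i<p. y ^ (p - Suc i) * x ^ i) = (\<Sum>i<p. y ^ (p - Suc i) * y ^ i)] (mod int p)"
    by (intro cong_sum cong_mult cong_pow cong_refl xy)
  also have "(\<Sum>i<p. y ^ (p - Suc i) * y ^ i) = (\<Sum>i<p. y ^ (p - 1))"
    by (intro sum.cong refl) (simp flip: power_add)
  also have "[\<dots> = 0] (mod int p)"
    by (simp add: cong_0_iff)
  finally have "int p dvd (\<Sum>i<p. y ^ (p - Suc i) * x ^ i)"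
    by (simp add: cong_0_iff)
  moreover have "int p ^ k dvd x - y"
    using assms by (simp add: cong_iff_dvd_diff)
  ultimately have "int p ^ k * int p dvd (x - y) * (\<Sum>i<p. y ^ (p - Suc i) * x ^ i)"
    by (rule mult_dvd_mono[rotated])
  also have "\<dots> = x ^ p - y ^ p"
    by (rule power_diff_sumr2 [symmetric])
  finally show ?thesis
    by (simp add: cong_iff_dvd_diff mult.commute)
qed

lemma fermat_int:
  fixes j :: int and p :: nat
  assumes "Factorial_Ring.prime p"
  shows "[j ^ p = j] (mod int p)"
proof (cases "int p dvd j")
  case True
  then have "[j = 0] (mod int p)" by (simp add: cong_0_iff)
  moreover from this have "[j ^ p = 0 ^ p] (mod int p)" by (rule cong_pow)
  ultimately show ?thesis
    using prime_gt_0_nat[OF assms] by (metis cong_sym cong_trans zero_power)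
next
  case False
  define a where "a = nat (j mod int p)"
  have p: "p > 0" using assms prime_gt_0_nat by blast
  have ja: "[j = int a] (mod int p)"
    using p by (simp add: a_def cong_def)
  have "\<not> p dvd a"
    using False ja by (metis cong_dvd_iff int_dvd_int_iff cong_sym cong_0_iff cong_trans)
  then have "[a ^ (p - 1) = 1] (mod p)"
    by (rule fermat_theorem[OF assms])
  then have "[a ^ (p - 1) * a = 1 * a] (mod p)"
    by (rule cong_scalar_right)
  then have "[a ^ p = a] (mod p)"
    using p by (metis mult_1 power_minus_mult)
  then have "[int a ^ p = int a] (mod int p)"
    by (metis cong_int_iff of_nat_power)
  then show ?thesis
    using ja by (meson cong_pow cong_sym cong_trans)
qed

lemma cong_pow_prime_power:
  fixes j :: int and p :: nat
  assumes "Factorial_Ring.prime p"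
  shows "[j ^ (p ^ Suc k) = j ^ (p ^ k)] (mod int p ^ Suc k)"
proof (induction k)
  case 0
  show ?case using fermat_int[OF assms] by simp
next
  case (Suc k)
  from cong_pow_prime_lift[OF Suc] show ?case
    by (simp flip: power_mult add: mult.commute)
qed

lemma moebius_mu_prime_mult:
  assumes "Factorial_Ring.prime p" "\<not> p dvd e"
  shows "moebius_mu (p * e) = - moebius_mu e"
proof (cases "squarefree e")
  case True
  have cop: "coprime p e" using assms by (simp add: prime_imp_coprime)
  have e: "e \<noteq> 0" using True by (metis not_squarefree_0)
  have sq: "squarefree (p * e)"
    by (rule squarefree_mult_coprime[OF cop squarefree_prime[OF assms(1)] True])
  have "prime_factors (p * e) = insert p (prime_factors e)"
    using assms e by (subst prime_factors_product) (auto simp: prime_prime_factors)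
  moreover have "p \<notin> prime_factors e" using assms by auto
  ultimately show ?thesis using True sq by (simp add: moebius_mu_def)
next
  case False
  then have "\<not> squarefree (p * e)" using squarefree_multD by blast
  then show ?thesis using False by (simp add: moebius_mu_def)
qed

lemma prime_power_dvd_moebius_sum:
  fixes j :: int
  assumes p: "Factorial_Ring.prime p" and n: "n = p ^ Suc k * c" and c: "\<not> p dvd c"
  shows "int p ^ Suc k dvd (\<Sum>e | e dvd n. moebius_mu e * j ^ (n div e))"
proof -
  have p0: "p > 0" using p prime_gt_0_nat by blast
  have c0: "c > 0" using c by (cases c) auto
  have n0: "n > 0" using n p0 c0 by simp
  define D where "D = {e. e dvd c}"
  have fin: "finite D" using c0 by (simp add: D_def)
  have ndvd: "\<not> p dvd e" if "e \<in> D" for e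
    using that c by (auto simp: D_def intro: dvd_trans)
  let ?f = "\<lambda>e. moebius_mu e * j ^ (n div e)"
  have sub: "D \<union> (*) p ` D \<subseteq> {e. e dvd n}"
    by (auto simp: D_def n intro: dvd_mult mult_dvd_mono)
  have zero: "?f e = 0" if "e dvd n" "e \<notin> D \<union> (*) p ` D" for e
  proof -
    have "\<not> squarefree e"
    proof
      assume sf: "squarefree e"
      show False
      proof (cases "p dvd e")
        case True
        then obtain d where d: "e = p * d" by blast
        have "\<not> p dvd d"
        proof
          assume "p dvd d"
          then have "p ^ 2 dvd e" by (auto simp: d power2_eq_square intro: mult_dvd_mono)
          with sf have "p dvd 1" by (rule squarefreeD)
          with p show False by auto
        qed
        then have "coprime d (p ^ k)"
          using p by (metis coprime_commute coprime_power_left_iff prime_imp_coprime)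
        moreover have "d dvd p ^ k * c"
          using that(1) p0 by (simp add: n d mult.assoc)
        ultimately have "d dvd c" by (simp add: coprime_dvd_mult_right_iff)
        with d that(2) show False by (auto simp: D_def)
      next
        case False
        then have "coprime e (p ^ Suc k)"
          using p by (metis coprime_commute coprime_power_left_iff prime_imp_coprime)
        then have "e dvd c" using that(1) n by (simp add: coprime_dvd_mult_right_iff)
        with that(2) show False by (auto simp: D_def)
      qed
    qed
    then show ?thesis by (simp add: moebius_mu_def)
  qed
  have "(\<Sum>e | e dvd n. ?f e) = (\<Sum>e\<in>D \<union> (*) p ` D. ?f e)"
    using n0 sub zero by (intro sum.mono_neutral_right) auto
  also have "\<dots> = (\<Sum>e\<in>D. ?f e) + (\<Sum>e\<in>(*) p ` D. ?f e)"
    using fin by (intro sum.union_disjoint) (auto dest!: ndvd)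
  also have "(\<Sum>e\<in>(*) p ` D. ?f e) = (\<Sum>e\<in>D. ?f (p * e))"
    using p0 by (subst sum.reindex) (auto simp: inj_on_def)
  also have "(\<Sum>e\<in>D. ?f e) + \<dots> = (\<Sum>e\<in>D. ?f e + ?f (p * e))"
    by (simp add: sum.distrib)
  also have "\<dots> = (\<Sum>e\<in>D. moebius_mu e *
      ((j ^ (c div e)) ^ (p ^ Suc k) - (j ^ (c div e)) ^ (p ^ k)))"
  proof (intro sum.cong refl)
    fix e assume e: "e \<in> D"
    then have ec: "e dvd c" by (simp add: D_def)
    have 1: "n div e = c div e * p ^ Suc k"
      using ec by (simp add: n dvd_div_mult mult.commute[of _ c])
    have 2: "n div (p * e) = c div e * p ^ k"
      using ec p0 by (simp add: n mult.assoc dvd_div_mult mult.commute[of _ c])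
    show "?f e + ?f (p * e) = moebius_mu e *
      ((j ^ (c div e)) ^ (p ^ Suc k) - (j ^ (c div e)) ^ (p ^ k))"
      unfolding 1 2 moebius_mu_prime_mult[OF p ndvd[OF e]] power_mult
      by (simp add: algebra_simps)
  qed
  also have "int p ^ Suc k dvd \<dots>"
    using cong_pow_prime_power[OF p] by (intro dvd_sum dvd_mult) (simp add: cong_iff_dvd_diff)
  finally show ?thesis .
qed

lemma kappa_in_Ints:
  assumes "n > 0"
  shows "kappa j n \<in> \<int>"
proof -
  let ?S = "\<Sum>m | m dvd n. moebius_mu (n div m) * j ^ m"
  have S: "?S = (\<Sum>e | e dvd n. moebius_mu e * j ^ (n div e))"
    using assms
    by (intro sum.reindex_bij_witness[of _ "\<lambda>e. n div e" "\<lambda>e. n div e"])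
       (auto simp: div_dvd_iff_mult dvd_div_eq_mult)
  have "n dvd nat \<bar>?S\<bar>"
  proof (cases "?S = 0")
    case False
    show ?thesis
    proof (rule multiplicity_le_imp_dvd)
      show "n \<noteq> 0" using assms by simp
      fix p :: nat assume p: "Factorial_Ring.prime p"
      show "multiplicity p n \<le> multiplicity p (nat \<bar>?S\<bar>)"
      proof (cases "multiplicity p n")
        case (Suc k)
        obtain c where c: "n = p ^ Suc k * c" "\<not> p dvd c"
          using multiplicity_decompose'[of n p] assms p Suc
          by (metis not_prime_unit gr_implies_not0)
        have "int (p ^ Suc k) dvd ?S"
          using prime_power_dvd_moebius_sum[OF p c] unfolding S by simp
        then have "p ^ Suc k dvd nat \<bar>?S\<bar>"
          by (simp add: nat_dvd_iff del: power_Suc) 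
        with False p show ?thesis
          unfolding Suc by (intro multiplicity_geI) auto
      qed auto
    qed
  qed auto
  then have "int n dvd ?S" by (simp add: dvd_nat_abs_iff)
  then obtain q where "?S = int n * q" by blast
  then have "kappa j n = of_int q"
    using assms unfolding kappa_def of_int_sum[symmetric] by simp
  then show ?thesis by simp
qed

lemma kappa_scheme_in_Ints:
  assumes "n > 0"
  shows "kappa_scheme n X \<in> \<int>"
  unfolding kappa_scheme_def using kappa_in_Ints[OF assms] by (intro Ints_sum Ints_mult Ints_power) auto

end

theory Submission
  imports Defs "HOL-Computational_Algebra.Fundamental_Theorem_Algebra"
begin

text \<open>
  Write \<open>N = \<Sum>j. a\<^sub>j t^j\<close> and \<open>u = 1 / s\<close>.  Then \<open>\<kappa>(n) = \<Sum>j. a\<^sub>j \<kappa>\<^sub>j(n)\<close>, and by Moebius inversion the sum of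
  \<open>m \<kappa>\<^sub>j(m)\<close> over the divisors \<open>m\<close> of \<open>n\<close> is \<open>j^n\<close>.  Rearranging the logarithm of the product as a Lambert
  series gives \<open>\<Prod>j. (1 - j u)^(- a\<^sub>j)\<close>, absolutely convergent for \<open>d \<bar>u\<bar> < 1\<close>, where \<open>d\<close> is the
  largest rank; and the zeta function is \<open>\<Prod>j. (s - j)^(- a\<^sub>j)\<close>.

  For the second claim it suffices that the relative dimension is at least the rank \<open>r\<close> of the unit
  group of every stalk.  Let \<open>t\<^sub>1, \<dots>, t\<^sub>r\<close> be algebraically independent complex numbers, and \<open>L\<close> a
  countable subfield of the complex numbers that contains them and whose multiplicative group is
  divisible; being countable, \<open>L\<close> can be realised in the universe.  A family of \<open>r\<close> independent units
  in the stalk at \<open>x\<close> is mapped to \<open>t\<^sub>1, \<dots>, t\<^sub>r\<close> by a character of the unit group with values in \<open>L\<close>,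
  that is, by an \<open>L\<close>-valued point of the monoid scheme.  The corresponding \<open>L\<close>-valued point of the scheme
  lies in some \<open>Spec R\<close> with \<open>R\<close> finitely generated; it is defined over the field of fractions \<open>L'\<close> of the
  image of \<open>R\<close> in \<open>L\<close>.  As the points over fields of both schemes agree, the original point is defined
  over \<open>L'\<close> too, so \<open>L'\<close> contains \<open>t\<^sub>1, \<dots>, t\<^sub>r\<close>.  Specialising \<open>t\<^sub>r\<close>, then \<open>t\<^sub>r\<^sub>-\<^sub>1\<close>, and so on, to
  integers gives a chain of \<open>r + 1\<close> prime ideals of \<open>R\<close> over the zero ideal of the integers.
\<close>

section \<open>The product formula\<close>

text \<open>The definition provides no map between the two geometric realisations; they are linked
  only through points with values in fields. Information about the units of a monoid stalk therefore
  has to travel as a character with values in a field, and two demands then conflict: extending a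
  character from the subgroup generated by independent units to the whole unit group calls for a
  divisible value group, whereas the chain of primes calls for values that are quotients of elements
  of a finitely generated ring. Hence a large field builds the point, and the comparison of
  field-valued points over a subfield brings it down afterwards. The large field cannot be all of
  the complex numbers, since carriers lie in a universe that is only assumed infinite. Integers
  serve as values of the specialisations because there are infinitely many of them and every subring
  contains them. All specialisations end in a field of characteristic 0, so no positive integer is
  killed; this keeps the whole chain in one fibre.\<close>

text \<open>Only squarefree divisors contribute. For a prime p dividing n they come in pairs d, p d
  with p not dividing d, and the two members have opposite signs.\<close>

lemma sum_moebius_mu_divisors:
  assumes "n > 0"
  shows "(\<Sum>d | d dvd n. moebius_mu d) = (if n = 1 then 1 else 0)"
proof (cases "n = 1")
  case True
  then show ?thesis by (simp add: moebius_mu_def)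
next
  case False
  then obtain p where p: "Factorial_Ring.prime p" "p dvd n"
    using prime_factor_nat by blast
  define A where "A = {d. d dvd n \<and> squarefree d \<and> \<not> p dvd d}"
  have fin: "finite {d. d dvd n}" using assms by simp
  have p0: "p > 0" using p prime_gt_0_nat by blast
  have "(\<Sum>d | d dvd n. moebius_mu d) = (\<Sum>d\<in>A \<union> (*) p ` A. moebius_mu d)"
  proof (rule sum.mono_neutral_right[OF fin])
    show "A \<union> (*) p ` A \<subseteq> {d. d dvd n}"
      using p by (auto simp: A_def intro!: divides_mult prime_imp_coprime)
    show "\<forall>d\<in>{d. d dvd n} - (A \<union> (*) p ` A). moebius_mu d = 0"
    proof
      fix d assume d: "d \<in> {d. d dvd n} - (A \<union> (*) p ` A)"
      have "\<not> squarefree d"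
      proof
        assume sq: "squarefree d"
        then obtain e where e: "d = p * e" using d by (auto simp: A_def)
        have "\<not> p dvd e"
        proof
          assume "p dvd e"
          then have "p ^ 2 dvd d" by (auto simp: e power2_eq_square intro: mult_dvd_mono)
          with sq have "p dvd 1" by (rule squarefreeD)
          with p show False by auto
        qed
        moreover have "squarefree e" using sq e squarefree_multD by blast
        moreover have "e dvd n" using d e by (auto elim: dvd_mult_right)
        ultimately show False using d e by (auto simp: A_def)
      qed
      then show "moebius_mu d = 0" by (simp add: moebius_mu_def)
    qed
  qed
  also have "\<dots> = (\<Sum>d\<in>A. moebius_mu d) + (\<Sum>d\<in>(*) p ` A. moebius_mu d)"
    using fin by (intro sum.union_disjoint) (auto simp: A_def)
  also have "(\<Sum>d\<in>(*) p ` A. moebius_mu d) = (\<Sum>d\<in>A. moebius_mu (p * d))"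
    using p0 by (subst sum.reindex) (auto simp: inj_on_def)
  also have "\<dots> = (\<Sum>d\<in>A. - moebius_mu d)"
    using p by (intro sum.cong refl moebius_mu_prime_mult) (auto simp: A_def)
  finally show ?thesis using False by (simp add: sum_negf)
qed

text \<open>Writing k = m e turns the double sum into the sum over m of \<open>g m\<close> times the
  sum of \<mu> over the divisors of \<open>n div m\<close>, which is 0 unless m = n.\<close>

lemma sum_divisors_moebius_inversion:
  fixes g :: "nat \<Rightarrow> int"
  assumes "n > 0"
  shows "(\<Sum>k | k dvd n. \<Sum>m | m dvd k. moebius_mu (k div m) * g m) = g n"
proof -
  have "(\<Sum>k | k dvd n. \<Sum>m | m dvd k. moebius_mu (k div m) * g m) =
      (\<Sum>(k, m)\<in>Sigma {k. k dvd n} (\<lambda>k. {m. m dvd k}). moebius_mu (k div m) * g m)"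
    using assms by (subst sum.Sigma) (auto intro: finite_divisors_nat dvd_pos_nat)
  also have "\<dots> = (\<Sum>(m, e)\<in>Sigma {m. m dvd n} (\<lambda>m. {e. e dvd n div m}). moebius_mu e * g m)"
  proof (intro sum.reindex_bij_witness[of _ "\<lambda>(m, e). (m * e, m)" "\<lambda>(k, m). (m, k div m)"])
    fix a assume "a \<in> Sigma {k. k dvd n} (\<lambda>k. {m. m dvd k})"
    then obtain k m where "a = (k, m)" "k dvd n" "m dvd k" by auto
    then obtain e where a: "a = (m * e, m)" "m * e dvd n" by (metis dvdE)
    moreover have "m > 0" using a assms by (intro Nat.gr0I) auto
    ultimately show "(case case a of (k, m) \<Rightarrow> (m, k div m) of (m, e) \<Rightarrow> (m * e, m)) = a"
      "(case a of (k, m) \<Rightarrow> (m, k div m)) \<in> (SIGMA m:{m. m dvd n}. {e. e dvd n div m})"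
      "(case case a of (k, m) \<Rightarrow> (m, k div m) of (m, e) \<Rightarrow> moebius_mu e * g m) =
         (case a of (k, m) \<Rightarrow> moebius_mu (k div m) * g m)"
      by (auto simp: dvd_div_iff_mult mult.commute[of e m] intro: dvd_mult_left)
  next
    fix b assume "b \<in> (SIGMA m:{m. m dvd n}. {e. e dvd n div m})"
    then obtain m e where b: "b = (m, e)" "m dvd n" "e dvd n div m" by auto
    moreover have "m > 0" using b assms by (intro Nat.gr0I) auto
    ultimately show "(case case b of (m, e) \<Rightarrow> (m * e, m) of (k, m) \<Rightarrow> (m, k div m)) = b"
      "(case b of (m, e) \<Rightarrow> (m * e, m)) \<in> (SIGMA k:{k. k dvd n}. {m. m dvd k})"
      by (auto simp: dvd_div_iff_mult mult.commute[of e m])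
  qed
  also have "\<dots> = (\<Sum>m | m dvd n. \<Sum>e | e dvd n div m. moebius_mu e * g m)"
    using assms by (subst sum.Sigma) (auto intro!: finite_divisors_nat dest: dvd_div_eq_0_iff simp: div_greater_zero_iff dvd_imp_le dvd_pos_nat)
  also have "\<dots> = (\<Sum>m | m dvd n. if m = n then g n else 0)"
  proof (intro sum.cong refl)
    fix m assume m: "m \<in> {m. m dvd n}"
    then have m0: "n div m > 0" "m > 0" using assms by (auto simp: div_greater_zero_iff dvd_imp_le dvd_pos_nat)
    have "(n div m = 1) = (m = n)" using m assms by (auto simp: dvd_div_eq_mult)
    then show "(\<Sum>e | e dvd n div m. moebius_mu e * g m) = (if m = n then g n else 0)"
      unfolding sum_distrib_right[symmetric] sum_moebius_mu_divisors[OF m0(1)] by auto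
  qed
  also have "\<dots> = g n" using assms by simp
  finally show ?thesis .
qed

lemma sum_divisors_kappa:
  assumes "n > 0"
  shows "(\<Sum>k | k dvd n. of_nat k * kappa j k) = of_int (j ^ n)"
proof -
  have "(\<Sum>k | k dvd n. of_nat k * kappa j k) =
      (\<Sum>k | k dvd n. of_int (\<Sum>m | m dvd k. moebius_mu (k div m) * j ^ m))"
    using assms by (intro sum.cong refl) (auto simp: kappa_def dvd_pos_nat)
  also have "\<dots> = of_int (\<Sum>k | k dvd n. \<Sum>m | m dvd k. moebius_mu (k div m) * j ^ m)"
    by simp
  finally show ?thesis
    using sum_divisors_moebius_inversion[OF assms] by simp
qed

lemma abs_moebius_mu_le: "\<bar>moebius_mu n\<bar> \<le> 1"
  by (simp add: moebius_mu_def power_abs)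

text \<open>For j \<ge> 1 each divisor m contributes at most j^m \<le> j^n, and the factor 1 / n
  absorbs the number of divisors. This growth rate is the origin of the condition
  \<open>d * norm u < 1\<close> below.\<close>

lemma abs_kappa_le:
  assumes "n > 0"
  shows "\<bar>kappa (int j) n\<bar> \<le> of_nat (j ^ n)"
proof (cases "j = 0")
  case True
  have "kappa (int j) n = 0"
    using assms unfolding kappa_def True by (auto intro!: sum.neutral dest: dvd_pos_nat simp: zero_power)
  then show ?thesis by simp
next
  case False
  have "\<bar>\<Sum>m | m dvd n. (of_int (moebius_mu (n div m) * int j ^ m) :: rat)\<bar> \<le>
      (\<Sum>m | m dvd n. \<bar>of_int (moebius_mu (n div m) * int j ^ m)\<bar>)"
    by (rule sum_abs)
  also have "\<dots> \<le> (\<Sum>m | m dvd n. of_nat (j ^ n))"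
  proof (rule sum_mono)
    fix m assume "m \<in> {m. m dvd n}"
    then have "m \<le> n" using assms by (auto intro: dvd_imp_le)
    then have "j ^ m \<le> j ^ n" using False by (intro power_increasing) auto
    have "\<bar>moebius_mu (n div m) * int j ^ m\<bar> \<le> 1 * int j ^ m"
      unfolding abs_mult using abs_moebius_mu_le by (intro mult_mono) auto
    also have "\<dots> \<le> int (j ^ n)" using \<open>j ^ m \<le> j ^ n\<close> by (metis mult_1 of_nat_mono of_nat_power)
    finally show "\<bar>of_int (moebius_mu (n div m) * int j ^ m) :: rat\<bar> \<le> of_nat (j ^ n)"
      using of_int_le_iff[where 'a = rat, THEN iffD2] by fastforce
  qed
  also have "\<dots> = of_nat (card {m. m dvd n}) * of_nat (j ^ n)" by simp
  also have "\<dots> \<le> of_nat n * of_nat (j ^ n)"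
  proof -
    have "card {m. m dvd n} \<le> card {1..n}"
      using assms by (intro card_mono) (auto dest: dvd_pos_nat dvd_imp_le simp: Suc_le_eq)
    then show ?thesis by (intro mult_right_mono) auto
  qed
  finally show ?thesis
    using assms by (simp add: kappa_def abs_mult field_simps)
qed

section \<open>Logarithms and Lambert series\<close>

lemma Ln_one_minus_sums:
  fixes v :: complex
  assumes "norm v < 1"
  shows "(\<lambda>m. v ^ Suc m / of_nat (Suc m)) sums (- Ln (1 - v))"
proof -
  have "(\<lambda>n. - (v ^ n) / of_nat n) sums ln (1 - v)"
    using Ln_series'[of "-v"] assms by simp
  then have "(\<lambda>n. - (v ^ Suc n) / of_nat (Suc n)) sums ln (1 - v)"
    by (subst sums_Suc_iff) simp
  from sums_minus[OF this] show ?thesis by simp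
qed

text \<open>The family k(i) u^(i m) / m is summed in two orders: for fixed i it gives the logarithm
  of one factor, and collecting the terms with i m = N gives 1 / N times the divisor sum at N.
  Absolute summability of the double family justifies the exchange. All indices in the code are
  shifted by one.\<close>

lemma sums_Ln_lambert:
  fixes k :: "nat \<Rightarrow> int" and u :: complex and C d :: real
  assumes k: "\<And>n. n > 0 \<Longrightarrow> \<bar>of_int (k n)\<bar> \<le> C * d ^ n" and d: "d \<ge> 1" "d * norm u < 1"
    and S: "(\<lambda>N. of_int (\<Sum>n | n dvd Suc N. int n * k n) * u ^ Suc N / of_nat (Suc N)) sums S"
  shows "(\<lambda>i. - of_int (k (Suc i)) * Ln (1 - u ^ Suc i)) sums S"
proof -
  define f :: "nat \<times> nat \<Rightarrow> complex"
    where "f = (\<lambda>(i, m). of_int (k (Suc i)) * u ^ (Suc i * Suc m) / of_nat (Suc m))"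
  have u: "norm u < 1"
    using d mult_right_mono[of 1 d "norm u"] by simp
  have C: "C \<ge> 0"
    using order_trans[OF abs_ge_zero k[of 1]] d by (simp add: zero_le_mult_iff)
  \<comment> \<open>A majorant with separated variables: the denominator is dropped, and the
    exponent (i + 1)(m + 1) is lowered to (i + 1) + m, which is allowed because |u| < 1.\<close>
  have geo: "(\<lambda>(i, m). C * (d * norm u) ^ Suc i * norm u ^ m) summable_on (UNIV \<times> UNIV)"
  proof (rule summable_on_SigmaI)
    fix i :: nat
    have "(\<lambda>m. norm u ^ m) sums (1 / (1 - norm u))" using u by (intro geometric_sums) simp
    then have "((\<lambda>m. norm u ^ m) has_sum (1 / (1 - norm u))) UNIV"
      by (rule sums_nonneg_imp_has_sum) simp
    from has_sum_cmult_right[OF this, of "C * (d * norm u) ^ Suc i"]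
    show "((\<lambda>m. case (i, m) of (i, m) \<Rightarrow> C * (d * norm u) ^ Suc i * norm u ^ m) has_sum
         C * (d * norm u) ^ Suc i * (1 / (1 - norm u))) UNIV" by simp
  next
    have "summable (\<lambda>i. (d * norm u) ^ i)" using d by (intro summable_geometric) simp
    then have "(\<lambda>i. (d * norm u) ^ i) summable_on UNIV"
      using d by (subst summable_on_UNIV_nonneg_real_iff) auto
    from summable_on_cmult_left[OF summable_on_cmult_right[OF this, of "C * (d * norm u)"], of "1 / (1 - norm u)"]
    show "(\<lambda>i. C * (d * norm u) ^ Suc i * (1 / (1 - norm u))) summable_on UNIV"
      by (simp add: mult_ac)
  qed (use C d in auto)
  have "(\<lambda>x. norm (f x)) summable_on (UNIV \<times> UNIV)"
  proof (rule Infinite_Sum.abs_summable_on_comparison_test'[OF geo])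
    fix x :: "nat \<times> nat" assume "x \<in> UNIV \<times> UNIV"
    obtain i m where x: "x = (i, m)" by (cases x)
    have "norm (f x) = \<bar>of_int (k (Suc i))\<bar> * norm u ^ (Suc i * Suc m) / of_nat (Suc m)"
      by (simp add: f_def x norm_mult norm_divide norm_power del: of_nat_Suc)
    also have "\<dots> \<le> \<bar>of_int (k (Suc i))\<bar> * norm u ^ (Suc i * Suc m) / 1"
      by (intro divide_left_mono) auto
    also have "norm u ^ (Suc i * Suc m) \<le> norm u ^ (Suc i + m)"
      using u by (intro power_decreasing) auto
    also have "\<bar>of_int (k (Suc i))\<bar> * norm u ^ (Suc i + m) / 1 \<le> C * d ^ Suc i * norm u ^ (Suc i + m)"
      using k[of "Suc i"] by (simp add: mult_right_mono)
    also have "\<dots> = (case x of (i, m) \<Rightarrow> C * (d * norm u) ^ Suc i * norm u ^ m)"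
      by (simp add: x power_add power_mult_distrib mult_ac)
    finally show "norm (f x) \<le> (case x of (i, m) \<Rightarrow> C * (d * norm u) ^ Suc i * norm u ^ m)"
      by (simp add: mult_left_mono)
  qed
  then have "f summable_on (UNIV \<times> UNIV)" by (rule abs_summable_summable)
  then obtain T where T: "(f has_sum T) (UNIV \<times> UNIV)" by (auto simp: summable_on_def)
  have "((\<lambda>i. - of_int (k (Suc i)) * Ln (1 - u ^ Suc i)) has_sum T) UNIV"
  proof (rule has_sum_SigmaD[OF T])
    fix i :: nat
    have v: "norm (u ^ Suc i) < 1" using u by (simp add: norm_power power_less_one_iff del: power_Suc)
    have "summable (\<lambda>m. norm ((u ^ Suc i) ^ Suc m / of_nat (Suc m)))"
    proof (rule summable_comparison_test')
      show "summable (\<lambda>m. norm (u ^ Suc i) ^ Suc m)"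
        using v summable_Suc_iff[of "\<lambda>m. norm (u ^ Suc i) ^ m"] by (simp add: summable_geometric)
      show "norm (norm ((u ^ Suc i) ^ Suc m / of_nat (Suc m))) \<le> norm (u ^ Suc i) ^ Suc m"
        if "m \<ge> 0" for m
        by (simp add: norm_divide norm_power field_simps del: power_Suc of_nat_Suc)
           (simp add: mult_le_cancel_right1 del: power_Suc)
    qed
    then have "((\<lambda>m. (u ^ Suc i) ^ Suc m / of_nat (Suc m)) has_sum (- Ln (1 - u ^ Suc i))) UNIV"
      using Ln_one_minus_sums[OF v] by (rule norm_summable_imp_has_sum)
    from has_sum_cmult_right[OF this, of "of_int (k (Suc i))"]
    show "((\<lambda>m. f (i, m)) has_sum - of_int (k (Suc i)) * Ln (1 - u ^ Suc i)) UNIV"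
      unfolding f_def prod.case power_mult by simp
  qed
  then have sT: "(\<lambda>i. - of_int (k (Suc i)) * Ln (1 - u ^ Suc i)) sums T" by (rule has_sum_imp_sums)
  \<comment> \<open>The same family, indexed by N with N + 1 = (i + 1)(m + 1) and by the divisor n =
    i + 1; the cofactor m + 1 is \<open>Suc N div n\<close>.\<close>
  define g :: "nat \<times> nat \<Rightarrow> complex"
    where "g = (\<lambda>(N, n). of_int (k n) * u ^ Suc N / of_nat (Suc N div n))"
  have "(f has_sum T) (UNIV \<times> UNIV) = (g has_sum T) (Sigma UNIV (\<lambda>N. {n. n dvd Suc N}))"
  proof (rule has_sum_reindex_bij_witness[of _ "\<lambda>(N, n). (n - 1, Suc N div n - 1)" "\<lambda>(i, m). (Suc i * Suc m - 1, Suc i)"])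
    fix b :: "nat \<times> nat" assume "b \<in> Sigma UNIV (\<lambda>N. {n. n dvd Suc N})"
    then obtain N n where b: "b = (N, n)" "n dvd Suc N" by auto
    then obtain e where e: "Suc N = n * e" by blast
    then have pos: "n > 0" "e > 0" by (auto intro: Nat.gr0I)
    then have *: "Suc (n - 1) * Suc (e - 1) - 1 = N" using e by (simp only: Suc_diff_1 flip: e)
    have **: "n * e div n = e" using pos by simp
    then show "(case case b of (N, n) \<Rightarrow> (n - 1, Suc N div n - 1) of (i, m) \<Rightarrow> (Suc i * Suc m - 1, Suc i)) = b"
      unfolding b(1) prod.case e ** * using pos by simp
  next
    fix a :: "nat \<times> nat"
    obtain i m where a: "a = (i, m)" by (cases a)
    have *: "Suc (Suc i * Suc m - 1) = Suc i * Suc m" by simp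
    show "(case case a of (i, m) \<Rightarrow> (Suc i * Suc m - 1, Suc i) of (N, n) \<Rightarrow> (n - 1, Suc N div n - 1)) = a"
      unfolding a prod.case * by (subst nonzero_mult_div_cancel_left) auto
    show "g (case a of (i, m) \<Rightarrow> (Suc i * Suc m - 1, Suc i)) = f a"
      unfolding a g_def f_def prod.case * by (subst nonzero_mult_div_cancel_left) auto
    show "(case a of (i, m) \<Rightarrow> (Suc i * Suc m - 1, Suc i)) \<in> Sigma UNIV (\<lambda>N. {n. n dvd Suc N})"
      unfolding a prod.case mem_Sigma_iff mem_Collect_eq * by (simp only: dvd_triv_left UNIV_I simp_thms)
  qed auto
  with T have g: "(g has_sum T) (Sigma UNIV (\<lambda>N. {n. n dvd Suc N}))" by simp
  have "((\<lambda>N. of_int (\<Sum>n | n dvd Suc N. int n * k n) * u ^ Suc N / of_nat (Suc N)) has_sum T) UNIV"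
  proof (rule has_sum_SigmaD[OF g])
    fix N :: nat
    have "(\<Sum>n | n dvd Suc N. g (N, n)) = (\<Sum>n | n dvd Suc N. of_int (int n * k n) * u ^ Suc N / of_nat (Suc N))"
    proof (rule sum.cong[OF refl])
      fix n assume "n \<in> {n. n dvd Suc N}"
      then obtain e where e: "Suc N = n * e" by blast
      then have "n > 0" "e > 0" by (auto intro: Nat.gr0I)
      then show "g (N, n) = of_int (int n * k n) * u ^ Suc N / of_nat (Suc N)"
        unfolding g_def prod.case e by (simp add: field_simps)
    qed
    also have "\<dots> = of_int (\<Sum>n | n dvd Suc N. int n * k n) * u ^ Suc N / of_nat (Suc N)"
      unfolding of_int_sum sum_distrib_right sum_divide_distrib ..
    finally show "((\<lambda>y. g (N, y)) has_sum of_int (\<Sum>n | n dvd Suc N. int n * k n) * u ^ Suc N / of_nat (Suc N)) {n. n dvd Suc N}"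
      using has_sum_finite[of "{n. n dvd Suc N}" "\<lambda>y. g (N, y)"] by simp
  qed
  then have "T = S" using has_sum_imp_sums S sums_unique2 by blast
  with sT show ?thesis by simp
qed

text \<open>Both claims are statements about the exponentials of the numbers \<open>w i\<close>.
  Since all exponents are integers, exp undoes the principal logarithm exactly and no branch has to
  be tracked. The single number d bounds the growth of k and the degree of N, so that |j u| < 1 for
  every j that occurs.\<close>

lemma lambert_has_prod:
  fixes k :: "nat \<Rightarrow> int" and u :: complex and C d :: real and N :: "int poly"
  assumes k: "\<And>n. n > 0 \<Longrightarrow> \<bar>of_int (k n)\<bar> \<le> C * d ^ n" and d: "d \<ge> 1" "d * norm u < 1" "real (degree N) \<le> d"
    and N: "\<And>n. n > 0 \<Longrightarrow> (\<Sum>m | m dvd n. int m * k m) = (\<Sum>j\<le>degree N. Polynomial.coeff N j * int j ^ n)"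
  shows "(\<lambda>i. (1 - u ^ Suc i) powi (- k (Suc i))) has_prod (\<Prod>j\<le>degree N. (1 - of_nat j * u) powi (- Polynomial.coeff N j))"
    and "abs_convergent_prod (\<lambda>i. (1 - u ^ Suc i) powi (- k (Suc i)))"
proof -
  have u: "norm u < 1"
    using d mult_right_mono[of 1 d "norm u"] by simp
  have C: "C \<ge> 0"
    using order_trans[OF abs_ge_zero k[of 1]] d by (simp add: zero_le_mult_iff)
  define w where "w i = - of_int (k (Suc i)) * Ln (1 - u ^ Suc i)" for i
  define S where "S = (\<Sum>j\<le>degree N. of_int (Polynomial.coeff N j) * (- Ln (1 - of_nat j * u)))"
  have uj: "norm (of_nat j * u) < 1" if "j \<le> degree N" for j
  proof -
    have "norm (of_nat j * u) = real j * norm u" by (simp add: norm_mult)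
    also have "\<dots> \<le> d * norm u" using that d by (intro mult_right_mono) auto
    finally show ?thesis using d by simp
  qed
  have unz: "1 - u ^ Suc i \<noteq> 0" for i
  proof
    assume "1 - u ^ Suc i = 0"
    then have "norm (u ^ Suc i) = 1" by (metis eq_iff_diff_eq_0 norm_one)
    moreover have "norm (u ^ Suc i) < 1" using u by (simp add: norm_power power_less_one_iff del: power_Suc)
    ultimately show False by simp
  qed
  have fac: "(1 - u ^ Suc i) powi (- k (Suc i)) = exp (w i)" for i
  proof -
    have "(1 - u ^ Suc i) powi (- k (Suc i)) = exp (Ln (1 - u ^ Suc i)) powi (- k (Suc i))"
      using unz[of i] by simp
    also have "\<dots> = exp (w i)" by (simp add: exp_power_int w_def del: exp_Ln)
    finally show ?thesis .
  qed
  have fac': "(1 - of_nat j * u) powi (- Polynomial.coeff N j) = exp (of_int (Polynomial.coeff N j) * (- Ln (1 - of_nat j * u)))"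
    if "j \<le> degree N" for j
  proof -
    have "1 - of_nat j * u \<noteq> 0" using uj[OF that] by (metis eq_iff_diff_eq_0 less_irrefl norm_one)
    then have "(1 - of_nat j * u) powi (- Polynomial.coeff N j) = exp (Ln (1 - of_nat j * u)) powi (- Polynomial.coeff N j)"
      by simp
    also have "\<dots> = exp (of_int (Polynomial.coeff N j) * (- Ln (1 - of_nat j * u)))" by (simp add: exp_power_int del: exp_Ln)
    finally show ?thesis .
  qed
  have "w sums S"
    unfolding w_def
  proof (rule sums_Ln_lambert[OF k d(1,2)])
    have "(\<lambda>n. \<Sum>j\<le>degree N. of_int (Polynomial.coeff N j) * ((of_nat j * u) ^ Suc n / of_nat (Suc n))) sums S"
      unfolding S_def by (intro sums_sum sums_mult Ln_one_minus_sums uj) auto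
    also have "(\<lambda>n. \<Sum>j\<le>degree N. of_int (Polynomial.coeff N j) * ((of_nat j * u) ^ Suc n / of_nat (Suc n))) =
       (\<lambda>n. of_int (\<Sum>m | m dvd Suc n. int m * k m) * u ^ Suc n / of_nat (Suc n))"
    proof
      fix n :: nat
      show "(\<Sum>j\<le>degree N. of_int (Polynomial.coeff N j) * ((of_nat j * u) ^ Suc n / of_nat (Suc n))) =
        of_int (\<Sum>m | m dvd Suc n. int m * k m) * u ^ Suc n / of_nat (Suc n)"
        unfolding N[OF zero_less_Suc] of_int_sum sum_distrib_right sum_divide_distrib
        by (intro sum.cong refl) (simp add: power_mult_distrib mult_ac del: of_nat_Suc)
    qed
    finally show "(\<lambda>n. of_int (\<Sum>m | m dvd Suc n. int m * k m) * u ^ Suc n / of_nat (Suc n)) sums S" .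
  qed
  then have "(\<lambda>i. exp (w i)) has_prod exp S"
    by (simp add: has_prod_def sums_imp_has_prod_exp)
  also have "exp S = (\<Prod>j\<le>degree N. (1 - of_nat j * u) powi (- Polynomial.coeff N j))"
    unfolding S_def by (subst exp_sum) (auto simp: fac' intro!: prod.cong)
  finally show "(\<lambda>i. (1 - u ^ Suc i) powi (- k (Suc i))) has_prod (\<Prod>j\<le>degree N. (1 - of_nat j * u) powi (- Polynomial.coeff N j))"
    by (simp only: fac)
  \<comment> \<open>\<open>norm_Ln_le\<close> asks for an argument of norm below 1/2, so the
    geometric bound is established only from some index on.\<close>
  have ev: "\<forall>\<^sub>F i in sequentially. norm (w i) \<le> 2 * C * (d * norm u) * (d * norm u) ^ i"
  proof -
    have "(\<lambda>i. norm u ^ i) \<longlonglongrightarrow> 0" using u by (intro LIMSEQ_power_zero) simp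
    then have "\<forall>\<^sub>F i in sequentially. norm u ^ i < 1 / 2" by (rule order_tendstoD) simp
    then have "\<forall>\<^sub>F i in sequentially. norm u ^ Suc i < 1 / 2"
      by (rule eventually_compose_filterlim) (rule filterlim_Suc)
    then show ?thesis
    proof eventually_elim
      case (elim i)
      have "norm (w i) = \<bar>of_int (k (Suc i))\<bar> * cmod (Ln (1 + (- (u ^ Suc i))))"
        by (simp add: w_def norm_mult)
      also have "\<dots> \<le> (C * d ^ Suc i) * (2 * norm (- (u ^ Suc i)))"
        using elim C d by (intro mult_mono k norm_Ln_le) (auto simp: norm_power norm_mult)
      also have "\<dots> = 2 * C * (d * norm u) * (d * norm u) ^ i"
        by (simp add: norm_power norm_mult power_mult_distrib)
      finally show ?case .
    qed
  qed
  have sumw: "summable (\<lambda>i. norm (w i))"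
    by (rule summable_comparison_test_ev[where g = "\<lambda>i. 2 * C * (d * norm u) * (d * norm u) ^ i"])
       (use ev d in \<open>auto intro!: summable_mult summable_geometric\<close>)
  \<comment> \<open>For small w the distance of exp w from 1 is at most 3/2 |w|; this carries
    summability from the logarithms to the factors.\<close>
  have "(\<lambda>i. norm (w i)) \<longlonglongrightarrow> 0" by (rule summable_LIMSEQ_zero[OF sumw])
  then have "\<forall>\<^sub>F i in sequentially. norm (w i) < 1 / 2" by (rule order_tendstoD) simp
  then have "\<forall>\<^sub>F i in sequentially. norm (norm (exp (w i) - 1)) \<le> 3 / 2 * norm (w i)"
  proof eventually_elim
    case (elim i)
    then show ?case using norm_exp_bounds(2)[of "w i"] by simp
  qed
  then have "summable (\<lambda>i. norm (exp (w i) - 1))"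
    by (rule summable_comparison_test_ev) (intro summable_mult sumw)
  then show "abs_convergent_prod (\<lambda>i. (1 - u ^ Suc i) powi (- k (Suc i)))"
    unfolding fac by (simp add: abs_convergent_prod_conv_summable)
qed

section \<open>Meromorphic continuation of the zeta function\<close>

text \<open>A meromorphic difference that vanishes on a nonempty open set vanishes outside a sparse
  set. Then f and g agree near every point, so they have the same poles and limits; at a pole both
  take the value 0 by niceness, elsewhere both equal their limit.\<close>

lemma nicely_meromorphic_on_eqI:
  assumes f: "f nicely_meromorphic_on UNIV" and g: "g nicely_meromorphic_on UNIV"
    and A: "open A" "A \<noteq> {}" "\<And>z. z \<in> A \<Longrightarrow> f z = g z"
  shows "f = g"
proof
  fix z
  have "(\<lambda>z. f z - g z) meromorphic_on UNIV"
    using f g by (auto simp: nicely_meromorphic_on_def intro!: meromorphic_intros)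
  then have "(\<forall>\<^sub>\<approx>x\<in>UNIV. f x - g x = 0) \<or> (\<forall>\<^sub>\<approx>x\<in>UNIV. f x - g x \<noteq> 0)"
    by (rule meromorphic_imp_constant_or_avoid) auto
  moreover have "\<not> (\<forall>\<^sub>\<approx>x\<in>UNIV. f x - g x \<noteq> 0)"
  proof
    assume *: "\<forall>\<^sub>\<approx>x\<in>UNIV. f x - g x \<noteq> 0"
    obtain a where a: "a \<in> A" using A by auto
    have "\<forall>\<^sub>F x in at a. f x - g x \<noteq> 0"
      using * by (rule eventually_cosparse_imp_eventually_at) auto
    moreover have "\<forall>\<^sub>F x in at a. x \<in> A"
      using A a by (simp add: eventually_at_in_open')
    ultimately have "\<forall>\<^sub>F x in at a. False"
      by eventually_elim (use A in auto)
    then show False by simp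
  qed
  ultimately have "\<forall>\<^sub>\<approx>x\<in>UNIV. f x - g x = 0" by blast
  then have "\<forall>\<^sub>F x in at z. f x - g x = 0"
    by (rule eventually_cosparse_imp_eventually_at) auto
  then have ev: "\<forall>\<^sub>F x in at z. f x = g x" by simp
  have pole: "is_pole f z = is_pole g z"
    using ev by (intro is_pole_cong) auto
  show "f z = g z"
  proof (cases "is_pole f z")
    case True
    have "\<not> f \<midarrow>z\<rightarrow> f z" "\<not> g \<midarrow>z\<rightarrow> g z" using True pole not_tendsto_and_filterlim_at_infinity[of "at z"]
      unfolding is_pole_def by auto
    then have "f z = 0" "g z = 0" using f g by (auto simp: nicely_meromorphic_on_def)
    then show ?thesis by simp
  next
    case False
    then have "f \<midarrow>z\<rightarrow> f z" "g \<midarrow>z\<rightarrow> g z" using f g pole by (auto simp: nicely_meromorphic_on_def)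
    then have "g \<midarrow>z\<rightarrow> f z" using ev by (simp add: tendsto_cong)
    then show ?thesis using \<open>g \<midarrow>z\<rightarrow> g z\<close> LIM_unique by blast
  qed
qed

text \<open>Injectivity of c gives each zero or pole to a single factor, so a negative exponent
  produces a pole that nothing cancels. The product has the value 0 there because 0 to a negative
  power is 0, which is what niceness demands at a pole.\<close>

lemma nicely_meromorphic_on_prod_linear_powi:
  fixes a :: "'a \<Rightarrow> int" and c :: "'a \<Rightarrow> complex"
  assumes "finite J" "inj_on c J"
  shows "(\<lambda>s. \<Prod>j\<in>J. (s - c j) powi a j) nicely_meromorphic_on UNIV"
proof -
  let ?f = "\<lambda>s. \<Prod>j\<in>J. (s - c j) powi a j"
  have mero: "?f meromorphic_on UNIV" by (intro meromorphic_intros)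
  moreover have "(is_pole ?f z \<and> ?f z = 0) \<or> ?f \<midarrow>z\<rightarrow> ?f z" for z
  proof (cases "\<exists>j\<in>J. c j = z \<and> a j < 0")
    case True
    then obtain j where j: "j \<in> J" "c j = z" "a j < 0" by blast
    have *: "?f s = (s - z) powi a j * (\<Prod>i\<in>J - {j}. (s - c i) powi a i)" for s
      using assms j by (subst prod.remove[of J j]) auto
    have ne: "c i \<noteq> z" if "i \<in> J - {j}" for i
      using assms j that by (auto simp: inj_on_def)
    have "is_pole (\<lambda>s. 1 / (s - z) ^ nat (- a j)) z"
      by (rule is_pole_inverse_power) (use j in auto)
    then have "is_pole (\<lambda>s. (s - z) powi a j) z"
      using j by (simp add: power_int_def power_one_over inverse_eq_divide)
    moreover have "(\<lambda>s. \<Prod>i\<in>J - {j}. (s - c i) powi a i) \<midarrow>z\<rightarrow> (\<Prod>i\<in>J - {j}. (z - c i) powi a i)"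
      using ne by (intro tendsto_prod tendsto_power_int tendsto_intros) (force simp: )
    moreover have "(\<Prod>i\<in>J - {j}. (z - c i) powi a i) \<noteq> 0"
      using ne assms by (auto simp: prod_zero_iff power_int_eq_0_iff)
    ultimately have "is_pole ?f z"
      unfolding * is_pole_def by (subst mult.commute) (rule tendsto_mult_filterlim_at_infinity)
    moreover have "?f z = 0" using j by (subst *) (simp add: power_int_0_left)
    ultimately show ?thesis by blast
  next
    case False
    have "((\<lambda>s. (s - c j) powi a j) \<longlongrightarrow> (z - c j) powi a j) (at z)" if "j \<in> J" for j
    proof (cases "a j \<ge> 0")
      case True
      then show ?thesis by (simp add: power_int_def) (intro tendsto_intros)
    next
      case a: False
      then have "z - c j \<noteq> 0" using False that by force
      then show ?thesis by (intro tendsto_power_int tendsto_intros)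
    qed
    then show ?thesis by (auto intro!: tendsto_prod)
  qed
  ultimately show ?thesis by (auto simp: nicely_meromorphic_on_def)
qed

text \<open>Up to sign this is the difference quotient of z powr w at 1, approached along the reals
  from the right.\<close>

lemma tendsto_one_minus_powr_div:
  fixes w :: complex
  shows "((\<lambda>p::real. (1 - of_real p powr w) / of_real (p - 1)) \<longlongrightarrow> - w) (at_right 1)"
proof -
  have "((\<lambda>z. z powr w) has_field_derivative w * 1 powr (w - 1)) (at (1::complex))"
    by (rule has_field_derivative_powr) auto
  then have lim: "((\<lambda>z. (z powr w - 1) / (z - 1)) \<longlongrightarrow> w) (at (1::complex))"
    by (simp add: has_field_derivative_iff)
  have "filterlim complex_of_real (at 1) (at_right 1)"
    by (intro filterlim_atI)
      (auto intro!: tendsto_eq_intros simp: eventually_at_filter)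
  from tendsto_minus[OF filterlim_compose[OF lim this]] show ?thesis
    by (rule tendsto_eq_rhs[OF tendsto_cong[THEN iffD1, rotated]])
       (auto simp flip: minus_divide_left simp: minus_divide_left algebra_simps)
qed

lemma power_int_sum_exponent:
  fixes x :: "'a :: field"
  assumes "x \<noteq> 0" "finite J"
  shows "x powi (\<Sum>j\<in>J. c j) = (\<Prod>j\<in>J. x powi c j)"
  using assms(2) by (induction rule: finite_induct) (auto simp: power_int_add assms(1))

text \<open>N(1) is the sum of the coefficients, so the power of p - 1 can be shared out: every 1 -
  p^(j - s) receives a denominator p - 1 under its own exponent. Each quotient tends to s - j by
  differentiation. Nice meromorphy together with the values on the half plane Re s > degree N
  determines the function, which resolves the definite description.\<close>

lemma absolute_zeta_eq:
  "absolute_zeta N s = (\<Prod>j\<le>degree N. (s - of_nat j) powi (- Polynomial.coeff N j))"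
proof -
  let ?Z = "\<lambda>s::complex. \<Prod>j\<le>degree N. (s - of_nat j) powi (- Polynomial.coeff N j)"
  let ?g = "\<lambda>s p. of_real (p - 1) powi poly N 1 *
            exp (\<Sum>i. let m = Suc i in
                   poly (map_poly of_int N) (of_real (p ^ m)) / of_nat m * of_real p powr (- s * of_nat m)) :: complex"
  have eq: "?g s p = (\<Prod>j\<le>degree N. ((1 - of_real p powr (of_nat j - s)) / of_real (p - 1)) powi (- Polynomial.coeff N j))"
    if s: "Re s > degree N" and p: "p > (1::real)" for s p
  proof -
    have v: "norm (of_real p powr (of_nat j - s)) < 1" if "j \<le> degree N" for j
      using p s that by (simp add: norm_powr_real_powr powr_less_one)
    have "(\<lambda>i. \<Sum>j\<le>degree N. of_int (Polynomial.coeff N j) * ((of_real p powr (of_nat j - s)) ^ Suc i / of_nat (Suc i))) sums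
       (\<Sum>j\<le>degree N. of_int (Polynomial.coeff N j) * (- Ln (1 - of_real p powr (of_nat j - s))))"
      by (intro sums_sum sums_mult Ln_one_minus_sums v) auto
    also have "(\<lambda>i. \<Sum>j\<le>degree N. of_int (Polynomial.coeff N j) * ((of_real p powr (of_nat j - s)) ^ Suc i / of_nat (Suc i))) =
      (\<lambda>i. let m = Suc i in
          poly (map_poly of_int N) (of_real (p ^ m)) / of_nat m * of_real p powr (- s * of_nat m))"
    proof
      fix i :: nat
      have d: "degree (map_poly (of_int :: int \<Rightarrow> complex) N) = degree N" by (rule degree_map_poly) auto
      have pw: "(of_real p powr (of_nat j - s)) ^ Suc i = of_real (p ^ Suc i) ^ j * of_real p powr (- s * of_nat (Suc i))" for j
      proof -
        have "(of_real p powr (of_nat j - s)) ^ Suc i = of_real p powr (of_nat (Suc i) * (of_nat j - s))"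
          using p by (simp add: powr_def exp_of_nat_mult mult_ac del: of_nat_Suc power_Suc)
        also have "of_nat (Suc i) * (of_nat j - s) = of_nat (Suc i * j) + (- s * of_nat (Suc i))"
          unfolding of_nat_mult by (simp add: algebra_simps del: of_nat_Suc)
        also have "of_real p powr \<dots> = of_real p powr of_nat (Suc i * j) * of_real p powr (- s * of_nat (Suc i))"
          using p by (intro powr_add)
        also have "complex_of_real p powr of_nat (Suc i * j) = of_real p ^ (Suc i * j)"
          using p by (intro powr_nat') auto
        finally show ?thesis by (simp only: power_mult of_real_power)
      qed
      show "(\<Sum>j\<le>degree N. of_int (Polynomial.coeff N j) * ((of_real p powr (of_nat j - s)) ^ Suc i / of_nat (Suc i))) =
        (let m = Suc i in
          poly (map_poly of_int N) (of_real (p ^ m)) / of_nat m * of_real p powr (- s * of_nat m))"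
        unfolding pw Let_def poly_altdef d sum_distrib_right sum_divide_distrib
        by (intro sum.cong refl) (simp add: coeff_map_poly mult_ac del: power_Suc of_nat_Suc)
    qed
    finally have S: "exp (\<Sum>i. let m = Suc i in
          poly (map_poly of_int N) (of_real (p ^ m)) / of_nat m * of_real p powr (- s * of_nat m)) =
        exp (\<Sum>j\<le>degree N. of_int (Polynomial.coeff N j) * (- Ln (1 - of_real p powr (of_nat j - s))))"
      by (simp add: sums_iff)
    also have "\<dots> = (\<Prod>j\<le>degree N. (1 - of_real p powr (of_nat j - s)) powi (- Polynomial.coeff N j))"
    proof (subst exp_sum, simp, rule prod.cong[OF refl])
      fix j assume "j \<in> {..degree N}"
      then have "1 - of_real p powr (of_nat j - s) \<noteq> 0" using v[of j] by (metis atMost_iff eq_iff_diff_eq_0 less_irrefl norm_one)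
      then have "(1 - of_real p powr (of_nat j - s)) powi (- Polynomial.coeff N j) =
          exp (Ln (1 - of_real p powr (of_nat j - s))) powi (- Polynomial.coeff N j)" by simp
      also have "\<dots> = exp (of_int (Polynomial.coeff N j) * (- Ln (1 - of_real p powr (of_nat j - s))))"
        by (simp add: exp_power_int del: exp_Ln)
      finally show "exp (of_int (Polynomial.coeff N j) * (- Ln (1 - of_real p powr (of_nat j - s)))) =
        (1 - of_real p powr (of_nat j - s)) powi (- Polynomial.coeff N j)" ..
    qed
    finally have "?g s p = of_real (p - 1) powi poly N 1 * (\<Prod>j\<le>degree N. (1 - of_real p powr (of_nat j - s)) powi (- Polynomial.coeff N j))"
      by (simp only:)
    moreover have "complex_of_real (p - 1) powi poly N 1 = (\<Prod>j\<le>degree N. of_real (p - 1) powi Polynomial.coeff N j)"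
      using p by (simp add: poly_altdef power_int_sum_exponent)
    moreover have "(\<Prod>j\<le>degree N. of_real (p - 1) powi Polynomial.coeff N j) * (\<Prod>j\<le>degree N. (1 - of_real p powr (of_nat j - s)) powi (- Polynomial.coeff N j)) =
      (\<Prod>j\<le>degree N. ((1 - of_real p powr (of_nat j - s)) / of_real (p - 1)) powi (- Polynomial.coeff N j))"
      unfolding prod.distrib[symmetric] power_int_divide_distrib
      by (intro prod.cong refl) (simp add: power_int_minus field_simps)
    ultimately show ?thesis by (simp only:)
  qed
  have lim: "(?g s \<longlongrightarrow> ?Z s) (at_right 1)" if s: "Re s > degree N" for s
  proof -
    have "((\<lambda>p. \<Prod>j\<le>degree N. ((1 - of_real p powr (of_nat j - s)) / of_real (p - 1)) powi (- Polynomial.coeff N j)) \<longlongrightarrow>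
       (\<Prod>j\<le>degree N. (- (of_nat j - s)) powi (- Polynomial.coeff N j))) (at_right 1)"
    \<comment> \<open>Integer powers with possibly negative exponents pass to the limit only if it
      is nonzero; Re s > degree N keeps every s - j away from 0.\<close>
    proof (intro tendsto_prod tendsto_power_int tendsto_one_minus_powr_div)
      fix j assume "j \<in> {..degree N}"
      then have "Re (of_nat j - s) < 0" using s by simp
      then show "- (of_nat j - s) \<noteq> 0" by auto
    qed
    also have "(\<Prod>j\<le>degree N. (- (of_nat j - s)) powi (- Polynomial.coeff N j)) = ?Z s" by simp
    finally show ?thesis
      by (rule tendsto_cong[THEN iffD1, rotated])
         (use eq[OF s] in \<open>auto simp: eventually_at_filter\<close>)
  qed
  have mero: "?Z nicely_meromorphic_on UNIV"
    by (rule nicely_meromorphic_on_prod_linear_powi) (auto simp: inj_on_def)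
  have "absolute_zeta N = ?Z"
    unfolding absolute_zeta_def
  proof (rule the_equality)
    show "?Z nicely_meromorphic_on UNIV \<and> (\<forall>s. Re s > real (degree N) \<longrightarrow> (?g s \<longlongrightarrow> ?Z s) (at_right 1))"
      using mero lim by blast
  next
    fix Z assume Z: "Z nicely_meromorphic_on UNIV \<and> (\<forall>s. Re s > real (degree N) \<longrightarrow> (?g s \<longlongrightarrow> Z s) (at_right 1))"
    show "Z = ?Z"
    proof (rule nicely_meromorphic_on_eqI)
      show "Z nicely_meromorphic_on UNIV" using Z by blast
      show "open {s. Re s > real (degree N)}" by (rule open_halfspace_Re_gt)
      have "of_nat (Suc (degree N)) \<in> {s. Re s > real (degree N)}" by simp
      then show "{s. Re s > real (degree N)} \<noteq> {}" by blast
      fix s assume s: "s \<in> {s. Re s > real (degree N)}"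
      then have "(?g s \<longlongrightarrow> Z s) (at_right 1)" using Z by blast
      moreover have "(?g s \<longlongrightarrow> ?Z s) (at_right 1)" using s lim by blast
      ultimately show "Z s = ?Z s" by (rule tendsto_unique[rotated]) simp
    qed (rule mero)
  qed
  then show ?thesis by simp
qed

section \<open>The counting polynomial and its exponents\<close>

text \<open>Binomial expansion of (t - 1)^r. For j > r the truncated subtraction r - j does no harm,
  as the binomial coefficient is 0.\<close>

lemma coeff_counting_function:
  "Polynomial.coeff (counting_function X) j =
     (\<Sum>x\<in>points X. (- 1) ^ (pt_rank X x - j) * int (pt_rank X x choose j))"
  unfolding counting_function_def coeff_sum
proof (intro sum.cong refl)
  fix x
  show "Polynomial.coeff ([:- 1, 1:] ^ pt_rank X x) j = (- 1) ^ (pt_rank X x - j) * int (pt_rank X x choose j)"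
  proof (cases "j \<le> pt_rank X x")
    case False
    then have "degree ([:- 1, 1 :: int:] ^ pt_rank X x) < j" by (simp add: degree_power_eq)
    then show ?thesis using False by (simp add: coeff_eq_0 binomial_eq_0)
  qed (simp add: coeff_linear_poly_power)
qed

text \<open>Some point contributes to the leading coefficient, which forces its rank up to the
  degree. Positive degree excludes the zero polynomial, for which no such point exists in
  general.\<close>

lemma degree_counting_function_le:
  assumes "degree (counting_function X) > 0"
  obtains x where "x \<in> points X" "degree (counting_function X) \<le> pt_rank X x"
proof -
  have "Polynomial.coeff (counting_function X) (degree (counting_function X)) \<noteq> 0"
    using assms leading_coeff_0_iff[of "counting_function X"] by auto
  then obtain x where "x \<in> points X" "pt_rank X x choose degree (counting_function X) \<noteq> 0"
    unfolding coeff_counting_function by (metis (no_types, lifting) mult_zero_right of_nat_0 sum.neutral)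
  then show ?thesis using that by (metis binomial_eq_0 not_le)
qed

lemma kappa_scheme_eq:
  assumes "n > 0"
  shows "kappa_scheme n X =
    (\<Sum>j\<le>degree (counting_function X). of_int (Polynomial.coeff (counting_function X) j) * kappa (int j) n)"
proof (cases "finite (points X)")
  \<comment> \<open>Sums over an infinite set are 0 by convention, which makes both sides 0.\<close>
  case False
  then show ?thesis by (simp add: kappa_scheme_def counting_function_def)
next
  case True
  define N where "N = counting_function X"
  \<comment> \<open>A common upper limit for all sums over j; the additional terms contain a
    vanishing binomial coefficient or a vanishing coefficient of N.\<close>
  define B where "B = Max (insert (degree N) (pt_rank X ` points X))"
  have B: "degree N \<le> B" "\<And>x. x \<in> points X \<Longrightarrow> pt_rank X x \<le> B"
    using True by (auto simp: B_def)
  have "kappa_scheme n X = (\<Sum>x\<in>points X. \<Sum>j\<le>B.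
     (- 1) ^ (pt_rank X x - j) * of_nat (pt_rank X x choose j) * kappa (int j) n)"
    unfolding kappa_scheme_def
    by (intro sum.cong refl sum.mono_neutral_left) (auto simp: binomial_eq_0 dest: B(2))
  also have "\<dots> = (\<Sum>j\<le>B. of_int (Polynomial.coeff N j) * kappa (int j) n)"
    unfolding N_def coeff_counting_function by (subst sum.swap) (simp add: sum_distrib_right)
  also have "\<dots> = (\<Sum>j\<le>degree N. of_int (Polynomial.coeff N j) * kappa (int j) n)"
    using B by (intro sum.mono_neutral_right) (auto simp: coeff_eq_0)
  finally show ?thesis unfolding N_def .
qed

text \<open>If N is not constant, \<open>degree_counting_function_le\<close> turns the bound on s
  into degree N < |s|, and the Lambert estimates apply with u = 1 / s and d = degree N. Constant N
  is treated apart because those estimates ask for d \<ge> 1; then all exponents are 0, since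
  \<kappa> vanishes at j = 0.\<close>

lemma zeta_product:
  assumes s: "\<And>x. x \<in> points X \<Longrightarrow> real (pt_rank X x) < cmod s"
  shows "absolute_zeta (counting_function X) s =
      (1 / s) powi poly (counting_function X) 1 * (\<Prod>i. zeta_factor X s i)"
    and "abs_convergent_prod (zeta_factor X s)"
proof -
  define N where "N = counting_function X"
  define k where "k n = \<lfloor>kappa_scheme n X\<rfloor>" for n
  have k: "of_int (k n) = (\<Sum>j\<le>degree N. of_int (Polynomial.coeff N j) * kappa (int j) n)" if "n > 0" for n
    using kappa_scheme_in_Ints[OF that, of X] kappa_scheme_eq[OF that, of X]
    by (auto simp: k_def N_def elim!: Ints_cases)
  have fac: "zeta_factor X s = (\<lambda>i. (1 - (1 / s) ^ Suc i) powi (- k (Suc i)))"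
    by (simp add: fun_eq_iff zeta_factor_def k_def)
  have "(absolute_zeta N s =
      (1 / s) powi poly N 1 * (\<Prod>i. zeta_factor X s i)) \<and> abs_convergent_prod (zeta_factor X s)"
  proof (cases "degree N = 0")
    case True
    have "k n = 0" if "n > 0" for n
    proof -
      have "of_int (k n) = (0::rat)" using k[OF that] abs_kappa_le[OF that, of 0] True that by (simp add: zero_power)
      then show ?thesis by simp
    qed
    then have "zeta_factor X s = (\<lambda>_. 1)" by (simp add: fac)
    moreover have "absolute_zeta N s = (1 / s) powi poly N 1"
      using True by (simp add: absolute_zeta_eq poly_altdef power_int_minus power_int_inverse flip: inverse_eq_divide)
    ultimately show ?thesis by (simp add: abs_convergent_prod_conv_summable)
  next
    case False
    define d where "d = real (degree N)"
    define C where "C = (\<Sum>j\<le>degree N. \<bar>real_of_int (Polynomial.coeff N j)\<bar>)"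
    have d1: "d \<ge> 1" using False by (simp add: d_def)
    have ds: "d < cmod s"
    proof -
      obtain x where "x \<in> points X" "degree N \<le> pt_rank X x"
        using degree_counting_function_le[of X] False by (auto simp: N_def)
      then show ?thesis using s[of x] by (simp add: d_def)
    qed
    then have s0: "s \<noteq> 0" using d1 by auto
    have du: "d * cmod (1 / s) < 1" using ds d1 s0 by (simp add: norm_divide field_simps)
    have kb: "\<bar>real_of_int (k n)\<bar> \<le> C * d ^ n" if "n > 0" for n
    proof -
      have "\<bar>of_int (k n) :: rat\<bar> \<le> (\<Sum>j\<le>degree N. \<bar>of_int (Polynomial.coeff N j) * kappa (int j) n\<bar>)"
        unfolding k[OF that] by (rule sum_abs)
      also have "\<dots> \<le> (\<Sum>j\<le>degree N. of_int \<bar>Polynomial.coeff N j\<bar> * of_nat (degree N ^ n))"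
      proof (rule sum_mono)
        fix j assume j: "j \<in> {..degree N}"
        have "\<bar>kappa (int j) n\<bar> \<le> of_nat (j ^ n)" by (rule abs_kappa_le[OF that])
        also have "\<dots> \<le> of_nat (degree N ^ n)" using j by (intro of_nat_mono power_mono) auto
        finally show "\<bar>of_int (Polynomial.coeff N j) * kappa (int j) n\<bar> \<le>
            of_int \<bar>Polynomial.coeff N j\<bar> * of_nat (degree N ^ n)"
          by (simp add: abs_mult mult_left_mono)
      qed
      also have "\<dots> = of_int (\<Sum>j\<le>degree N. \<bar>Polynomial.coeff N j\<bar> * int (degree N ^ n))"
        by simp
      finally have "\<bar>k n\<bar> \<le> (\<Sum>j\<le>degree N. \<bar>Polynomial.coeff N j\<bar> * int (degree N ^ n))"
        by (simp only: of_int_le_iff flip: of_int_abs)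
      then have "real_of_int \<bar>k n\<bar> \<le> real_of_int (\<Sum>j\<le>degree N. \<bar>Polynomial.coeff N j\<bar> * int (degree N ^ n))"
        by (simp only: of_int_le_iff)
      then show ?thesis by (simp add: C_def d_def sum_distrib_right)
    qed
    have conv: "(\<Sum>m | m dvd n. int m * k m) = (\<Sum>j\<le>degree N. Polynomial.coeff N j * int j ^ n)" if "n > 0" for n
    proof -
      have "(\<Sum>m | m dvd n. of_nat m * of_int (k m)) =
          (\<Sum>m | m dvd n. \<Sum>j\<le>degree N. of_int (Polynomial.coeff N j) * (of_nat m * kappa (int j) m))"
        using that by (intro sum.cong refl) (auto simp: k dvd_pos_nat sum_distrib_left mult_ac)
      also have "\<dots> = (\<Sum>j\<le>degree N. of_int (Polynomial.coeff N j) * (\<Sum>m | m dvd n. of_nat m * kappa (int j) m))"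
        by (subst sum.swap) (simp add: sum_distrib_left)
      also have "\<dots> = of_int (\<Sum>j\<le>degree N. Polynomial.coeff N j * int j ^ n)"
        unfolding sum_divisors_kappa[OF that] by simp
      finally have "rat_of_int (\<Sum>m | m dvd n. int m * k m) = of_int (\<Sum>j\<le>degree N. Polynomial.coeff N j * int j ^ n)"
        by simp
      then show ?thesis by (simp only: of_int_eq_iff)
    qed
    note L = lambert_has_prod[OF kb d1 du _ conv, folded fac]
    \<comment> \<open>The exponent N(1) is spread over the coefficients, and each resulting power of
      s turns its factor 1 - j / s into s - j.\<close>
    have "(1 / s) powi poly N 1 = s powi (\<Sum>j\<le>degree N. - Polynomial.coeff N j)"
      by (simp add: poly_altdef power_int_minus power_int_inverse sum_negf flip: inverse_eq_divide)
    also have "\<dots> = (\<Prod>j\<le>degree N. s powi (- Polynomial.coeff N j))"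
      using s0 by (intro power_int_sum_exponent) auto
    finally have "(1 / s) powi poly N 1 * (\<Prod>i. zeta_factor X s i) =
        (\<Prod>j\<le>degree N. s powi (- Polynomial.coeff N j)) * (\<Prod>j\<le>degree N. (1 - of_nat j * (1 / s)) powi (- Polynomial.coeff N j))"
      using L(1) by (simp add: d_def has_prod_iff)
    also have "\<dots> = (\<Prod>j\<le>degree N. (s - of_nat j) powi (- Polynomial.coeff N j))"
      unfolding prod.distrib[symmetric] power_int_mult_distrib[symmetric]
      using s0 by (simp add: right_diff_distrib)
    finally show ?thesis using L(2) by (simp add: absolute_zeta_eq d_def)
  qed
  then show "absolute_zeta (counting_function X) s =
      (1 / s) powi poly (counting_function X) 1 * (\<Prod>i. zeta_factor X s i)"
    and "abs_convergent_prod (zeta_factor X s)"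
    by (simp_all add: N_def)
qed

section \<open>Specialisation of algebraically independent elements\<close>

definition subring_set :: "'a::comm_ring_1 set \<Rightarrow> bool" where
  "subring_set D \<longleftrightarrow> 1 \<in> D \<and> (\<forall>x\<in>D. \<forall>y\<in>D. x - y \<in> D \<and> x * y \<in> D)"

definition ring_gen :: "'a::comm_ring_1 set \<Rightarrow> 'a set" where
  "ring_gen S = \<Inter>{D. subring_set D \<and> S \<subseteq> D}"

definition poly_over :: "'a::comm_ring_1 set \<Rightarrow> 'a poly set" where
  "poly_over D = {p. \<forall>i. Polynomial.coeff p i \<in> D}"

text \<open>Every element comes with a representing polynomial, which is what an extension of a
  homomorphism is computed from; \<open>adjoin_eq_ring_gen\<close> identifies this set with the
  generated subring.\<close>

definition adjoin :: "'a::comm_ring_1 set \<Rightarrow> 'a \<Rightarrow> 'a set" where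
  "adjoin D b = (\<lambda>p. poly p b) ` poly_over D"

definition transcendental_over :: "'a::comm_ring_1 set \<Rightarrow> 'a \<Rightarrow> bool" where
  "transcendental_over D b \<longleftrightarrow> (\<forall>p\<in>poly_over D. poly p b = 0 \<longrightarrow> p = 0)"

text \<open>A homomorphism on a subring is kept as a total function whose values off D carry no
  meaning, so that D can vary without changing types.\<close>

definition hom_on :: "'a::comm_ring_1 set \<Rightarrow> ('a \<Rightarrow> 'b::comm_ring_1) \<Rightarrow> bool" where
  "hom_on D f \<longleftrightarrow> f 1 = 1 \<and> (\<forall>x\<in>D. \<forall>y\<in>D. f (x + y) = f x + f y \<and> f (x * y) = f x * f y)"

lemma subring_setD:
  assumes "subring_set D"
  shows "1 \<in> D" "0 \<in> D" "\<And>x y. x \<in> D \<Longrightarrow> y \<in> D \<Longrightarrow> x - y \<in> D"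
    "\<And>x y. x \<in> D \<Longrightarrow> y \<in> D \<Longrightarrow> x * y \<in> D" "\<And>x. x \<in> D \<Longrightarrow> - x \<in> D"
    "\<And>x y. x \<in> D \<Longrightarrow> y \<in> D \<Longrightarrow> x + y \<in> D"
proof -
  show 1: "1 \<in> D" and d: "\<And>x y. x \<in> D \<Longrightarrow> y \<in> D \<Longrightarrow> x - y \<in> D"
    and "\<And>x y. x \<in> D \<Longrightarrow> y \<in> D \<Longrightarrow> x * y \<in> D" using assms by (auto simp: subring_set_def)
  show 0: "0 \<in> D" using d[OF 1 1] by simp
  show m: "- x \<in> D" if "x \<in> D" for x using d[OF 0 that] by simp
  show "x + y \<in> D" if "x \<in> D" "y \<in> D" for x y using d[OF that(1) m[OF that(2)]] by simp
qed

lemma subring_set_sum: "subring_set D \<Longrightarrow> (\<And>i. i \<in> I \<Longrightarrow> f i \<in> D) \<Longrightarrow> sum f I \<in> D"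
  by (induction I rule: infinite_finite_induct) (auto simp: subring_setD)

lemma subring_set_power: "subring_set D \<Longrightarrow> x \<in> D \<Longrightarrow> x ^ n \<in> D"
  by (induction n) (auto simp: subring_setD)

lemma subring_set_of_nat: "subring_set D \<Longrightarrow> of_nat n \<in> D"
  by (induction n) (auto simp: subring_setD)

lemma subring_set_ring_gen: "subring_set (ring_gen S)"
  by (auto simp: subring_set_def ring_gen_def)

lemma ring_gen_superset: "S \<subseteq> ring_gen S"
  by (auto simp: ring_gen_def)

lemma ring_gen_least: "subring_set D \<Longrightarrow> S \<subseteq> D \<Longrightarrow> ring_gen S \<subseteq> D"
  by (auto simp: ring_gen_def)

lemma poly_over_mono: "D \<subseteq> E \<Longrightarrow> poly_over D \<subseteq> poly_over E"
  by (auto simp: poly_over_def)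

lemma poly_over_closed:
  assumes "subring_set D"
  shows "0 \<in> poly_over D" "1 \<in> poly_over D"
    "p \<in> poly_over D \<Longrightarrow> q \<in> poly_over D \<Longrightarrow> p + q \<in> poly_over D"
    "p \<in> poly_over D \<Longrightarrow> q \<in> poly_over D \<Longrightarrow> p - q \<in> poly_over D"
    "p \<in> poly_over D \<Longrightarrow> q \<in> poly_over D \<Longrightarrow> p * q \<in> poly_over D"
    "c \<in> D \<Longrightarrow> p \<in> poly_over D \<Longrightarrow> Polynomial.smult c p \<in> poly_over D"
    "c \<in> D \<Longrightarrow> Polynomial.monom c n \<in> poly_over D"
    "c \<in> D \<Longrightarrow> [:c:] \<in> poly_over D"
    "c \<in> D \<Longrightarrow> e \<in> D \<Longrightarrow> [:c, e:] \<in> poly_over D"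
  using assms
  by (auto simp: poly_over_def subring_setD coeff_mult coeff_pCons intro!: subring_set_sum split: nat.splits)

lemma poly_in_subring:
  assumes "subring_set D" "p \<in> poly_over D" "b \<in> D"
  shows "poly p b \<in> D"
  using assms unfolding poly_altdef poly_over_def
  by (auto intro!: subring_set_sum subring_setD(4) subring_set_power)

lemma adjoin_eq_ring_gen:
  assumes "subring_set D"
  shows "adjoin D b = ring_gen (insert b D)"
proof
  have "D \<subseteq> ring_gen (insert b D)" "b \<in> ring_gen (insert b D)"
    using ring_gen_superset[of "insert b D"] by auto
  then show "adjoin D b \<subseteq> ring_gen (insert b D)"
    unfolding adjoin_def using poly_in_subring[OF subring_set_ring_gen] poly_over_mono by blast
  show "ring_gen (insert b D) \<subseteq> adjoin D b"
  proof (rule ring_gen_least)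
    show "subring_set (adjoin D b)"
      unfolding subring_set_def adjoin_def
    proof (intro conjI ballI)
      show "1 \<in> (\<lambda>p. poly p b) ` poly_over D" using poly_over_closed(2)[OF assms] by (force simp: image_iff)
    next
      fix x y assume "x \<in> (\<lambda>p. poly p b) ` poly_over D" "y \<in> (\<lambda>p. poly p b) ` poly_over D"
      then obtain p q where p: "p \<in> poly_over D" "x = poly p b" and q: "q \<in> poly_over D" "y = poly q b" by auto
      show "x - y \<in> (\<lambda>p. poly p b) ` poly_over D"
        using poly_over_closed(4)[OF assms p(1) q(1)] by (rule rev_image_eqI) (simp add: p q)
      show "x * y \<in> (\<lambda>p. poly p b) ` poly_over D"
        using poly_over_closed(5)[OF assms p(1) q(1)] by (rule rev_image_eqI) (simp add: p q)
    qed
    show "insert b D \<subseteq> adjoin D b"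
    proof
      fix x assume "x \<in> insert b D"
      then consider "x = b" | "x \<in> D" by auto
      then show "x \<in> adjoin D b"
      proof cases
        case 1
        have "[:0, 1:] \<in> poly_over D" using assms by (intro poly_over_closed) (auto simp: subring_setD)
        then show ?thesis unfolding adjoin_def by (rule rev_image_eqI) (simp add: 1)
      next
        case 2
        then have "[:x:] \<in> poly_over D" using assms by (intro poly_over_closed)
        then show ?thesis unfolding adjoin_def by (rule rev_image_eqI) simp
      qed
    qed
  qed
qed

lemma hom_onD:
  assumes "hom_on D f" "subring_set D"
  shows "f 1 = 1" "f 0 = 0" "\<And>x y. x \<in> D \<Longrightarrow> y \<in> D \<Longrightarrow> f (x + y) = f x + f y"
    "\<And>x y. x \<in> D \<Longrightarrow> y \<in> D \<Longrightarrow> f (x * y) = f x * f y"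
    "\<And>x y. x \<in> D \<Longrightarrow> y \<in> D \<Longrightarrow> f (x - y) = f x - f y"
proof -
  show "f 1 = 1" and a: "\<And>x y. x \<in> D \<Longrightarrow> y \<in> D \<Longrightarrow> f (x + y) = f x + f y"
    and "\<And>x y. x \<in> D \<Longrightarrow> y \<in> D \<Longrightarrow> f (x * y) = f x * f y" using assms by (auto simp: hom_on_def)
  have "f (0 + 0) = f 0 + f 0" using assms by (intro a) (auto simp: subring_setD)
  then show "f 0 = 0" by simp
  show "f (x - y) = f x - f y" if "x \<in> D" "y \<in> D" for x y
    using a[of "x - y" y] that assms(2) by (simp add: subring_setD)
qed

lemma hom_on_sum:
  assumes "hom_on D f" "subring_set D" "\<And>i. i \<in> I \<Longrightarrow> g i \<in> D"
  shows "f (sum g I) = (\<Sum>i\<in>I. f (g i))"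
  using assms(3)
  by (induction I rule: infinite_finite_induct) (auto simp: hom_onD[OF assms(1,2)] subring_set_sum[OF assms(2)])

lemma hom_on_power:
  assumes "hom_on D f" "subring_set D" "x \<in> D"
  shows "f (x ^ n) = f x ^ n"
  by (induction n) (auto simp: hom_onD[OF assms(1,2)] subring_set_power[OF assms(2)] assms(3))

lemma hom_on_map_poly:
  assumes "hom_on D f" "subring_set D" "p \<in> poly_over D" "q \<in> poly_over D"
  shows "map_poly f (p + q) = map_poly f p + map_poly f q"
    and "map_poly f (p - q) = map_poly f p - map_poly f q"
    and "map_poly f (p * q) = map_poly f p * map_poly f q"
  using assms(3,4)
  by (auto intro!: poly_eqI simp: coeff_map_poly hom_onD[OF assms(1,2)] poly_over_def coeff_mult
      hom_on_sum[OF assms(1,2)] subring_setD[OF assms(2)])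

text \<open>The universal property of D[b]: the extension evaluates a chosen representing polynomial
  at c after applying f to its coefficients. Assumption \<open>c\<close> says that every relation
  satisfied by b over D survives, so the choice does not matter.\<close>

lemma hom_on_extend:
  fixes f :: "'a::comm_ring_1 \<Rightarrow> 'b::comm_ring_1"
  assumes f: "hom_on D f" and D: "subring_set D"
    and c: "\<And>p. p \<in> poly_over D \<Longrightarrow> poly p b = 0 \<Longrightarrow> poly (map_poly f p) c = 0"
  obtains g where "hom_on (adjoin D b) g" "\<And>x. x \<in> D \<Longrightarrow> g x = f x"
    "\<And>p. p \<in> poly_over D \<Longrightarrow> g (poly p b) = poly (map_poly f p) c"
proof -
  define g where "g y = poly (map_poly f (SOME p. p \<in> poly_over D \<and> poly p b = y)) c" for y
  have g: "g (poly p b) = poly (map_poly f p) c" if "p \<in> poly_over D" for p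
  proof -
    define q where "q = (SOME q. q \<in> poly_over D \<and> poly q b = poly p b)"
    have q: "q \<in> poly_over D" "poly q b = poly p b"
      using someI[of "\<lambda>q. q \<in> poly_over D \<and> poly q b = poly p b" p] that by (auto simp: q_def)
    have "poly (map_poly f (q - p)) c = 0"
      using q that by (intro c poly_over_closed[OF D]) auto
    then show ?thesis using hom_on_map_poly(2)[OF f D q(1) that] by (simp add: g_def q_def)
  qed
  have const: "g x = f x" if "x \<in> D" for x
    using g[OF poly_over_closed(8)[OF D that]] hom_onD(2)[OF f D] by (simp add: map_poly_pCons)
  have "hom_on (adjoin D b) g"
    unfolding hom_on_def
  proof (intro conjI ballI)
    show "g 1 = 1" using const[of 1] hom_onD(1)[OF f D] subring_setD(1)[OF D] by simp
    fix x y assume "x \<in> adjoin D b" "y \<in> adjoin D b"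
    then obtain p q where p: "p \<in> poly_over D" "x = poly p b" and q: "q \<in> poly_over D" "y = poly q b"
      by (auto simp: adjoin_def)
    show "g (x + y) = g x + g y"
      using g[OF poly_over_closed(3)[OF D p(1) q(1)]] g[OF p(1)] g[OF q(1)] hom_on_map_poly(1)[OF f D p(1) q(1)]
      by (simp add: p q)
    show "g (x * y) = g x * g y"
      using g[OF poly_over_closed(5)[OF D p(1) q(1)]] g[OF p(1)] g[OF q(1)] hom_on_map_poly(3)[OF f D p(1) q(1)]
      by (simp add: p q)
  qed
  then show ?thesis using that const g by blast
qed

text \<open>Coefficients must stay in D, where the leading coefficient of g need not be invertible;
  so f is multiplied by a power of that coefficient, once for every top term that is
  cancelled.\<close>

lemma pseudo_division_over:
  fixes D :: "'a::idom set"
  assumes D: "subring_set D" and g: "g \<in> poly_over D" "g \<noteq> 0" and f: "f \<in> poly_over D"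
  shows "\<exists>k q r. q \<in> poly_over D \<and> r \<in> poly_over D \<and>
    Polynomial.smult (lead_coeff g ^ k) f = q * g + r \<and> (r = 0 \<or> degree r < degree g)"
  using f
proof (induction "degree f" arbitrary: f rule: less_induct)
  case less
  let ?l = "lead_coeff g"
  have l: "?l \<in> D" using g by (auto simp: poly_over_def)
  show ?case
  proof (cases "f = 0 \<or> degree f < degree g")
    case True
    then show ?thesis using less.prems poly_over_closed(1)[OF D]
      by (intro exI[of _ 0] exI[of _ "0::'a poly"] exI[of _ f]) auto
  next
    case False
    define m where "m = Polynomial.monom (lead_coeff f) (degree f - degree g)"
    define f1 where "f1 = Polynomial.smult ?l f - m * g"
    have lf: "lead_coeff f \<in> D" using less.prems by (auto simp: poly_over_def)
    then have m: "m \<in> poly_over D" unfolding m_def by (intro poly_over_closed[OF D])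
    have f1: "f1 \<in> poly_over D"
      unfolding f1_def using D l m g less.prems by (intro poly_over_closed)
    have dm: "degree (m * g) \<le> degree f"
      using False degree_mult_le[of m g] degree_monom_le[of "lead_coeff f" "degree f - degree g"]
      unfolding m_def by linarith
    have "degree f1 \<le> degree f"
      unfolding f1_def using dm by (intro degree_diff_le) (auto intro: order_trans[OF degree_smult_le])
    moreover have "Polynomial.coeff f1 (degree f) = 0"
      using False by (simp add: f1_def m_def coeff_monom_mult)
    ultimately have "f1 = 0 \<or> degree f1 < degree f"
      by (metis leading_coeff_0_iff le_neq_implies_less)
    then have "\<exists>k q r. q \<in> poly_over D \<and> r \<in> poly_over D \<and>
      Polynomial.smult (?l ^ k) f1 = q * g + r \<and> (r = 0 \<or> degree r < degree g)"
    proof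
      assume "f1 = 0"
      then show ?thesis using poly_over_closed(1)[OF D]
        by (intro exI[of _ 0] exI[of _ "0::'a poly"]) auto
    qed (use less.hyps f1 in blast)
    then obtain k q r where kqr: "q \<in> poly_over D" "r \<in> poly_over D"
      "Polynomial.smult (?l ^ k) f1 = q * g + r" "r = 0 \<or> degree r < degree g" by blast
    have "Polynomial.smult (?l ^ Suc k) f = Polynomial.smult (?l ^ k) (f1 + m * g)"
      by (simp add: f1_def mult.commute)
    also have "\<dots> = (q + Polynomial.smult (?l ^ k) m) * g + r"
      by (simp add: smult_add_right kqr(3) algebra_simps)
    finally have "Polynomial.smult (?l ^ Suc k) f = (q + Polynomial.smult (?l ^ k) m) * g + r" .
    moreover have "q + Polynomial.smult (?l ^ k) m \<in> poly_over D"
      using D l m kqr(1) by (intro poly_over_closed subring_set_power)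
    ultimately show ?thesis using kqr by blast
  qed
qed

text \<open>The extension step in the style of Chevalley. If b is transcendental, d is a nonzero
  coefficient of a polynomial representing u, and b is sent to a point where the image of that
  polynomial does not vanish. If b is algebraic, d is the leading coefficient of a relation of least
  degree times a nonzero multiple of u in D, and b is sent to a root of the image of that
  relation.\<close>

lemma hom_extension_adjoin:
  fixes D :: "'a::idom set" and b u :: 'a
  assumes D: "subring_set D" and u: "u \<in> adjoin D b" "u \<noteq> 0"
  obtains d where "d \<in> D" "d \<noteq> 0"
    "\<And>f :: 'a \<Rightarrow> 'b::{alg_closed_field, field_char_0}. hom_on D f \<Longrightarrow> f d \<noteq> 0 \<Longrightarrow>
       \<exists>g. hom_on (adjoin D b) g \<and> (\<forall>x\<in>D. g x = f x) \<and> g u \<noteq> 0"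
proof -
  obtain p where p: "p \<in> poly_over D" "u = poly p b" using u by (auto simp: adjoin_def)
  show ?thesis
  proof (cases "transcendental_over D b")
    case True
    obtain i where i: "Polynomial.coeff p i \<noteq> 0" using p u by (metis poly_0 poly_eqI coeff_0)
    show ?thesis
    proof (rule that[of "Polynomial.coeff p i"])
      show "Polynomial.coeff p i \<in> D" "Polynomial.coeff p i \<noteq> 0" using p i by (auto simp: poly_over_def)
      fix f :: "'a \<Rightarrow> 'b" assume f: "hom_on D f" "f (Polynomial.coeff p i) \<noteq> 0"
      have "map_poly f p \<noteq> 0"
        using f hom_onD(2)[OF f(1) D] by (metis coeff_0 coeff_map_poly)
      then have "finite {c. poly (map_poly f p) c = 0}" by (rule poly_roots_finite)
      \<comment> \<open>All but finitely many values avoid the roots, and a field of characteristic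
        0 is infinite.\<close>
      then obtain c where c: "poly (map_poly f p) c \<noteq> 0"
        using infinite_UNIV_char_0 by (metis (mono_tags, lifting) UNIV_eq_I mem_Collect_eq)
      obtain g where "hom_on (adjoin D b) g" "\<And>x. x \<in> D \<Longrightarrow> g x = f x"
        "\<And>p. p \<in> poly_over D \<Longrightarrow> g (poly p b) = poly (map_poly f p) c"
        by (rule hom_on_extend[OF f(1) D, of b c])
           (use True in \<open>auto simp: transcendental_over_def\<close>)
      then show "\<exists>g. hom_on (adjoin D b) g \<and> (\<forall>x\<in>D. g x = f x) \<and> g u \<noteq> 0" using c p by auto
    qed
  next
    case False
    define P where "P = (\<lambda>h. h \<in> poly_over D \<and> h \<noteq> 0 \<and> poly h b = 0)"
    have "\<exists>h. P h" using False by (auto simp: transcendental_over_def P_def)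
    then obtain h where h: "P h" "\<And>h'. P h' \<Longrightarrow> degree h \<le> degree h'"
      using ex_has_least_nat[of P _ degree] by blast
    \<comment> \<open>\<open>D[b]\<close> is algebraic over \<open>D\<close>, so \<open>u\<close> has a nonzero multiple in \<open>D\<close>: take a multiple
      \<open>poly q b\<close> with \<open>q\<close> of least degree; if \<open>q\<close> were not constant, dividing \<open>h\<close> by it would
      contradict minimality.\<close>
    define Q where "Q = (\<lambda>q. q \<in> poly_over D \<and> poly q b \<noteq> 0 \<and> (\<exists>v\<in>poly_over D. poly q b = u * poly v b))"
    have "Q p" using p u poly_over_closed(2)[OF D] by (auto simp: Q_def intro!: bexI[of _ 1])
    then obtain q where q: "Q q" "\<And>q'. Q q' \<Longrightarrow> degree q \<le> degree q'"
      using ex_has_least_nat[of Q _ degree] by blast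
    then obtain v where v: "v \<in> poly_over D" "poly q b = u * poly v b" by (auto simp: Q_def)
    have qD: "q \<in> poly_over D" "poly q b \<noteq> 0" "q \<noteq> 0" using q by (auto simp: Q_def)
    have hD: "h \<in> poly_over D" "poly h b = 0" "h \<noteq> 0" using h by (auto simp: P_def)
    have "degree q = 0"
    proof (rule ccontr)
      assume dq: "degree q \<noteq> 0"
      obtain k e r where ker: "e \<in> poly_over D" "r \<in> poly_over D"
        "Polynomial.smult (lead_coeff q ^ k) h = e * q + r" "r = 0 \<or> degree r < degree q"
        using pseudo_division_over[OF D qD(1,3) hD(1)] by blast
      have "0 = poly (Polynomial.smult (lead_coeff q ^ k) h) b" using hD by simp
      also have "\<dots> = poly e b * poly q b + poly r b" unfolding ker(3) by simp
      finally have rb: "poly r b = u * poly (- e * v) b" using v by (simp add: add_eq_0_iff mult_ac)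
      have "- e * v \<in> poly_over D"
        using poly_over_closed(4)[OF D poly_over_closed(1)[OF D] ker(1)] v
        by (intro poly_over_closed(5)[OF D]) auto
      have "poly r b = 0"
      proof (rule ccontr)
        assume "poly r b \<noteq> 0"
        then have "Q r" using ker(2) rb \<open>- e * v \<in> poly_over D\<close> unfolding Q_def by blast
        then have "degree q \<le> degree r" by (rule q)
        then show False using ker(4) \<open>poly r b \<noteq> 0\<close> by auto
      qed
      \<comment> \<open>Since h vanishes at b, the remainder of q modulo h still represents a
        nonzero multiple of u; were q of larger degree than h, this remainder would beat it.\<close>
      have "degree q \<le> degree h"
      proof (rule ccontr)
        assume hq: "\<not> degree q \<le> degree h"
        obtain k' e' r' where ker': "e' \<in> poly_over D" "r' \<in> poly_over D"
          "Polynomial.smult (lead_coeff h ^ k') q = e' * h + r'" "r' = 0 \<or> degree r' < degree h"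
          using pseudo_division_over[OF D hD(1,3) qD(1)] by blast
        have "poly r' b = poly (Polynomial.smult (lead_coeff h ^ k') q) b"
          unfolding ker'(3) using hD by simp
        also have "\<dots> = u * poly (Polynomial.smult (lead_coeff h ^ k') v) b" using v by simp
        finally have rb': "poly r' b = u * poly (Polynomial.smult (lead_coeff h ^ k') v) b" .
        have "lead_coeff h ^ k' \<in> D" using hD D by (intro subring_set_power) (auto simp: poly_over_def)
        then have "Polynomial.smult (lead_coeff h ^ k') v \<in> poly_over D" using v D by (intro poly_over_closed)
        moreover have "poly r' b \<noteq> 0" unfolding rb' using hD qD v by auto
        ultimately have "Q r'" using rb' ker' unfolding Q_def by blast
        then have "degree q \<le> degree r'" by (rule q)
        moreover have "r' \<noteq> 0" using \<open>poly r' b \<noteq> 0\<close> by auto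
        ultimately show False using ker'(4) hq by auto
      qed
      then have "degree r < degree h \<or> r = 0" using ker(4) by auto
      then have "r = 0" using h(2)[of r] \<open>poly r b = 0\<close> ker(2) by (force simp: P_def)
      then have eq: "Polynomial.smult (lead_coeff q ^ k) h = e * q" using ker by simp
      have "e \<noteq> 0" using eq qD hD by auto
      have "poly e b * poly q b = 0" using arg_cong[OF eq, of "\<lambda>p. poly p b"] hD by simp
      then have "P e" using qD ker \<open>e \<noteq> 0\<close> by (simp add: P_def)
      then have "degree h \<le> degree e" by (rule h)
      moreover have "degree h = degree e + degree q"
        using arg_cong[OF eq, of degree] qD \<open>e \<noteq> 0\<close> by (simp add: degree_mult_eq)
      ultimately show False using dq by simp
    qed
    then obtain w where w: "q = [:w:]" by (rule degree_eq_zeroE)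
    have w': "w \<in> D" "w \<noteq> 0" using qD by (auto simp: w poly_over_def coeff_pCons dest!: spec[of _ 0])
    have lh: "lead_coeff h \<in> D" "lead_coeff h \<noteq> 0" using hD by (auto simp: poly_over_def)
    have dh: "degree h \<noteq> 0"
    proof
      assume "degree h = 0"
      then obtain z where "h = [:z:]" by (rule degree_eq_zeroE)
      then show False using hD by simp
    qed
    show ?thesis
    \<comment> \<open>The first factor keeps the degree of h under f, so that its image has a root.
      The second is a multiple of u, so the extension cannot kill u unless f kills w.\<close>
    proof (rule that[of "lead_coeff h * w"])
      show "lead_coeff h * w \<in> D" "lead_coeff h * w \<noteq> 0" using D w' lh by (auto simp: subring_setD)
      fix f :: "'a \<Rightarrow> 'b" assume f: "hom_on D f" "f (lead_coeff h * w) \<noteq> 0"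
      note fD = hom_onD[OF f(1) D]
      have nz: "f (lead_coeff h) \<noteq> 0" "f w \<noteq> 0" using f(2) fD(4)[OF lh(1) w'(1)] by auto
      have "degree (map_poly f h) = degree h" using nz by (intro map_poly_degree_eq) 
      then obtain c where c: "poly (map_poly f h) c = 0"
        using alg_closed_imp_poly_has_root[of "map_poly f h"] dh by auto
      obtain g where g: "hom_on (adjoin D b) g" "\<And>x. x \<in> D \<Longrightarrow> g x = f x"
        "\<And>p. p \<in> poly_over D \<Longrightarrow> g (poly p b) = poly (map_poly f p) c"
      \<comment> \<open>By minimality of h every relation of b is, after multiplication by a power
        of \<open>lead_coeff h\<close>, a multiple of h; f does not kill that power.\<close>
      proof (rule hom_on_extend[OF f(1) D, of b c])
        fix p assume p: "p \<in> poly_over D" "poly p b = 0"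
        obtain k e r where ker: "e \<in> poly_over D" "r \<in> poly_over D"
          "Polynomial.smult (lead_coeff h ^ k) p = e * h + r" "r = 0 \<or> degree r < degree h"
          using pseudo_division_over[OF D hD(1,3) p(1)] by blast
        have "poly r b = 0" using arg_cong[OF ker(3), of "\<lambda>p. poly p b"] hD p by simp
        then have "r = 0" using ker h(2)[of r] by (force simp: P_def)
        then have eq: "[:lead_coeff h ^ k:] * p = e * h" using ker by simp
        have "[:lead_coeff h ^ k:] \<in> poly_over D" using D lh by (intro poly_over_closed subring_set_power)
        then have "map_poly f [:lead_coeff h ^ k:] * map_poly f p = map_poly f e * map_poly f h"
          using arg_cong[OF eq, of "map_poly f"] hom_on_map_poly(3)[OF f(1) D _ p(1)]
            hom_on_map_poly(3)[OF f(1) D ker(1) hD(1)] by (simp only:)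
        from arg_cong[OF this, of "\<lambda>p. poly p c"] have "f (lead_coeff h ^ k) * poly (map_poly f p) c = 0"
          using c fD by (simp add: map_poly_pCons)
        then show "poly (map_poly f p) c = 0"
          using nz by (simp add: hom_on_power[OF f(1) D lh(1)])
      qed (rule that)
      have "f w = g (poly q b)" using g(2) w w' by simp
      also have "\<dots> = g (u * poly v b)" using v by simp
      also have "\<dots> = g u * g (poly v b)"
        using g(1) u v unfolding hom_on_def adjoin_def by blast
      finally have "g u \<noteq> 0" using nz by auto
      then show "\<exists>g. hom_on (adjoin D b) g \<and> (\<forall>x\<in>D. g x = f x) \<and> g u \<noteq> 0" using g by blast
    qed
  qed
qed

text \<open>Generators are removed one at a time. The element that must not vanish moves down with
  them: the d obtained for the last generator is the u for the remaining ones, which is why an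
  arbitrary nonzero u is carried along.\<close>

lemma hom_extension_finite:
  fixes D :: "'a::{alg_closed_field, field_char_0} set"
  assumes D: "subring_set D" and "finite B" and "u \<in> ring_gen (D \<union> B)" "u \<noteq> 0"
  shows "\<exists>d\<in>D. d \<noteq> 0 \<and> (\<forall>f :: 'a \<Rightarrow> 'a. hom_on D f \<and> f d \<noteq> 0 \<longrightarrow>
       (\<exists>g. hom_on (ring_gen (D \<union> B)) g \<and> (\<forall>x\<in>D. g x = f x) \<and> g u \<noteq> 0))"
  using assms(2-4)
proof (induction B arbitrary: u rule: finite_induct)
  case empty
  have "ring_gen D = D" using ring_gen_superset[of D] ring_gen_least[OF D, of D] by auto
  then show ?case using empty by auto
next
  case (insert b B)
  let ?E = "ring_gen (D \<union> B)"
  have "ring_gen (D \<union> insert b B) = ring_gen (insert b ?E)"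
  proof
    show "ring_gen (D \<union> insert b B) \<subseteq> ring_gen (insert b ?E)"
      using ring_gen_superset[of "insert b ?E"] ring_gen_superset[of "D \<union> B"]
      by (intro ring_gen_least subring_set_ring_gen) auto
    have "?E \<subseteq> ring_gen (D \<union> insert b B)"
      using ring_gen_superset[of "D \<union> insert b B"] by (intro ring_gen_least subring_set_ring_gen) auto
    then show "ring_gen (insert b ?E) \<subseteq> ring_gen (D \<union> insert b B)"
      using ring_gen_superset[of "D \<union> insert b B"] by (intro ring_gen_least subring_set_ring_gen) auto
  qed
  then have eq: "ring_gen (D \<union> insert b B) = adjoin ?E b"
    by (simp add: adjoin_eq_ring_gen subring_set_ring_gen)
  have DE: "D \<subseteq> ?E" using ring_gen_superset[of "D \<union> B"] by auto
  obtain e where e: "e \<in> ?E" "e \<noteq> 0"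
    "\<And>f :: 'a \<Rightarrow> 'a. hom_on ?E f \<Longrightarrow> f e \<noteq> 0 \<Longrightarrow>
       \<exists>g. hom_on (adjoin ?E b) g \<and> (\<forall>x\<in>?E. g x = f x) \<and> g u \<noteq> 0"
    using hom_extension_adjoin[OF subring_set_ring_gen insert.prems(1)[unfolded eq] insert.prems(2)] by metis
  obtain d where d: "d \<in> D" "d \<noteq> 0" "\<And>f :: 'a \<Rightarrow> 'a. hom_on D f \<Longrightarrow> f d \<noteq> 0 \<Longrightarrow>
       \<exists>g. hom_on ?E g \<and> (\<forall>x\<in>D. g x = f x) \<and> g e \<noteq> 0"
    using insert.IH[OF e(1,2)] by blast
  show ?case
  proof (intro bexI[OF _ d(1)] conjI d(2) allI impI)
    fix f :: "'a \<Rightarrow> 'a" assume "hom_on D f \<and> f d \<noteq> 0"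
    then obtain g where g: "hom_on ?E g" "\<forall>x\<in>D. g x = f x" "g e \<noteq> 0" using d(3) by blast
    then obtain g' where "hom_on (adjoin ?E b) g'" "\<forall>x\<in>?E. g' x = g x" "g' u \<noteq> 0" using e(3) by blast
    then show "\<exists>g. hom_on (ring_gen (D \<union> insert b B)) g \<and> (\<forall>x\<in>D. g x = f x) \<and> g u \<noteq> 0"
      using g DE unfolding eq by (metis subsetD)
  qed
qed

text \<open>A specialisation of a transcendental element to an integer that avoids the finitely many bad
  values extends to the whole ring.\<close>

lemma hom_with_kernel:
  fixes D :: "'a::{alg_closed_field, field_char_0} set"
  assumes D: "subring_set D" and t: "transcendental_over D t" and B: "finite B" "D \<subseteq> ring_gen B" "t \<in> ring_gen B"
  obtains g :: "'a \<Rightarrow> 'a" and a where "hom_on (ring_gen B) g" "\<forall>x\<in>D. g x = x"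
    "a \<in> ring_gen B" "a \<noteq> 0" "g a = 0"
proof -
  let ?E = "adjoin D t"
  have E: "subring_set ?E" "D \<subseteq> ?E" "t \<in> ?E"
    using ring_gen_superset[of "insert t D"] by (auto simp: adjoin_eq_ring_gen[OF D] subring_set_ring_gen)
  have EB: "?E \<subseteq> ring_gen B"
    unfolding adjoin_eq_ring_gen[OF D] using B by (intro ring_gen_least subring_set_ring_gen) auto
  have gen: "ring_gen (?E \<union> B) = ring_gen B"
  proof
    show "ring_gen (?E \<union> B) \<subseteq> ring_gen B"
      using EB ring_gen_superset[of B] by (intro ring_gen_least subring_set_ring_gen) auto
    show "ring_gen B \<subseteq> ring_gen (?E \<union> B)"
      using ring_gen_superset[of "?E \<union> B"] by (intro ring_gen_least subring_set_ring_gen) auto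
  qed
  \<comment> \<open>Only the existence of an extension matters here, so the element to be kept
    nonzero is 1.\<close>
  have "1 \<in> ring_gen (?E \<union> B)" using subring_setD(1)[OF subring_set_ring_gen] .
  then obtain d where d: "d \<in> ?E" "d \<noteq> 0" "\<And>f :: 'a \<Rightarrow> 'a. hom_on ?E f \<Longrightarrow> f d \<noteq> 0 \<Longrightarrow>
       \<exists>g. hom_on (ring_gen B) g \<and> (\<forall>x\<in>?E. g x = f x)"
    using hom_extension_finite[OF E(1) B(1), of 1] unfolding gen by (metis one_neq_zero)
  obtain p where p: "p \<in> poly_over D" "d = poly p t" using d by (auto simp: adjoin_def)
  then have "p \<noteq> 0" using d by auto
  then have "finite {c. poly p c = 0}" by (rule poly_roots_finite)
  moreover have "infinite (range (of_nat :: nat \<Rightarrow> 'a))" by (rule range_inj_infinite) (rule inj_of_nat)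
  ultimately obtain n where n: "poly p (of_nat n) \<noteq> 0"
    by (metis (mono_tags, lifting) finite_subset image_subset_iff mem_Collect_eq rangeI)
  have id: "hom_on D (\<lambda>x. x)" by (simp add: hom_on_def)
  obtain f where f: "hom_on ?E f" "\<And>x. x \<in> D \<Longrightarrow> f x = x"
    "\<And>q. q \<in> poly_over D \<Longrightarrow> f (poly q t) = poly (map_poly (\<lambda>x. x) q) (of_nat n)"
    by (rule hom_on_extend[OF id D, of t "of_nat n"]) (use t in \<open>auto simp: transcendental_over_def\<close>)
  have "f d \<noteq> 0" using f(3)[OF p(1)] p n by (simp add: map_poly_idI')
  then obtain g where g: "hom_on (ring_gen B) g" "\<And>x. x \<in> ?E \<Longrightarrow> g x = f x" using d(3) f(1) by blast
  have q: "[:- of_nat n, 1:] \<in> poly_over D"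
    using D by (intro poly_over_closed subring_setD subring_set_of_nat)
  have tn: "t - of_nat n \<in> ?E" using E by (intro subring_setD(3) subring_set_of_nat)
  show ?thesis
  proof (rule that[OF g(1)])
    show "\<forall>x\<in>D. g x = x" using g(2) f(2) E by auto
    show "t - of_nat n \<in> ring_gen B" using tn EB by auto
    show "t - of_nat n \<noteq> 0"
    proof
      assume "t - of_nat n = 0"
      then have "poly [:- of_nat n, 1:] t = 0" by simp
      then show False using t q unfolding transcendental_over_def by fastforce
    qed
    show "g (t - of_nat n) = 0"
      using g(2)[OF tn] f(3)[OF q] by (simp add: map_poly_idI' algebra_simps)
  qed
qed

text \<open>The image of a finitely generated ring is generated by the images of the generators;
  this lets the specialisation be repeated.\<close>

lemma hom_on_image_ring_gen:
  assumes f: "hom_on (ring_gen B) f"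
  shows "f ` ring_gen B = ring_gen (f ` B)"
proof
  note R = subring_set_ring_gen[of B]
  have "subring_set (f ` ring_gen B)"
    unfolding subring_set_def
  proof (intro conjI ballI)
    show "1 \<in> f ` ring_gen B" using subring_setD(1)[OF R] hom_onD(1)[OF f R] by (metis imageI)
    fix x y assume "x \<in> f ` ring_gen B" "y \<in> f ` ring_gen B"
    then obtain a b where ab: "a \<in> ring_gen B" "x = f a" "b \<in> ring_gen B" "y = f b" by auto
    then show "x - y \<in> f ` ring_gen B" "x * y \<in> f ` ring_gen B"
      using subring_setD(3,4)[OF R ab(1,3)] hom_onD(4,5)[OF f R ab(1,3)] by (metis imageI)+
  qed
  then show "ring_gen (f ` B) \<subseteq> f ` ring_gen B"
    using ring_gen_superset[of B] by (intro ring_gen_least) auto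
  have "subring_set {a \<in> ring_gen B. f a \<in> ring_gen (f ` B)}"
    using subring_setD[OF R] hom_onD[OF f R] subring_setD[OF subring_set_ring_gen[of "f ` B"]]
    by (auto simp: subring_set_def)
  then have "ring_gen B \<subseteq> {a \<in> ring_gen B. f a \<in> ring_gen (f ` B)}"
    using ring_gen_superset[of B] ring_gen_superset[of "f ` B"] by (intro ring_gen_least) auto
  then show "f ` ring_gen B \<subseteq> ring_gen (f ` B)" by auto
qed

text \<open>The kernels of the maps \<open>\<psi> i\<close> form the strictly increasing chain. The
  last element is specialised first because this leaves the others alone: g fixes the ring generated
  by the earlier ones, so they still lie in the image ring and the induction hypothesis applies
  there.\<close>

lemma hom_chain:
  fixes t :: "nat \<Rightarrow> 'a::{alg_closed_field, field_char_0}"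
  assumes "\<And>i. i < r \<Longrightarrow> transcendental_over (ring_gen (t ` {..<i})) (t i)"
    and "finite B" "t ` {..<r} \<subseteq> ring_gen B"
  shows "\<exists>\<psi> :: nat \<Rightarrow> 'a \<Rightarrow> 'a. (\<forall>x. \<psi> 0 x = x) \<and> (\<forall>i\<le>r. hom_on (ring_gen B) (\<psi> i)) \<and>
    (\<forall>i<r. (\<forall>a\<in>ring_gen B. \<psi> i a = 0 \<longrightarrow> \<psi> (Suc i) a = 0) \<and>
           (\<exists>a\<in>ring_gen B. \<psi> i a \<noteq> 0 \<and> \<psi> (Suc i) a = 0))"
  using assms
proof (induction r arbitrary: B)
  case 0
  then show ?case by (intro exI[of _ "\<lambda>_ x. x"]) (auto simp: hom_on_def)
next
  case (Suc r)
  let ?D = "ring_gen (t ` {..<r})"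
  note R = subring_set_ring_gen[of B]
  have DB: "?D \<subseteq> ring_gen B" using Suc.prems(3) by (intro ring_gen_least subring_set_ring_gen) auto
  have tB: "t r \<in> ring_gen B" using Suc.prems(3) by auto
  obtain g :: "'a \<Rightarrow> 'a" and a where g: "hom_on (ring_gen B) g" "\<forall>x\<in>?D. g x = x"
    "a \<in> ring_gen B" "a \<noteq> 0" "g a = 0"
    using hom_with_kernel[OF subring_set_ring_gen Suc.prems(1)[OF lessI] Suc.prems(2) DB tB] by blast
  note img = hom_on_image_ring_gen[OF g(1)]
  have "t ` {..<r} \<subseteq> ring_gen (g ` B)"
  proof
    fix x assume x: "x \<in> t ` {..<r}"
    then have "x \<in> ?D" by (rule subsetD[OF ring_gen_superset])
    then have "g x = x" using g(2) by blast
    moreover have "x \<in> ring_gen B" using x Suc.prems(3) by auto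
    ultimately show "x \<in> ring_gen (g ` B)" unfolding img[symmetric] by (metis imageI)
  qed
  then have "\<exists>\<psi> :: nat \<Rightarrow> 'a \<Rightarrow> 'a. (\<forall>x. \<psi> 0 x = x) \<and> (\<forall>i\<le>r. hom_on (ring_gen (g ` B)) (\<psi> i)) \<and>
    (\<forall>i<r. (\<forall>a\<in>ring_gen (g ` B). \<psi> i a = 0 \<longrightarrow> \<psi> (Suc i) a = 0) \<and>
           (\<exists>a\<in>ring_gen (g ` B). \<psi> i a \<noteq> 0 \<and> \<psi> (Suc i) a = 0))"
    using Suc.prems(1,2) by (intro Suc.IH) auto
  then obtain \<psi> :: "nat \<Rightarrow> 'a \<Rightarrow> 'a" where \<psi>: "\<forall>x. \<psi> 0 x = x"
    "\<forall>i\<le>r. hom_on (g ` ring_gen B) (\<psi> i)"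
    "\<forall>i<r. (\<forall>a\<in>g ` ring_gen B. \<psi> i a = 0 \<longrightarrow> \<psi> (Suc i) a = 0) \<and>
           (\<exists>a\<in>g ` ring_gen B. \<psi> i a \<noteq> 0 \<and> \<psi> (Suc i) a = 0)"
    unfolding img by blast
  \<comment> \<open>The chain of the image ring is pulled back along g, with the identity put in
    front; the element a that g kills makes the first inclusion strict.\<close>
  define \<phi> where "\<phi> i = (case i of 0 \<Rightarrow> \<lambda>x. x | Suc j \<Rightarrow> \<lambda>x. \<psi> j (g x))" for i
  have "hom_on (ring_gen B) (\<phi> i)" if "i \<le> Suc r" for i
  proof (cases i)
    case (Suc j)
    then have "hom_on (g ` ring_gen B) (\<psi> j)" using \<psi>(2) that by auto
    then show ?thesis using g(1) by (auto simp: \<phi>_def Suc hom_on_def)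
  qed (auto simp: \<phi>_def hom_on_def)
  moreover have "(\<forall>a\<in>ring_gen B. \<phi> i a = 0 \<longrightarrow> \<phi> (Suc i) a = 0) \<and>
           (\<exists>a\<in>ring_gen B. \<phi> i a \<noteq> 0 \<and> \<phi> (Suc i) a = 0)" if "i < Suc r" for i
  proof (cases i)
    case 0
    then show ?thesis using g \<psi>(1) hom_onD(2)[OF g(1) R] by (auto simp: \<phi>_def)
  next
    case (Suc j)
    then show ?thesis using \<psi>(3) that by (auto simp: \<phi>_def)
  qed
  ultimately show ?case by (intro exI[of _ \<phi>]) (auto simp: \<phi>_def)
qed

section \<open>Countability and algebraically independent numbers\<close>

lemma countable_poly_over:
  assumes "countable D"
  shows "countable (poly_over D)"
proof (rule countable_subset)
  show "poly_over D \<subseteq> Poly ` lists D"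
  proof
    fix p assume "p \<in> poly_over D"
    then have "coeffs p \<in> lists D" by (auto simp: poly_over_def coeffs_def)
    then show "p \<in> Poly ` lists D" by (metis Poly_coeffs imageI)
  qed
qed (use assms in \<open>simp add: countable_lists\<close>)

lemma countable_ring_gen:
  assumes "finite B"
  shows "countable (ring_gen (B :: 'a::comm_ring_1 set))"
  using assms
proof (induction rule: finite_induct)
  case empty
  have "subring_set (range (of_int :: int \<Rightarrow> 'a))"
    unfolding subring_set_def by (auto simp flip: of_int_diff of_int_mult intro!: rev_image_eqI[of 1])
  then have "ring_gen {} \<subseteq> range (of_int :: int \<Rightarrow> 'a)" by (rule ring_gen_least) auto
  then show ?case by (rule countable_subset) auto
next
  case (insert b B)
  have "ring_gen (insert b B) \<subseteq> ring_gen (insert b (ring_gen B))"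
    using ring_gen_superset[of "insert b (ring_gen B)"] ring_gen_superset[of B]
    by (intro ring_gen_least subring_set_ring_gen) auto
  also have "\<dots> = adjoin (ring_gen B) b" by (simp add: adjoin_eq_ring_gen subring_set_ring_gen)
  finally show ?case
    using countable_poly_over[OF insert.IH] by (auto simp: adjoin_def intro: countable_subset)
qed

text \<open>The numbers algebraic over a finitely generated ring form a countable union of finite
  sets of roots, whereas the complex numbers are uncountable; so a sequence can be chosen step by
  step.\<close>

lemma exists_algebraically_independent:
  obtains t :: "nat \<Rightarrow> complex" where "\<And>i. transcendental_over (ring_gen (t ` {..<i})) (t i)"
proof -
  have ex: "\<exists>z. transcendental_over (ring_gen B) z" if "finite B" for B :: "complex set"
  proof (rule ccontr)
    assume "\<not> ?thesis"
    then have "UNIV \<subseteq> (\<Union>p\<in>poly_over (ring_gen B) - {0}. {z. poly p z = 0})"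
      by (auto simp: transcendental_over_def)
    moreover have "countable (\<Union>p\<in>poly_over (ring_gen B) - {0}. {z. poly p z = 0})"
      using countable_poly_over[OF countable_ring_gen[OF that]]
      by (intro countable_UN countable_Diff) (auto intro!: countable_finite poly_roots_finite)
    ultimately show False using uncountable_UNIV_complex countable_subset by blast
  qed
  define pick where "pick B = (SOME z. transcendental_over (ring_gen B) z)" for B :: "complex set"
  \<comment> \<open>The recursion carries the set of the first n choices, because the next choice
    depends on all of them; the sequence is read off from it.\<close>
  define S where "S = rec_nat {} (\<lambda>_ B. insert (pick B) B)"
  have S: "S 0 = {}" "\<And>n. S (Suc n) = insert (pick (S n)) (S n)" by (simp_all add: S_def)
  have fin: "finite (S n)" for n by (induction n) (auto simp: S)
  have img: "(\<lambda>n. pick (S n)) ` {..<n} = S n" for n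
    by (induction n) (auto simp: S lessThan_Suc)
  show ?thesis
  proof (rule that[of "\<lambda>n. pick (S n)"])
    fix i
    show "transcendental_over (ring_gen ((\<lambda>n. pick (S n)) ` {..<i})) (pick (S i))"
      unfolding img using someI_ex[OF ex[OF fin[of i]]] by (simp add: pick_def)
  qed
qed

text \<open>Terms for closing a sequence of complex numbers under the field operations and roots; the
  closure is countable because there are countably many terms.\<close>

datatype root_term = Var nat | Sub root_term root_term | Mult root_term root_term | Inverse root_term
  | Root nat root_term

instance root_term :: countable by countable_datatype

primrec eval_root_term :: "(nat \<Rightarrow> complex) \<Rightarrow> root_term \<Rightarrow> complex" where
  "eval_root_term t (Var n) = t n"
| "eval_root_term t (Sub a b) = eval_root_term t a - eval_root_term t b"
| "eval_root_term t (Mult a b) = eval_root_term t a * eval_root_term t b"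
| "eval_root_term t (Inverse a) = inverse (eval_root_term t a)"
| "eval_root_term t (Root n a) = exp (Ln (eval_root_term t a) / of_nat n)"

definition subfield_set :: "'a::field set \<Rightarrow> bool" where
  "subfield_set L \<longleftrightarrow> subring_set L \<and> (\<forall>x\<in>L. inverse x \<in> L)"

text \<open>The values of all terms form the field. The unit is obtained as \<open>t 0\<close> times
  its inverse, which uses \<open>t 0 \<noteq> 0\<close>, and the roots are the ones given by the
  principal logarithm.\<close>

lemma exists_countable_divisible_subfield:
  fixes t :: "nat \<Rightarrow> complex"
  assumes "t 0 \<noteq> 0"
  obtains L where "subfield_set L" "countable L" "range t \<subseteq> L"
    "\<And>z n. z \<in> L \<Longrightarrow> z \<noteq> 0 \<Longrightarrow> n > 0 \<Longrightarrow> \<exists>w\<in>L. w \<noteq> 0 \<and> w ^ n = z"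
proof (rule that[of "range (eval_root_term t)"])
  have closed: "x - y \<in> range (eval_root_term t)" "x * y \<in> range (eval_root_term t)"
    "inverse x \<in> range (eval_root_term t)" "exp (Ln x / of_nat n) \<in> range (eval_root_term t)"
    if "x \<in> range (eval_root_term t)" "y \<in> range (eval_root_term t)" for x y n
    using that by (auto simp flip: eval_root_term.simps(2-5))
  have t: "t n \<in> range (eval_root_term t)" for n
    by (metis eval_root_term.simps(1) rangeI)
  have "t 0 * inverse (t 0) \<in> range (eval_root_term t)" by (intro closed(2) closed(3)[OF _ t] t)
  then have "1 \<in> range (eval_root_term t)" using assms by simp
  then show "subfield_set (range (eval_root_term t))"
    by (auto simp: subfield_set_def subring_set_def intro: closed simp del: eval_root_term.simps)
  show "countable (range (eval_root_term t))" "range t \<subseteq> range (eval_root_term t)"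
    using t by auto
  fix z n assume z: "z \<in> range (eval_root_term t)" "z \<noteq> 0" and n: "n > (0::nat)"
  have "exp (Ln z / of_nat n) ^ n = z" using z n by (simp flip: exp_of_nat_mult)
  then show "\<exists>w\<in>range (eval_root_term t). w \<noteq> 0 \<and> w ^ n = z" 
    by (intro bexI[OF _ closed(4)[OF z(1) z(1), of n]]) simp
qed

section \<open>Characters with values in a divisible group\<close>

text \<open>The graph of a homomorphism from a subgroup of \<open>G\<close> to the nonzero elements of \<open>L\<close>.\<close>

definition partial_character :: "('a, 'e) monoid_scheme \<Rightarrow> 'k::field set \<Rightarrow> ('a \<times> 'k) set \<Rightarrow> bool" where
  "partial_character G L \<Gamma> \<longleftrightarrow> \<Gamma> \<subseteq> carrier G \<times> (L - {0}) \<and> (\<one>\<^bsub>G\<^esub>, 1) \<in> \<Gamma> \<and>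
     (\<forall>(x, a)\<in>\<Gamma>. \<forall>(y, b)\<in>\<Gamma>. (x \<otimes>\<^bsub>G\<^esub> y, a * b) \<in> \<Gamma>) \<and>
     (\<forall>(x, a)\<in>\<Gamma>. (inv\<^bsub>G\<^esub> x, inverse a) \<in> \<Gamma>) \<and> (\<forall>a. (\<one>\<^bsub>G\<^esub>, a) \<in> \<Gamma> \<longrightarrow> a = 1)"

context comm_group
begin

context
  fixes L :: "'k::field set" and \<Gamma> :: "('a \<times> 'k) set"
  assumes \<Gamma>: "partial_character G L \<Gamma>"
begin

lemma partial_character_dom: "(x, a) \<in> \<Gamma> \<Longrightarrow> x \<in> carrier G \<and> a \<in> L \<and> a \<noteq> 0"
  using \<Gamma> by (auto simp: partial_character_def)

lemma partial_character_one: "(\<one>, 1) \<in> \<Gamma>"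
  using \<Gamma> by (auto simp: partial_character_def)

lemma partial_character_mult: "(x, a) \<in> \<Gamma> \<Longrightarrow> (y, b) \<in> \<Gamma> \<Longrightarrow> (x \<otimes> y, a * b) \<in> \<Gamma>"
  using \<Gamma> by (auto simp: partial_character_def)

lemma partial_character_inv: "(x, a) \<in> \<Gamma> \<Longrightarrow> (inv x, inverse a) \<in> \<Gamma>"
  using \<Gamma> by (auto simp: partial_character_def)

text \<open>The definition asks for a unique value only at the identity; dividing two pairs with the
  same first component spreads this to the whole graph.\<close>

lemma partial_character_unique:
  assumes "(x, a) \<in> \<Gamma>" "(x, b) \<in> \<Gamma>"
  shows "a = b"
proof -
  have "(x \<otimes> inv x, a * inverse b) \<in> \<Gamma>"
    using assms by (intro partial_character_mult partial_character_inv)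
  then have "a * inverse b = 1"
    using \<Gamma> partial_character_dom[OF assms(1)] by (auto simp: partial_character_def)
  then show ?thesis
    using partial_character_dom[OF assms(2)] by (simp add: field_simps)
qed

lemma partial_character_nat_pow: "(x, a) \<in> \<Gamma> \<Longrightarrow> (x [^] (n::nat), a ^ n) \<in> \<Gamma>"
  by (induction n) (auto simp: partial_character_one power_commutes[symmetric] intro: partial_character_mult)

lemma partial_character_int_pow:
  assumes "(x, a) \<in> \<Gamma>"
  shows "(x [^] (n::int), a powi n) \<in> \<Gamma>"
proof (cases n rule: int_cases2)
  case (nonneg m)
  then show ?thesis using partial_character_nat_pow[OF assms] by (simp only: int_pow_int power_int_of_nat)
next
  case (nonpos m)
  have "x \<in> carrier G" using partial_character_dom[OF assms] by blast
  with nonpos show ?thesis using partial_character_inv[OF partial_character_nat_pow[OF assms, of m]]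
    by (simp only: int_pow_neg_int power_int_of_nat power_int_minus)
qed

text \<open>Finds a value for g compatible with the given graph. If no positive power of g lies in
  the domain, 1 will do. Otherwise let m be the least positive exponent of such a power; an m-th
  root of its value exists by divisibility and fits all powers in the domain, whose exponents are
  multiples of m.\<close>

lemma partial_character_root:
  assumes div: "\<And>z n. z \<in> L \<Longrightarrow> z \<noteq> 0 \<Longrightarrow> n > 0 \<Longrightarrow> \<exists>w\<in>L. w \<noteq> 0 \<and> w ^ n = z"
    and L: "1 \<in> L" and g: "g \<in> carrier G"
  obtains c where "c \<in> L" "c \<noteq> 0" "\<forall>n a. (g [^] (n::int), a) \<in> \<Gamma> \<longrightarrow> a = c powi n"
proof (cases "\<exists>n::nat. n > 0 \<and> (\<exists>a. (g [^] n, a) \<in> \<Gamma>)")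
  case False
  have *: "a = 1 powi n" if "(g [^] (n::int), a) \<in> \<Gamma>" for n a
  proof (cases "n = 0")
    case True
    then show ?thesis using that partial_character_unique partial_character_one by fastforce
  next
    case n: False
    have "\<exists>b. (g [^] nat \<bar>n\<bar>, b) \<in> \<Gamma>"
    proof (cases n rule: int_cases2)
      case (nonneg m)
      then show ?thesis using that by (auto simp: int_pow_int)
    next
      case (nonpos m)
      then show ?thesis using partial_character_inv[OF that] g by (auto simp: int_pow_neg_int)
    qed
    moreover have "nat \<bar>n\<bar> > 0" using n by simp
    ultimately show ?thesis using False by blast
  qed
  show ?thesis by (rule that[of 1]) (use L * in auto)
next
  case True
  define m where "m = (LEAST n. n > 0 \<and> (\<exists>a. (g [^] (n::nat), a) \<in> \<Gamma>))"
  from LeastI_ex[OF True] obtain z where m: "m > 0" "(g [^] m, z) \<in> \<Gamma>"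
    unfolding m_def by blast
  have least: "m \<le> n" if "n > 0" "(g [^] n, a) \<in> \<Gamma>" for n a
    unfolding m_def using that by (intro Least_le) blast
  obtain w where w: "w \<in> L" "w \<noteq> 0" "w ^ m = z"
    using div m partial_character_dom[OF m(2)] by blast
  have "a = w powi n" if n: "(g [^] n, a) \<in> \<Gamma>" for n :: int and a
  proof -
    \<comment> \<open>If m did not divide n, the remainder r would be a smaller positive exponent
      with a power of g in the domain.\<close>
    define k r where "k = n div int m" and "r = n mod int m"
    have nk: "n = int m * k + r" "0 \<le> r" "r < int m" using m by (auto simp: k_def r_def)
    have pk: "(g [^] (int m * k), w powi (int m * k)) \<in> \<Gamma>"
      using partial_character_int_pow[OF m(2), of k] g
      by (simp add: int_pow_pow w(3)[symmetric] power_int_mult flip: int_pow_int)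
    have "(g [^] n \<otimes> inv (g [^] (int m * k)), a * inverse (w powi (int m * k))) \<in> \<Gamma>"
      using n pk by (intro partial_character_mult partial_character_inv)
    moreover have "g [^] n \<otimes> inv (g [^] (int m * k)) = g [^] r"
      using g by (simp add: nk(1) int_pow_diff[symmetric])
    ultimately have "(g [^] nat r, a * inverse (w powi (int m * k))) \<in> \<Gamma>"
      using int_pow_int[of G g "nat r"] unfolding nat_0_le[OF nk(2)] by (simp only:)
    then have "r = 0" using least[of "nat r"] nk by force
    then have "(g [^] (int m * k), a) \<in> \<Gamma>" using n nk(1) by simp
    from partial_character_unique[OF this pk] show ?thesis using nk(1) \<open>r = 0\<close> by simp
  qed
  then show ?thesis using that[of w] w by blast
qed

text \<open>The choice of c secures uniqueness at the identity: if x g^n = 1, then g^(-n) = x lies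
  in the old domain, so its value is c^(-n) and the product of the values is 1.\<close>

lemma partial_character_extend:
  assumes L: "subfield_set L" and c: "c \<in> L" "c \<noteq> 0" "\<forall>n a. (g [^] (n::int), a) \<in> \<Gamma> \<longrightarrow> a = c powi n"
    and g: "g \<in> carrier G"
  shows "partial_character G L {(x \<otimes> g [^] (n::int), a * c powi n) | x a n. (x, a) \<in> \<Gamma>}"
    (is "partial_character G L ?\<Delta>")
proof -
  note R = L[unfolded subfield_set_def, THEN conjunct1]
  have cL: "c powi n \<in> L" for n :: int
  proof (cases "n \<ge> 0")
    case True
    then show ?thesis using subring_set_power[OF R c(1)] by (simp add: power_int_def)
  next
    case False
    then show ?thesis using subring_set_power[OF R c(1)] L by (simp add: power_int_def power_inverse subfield_set_def)
  qed
  show ?thesis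
    unfolding partial_character_def
  proof (intro conjI)
    show "?\<Delta> \<subseteq> carrier G \<times> (L - {0})"
      using c g cL subring_setD(4)[OF R] by (auto dest: partial_character_dom)
    show "(\<one>, 1) \<in> ?\<Delta>" using partial_character_one g by (force intro!: exI[of _ \<one>] exI[of _ 1] exI[of _ "0::int"])
    show "\<forall>(x, a)\<in>?\<Delta>. \<forall>(y, b)\<in>?\<Delta>. (x \<otimes> y, a * b) \<in> ?\<Delta>"
    proof clarify
      fix x a n y b and m :: int
      assume xy: "(x, a) \<in> \<Gamma>" "(y, b) \<in> \<Gamma>"
      have "x \<in> carrier G" "y \<in> carrier G" using xy partial_character_dom by auto
      then have "x \<otimes> g [^] n \<otimes> (y \<otimes> g [^] m) = (x \<otimes> y) \<otimes> g [^] (n + m)"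
        using g by (simp add: int_pow_mult m_ac)
      moreover have "a * c powi n * (b * c powi m) = (a * b) * c powi (n + m)"
        using c by (simp add: power_int_add)
      ultimately show "\<exists>x' a' n'. (x \<otimes> g [^] n \<otimes> (y \<otimes> g [^] m), a * c powi n * (b * c powi m)) =
           (x' \<otimes> g [^] (n'::int), a' * c powi n') \<and> (x', a') \<in> \<Gamma>"
        using partial_character_mult[OF xy] by (metis (no_types))
    qed
    show "\<forall>(x, a)\<in>?\<Delta>. (inv x, inverse a) \<in> ?\<Delta>"
    proof clarify
      fix x a and n :: int assume x: "(x, a) \<in> \<Gamma>"
      then have "x \<in> carrier G" using partial_character_dom by auto
      then have "inv (x \<otimes> g [^] n) = inv x \<otimes> g [^] (- n)" using g by (simp add: int_pow_neg inv_mult)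
      moreover have "inverse (a * c powi n) = inverse a * c powi (- n)" by (simp add: power_int_minus)
      ultimately show "\<exists>x' a' n'. (inv (x \<otimes> g [^] n), inverse (a * c powi n)) =
           (x' \<otimes> g [^] (n'::int), a' * c powi n') \<and> (x', a') \<in> \<Gamma>"
        using partial_character_inv[OF x] by (metis (no_types))
    qed
    show "\<forall>a. (\<one>, a) \<in> ?\<Delta> \<longrightarrow> a = 1"
    proof clarify
      fix x a and n :: int assume x: "(x, a) \<in> \<Gamma>" "\<one> = x \<otimes> g [^] n"
      have "x \<in> carrier G" using x partial_character_dom by auto
      then have "x = g [^] (- n)" using x(2) g by (metis int_pow_closed int_pow_neg inv_equality)
      then have "a = c powi (- n)" using x c(3) by auto
      then show "a * c powi n = 1" using c by (simp add: power_int_minus)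
    qed
  qed
qed

end

text \<open>A divisible abelian group is injective. By Zorn's lemma there is a maximal graph above
  the one prescribed on the subgroup generated by S, and a maximal graph is defined
  everywhere.\<close>

lemma character_extension:
  fixes L :: "'k::field set" and t :: "'a \<Rightarrow> 'k"
  assumes L: "subfield_set L"
    and div: "\<And>z n. z \<in> L \<Longrightarrow> z \<noteq> 0 \<Longrightarrow> n > 0 \<Longrightarrow> \<exists>w\<in>L. w \<noteq> 0 \<and> w ^ n = z"
    and S: "int_independent G S" and t: "\<And>g. g \<in> S \<Longrightarrow> t g \<in> L \<and> t g \<noteq> 0"
  obtains \<xi> where "\<And>x. x \<in> carrier G \<Longrightarrow> \<xi> x \<in> L \<and> \<xi> x \<noteq> 0" "\<xi> \<one> = 1"
    "\<And>x y. x \<in> carrier G \<Longrightarrow> y \<in> carrier G \<Longrightarrow> \<xi> (x \<otimes> y) = \<xi> x * \<xi> y"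
    "\<And>g. g \<in> S \<Longrightarrow> \<xi> g = t g"
proof -
  note R = L[unfolded subfield_set_def, THEN conjunct1]
  have Lpow: "c powi n \<in> L" if "c \<in> L" for c and n :: int
  proof (cases "n \<ge> 0")
    case True
    then show ?thesis using subring_set_power[OF R that] by (simp add: power_int_def)
  next
    case False
    then show ?thesis using subring_set_power[OF R that] L by (simp add: power_int_def power_inverse subfield_set_def)
  qed
  have Lprod: "(\<Prod>g\<in>S. t g powi c g) \<in> L" for c :: "'a \<Rightarrow> int"
    using t Lpow by (induction S rule: infinite_finite_induct) (auto simp: subring_setD[OF R])
  have SG: "S \<subseteq> carrier G" "finite S" using S by (auto simp: int_independent_def)
  define P where "P c = finprod G (\<lambda>g. g [^] (c g :: int)) S" for c
  \<comment> \<open>Independence of S is exactly what gives this graph the single value 1 at the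
    identity.\<close>
  define \<Gamma>0 where "\<Gamma>0 = {(P c, \<Prod>g\<in>S. t g powi c g) | c. True}"
  have pw: "(\<lambda>g. g [^] (c g :: int)) \<in> S \<rightarrow> carrier G" for c using SG by auto
  have Pcl: "P c \<in> carrier G" for c unfolding P_def by (rule finprod_closed[OF pw])
  have Padd: "P (\<lambda>g. c g + d g) = P c \<otimes> P d" for c d
    unfolding P_def using SG by (subst finprod_multf[symmetric]) (auto simp: int_pow_mult intro!: finprod_cong')
  have P0: "P (\<lambda>_. 0) = \<one>" by (simp add: P_def)
  have Pneg: "P (\<lambda>g. - c g) = inv (P c)" for c
    using Padd[of "\<lambda>g. - c g" c] P0 Pcl by (intro inv_equality[symmetric]) auto
  have \<Gamma>0: "partial_character G L \<Gamma>0"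
    unfolding partial_character_def
  proof (intro conjI)
    show "\<Gamma>0 \<subseteq> carrier G \<times> (L - {0})"
      using Pcl Lprod t SG by (auto simp: \<Gamma>0_def power_int_eq_0_iff)
    show "(\<one>, 1) \<in> \<Gamma>0" using P0 by (auto simp: \<Gamma>0_def intro!: exI[of _ "\<lambda>_. 0"])
    show "\<forall>(x, a)\<in>\<Gamma>0. \<forall>(y, b)\<in>\<Gamma>0. (x \<otimes> y, a * b) \<in> \<Gamma>0"
    proof (clarsimp simp: \<Gamma>0_def)
      fix c d
      have "(\<Prod>g\<in>S. t g powi c g) * (\<Prod>g\<in>S. t g powi d g) = (\<Prod>g\<in>S. t g powi (c g + d g))"
        unfolding prod.distrib[symmetric] using t by (intro prod.cong) (auto simp: power_int_add)
      then show "\<exists>e. P c \<otimes> P d = P e \<and> (\<Prod>g\<in>S. t g powi c g) * (\<Prod>g\<in>S. t g powi d g) = (\<Prod>g\<in>S. t g powi e g)"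
        using Padd[of c d] by (intro exI[of _ "\<lambda>g. c g + d g"]) auto
    qed
    show "\<forall>(x, a)\<in>\<Gamma>0. (inv x, inverse a) \<in> \<Gamma>0"
    proof (clarsimp simp: \<Gamma>0_def)
      fix c
      show "\<exists>e. inv (P c) = P e \<and> inverse (\<Prod>g\<in>S. t g powi c g) = (\<Prod>g\<in>S. t g powi e g)"
        using Pneg[of c] by (intro exI[of _ "\<lambda>g. - c g"]) (auto simp: power_int_minus prod_inversef[symmetric] o_def)
    qed
    show "\<forall>a. (\<one>, a) \<in> \<Gamma>0 \<longrightarrow> a = 1"
    proof (clarsimp simp: \<Gamma>0_def)
      fix c assume "\<one> = P c"
      then have "\<forall>g\<in>S. c g = 0" using S unfolding int_independent_def P_def by metis
      then show "(\<Prod>g\<in>S. t g powi c g) = 1" by simp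
    qed
  qed
  define A where "A = {\<Gamma>. partial_character G L \<Gamma> \<and> \<Gamma>0 \<subseteq> \<Gamma>}"
  have "\<exists>M\<in>A. \<forall>X\<in>A. M \<subseteq> X \<longrightarrow> X = M"
  proof (rule subset_Zorn_nonempty)
    show "A \<noteq> {}" using \<Gamma>0 by (auto simp: A_def)
    fix C assume C: "C \<noteq> {}" "subset.chain A C"
    have pc: "partial_character G L \<Gamma>" "\<Gamma>0 \<subseteq> \<Gamma>" if "\<Gamma> \<in> C" for \<Gamma>
      using C that by (auto simp: subset_chain_def A_def)
    have "partial_character G L (\<Union>C)"
      unfolding partial_character_def
    proof (intro conjI)
      show "\<Union>C \<subseteq> carrier G \<times> (L - {0})"
        using pc(1) unfolding partial_character_def by (intro Union_least) blast
      show "(\<one>, 1) \<in> \<Union>C" using C(1) partial_character_one[OF pc(1)] by blast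
      show "\<forall>(x, a)\<in>\<Union>C. \<forall>(y, b)\<in>\<Union>C. (x \<otimes> y, a * b) \<in> \<Union>C"
      proof clarify
        fix x a y b X Y assume XY: "(x, a) \<in> X" "X \<in> C" "(y, b) \<in> Y" "Y \<in> C"
        then have "X \<subseteq> Y \<or> Y \<subseteq> X" using C(2) by (auto simp: subset_chain_def)
        then show "(x \<otimes> y, a * b) \<in> \<Union>C"
          using XY partial_character_mult[OF pc(1)[OF XY(2)]] partial_character_mult[OF pc(1)[OF XY(4)]] by blast
      qed
      show "\<forall>(x, a)\<in>\<Union>C. (inv x, inverse a) \<in> \<Union>C"
        using partial_character_inv[OF pc(1)] by blast
      show "\<forall>a. (\<one>, a) \<in> \<Union>C \<longrightarrow> a = 1"
        using pc(1) unfolding partial_character_def by blast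
    qed
    then show "\<Union>C \<in> A" using C(1) pc(2) by (auto simp: A_def)
  qed
  then obtain \<Gamma> where \<Gamma>: "\<Gamma> \<in> A" "\<And>X. X \<in> A \<Longrightarrow> \<Gamma> \<subseteq> X \<Longrightarrow> X = \<Gamma>" by blast
  have pc: "partial_character G L \<Gamma>" "\<Gamma>0 \<subseteq> \<Gamma>" using \<Gamma> by (auto simp: A_def)
  \<comment> \<open>The graph enlarged by a compatible value at x contains the maximal one, hence
    equals it, and x lies in its domain.\<close>
  have total: "\<exists>a. (x, a) \<in> \<Gamma>" if g: "x \<in> carrier G" for x
  proof -
    obtain c where c: "c \<in> L" "c \<noteq> 0" "\<forall>n a. (x [^] (n::int), a) \<in> \<Gamma> \<longrightarrow> a = c powi n"
      using partial_character_root[OF pc(1) _ subring_setD(1)[OF R] g] div by blast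
    let ?\<Delta> = "{(y \<otimes> x [^] (n::int), a * c powi n) | y a n. (y, a) \<in> \<Gamma>}"
    have "partial_character G L ?\<Delta>"
      by (rule partial_character_extend[OF pc(1) L c g])
    moreover have sub: "\<Gamma> \<subseteq> ?\<Delta>"
    proof clarify
      fix y a assume "(y, a) \<in> \<Gamma>"
      moreover have "y \<in> carrier G" using calculation partial_character_dom[OF pc(1)] by blast
      ultimately show "\<exists>y' a' n. (y, a) = (y' \<otimes> x [^] (n::int), a' * c powi n) \<and> (y', a') \<in> \<Gamma>"
        by (intro exI[of _ y] exI[of _ a] exI[of _ "0::int"]) simp
    qed
    ultimately have "?\<Delta> = \<Gamma>" using pc(2) by (intro \<Gamma>(2)) (auto simp: A_def)
    moreover have "(\<one> \<otimes> x [^] (1::int), 1 * c powi 1) \<in> ?\<Delta>"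
      using partial_character_one[OF pc(1)] by blast
    ultimately have "(\<one> \<otimes> x [^] (1::int), 1 * c powi 1) \<in> \<Gamma>" by (simp only:)
    then show ?thesis using g by auto
  qed
  define \<xi> where "\<xi> x = (SOME a. (x, a) \<in> \<Gamma>)" for x
  have \<xi>: "(x, \<xi> x) \<in> \<Gamma>" if "x \<in> carrier G" for x
    unfolding \<xi>_def by (rule someI_ex[OF total[OF that]])
  have eq: "\<xi> x = a" if "(x, a) \<in> \<Gamma>" for x a
    using partial_character_unique[OF pc(1) that \<xi>] partial_character_dom[OF pc(1) that] by auto
  show ?thesis
  proof (rule that)
    show "\<xi> x \<in> L \<and> \<xi> x \<noteq> 0" if "x \<in> carrier G" for x
      using \<xi>[OF that] partial_character_dom[OF pc(1)] by blast
    show "\<xi> \<one> = 1" by (rule eq[OF partial_character_one[OF pc(1)]])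
    show "\<xi> (x \<otimes> y) = \<xi> x * \<xi> y" if "x \<in> carrier G" "y \<in> carrier G" for x y
      by (intro eq partial_character_mult[OF pc(1)] \<xi> that)
    show "\<xi> g = t g" if g: "g \<in> S" for g
    proof (rule eq)
      let ?c = "\<lambda>h. if h = g then 1 else 0 :: int"
      have "P ?c = finprod G (\<lambda>h. if g = h then h else \<one>) S"
        unfolding P_def using SG by (intro finprod_cong') auto
      also have "\<dots> = g" using SG g by (intro finprod_singleton[of g S "\<lambda>x. x"]) auto
      finally have 1: "P ?c = g" .
      have "(\<Prod>h\<in>S. t h powi ?c h) = (\<Prod>h\<in>S. if h = g then t h else 1)"
        by (intro prod.cong) auto
      then have 2: "(\<Prod>h\<in>S. t h powi ?c h) = t g" using SG g by simp
      have "(g, t g) = (P ?c, \<Prod>h\<in>S. t h powi ?c h)" unfolding 1 2 ..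
      then have "(g, t g) \<in> \<Gamma>0" unfolding \<Gamma>0_def by blast
      then show "(g, t g) \<in> \<Gamma>" using pc(2) by blast
    qed
  qed
qed

end

section \<open>Stalks\<close>

text \<open>The multiplicative structure on which stalks depend, shared by sheaves of monoids,
  sheaves of rings, spectra, and their restrictions to open subsets.\<close>

locale mon_presheaf =
  fixes X :: "('p, 's, 'e) sheafed_space"
  assumes sections_monoid: "U \<in> opens X \<Longrightarrow> comm_monoid (sections X U)"
    and res_closed: "U \<in> opens X \<Longrightarrow> V \<in> opens X \<Longrightarrow> V \<subseteq> U \<Longrightarrow> s \<in> carrier (sections X U) \<Longrightarrow>
      res X U V s \<in> carrier (sections X V)"
    and res_mult: "U \<in> opens X \<Longrightarrow> V \<in> opens X \<Longrightarrow> V \<subseteq> U \<Longrightarrow> s \<in> carrier (sections X U) \<Longrightarrow>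
      t \<in> carrier (sections X U) \<Longrightarrow>
      res X U V (s \<otimes>\<^bsub>sections X U\<^esub> t) = res X U V s \<otimes>\<^bsub>sections X V\<^esub> res X U V t"
    and res_one: "U \<in> opens X \<Longrightarrow> V \<in> opens X \<Longrightarrow> V \<subseteq> U \<Longrightarrow>
      res X U V \<one>\<^bsub>sections X U\<^esub> = \<one>\<^bsub>sections X V\<^esub>"
    and res_id: "U \<in> opens X \<Longrightarrow> s \<in> carrier (sections X U) \<Longrightarrow> res X U U s = s"
    and res_comp: "U \<in> opens X \<Longrightarrow> V \<in> opens X \<Longrightarrow> W \<in> opens X \<Longrightarrow> W \<subseteq> V \<Longrightarrow> V \<subseteq> U \<Longrightarrow>
      s \<in> carrier (sections X U) \<Longrightarrow> res X V W (res X U V s) = res X U W s"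
begin

lemma opens_Int: "U \<in> opens X \<Longrightarrow> V \<in> opens X \<Longrightarrow> U \<inter> V \<in> opens X"
  by auto

lemma germ_eqI:
  assumes "U \<in> opens X" "V \<in> opens X" "s \<in> carrier (sections X U)" "t \<in> carrier (sections X V)"
    and W: "W \<in> opens X" "x \<in> W" "W \<subseteq> U \<inter> V" "res X U W s = res X V W t"
  shows "germ X x U s = germ X x V t"
proof -
  have half: "germ X x U s \<subseteq> germ X x V t"
    if A: "U \<in> opens X" "V \<in> opens X" "s \<in> carrier (sections X U)" "t \<in> carrier (sections X V)"
      "W \<subseteq> U \<inter> V" "res X U W s = res X V W t" for U V s t
  proof
    fix z assume "z \<in> germ X x U s"
    then obtain Z r W' where z: "z = (Z, r)" "Z \<in> opens X" "x \<in> Z" "r \<in> carrier (sections X Z)"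
      "W' \<in> opens X" "x \<in> W'" "W' \<subseteq> U \<inter> Z" "res X U W' s = res X Z W' r" by (auto simp: germ_def)
    let ?Y = "W \<inter> W'"
    have Y: "?Y \<in> opens X" using W z by (intro opens_Int)
    have "res X V ?Y t = res X W ?Y (res X V W t)"
      using A W z Y by (intro res_comp[symmetric]) auto
    also have "\<dots> = res X U ?Y s"
      using A W z Y by (subst A(6)[symmetric], intro res_comp) auto
    also have "\<dots> = res X W' ?Y (res X U W' s)"
      using A W z Y by (intro res_comp[symmetric]) auto
    also have "\<dots> = res X Z ?Y r"
      using A W z Y by (subst z(8), intro res_comp) auto
    finally have "res X V ?Y t = res X Z ?Y r" .
    moreover have "x \<in> ?Y" "?Y \<subseteq> V \<inter> Z" using A W z by auto
    ultimately show "z \<in> germ X x V t"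
      unfolding germ_def z(1) using z(2-4) Y by blast
  qed
  show ?thesis
  proof
    show "germ X x U s \<subseteq> germ X x V t" by (rule half) (use assms in auto)
    show "germ X x V t \<subseteq> germ X x U s" by (rule half) (use assms in auto)
  qed
qed

lemma germ_self:
  assumes "U \<in> opens X" "x \<in> U" "s \<in> carrier (sections X U)"
  shows "(U, s) \<in> germ X x U s"
  using assms by (auto simp: germ_def)

lemma germ_eqD:
  assumes "V \<in> opens X" "x \<in> V" "t \<in> carrier (sections X V)" "germ X x U s = germ X x V t"
  obtains W where "W \<in> opens X" "x \<in> W" "W \<subseteq> U \<inter> V" "res X U W s = res X V W t"
  using germ_self[OF assms(1-3)] unfolding assms(4)[symmetric] by (auto simp: germ_def)

lemma germ_memD:
  assumes "U \<in> opens X" "s \<in> carrier (sections X U)" "(V, t) \<in> germ X x U s"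
  shows "V \<in> opens X" "x \<in> V" "t \<in> carrier (sections X V)" "germ X x V t = germ X x U s"
proof -
  from assms obtain W where W: "V \<in> opens X" "x \<in> V" "t \<in> carrier (sections X V)"
    "W \<in> opens X" "x \<in> W" "W \<subseteq> U \<inter> V" "res X U W s = res X V W t" by (auto simp: germ_def)
  then show "V \<in> opens X" "x \<in> V" "t \<in> carrier (sections X V)" by auto
  show "germ X x V t = germ X x U s"
    using assms W by (intro germ_eqI[of V U t s W]) auto
qed

lemma germ_res:
  assumes "U \<in> opens X" "V \<in> opens X" "x \<in> V" "V \<subseteq> U" "s \<in> carrier (sections X U)"
  shows "germ X x V (res X U V s) = germ X x U s"
  using assms by (intro germ_eqI[of V U _ _ V]) (auto simp: res_closed res_id)

lemma sections_m_closed: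
  "U \<in> opens X \<Longrightarrow> s \<in> carrier (sections X U) \<Longrightarrow> t \<in> carrier (sections X U) \<Longrightarrow>
    s \<otimes>\<^bsub>sections X U\<^esub> t \<in> carrier (sections X U)"
  using sections_monoid by (simp add: comm_monoid_def monoid.m_closed)

lemma sections_one_closed: "U \<in> opens X \<Longrightarrow> \<one>\<^bsub>sections X U\<^esub> \<in> carrier (sections X U)"
  using sections_monoid by (simp add: comm_monoid_def monoid.one_closed)

text \<open>The product in the stalk is a union over all pairs of representatives; since all pairs
  give the same germ, the union collapses to it.\<close>

lemma stalk_mult:
  assumes U: "U \<in> opens X" "x \<in> U" "s \<in> carrier (sections X U)"
    and V: "V \<in> opens X" "x \<in> V" "t \<in> carrier (sections X V)"
  shows "germ X x U s \<otimes>\<^bsub>stalk X x\<^esub> germ X x V t =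
    germ X x (U \<inter> V) (res X U (U \<inter> V) s \<otimes>\<^bsub>sections X (U \<inter> V)\<^esub> res X V (U \<inter> V) t)"
proof -
  have key: "germ X x (U' \<inter> V') (res X U' (U' \<inter> V') s' \<otimes>\<^bsub>sections X (U' \<inter> V')\<^esub> res X V' (U' \<inter> V') t') =
      germ X x (U \<inter> V) (res X U (U \<inter> V) s \<otimes>\<^bsub>sections X (U \<inter> V)\<^esub> res X V (U \<inter> V) t)"
    if st: "(U', s') \<in> germ X x U s" "(V', t') \<in> germ X x V t" for U' s' V' t'
  proof -
    note U' = germ_memD[OF U(1,3) st(1)] and V' = germ_memD[OF V(1,3) st(2)]
    obtain W1 where W1: "W1 \<in> opens X" "x \<in> W1" "W1 \<subseteq> U' \<inter> U" "res X U' W1 s' = res X U W1 s"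
      using germ_eqD[OF U U'(4)] .
    obtain W2 where W2: "W2 \<in> opens X" "x \<in> W2" "W2 \<subseteq> V' \<inter> V" "res X V' W2 t' = res X V W2 t"
      using germ_eqD[OF V V'(4)] .
    let ?W = "W1 \<inter> W2"
    have W: "?W \<in> opens X" "x \<in> ?W" using W1 W2 opens_Int by auto
    have o: "U \<inter> V \<in> opens X" "U' \<inter> V' \<in> opens X" using U V U' V' opens_Int by auto
    have sub: "?W \<subseteq> U \<inter> V" "?W \<subseteq> U' \<inter> V'" using W1 W2 by auto
    have cl: "res X U (U \<inter> V) s \<in> carrier (sections X (U \<inter> V))" "res X V (U \<inter> V) t \<in> carrier (sections X (U \<inter> V))"
      "res X U' (U' \<inter> V') s' \<in> carrier (sections X (U' \<inter> V'))" "res X V' (U' \<inter> V') t' \<in> carrier (sections X (U' \<inter> V'))"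
      using o U V U' V' by (auto intro!: res_closed)
    have "res X (U' \<inter> V') ?W (res X U' (U' \<inter> V') s' \<otimes>\<^bsub>sections X (U' \<inter> V')\<^esub> res X V' (U' \<inter> V') t') =
        res X U' ?W s' \<otimes>\<^bsub>sections X ?W\<^esub> res X V' ?W t'"
      using res_mult[OF o(2) W(1) _ cl(3,4)] res_comp[OF U'(1) o(2) W(1) _ _ U'(3)]
        res_comp[OF V'(1) o(2) W(1) _ _ V'(3)] sub by auto
    also have "res X U' ?W s' = res X W1 ?W (res X U' W1 s')"
      using W W1 U' by (intro res_comp[symmetric]) auto
    also have "\<dots> = res X U ?W s" unfolding W1(4) using W W1 U by (intro res_comp) auto
    also have "res X V' ?W t' = res X W2 ?W (res X V' W2 t')"
      using W W2 V' by (intro res_comp[symmetric]) auto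
    also have "\<dots> = res X V ?W t" unfolding W2(4) using W W2 V by (intro res_comp) auto
    also have "res X U ?W s \<otimes>\<^bsub>sections X ?W\<^esub> res X V ?W t =
        res X (U \<inter> V) ?W (res X U (U \<inter> V) s \<otimes>\<^bsub>sections X (U \<inter> V)\<^esub> res X V (U \<inter> V) t)"
      using res_mult[OF o(1) W(1) _ cl(1,2)] res_comp[OF U(1) o(1) W(1) _ _ U(3)]
        res_comp[OF V(1) o(1) W(1) _ _ V(3)] sub by auto
    finally show ?thesis
      using o cl W sub by (intro germ_eqI[OF o(2,1) _ _ W]) (auto intro!: sections_m_closed)
  qed
  have const: "(\<Union>a\<in>A. \<Union>b\<in>B. F a b) = C" if "\<And>a b. a \<in> A \<Longrightarrow> b \<in> B \<Longrightarrow> F a b = C" "a0 \<in> A" "b0 \<in> B"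
    for A B F C a0 b0 using that by auto
  have "germ X x U s \<otimes>\<^bsub>stalk X x\<^esub> germ X x V t =
      (\<Union>a\<in>germ X x U s. \<Union>b\<in>germ X x V t. germ X x (fst a \<inter> fst b)
        (res X (fst a) (fst a \<inter> fst b) (snd a) \<otimes>\<^bsub>sections X (fst a \<inter> fst b)\<^esub> res X (fst b) (fst a \<inter> fst b) (snd b)))"
    by (simp add: stalk_def split_beta)
  also have "\<dots> = germ X x (U \<inter> V) (res X U (U \<inter> V) s \<otimes>\<^bsub>sections X (U \<inter> V)\<^esub> res X V (U \<inter> V) t)"
    by (rule const[OF _ germ_self[OF U] germ_self[OF V]]) (use key in auto)
  finally show ?thesis .
qed

lemma germ_mult:
  assumes U: "U \<in> opens X" "x \<in> U" "s \<in> carrier (sections X U)" "t \<in> carrier (sections X U)"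
  shows "germ X x U s \<otimes>\<^bsub>stalk X x\<^esub> germ X x U t = germ X x U (s \<otimes>\<^bsub>sections X U\<^esub> t)"
  using stalk_mult[OF U(1-3) U(1,2,4)] U by (simp add: res_id)

lemma germ_one:
  assumes "U \<in> opens X" "x \<in> U"
  shows "germ X x U \<one>\<^bsub>sections X U\<^esub> = \<one>\<^bsub>stalk X x\<^esub>"
proof -
  have "U \<subseteq> points X" using assms openin_subset by auto
  then have "germ X x U (res X (points X) U \<one>\<^bsub>sections X (points X)\<^esub>) = germ X x (points X) \<one>\<^bsub>sections X (points X)\<^esub>"
    using assms by (intro germ_res sections_one_closed) auto
  then show ?thesis using assms \<open>U \<subseteq> points X\<close> by (simp add: res_one stalk_def)
qed

lemma germ_closed:
  "U \<in> opens X \<Longrightarrow> x \<in> U \<Longrightarrow> s \<in> carrier (sections X U) \<Longrightarrow> germ X x U s \<in> carrier (stalk X x)"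
  by (auto simp: stalk_def)

lemma stalk_cases:
  assumes "g \<in> carrier (stalk X x)"
  obtains U s where "U \<in> opens X" "x \<in> U" "s \<in> carrier (sections X U)" "g = germ X x U s"
  using assms by (auto simp: stalk_def)

lemma stalk_cases2:
  assumes "g \<in> carrier (stalk X x)" "h \<in> carrier (stalk X x)"
  obtains U s t where "U \<in> opens X" "x \<in> U" "s \<in> carrier (sections X U)" "t \<in> carrier (sections X U)"
    "g = germ X x U s" "h = germ X x U t"
proof -
  obtain U s where U: "U \<in> opens X" "x \<in> U" "s \<in> carrier (sections X U)" "g = germ X x U s"
    using stalk_cases[OF assms(1)] .
  obtain V t where V: "V \<in> opens X" "x \<in> V" "t \<in> carrier (sections X V)" "h = germ X x V t"
    using stalk_cases[OF assms(2)] .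
  have o: "U \<inter> V \<in> opens X" using U V opens_Int by auto
  show ?thesis
  proof (rule that[of "U \<inter> V" "res X U (U \<inter> V) s" "res X V (U \<inter> V) t"])
    show "g = germ X x (U \<inter> V) (res X U (U \<inter> V) s)" using U V o by (simp add: germ_res)
    show "h = germ X x (U \<inter> V) (res X V (U \<inter> V) t)" using U V o by (simp add: germ_res)
  qed (use U V o in \<open>auto intro!: res_closed\<close>)
qed

lemma stalk_comm_monoid:
  assumes x: "x \<in> points X"
  shows "comm_monoid (stalk X x)"
proof (rule comm_monoidI)
  show one: "\<one>\<^bsub>stalk X x\<^esub> \<in> carrier (stalk X x)"
    using germ_one[of "points X" x] x
      germ_closed[of "points X" x "\<one>\<^bsub>sections X (points X)\<^esub>"] sections_one_closed[of "points X"] by simp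
  fix g h assume gh: "g \<in> carrier (stalk X x)" "h \<in> carrier (stalk X x)"
  obtain U s t where U: "U \<in> opens X" "x \<in> U" "s \<in> carrier (sections X U)" "t \<in> carrier (sections X U)"
    "g = germ X x U s" "h = germ X x U t" using stalk_cases2[OF gh] .
  interpret SU: comm_monoid "sections X U" using U by (intro sections_monoid)
  show "g \<otimes>\<^bsub>stalk X x\<^esub> h \<in> carrier (stalk X x)"
    using U by (simp add: germ_mult germ_closed)
  show "g \<otimes>\<^bsub>stalk X x\<^esub> h = h \<otimes>\<^bsub>stalk X x\<^esub> g"
    using U by (simp add: germ_mult SU.m_comm)
  show "\<one>\<^bsub>stalk X x\<^esub> \<otimes>\<^bsub>stalk X x\<^esub> g = g"
    using U germ_one[OF U(1,2), symmetric] by (simp add: germ_mult)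
  fix k assume k: "k \<in> carrier (stalk X x)"
  obtain V r where V: "V \<in> opens X" "x \<in> V" "r \<in> carrier (sections X V)" "k = germ X x V r"
    using stalk_cases[OF k] .
  let ?W = "U \<inter> V"
  have W: "?W \<in> opens X" "x \<in> ?W" using U V opens_Int by auto
  interpret SW: comm_monoid "sections X ?W" using W by (intro sections_monoid)
  have eq: "g = germ X x ?W (res X U ?W s)" "h = germ X x ?W (res X U ?W t)" "k = germ X x ?W (res X V ?W r)"
    using U V W by (auto simp: germ_res)
  have cl: "res X U ?W s \<in> carrier (sections X ?W)" "res X U ?W t \<in> carrier (sections X ?W)"
    "res X V ?W r \<in> carrier (sections X ?W)" using U V W by (auto intro!: res_closed)
  show "g \<otimes>\<^bsub>stalk X x\<^esub> h \<otimes>\<^bsub>stalk X x\<^esub> k = g \<otimes>\<^bsub>stalk X x\<^esub> (h \<otimes>\<^bsub>stalk X x\<^esub> k)"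
    unfolding eq using W cl by (simp add: germ_mult SW.m_assoc)
qed

lemma germ_UnitsI:
  assumes "U \<in> opens X" "s \<in> carrier (sections X U)" "W \<in> opens X" "x \<in> W" "W \<subseteq> U"
    and t: "t \<in> carrier (sections X W)" "res X U W s \<otimes>\<^bsub>sections X W\<^esub> t = \<one>\<^bsub>sections X W\<^esub>"
  shows "germ X x U s \<in> Units (stalk X x)"
proof -
  interpret SW: comm_monoid "sections X W" using assms by (intro sections_monoid)
  have cl: "res X U W s \<in> carrier (sections X W)" using assms by (intro res_closed)
  have eq: "germ X x U s = germ X x W (res X U W s)" using assms by (simp add: germ_res)
  have "germ X x U s \<otimes>\<^bsub>stalk X x\<^esub> germ X x W t = \<one>\<^bsub>stalk X x\<^esub>"
    "germ X x W t \<otimes>\<^bsub>stalk X x\<^esub> germ X x U s = \<one>\<^bsub>stalk X x\<^esub>"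
    unfolding eq using assms cl by (simp_all add: germ_mult germ_one SW.m_comm[OF t(1) cl])
  moreover have "germ X x U s \<in> carrier (stalk X x)" "germ X x W t \<in> carrier (stalk X x)"
    using assms by (auto intro!: germ_closed)
  ultimately show ?thesis by (auto simp: Units_def)
qed

text \<open>An inverse germ becomes an inverse section once the neighbourhood is so small that the
  equation between germs holds between sections.\<close>

lemma germ_UnitsD:
  assumes U: "U \<in> opens X" "x \<in> U" "s \<in> carrier (sections X U)" and unit: "germ X x U s \<in> Units (stalk X x)"
  obtains W t where "W \<in> opens X" "x \<in> W" "W \<subseteq> U" "t \<in> carrier (sections X W)"
    "res X U W s \<otimes>\<^bsub>sections X W\<^esub> t = \<one>\<^bsub>sections X W\<^esub>"
proof -
  obtain h where h: "h \<in> carrier (stalk X x)" "germ X x U s \<otimes>\<^bsub>stalk X x\<^esub> h = \<one>\<^bsub>stalk X x\<^esub>"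
    using unit by (auto simp: Units_def)
  obtain V t where V: "V \<in> opens X" "x \<in> V" "t \<in> carrier (sections X V)" "h = germ X x V t"
    using stalk_cases[OF h(1)] .
  let ?W = "U \<inter> V"
  have W: "?W \<in> opens X" "x \<in> ?W" using U V opens_Int by auto
  have cl: "res X U ?W s \<in> carrier (sections X ?W)" "res X V ?W t \<in> carrier (sections X ?W)"
    using U V W by (auto intro!: res_closed)
  have "germ X x ?W (res X U ?W s \<otimes>\<^bsub>sections X ?W\<^esub> res X V ?W t) = germ X x ?W \<one>\<^bsub>sections X ?W\<^esub>"
    using h(2) V U W by (simp add: stalk_mult germ_one)
  then obtain Y where Y: "Y \<in> opens X" "x \<in> Y" "Y \<subseteq> ?W \<inter> ?W"
    "res X ?W Y (res X U ?W s \<otimes>\<^bsub>sections X ?W\<^esub> res X V ?W t) = res X ?W Y \<one>\<^bsub>sections X ?W\<^esub>"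
    using germ_eqD[OF W sections_one_closed[OF W(1)]] by metis
  have "res X U Y s \<otimes>\<^bsub>sections X Y\<^esub> res X V Y t = \<one>\<^bsub>sections X Y\<^esub>"
    using Y(4) res_mult[OF W(1) Y(1) _ cl] res_comp[OF U(1) W(1) Y(1) _ _ U(3)] res_comp[OF V(1) W(1) Y(1) _ _ V(3)]
      res_one[OF W(1) Y(1)] Y(3) by auto
  then show ?thesis using that[of Y "res X V Y t"] Y U V by (auto intro!: res_closed)
qed

end

section \<open>Restriction to open subsets; sheaves of monoids and rings\<close>

lemma mon_presheaf_restrict:
  assumes "mon_presheaf X" "U \<in> opens X"
  shows "mon_presheaf (restrict_space_to X U)"
proof -
  interpret mon_presheaf X by (rule assms)
  have o: "V \<in> opens X" if "V \<in> opens (restrict_space_to X U)" for V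
    using that assms(2) by (auto simp: restrict_space_to_def openin_open_subtopology)
  have eq: "sections (restrict_space_to X U) = sections X" "res (restrict_space_to X U) = res X"
    by (simp_all add: restrict_space_to_def)
  show ?thesis
    by (rule mon_presheaf.intro; unfold eq; drule o; (drule o)?; (drule o)?)
       (simp_all only: sections_monoid res_closed res_mult res_one res_id res_comp)
qed

lemma opens_restrict_iff:
  assumes "U \<in> opens X"
  shows "V \<in> opens (restrict_space_to X U) \<longleftrightarrow> V \<in> opens X \<and> V \<subseteq> U"
  using assms by (auto simp: restrict_space_to_def openin_open_subtopology)

lemma is_sheaf_mon_presheaf:
  assumes sh: "is_sheaf obj H X" and obj: "\<And>M. obj M \<Longrightarrow> comm_monoid M"
    and H: "\<And>M N h. obj M \<Longrightarrow> obj N \<Longrightarrow> h \<in> H M N \<Longrightarrow> h \<in> hom M N \<and> h \<one>\<^bsub>M\<^esub> = \<one>\<^bsub>N\<^esub>"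
  shows "mon_presheaf X"
proof -
  note sh1 = sh[unfolded is_sheaf_def, THEN conjunct1]
    and sh2 = sh[unfolded is_sheaf_def, THEN conjunct2, THEN conjunct1]
    and sh3 = sh[unfolded is_sheaf_def, THEN conjunct2, THEN conjunct2, THEN conjunct1]
    and sh4 = sh[unfolded is_sheaf_def, THEN conjunct2, THEN conjunct2, THEN conjunct2, THEN conjunct1]
  have o: "obj (sections X U)" if "U \<in> opens X" for U using sh1 that by (rule bspec)
  have h: "res X U V \<in> hom (sections X U) (sections X V)" "res X U V \<one>\<^bsub>sections X U\<^esub> = \<one>\<^bsub>sections X V\<^esub>"
    if "U \<in> opens X" "V \<in> opens X" "V \<subseteq> U" for U V
    using sh2[THEN bspec, OF that(1), THEN bspec, OF that(2), rule_format, OF that(3)]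
      H[OF o[OF that(1)] o[OF that(2)]] by auto
  show ?thesis
  proof (rule mon_presheaf.intro)
    show "comm_monoid (sections X U)" if "U \<in> opens X" for U by (rule obj[OF o[OF that]])
    show "res X U V \<one>\<^bsub>sections X U\<^esub> = \<one>\<^bsub>sections X V\<^esub>" if "U \<in> opens X" "V \<in> opens X" "V \<subseteq> U" for U V
      by (rule h(2)[OF that])
    show "res X U V s \<in> carrier (sections X V)"
      if "U \<in> opens X" "V \<in> opens X" "V \<subseteq> U" "s \<in> carrier (sections X U)" for U V s
      using h(1)[OF that(1-3)] that(4) by (auto simp: hom_def)
    show "res X U V (s \<otimes>\<^bsub>sections X U\<^esub> t) = res X U V s \<otimes>\<^bsub>sections X V\<^esub> res X U V t"
      if "U \<in> opens X" "V \<in> opens X" "V \<subseteq> U" "s \<in> carrier (sections X U)" "t \<in> carrier (sections X U)" for U V s t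
      using h(1)[OF that(1-3)] that(4,5) by (auto simp: hom_def)
    show "res X U U s = s" if "U \<in> opens X" "s \<in> carrier (sections X U)" for U s
      using sh3 that by blast
    show "res X V W (res X U V s) = res X U W s"
      if "U \<in> opens X" "V \<in> opens X" "W \<in> opens X" "W \<subseteq> V" "V \<subseteq> U" "s \<in> carrier (sections X U)" for U V W s
      using sh4[THEN bspec, OF that(1), THEN bspec, OF that(2), THEN bspec, OF that(3)] that(4-6) by simp
  qed
qed

lemma scheme_mon_presheaf: "scheme X \<Longrightarrow> mon_presheaf X"
  unfolding scheme_def
  by (rule is_sheaf_mon_presheaf[of cring ring_hom])
     (auto simp: cring_def ring_hom_def hom_def)

lemma mon_scheme_mon_presheaf: "mon_scheme X \<Longrightarrow> mon_presheaf X"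
  unfolding mon_scheme_def
  by (rule is_sheaf_mon_presheaf[of mon0 mon0_hom]) (auto simp: mon0_def mon0_hom_def)

section \<open>Spectra\<close>

text \<open>Topology, fractions and the multiplication of sections are given by the same formulas
  for monoids and for rings, so both spectra are treated at once: P is the set of primes and S the
  spectrum.\<close>

locale prime_spec = comm_monoid A for A :: "('a, 'g) monoid_scheme" (structure) +
  fixes P :: "'a set set" and S :: "('a set, 'a spec_section, 'e) sheafed_space"
  assumes prime_sub: "p \<in> P \<Longrightarrow> p \<subseteq> carrier A"
    and prime_one: "p \<in> P \<Longrightarrow> \<one> \<notin> p"
    and prime_ideal: "p \<in> P \<Longrightarrow> a \<in> p \<Longrightarrow> x \<in> carrier A \<Longrightarrow> a \<otimes> x \<in> p"
    and prime_mult: "p \<in> P \<Longrightarrow> x \<in> carrier A \<Longrightarrow> y \<in> carrier A \<Longrightarrow> x \<notin> p \<Longrightarrow> y \<notin> p \<Longrightarrow> x \<otimes> y \<notin> p"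
    and sp_top_eq: "sp_top S = zariski (carrier A) P"
    and sections_carrier: "carrier (sections S U) = loc_sections A (zariski (carrier A) P) U"
    and sections_mult: "s \<otimes>\<^bsub>sections S U\<^esub> t = (\<lambda>p\<in>U. loc_mult A p (s p) (t p))"
    and sections_one: "\<one>\<^bsub>sections S U\<^esub> = (\<lambda>p\<in>U. mk_frac A p \<one> \<one>)"
    and res_eq: "res S U V s = restrict s V"
begin

lemma prime_mult_iff:
  assumes "p \<in> P" "x \<in> carrier A" "y \<in> carrier A"
  shows "x \<otimes> y \<in> p \<longleftrightarrow> x \<in> p \<or> y \<in> p"
  using assms prime_ideal[of p x y] prime_ideal[of p y x] prime_mult[of p x y] by (auto simp: m_comm)

text \<open>A union of open sets is given by the union of the sets E, an intersection by the set of
  products; primality makes the latter correct.\<close>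

lemma istopology_zariski: "istopology (\<lambda>U. \<exists>E\<subseteq>carrier A. U = P - {p\<in>P. E \<subseteq> p})"
  unfolding istopology_def
proof (intro conjI allI impI ballI)
  fix U V assume "\<exists>E\<subseteq>carrier A. U = P - {p\<in>P. E \<subseteq> p}" "\<exists>E\<subseteq>carrier A. V = P - {p\<in>P. E \<subseteq> p}"
  then obtain E F where E: "E \<subseteq> carrier A" "U = P - {p\<in>P. E \<subseteq> p}" and F: "F \<subseteq> carrier A" "V = P - {p\<in>P. F \<subseteq> p}"
    by blast
  let ?G = "{x \<otimes> y | x y. x \<in> E \<and> y \<in> F}"
  have "U \<inter> V = P - {p\<in>P. ?G \<subseteq> p}"
  proof -
    have "?G \<subseteq> p \<longleftrightarrow> E \<subseteq> p \<or> F \<subseteq> p" if p: "p \<in> P" for p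
    proof
      assume G: "?G \<subseteq> p"
      show "E \<subseteq> p \<or> F \<subseteq> p"
      proof (rule ccontr)
        assume "\<not> ?thesis"
        then obtain x y where xy: "x \<in> E" "x \<notin> p" "y \<in> F" "y \<notin> p" by auto
        then have "x \<otimes> y \<notin> p" using E F p by (intro prime_mult) auto
        then show False using G xy by blast
      qed
    next
      assume EF: "E \<subseteq> p \<or> F \<subseteq> p"
      show "?G \<subseteq> p"
      proof clarify
        fix x y assume xy: "x \<in> E" "y \<in> F"
        then have "x \<in> carrier A" "y \<in> carrier A" "x \<in> p \<or> y \<in> p" using E F EF by auto
        then show "x \<otimes> y \<in> p" using prime_mult_iff[OF p] by blast
      qed
    qed
    then show ?thesis unfolding E(2) F(2) by blast
  qed
  moreover have "?G \<subseteq> carrier A" using E F by auto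
  ultimately show "\<exists>E\<subseteq>carrier A. U \<inter> V = P - {p\<in>P. E \<subseteq> p}" by blast
next
  fix \<K> assume "\<forall>K\<in>\<K>. \<exists>E\<subseteq>carrier A. K = P - {p\<in>P. E \<subseteq> p}"
  then obtain E where E: "\<And>K. K \<in> \<K> \<Longrightarrow> E K \<subseteq> carrier A" "\<And>K. K \<in> \<K> \<Longrightarrow> K = P - {p\<in>P. E K \<subseteq> p}"
    by metis
  have "\<Union>\<K> = P - {p\<in>P. (\<Union>K\<in>\<K>. E K) \<subseteq> p}"
  proof (intro subset_antisym subsetI)
    fix p assume "p \<in> \<Union>\<K>"
    then obtain K where K: "K \<in> \<K>" "p \<in> K" by auto
    then have "p \<in> P" "\<not> E K \<subseteq> p" using E(2)[OF K(1)] by auto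
    then show "p \<in> P - {p\<in>P. (\<Union>K\<in>\<K>. E K) \<subseteq> p}" using K by auto
  next
    fix p assume p: "p \<in> P - {p\<in>P. (\<Union>K\<in>\<K>. E K) \<subseteq> p}"
    then obtain K where K: "K \<in> \<K>" "\<not> E K \<subseteq> p" by auto
    then have "p \<in> K" using E(2)[OF K(1)] p by auto
    then show "p \<in> \<Union>\<K>" using K by auto
  qed
  moreover have "(\<Union>K\<in>\<K>. E K) \<subseteq> carrier A" using E(1) by auto
  ultimately show "\<exists>E\<subseteq>carrier A. \<Union>\<K> = P - {p\<in>P. E \<subseteq> p}" by blast
qed

lemma openin_spec: "openin (sp_top S) U \<longleftrightarrow> (\<exists>E\<subseteq>carrier A. U = P - {p\<in>P. E \<subseteq> p})"
  unfolding sp_top_eq zariski_def topology_inverse'[OF istopology_zariski] ..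

lemma basic_open: "f \<in> carrier A \<Longrightarrow> openin (sp_top S) {p\<in>P. f \<notin> p}"
  unfolding openin_spec by (intro exI[of _ "{f}"]) auto

lemma points_spec: "points S = P"
proof
  show "points S \<subseteq> P" using openin_topspace[of "sp_top S"] unfolding openin_spec by auto
  have "P = {p\<in>P. \<one> \<notin> p}" using prime_one by auto
  then show "P \<subseteq> points S" using basic_open[of \<one>] openin_subset by fastforce
qed

lemma open_sub: "U \<in> opens S \<Longrightarrow> U \<subseteq> P"
  using openin_subset points_spec by blast

section \<open>Fractions and sections of a spectrum\<close>

lemma mem_frac_self:
  assumes "p \<in> P" "a \<in> carrier A" "f \<in> carrier A - p"
  shows "(a, f) \<in> mk_frac A p a f"
  using assms prime_one[of p] by (auto simp: mk_frac_def)

lemma frac_sym: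
  assumes "b \<in> carrier A" "g \<in> carrier A - p" "a \<in> carrier A" "f \<in> carrier A - p"
  shows "(b, g) \<in> mk_frac A p a f \<longleftrightarrow> (a, f) \<in> mk_frac A p b g"
proof -
  have "(\<exists>h\<in>carrier A - p. h \<otimes> (a \<otimes> g) = h \<otimes> (b \<otimes> f)) =
      (\<exists>h\<in>carrier A - p. h \<otimes> (b \<otimes> f) = h \<otimes> (a \<otimes> g))"
    by (intro bex_cong refl eq_commute)
  then show ?thesis using assms by (simp add: mk_frac_def)
qed

lemma frac_trans:
  assumes p: "p \<in> P" and a: "a \<in> carrier A" "f \<in> carrier A - p"
    and 1: "(b, g) \<in> mk_frac A p a f" and 2: "(c, k) \<in> mk_frac A p b g"
  shows "(c, k) \<in> mk_frac A p a f"
proof -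
  obtain h where h: "b \<in> carrier A" "g \<in> carrier A - p" "h \<in> carrier A - p" "h \<otimes> (a \<otimes> g) = h \<otimes> (b \<otimes> f)"
    using 1 by (auto simp: mk_frac_def)
  obtain h' where h': "c \<in> carrier A" "k \<in> carrier A - p" "h' \<in> carrier A - p" "h' \<otimes> (b \<otimes> k) = h' \<otimes> (c \<otimes> g)"
    using 2 by (auto simp: mk_frac_def)
  have cl: "a \<in> carrier A" "f \<in> carrier A" "b \<in> carrier A" "g \<in> carrier A" "h \<in> carrier A" "c \<in> carrier A"
    "k \<in> carrier A" "h' \<in> carrier A" using a h h' by auto
  \<comment> \<open>Besides the two given multipliers, the middle denominator g enters the new one,
    because it cannot be cancelled.\<close>
  have "(h \<otimes> h' \<otimes> g) \<otimes> (a \<otimes> k) = (h \<otimes> (a \<otimes> g)) \<otimes> (h' \<otimes> k)" using cl by (simp add: m_ac)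
  also have "\<dots> = (h' \<otimes> (b \<otimes> k)) \<otimes> (h \<otimes> f)" unfolding h(4) using cl by (simp add: m_ac)
  also have "\<dots> = (h \<otimes> h' \<otimes> g) \<otimes> (c \<otimes> f)" unfolding h'(4) using cl by (simp add: m_ac)
  finally have "(h \<otimes> h' \<otimes> g) \<otimes> (a \<otimes> k) = (h \<otimes> h' \<otimes> g) \<otimes> (c \<otimes> f)" .
  moreover have "h \<otimes> h' \<otimes> g \<in> carrier A - p"
    using p h h' by (auto simp: prime_mult_iff)
  ultimately show ?thesis using h' unfolding mk_frac_def by blast
qed

lemma frac_eq:
  assumes p: "p \<in> P" and a: "a \<in> carrier A" "f \<in> carrier A - p" and b: "(b, g) \<in> mk_frac A p a f"
  shows "mk_frac A p a f = mk_frac A p b g"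
proof -
  have bg: "b \<in> carrier A" "g \<in> carrier A - p" using b by (auto simp: mk_frac_def)
  show ?thesis
  proof (intro subset_antisym subsetI)
    fix z assume z: "z \<in> mk_frac A p a f"
    have "(a, f) \<in> mk_frac A p b g" using b frac_sym[OF bg a] by simp
    from frac_trans[OF p bg this] z show "z \<in> mk_frac A p b g" by (cases z) simp
  next
    fix z assume "z \<in> mk_frac A p b g"
    then show "z \<in> mk_frac A p a f" using frac_trans[OF p a b] by (cases z) simp
  qed
qed

lemma frac_eqI:
  assumes "p \<in> P" "a \<in> carrier A" "f \<in> carrier A - p" "b \<in> carrier A" "g \<in> carrier A - p"
    "h \<in> carrier A - p" "h \<otimes> (a \<otimes> g) = h \<otimes> (b \<otimes> f)"
  shows "mk_frac A p a f = mk_frac A p b g"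
  using assms by (intro frac_eq) (auto simp: mk_frac_def)

lemma frac_eqD:
  assumes "p \<in> P" "b \<in> carrier A" "g \<in> carrier A - p" "mk_frac A p a f = mk_frac A p b g"
  obtains h where "h \<in> carrier A - p" "h \<otimes> (a \<otimes> g) = h \<otimes> (b \<otimes> f)"
  using mem_frac_self[OF assms(1-3)] unfolding assms(4)[symmetric] by (auto simp: mk_frac_def)

lemma UN_const2: "(\<Union>a\<in>B. \<Union>b\<in>D. F a b) = C"
  if "\<And>a b. a \<in> B \<Longrightarrow> b \<in> D \<Longrightarrow> F a b = C" "a0 \<in> B" "b0 \<in> D" for a0 b0
  using that by auto

text \<open>As for stalks, the union over representatives collapses; the multipliers witnessing the
  two equivalences are multiplied.\<close>

lemma loc_mult_frac:
  assumes p: "p \<in> P" and a: "a \<in> carrier A" "f \<in> carrier A - p" and b: "b \<in> carrier A" "g \<in> carrier A - p"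
  shows "loc_mult A p (mk_frac A p a f) (mk_frac A p b g) = mk_frac A p (a \<otimes> b) (f \<otimes> g)"
proof -
  have key: "mk_frac A p (a' \<otimes> b') (f' \<otimes> g') = mk_frac A p (a \<otimes> b) (f \<otimes> g)"
    if af: "(a', f') \<in> mk_frac A p a f" and bg: "(b', g') \<in> mk_frac A p b g" for a' f' b' g'
  proof -
    obtain h where h: "a' \<in> carrier A" "f' \<in> carrier A - p" "h \<in> carrier A - p" "h \<otimes> (a \<otimes> f') = h \<otimes> (a' \<otimes> f)"
      using af by (auto simp: mk_frac_def)
    obtain k where k: "b' \<in> carrier A" "g' \<in> carrier A - p" "k \<in> carrier A - p" "k \<otimes> (b \<otimes> g') = k \<otimes> (b' \<otimes> g)"
      using bg by (auto simp: mk_frac_def)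
    have cl: "a \<in> carrier A" "f \<in> carrier A" "b \<in> carrier A" "g \<in> carrier A" "h \<in> carrier A" "k \<in> carrier A"
      "a' \<in> carrier A" "f' \<in> carrier A" "b' \<in> carrier A" "g' \<in> carrier A" using a b h k by auto
    have "(h \<otimes> k) \<otimes> ((a' \<otimes> b') \<otimes> (f \<otimes> g)) = (h \<otimes> (a' \<otimes> f)) \<otimes> (k \<otimes> (b' \<otimes> g))" using cl by (simp add: m_ac)
    also have "\<dots> = (h \<otimes> k) \<otimes> ((a \<otimes> b) \<otimes> (f' \<otimes> g'))"
      unfolding h(4)[symmetric] k(4)[symmetric] using cl by (simp add: m_ac)
    finally show ?thesis
      using p a b h k by (intro frac_eqI[where h = "h \<otimes> k"]) (auto simp: prime_mult_iff)
  qed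
  show ?thesis
    unfolding loc_mult_def split_beta
    by (rule UN_const2[OF _ mem_frac_self[OF p a] mem_frac_self[OF p b]]) (use key in auto)
qed

definition frac_section :: "'a set set \<Rightarrow> 'a \<Rightarrow> 'a \<Rightarrow> 'a spec_section" where
  "frac_section V a f = (\<lambda>p\<in>V. mk_frac A p a f)"

lemma section_local:
  assumes "s \<in> carrier (sections S U)" "p \<in> U"
  obtains V a f where "V \<in> opens S" "p \<in> V" "V \<subseteq> U" "a \<in> carrier A" "f \<in> carrier A"
    "\<forall>q\<in>V. f \<notin> q \<and> s q = mk_frac A q a f"
  using assms unfolding sections_carrier loc_sections_def sp_top_eq by auto

lemma section_frac:
  assumes "s \<in> carrier (sections S U)" "p \<in> U"
  obtains a f where "a \<in> carrier A" "f \<in> carrier A - p" "s p = mk_frac A p a f"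
proof -
  obtain V a f where V: "p \<in> V" "a \<in> carrier A" "f \<in> carrier A"
    and *: "\<forall>q\<in>V. f \<notin> q \<and> s q = mk_frac A q a f"
    by (rule section_local[OF assms])
  from * V(1) have "f \<notin> p \<and> s p = mk_frac A p a f" by (rule bspec)
  with V show ?thesis by (intro that) simp_all
qed

lemma section_ext: "s \<in> carrier (sections S U) \<Longrightarrow> s \<in> extensional U"
  by (simp add: sections_carrier loc_sections_def)

lemma sectionI:
  assumes "s \<in> extensional U"
    "\<And>p. p \<in> U \<Longrightarrow> \<exists>V a f. V \<in> opens S \<and> p \<in> V \<and> V \<subseteq> U \<and> a \<in> carrier A \<and> f \<in> carrier A \<and>
      (\<forall>q\<in>V. f \<notin> q \<and> s q = mk_frac A q a f)"
  shows "s \<in> carrier (sections S U)"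
  unfolding sections_carrier loc_sections_def mem_Collect_eq
proof (intro conjI assms(1) ballI)
  fix p assume "p \<in> U"
  from assms(2)[OF this] obtain V a f where V: "V \<in> opens S" "p \<in> V" "V \<subseteq> U" "a \<in> carrier A" "f \<in> carrier A"
    "\<forall>q\<in>V. f \<notin> q \<and> s q = mk_frac A q a f" by blast
  show "\<exists>V. openin (zariski (carrier A) P) V \<and> p \<in> V \<and> V \<subseteq> U \<and>
      (\<exists>a\<in>carrier A. \<exists>f\<in>carrier A. \<forall>q\<in>V. f \<notin> q \<and> s q = mk_frac A q a f)"
    by (rule exI[of _ V]) (use V in \<open>auto simp: sp_top_eq\<close>)
qed

lemma frac_section_closed:
  assumes "V \<in> opens S" "a \<in> carrier A" "f \<in> carrier A" "\<And>q. q \<in> V \<Longrightarrow> f \<notin> q"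
  shows "frac_section V a f \<in> carrier (sections S V)"
  using assms by (intro sectionI) (auto simp: frac_section_def)

lemma frac_section_mult:
  assumes "V \<in> opens S" "a \<in> carrier A" "f \<in> carrier A" "\<And>q. q \<in> V \<Longrightarrow> f \<notin> q"
    "b \<in> carrier A" "g \<in> carrier A" "\<And>q. q \<in> V \<Longrightarrow> g \<notin> q"
  shows "frac_section V a f \<otimes>\<^bsub>sections S V\<^esub> frac_section V b g = frac_section V (a \<otimes> b) (f \<otimes> g)"
  unfolding sections_mult frac_section_def
  using assms open_sub[OF assms(1)] by (intro restrict_ext) (simp add: loc_mult_frac subset_iff)

text \<open>Clears the denominator of a/g; with a = 1 it shows that g is invertible over V.\<close>

lemma frac_section_cancel:
  assumes "V \<in> opens S" "g \<in> carrier A" "\<And>q. q \<in> V \<Longrightarrow> g \<notin> q" "a \<in> carrier A"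
  shows "frac_section V a g \<otimes>\<^bsub>sections S V\<^esub> frac_section V g \<one> = frac_section V a \<one>"
proof -
  have P: "q \<in> P" if "q \<in> V" for q using that open_sub[OF assms(1)] by auto
  have "mk_frac A q (a \<otimes> g) (g \<otimes> \<one>) = mk_frac A q a \<one>" if "q \<in> V" for q
    using assms P[OF that] that prime_one[OF P[OF that]]
    by (intro frac_eqI[where h = \<one>]) (auto simp: m_ac)
  then show ?thesis
    using assms P prime_one by (subst frac_section_mult) (auto simp: frac_section_def intro!: restrict_ext)
qed

lemma sections_one_eq: "\<one>\<^bsub>sections S U\<^esub> = frac_section U \<one> \<one>"
  by (simp add: sections_one frac_section_def)

lemma sections_comm_monoid:
  assumes U: "U \<in> opens S"
  shows "comm_monoid (sections S U)"
proof (rule comm_monoidI)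
  have P: "p \<in> P" if "p \<in> U" for p using that open_sub[OF U] by auto
  show "\<one>\<^bsub>sections S U\<^esub> \<in> carrier (sections S U)"
    unfolding sections_one_eq using U P prime_one by (intro frac_section_closed) auto
  fix s t assume s: "s \<in> carrier (sections S U)" and t: "t \<in> carrier (sections S U)"
  show "s \<otimes>\<^bsub>sections S U\<^esub> t \<in> carrier (sections S U)"
  proof (rule sectionI)
    fix p assume p: "p \<in> U"
    obtain V a f where V: "V \<in> opens S" "p \<in> V" "V \<subseteq> U" "a \<in> carrier A" "f \<in> carrier A"
      "\<forall>q\<in>V. f \<notin> q \<and> s q = mk_frac A q a f" using section_local[OF s p] by blast
    obtain W b g where W: "W \<in> opens S" "p \<in> W" "W \<subseteq> U" "b \<in> carrier A" "g \<in> carrier A"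
      "\<forall>q\<in>W. g \<notin> q \<and> t q = mk_frac A q b g" using section_local[OF t p] by blast
    have h: "\<forall>q\<in>V \<inter> W. f \<otimes> g \<notin> q \<and> (s \<otimes>\<^bsub>sections S U\<^esub> t) q = mk_frac A q (a \<otimes> b) (f \<otimes> g)"
    proof
      fix q assume that: "q \<in> V \<inter> W"
      have q: "q \<in> U" "q \<in> P" "s q = mk_frac A q a f" "t q = mk_frac A q b g" "f \<notin> q" "g \<notin> q"
        using that V W P by auto
      then show "f \<otimes> g \<notin> q \<and> (s \<otimes>\<^bsub>sections S U\<^esub> t) q = mk_frac A q (a \<otimes> b) (f \<otimes> g)"
        using V(4,5) W(4,5) by (simp add: sections_mult loc_mult_frac prime_mult_iff)
    qed
    show "\<exists>V a f. V \<in> opens S \<and> p \<in> V \<and> V \<subseteq> U \<and> a \<in> carrier A \<and> f \<in> carrier A \<and>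
      (\<forall>q\<in>V. f \<notin> q \<and> (s \<otimes>\<^bsub>sections S U\<^esub> t) q = mk_frac A q a f)"
      by (intro exI[of _ "V \<inter> W"] exI[of _ "a \<otimes> b"] exI[of _ "f \<otimes> g"] conjI h)
         (use V(1-5) W(1-5) in auto)
  qed (simp add: sections_mult)
  show "s \<otimes>\<^bsub>sections S U\<^esub> t = t \<otimes>\<^bsub>sections S U\<^esub> s"
    unfolding sections_mult
  proof (rule restrict_ext)
    fix p assume p: "p \<in> U"
    obtain a f where a: "a \<in> carrier A" "f \<in> carrier A - p" "s p = mk_frac A p a f" using section_frac[OF s p] .
    obtain b g where b: "b \<in> carrier A" "g \<in> carrier A - p" "t p = mk_frac A p b g" using section_frac[OF t p] .
    show "loc_mult A p (s p) (t p) = loc_mult A p (t p) (s p)"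
      using a b P[OF p] by (simp add: loc_mult_frac m_comm)
  qed
  show "\<one>\<^bsub>sections S U\<^esub> \<otimes>\<^bsub>sections S U\<^esub> s = s"
  proof (rule extensionalityI[of _ U])
    fix p assume p: "p \<in> U"
    obtain a f where a: "a \<in> carrier A" "f \<in> carrier A - p" "s p = mk_frac A p a f" using section_frac[OF s p] .
    show "(\<one>\<^bsub>sections S U\<^esub> \<otimes>\<^bsub>sections S U\<^esub> s) p = s p"
      using a P[OF p] p prime_one[OF P[OF p]] by (simp add: sections_mult sections_one loc_mult_frac)
  qed (auto simp: sections_mult section_ext[OF s])
  fix r assume r: "r \<in> carrier (sections S U)"
  show "s \<otimes>\<^bsub>sections S U\<^esub> t \<otimes>\<^bsub>sections S U\<^esub> r = s \<otimes>\<^bsub>sections S U\<^esub> (t \<otimes>\<^bsub>sections S U\<^esub> r)"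
    unfolding sections_mult
  proof (rule restrict_ext)
    fix p assume p: "p \<in> U"
    obtain a f where a: "a \<in> carrier A" "f \<in> carrier A - p" "s p = mk_frac A p a f" using section_frac[OF s p] .
    obtain b g where b: "b \<in> carrier A" "g \<in> carrier A - p" "t p = mk_frac A p b g" using section_frac[OF t p] .
    obtain c k where c: "c \<in> carrier A" "k \<in> carrier A - p" "r p = mk_frac A p c k" using section_frac[OF r p] .
    have "f \<otimes> g \<in> carrier A - p" "g \<otimes> k \<in> carrier A - p" using a b c P[OF p] by (auto simp: prime_mult_iff)
    then show "loc_mult A p ((\<lambda>p\<in>U. loc_mult A p (s p) (t p)) p) (r p) =
        loc_mult A p (s p) ((\<lambda>p\<in>U. loc_mult A p (t p) (r p)) p)"
      using a b c P[OF p] p by (simp add: loc_mult_frac m_assoc)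
  qed
qed

lemma presheaf: "mon_presheaf S"
proof (rule mon_presheaf.intro)
  show "comm_monoid (sections S U)" if "U \<in> opens S" for U by (rule sections_comm_monoid[OF that])
  show "res S U V s \<in> carrier (sections S V)"
    if UV: "U \<in> opens S" "V \<in> opens S" "V \<subseteq> U" "s \<in> carrier (sections S U)" for U V s
    unfolding res_eq
  proof (rule sectionI)
    fix p assume p: "p \<in> V"
    obtain W a f where W: "W \<in> opens S" "p \<in> W" "W \<subseteq> U" "a \<in> carrier A" "f \<in> carrier A"
      "\<forall>q\<in>W. f \<notin> q \<and> s q = mk_frac A q a f" using section_local[OF UV(4), of p] p UV(3) by blast
    have h: "\<forall>q\<in>V \<inter> W. f \<notin> q \<and> restrict s V q = mk_frac A q a f"
    proof
      fix q assume q: "q \<in> V \<inter> W"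
      with W(6) have "f \<notin> q \<and> s q = mk_frac A q a f" by blast
      then show "f \<notin> q \<and> restrict s V q = mk_frac A q a f" using q by simp
    qed
    show "\<exists>W a f. W \<in> opens S \<and> p \<in> W \<and> W \<subseteq> V \<and> a \<in> carrier A \<and> f \<in> carrier A \<and>
      (\<forall>q\<in>W. f \<notin> q \<and> restrict s V q = mk_frac A q a f)"
      by (intro exI[of _ "V \<inter> W"] exI[of _ a] exI[of _ f] conjI h) (use UV(1-3) W(1-5) p in auto)
  qed auto
  show "res S U V (s \<otimes>\<^bsub>sections S U\<^esub> t) = res S U V s \<otimes>\<^bsub>sections S V\<^esub> res S U V t" if "V \<subseteq> U" for U V s t
    unfolding res_eq sections_mult using that by (simp add: fun_eq_iff restrict_def subset_iff)
  show "res S U V \<one>\<^bsub>sections S U\<^esub> = \<one>\<^bsub>sections S V\<^esub>" if "V \<subseteq> U" for U V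
    unfolding res_eq sections_one using that by (simp add: fun_eq_iff restrict_def subset_iff)
  show "res S U U s = s" if "s \<in> carrier (sections S U)" for U s
    unfolding res_eq by (rule extensional_restrict[OF section_ext[OF that]])
  show "res S V W (res S U V s) = res S U W s" if "W \<subseteq> V" for U V W s
    unfolding res_eq using that by (simp add: Int_absorb1)
qed

end

lemma prime_spec_mspec:
  assumes "mon0 M"
  shows "prime_spec M {p. mon_prime M p} (mspec M)"
proof -
  interpret comm_monoid M using assms by (simp add: mon0_def)
  show ?thesis
  proof (intro prime_spec.intro prime_spec_axioms.intro comm_monoid_axioms)
    fix p assume p: "p \<in> {p. mon_prime M p}"
    show "\<one>\<^bsub>M\<^esub> \<notin> p"
    proof
      assume "\<one>\<^bsub>M\<^esub> \<in> p"
      then have "\<one>\<^bsub>M\<^esub> \<otimes>\<^bsub>M\<^esub> x \<in> p" if "x \<in> carrier M" for x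
        using p that unfolding mon_prime_def mon_ideal_def by blast
      then show False using p by (auto simp: mon_prime_def mon_ideal_def)
    qed
  qed (auto simp: mon_prime_def mon_ideal_def mspec_def Let_def)
qed

lemma prime_spec_rspec:
  assumes "cring R"
  shows "prime_spec R {p. primeideal p R} (rspec R)"
proof -
  interpret cring R by fact
  show ?thesis
  proof (intro prime_spec.intro prime_spec_axioms.intro comm_monoid_axioms)
    fix p assume "p \<in> {p. primeideal p R}"
    then interpret primeideal p R by simp
    show "p \<subseteq> carrier R" by (rule a_subset)
    show "\<one>\<^bsub>R\<^esub> \<notin> p" using I_notcarr one_imp_carrier by auto
    show "a \<otimes>\<^bsub>R\<^esub> x \<in> p" if "a \<in> p" "x \<in> carrier R" for a x using that by (rule I_r_closed)
    show "x \<otimes>\<^bsub>R\<^esub> y \<notin> p" if "x \<in> carrier R" "y \<in> carrier R" "x \<notin> p" "y \<notin> p" for x y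
      using I_prime[OF that(1,2)] that(3,4) by auto
  qed (auto simp: rspec_def Let_def)
qed

text \<open>The index is shifted by one, so that the zero of the ring is not involved.\<close>

primrec unit_multiple :: "('a, 'e) ring_scheme \<Rightarrow> nat \<Rightarrow> 'a" where
  "unit_multiple R 0 = \<one>\<^bsub>R\<^esub>"
| "unit_multiple R (Suc n) = unit_multiple R n \<oplus>\<^bsub>R\<^esub> \<one>\<^bsub>R\<^esub>"

locale ring_spec = cring R for R :: "'a ring" (structure)

sublocale ring_spec \<subseteq> prime_spec R "{p. primeideal p R}" "rspec R"
  by (rule prime_spec_rspec) (rule cring_axioms)

context ring_spec
begin

lemma loc_add_frac:
  assumes p: "p \<in> {p. primeideal p R}" and a: "a \<in> carrier R" "f \<in> carrier R - p" and b: "b \<in> carrier R" "g \<in> carrier R - p"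
  shows "loc_add R p (mk_frac R p a f) (mk_frac R p b g) = mk_frac R p (a \<otimes> g \<oplus> b \<otimes> f) (f \<otimes> g)"
proof -
  have key: "mk_frac R p (a' \<otimes> g' \<oplus> b' \<otimes> f') (f' \<otimes> g') = mk_frac R p (a \<otimes> g \<oplus> b \<otimes> f) (f \<otimes> g)"
    if af: "(a', f') \<in> mk_frac R p a f" and bg: "(b', g') \<in> mk_frac R p b g" for a' f' b' g'
  proof -
    obtain h where h: "a' \<in> carrier R" "f' \<in> carrier R - p" "h \<in> carrier R - p" "h \<otimes> (a \<otimes> f') = h \<otimes> (a' \<otimes> f)"
      using af by (auto simp: mk_frac_def)
    obtain k where k: "b' \<in> carrier R" "g' \<in> carrier R - p" "k \<in> carrier R - p" "k \<otimes> (b \<otimes> g') = k \<otimes> (b' \<otimes> g)"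
      using bg by (auto simp: mk_frac_def)
    have cl: "a \<in> carrier R" "f \<in> carrier R" "b \<in> carrier R" "g \<in> carrier R" "h \<in> carrier R" "k \<in> carrier R"
      "a' \<in> carrier R" "f' \<in> carrier R" "b' \<in> carrier R" "g' \<in> carrier R" using a b h k by auto
    have "(h \<otimes> k) \<otimes> ((a' \<otimes> g' \<oplus> b' \<otimes> f') \<otimes> (f \<otimes> g)) =
        (h \<otimes> (a' \<otimes> f)) \<otimes> (k \<otimes> g' \<otimes> g) \<oplus> (k \<otimes> (b' \<otimes> g)) \<otimes> (h \<otimes> f' \<otimes> f)"
      using cl by (simp add: l_distr r_distr m_ac)
    also have "\<dots> = (h \<otimes> k) \<otimes> ((a \<otimes> g \<oplus> b \<otimes> f) \<otimes> (f' \<otimes> g'))"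
      unfolding h(4)[symmetric] k(4)[symmetric] using cl by (simp add: l_distr r_distr m_ac)
    finally show ?thesis
      using p a b h k by (intro frac_eqI[where h = "h \<otimes> k"]) (auto simp: prime_mult_iff)
  qed
  show ?thesis
    unfolding loc_add_def split_beta
    by (rule UN_const2[OF _ mem_frac_self[OF p a] mem_frac_self[OF p b]]) (use key in auto)
qed

lemma one_notin_open: "V \<in> opens (rspec R) \<Longrightarrow> q \<in> V \<Longrightarrow> \<one> \<notin> q"
  using open_sub prime_one by blast

lemma const_section_closed:
  "V \<in> opens (rspec R) \<Longrightarrow> a \<in> carrier R \<Longrightarrow> frac_section V a \<one> \<in> carrier (sections (rspec R) V)"
  using one_notin_open by (intro frac_section_closed) auto

lemma const_section_mult:
  "V \<in> opens (rspec R) \<Longrightarrow> a \<in> carrier R \<Longrightarrow> b \<in> carrier R \<Longrightarrow>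
    frac_section V a \<one> \<otimes>\<^bsub>sections (rspec R) V\<^esub> frac_section V b \<one> = frac_section V (a \<otimes> b) \<one>"
  using one_notin_open by (subst frac_section_mult) auto

lemma const_section_add:
  assumes "V \<in> opens (rspec R)" "a \<in> carrier R" "b \<in> carrier R"
  shows "frac_section V a \<one> \<oplus>\<^bsub>sections (rspec R) V\<^esub> frac_section V b \<one> = frac_section V (a \<oplus> b) \<one>"
proof -
  have "frac_section V a \<one> \<oplus>\<^bsub>sections (rspec R) V\<^esub> frac_section V b \<one> =
      (\<lambda>p\<in>V. loc_add R p (mk_frac R p a \<one>) (mk_frac R p b \<one>))"
    by (simp add: rspec_def Let_def frac_section_def fun_eq_iff restrict_def)
  also have "\<dots> = frac_section V (a \<oplus> b) \<one>"
    unfolding frac_section_def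
    using assms open_sub[OF assms(1)] one_notin_open[OF assms(1)]
    by (intro restrict_ext, subst loc_add_frac) (simp_all add: subset_iff)
  finally show ?thesis .
qed

lemma unit_multiple_sections:
  assumes "V \<in> opens (rspec R)"
  shows "unit_multiple (sections (rspec R) V) n = frac_section V (unit_multiple R n) \<one> \<and> unit_multiple R n \<in> carrier R"
  by (induction n) (auto simp: sections_one_eq const_section_add[OF assms])

end

lemma ring_hom_unit_multiple:
  assumes "h \<in> ring_hom R S" "\<And>n. unit_multiple R n \<in> carrier R" "\<one>\<^bsub>R\<^esub> \<in> carrier R"
  shows "h (unit_multiple R n) = unit_multiple S n"
  using assms by (induction n) (auto simp: ring_hom_def)

section \<open>Points with values in a field\<close>

text \<open>A field has one prime, both as a ring and as a multiplicative monoid, and the fractions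
  are the same; S may be either spectrum.\<close>

locale field_spec = field K + prime_spec K "{{\<zero>}}" S
  for K :: "'a ring" (structure) and S :: "('a set, 'a spec_section, 'e) sheafed_space"

lemma Collect_eq_singletonI: "(\<And>x. P x \<Longrightarrow> x = a) \<Longrightarrow> P a \<Longrightarrow> {x. P x} = {a}"
  by blast

lemma primeideals_field:
  assumes "field K"
  shows "{p. primeideal p K} = {{\<zero>\<^bsub>K\<^esub>}}"
proof -
  interpret field K by fact
  have "p = {\<zero>\<^bsub>K\<^esub>}" if "primeideal p K" for p
  proof -
    interpret primeideal p K by fact
    have "p \<in> {{\<zero>\<^bsub>K\<^esub>}, carrier K}" unfolding all_ideals[symmetric] using is_ideal by simp
    then have "p = {\<zero>\<^bsub>K\<^esub>} \<or> p = carrier K" by simp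
    then show ?thesis
    proof (elim disjE)
      assume "p = carrier K"
      then have "carrier K = p" by (rule sym)
      with I_notcarr show ?thesis by (rule notE)
    qed
  qed
  then show ?thesis using zeroprimeideal by (rule Collect_eq_singletonI)
qed

lemma field_spec_rspec:
  assumes "field K"
  shows "field_spec K (rspec K)"
proof -
  interpret field K by fact
  have "prime_spec K {p. primeideal p K} (rspec K)" by (rule prime_spec_rspec) (rule cring_axioms)
  then show ?thesis unfolding primeideals_field[OF assms] by (intro field_spec.intro assms)
qed

lemma mzero_eq:
  assumes "absorbing M z"
  shows "mzero M = z"
  unfolding mzero_def
proof (rule the_equality)
  show "absorbing M z" by (rule assms)
  fix y assume y: "absorbing M y"
  have "z \<in> carrier M" "y \<in> carrier M" using assms y by (simp_all add: absorbing_def)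
  then have "y \<otimes>\<^bsub>M\<^esub> z = y" "y \<otimes>\<^bsub>M\<^esub> z = z"
    using assms y unfolding absorbing_def by blast+
  then show "y = z" by simp
qed

lemma absorbing_mzero:
  assumes "mon0 M"
  shows "absorbing M (mzero M)"
proof -
  obtain z where "absorbing M z" using assms by (auto simp: mon0_def)
  then show ?thesis by (simp add: mzero_eq)
qed

lemma mult_monoid_simps [simp]:
  "carrier (mult_monoid R) = carrier R" "mult (mult_monoid R) = mult R" "one (mult_monoid R) = one R"
  by (simp_all add: mult_monoid_def)

lemma absorbing_mult_monoid:
  assumes "cring R"
  shows "absorbing (mult_monoid R) \<zero>\<^bsub>R\<^esub>"
proof -
  interpret cring R by fact
  show ?thesis by (simp add: absorbing_def)
qed

lemma mon0_mult_monoid: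
  assumes "cring R"
  shows "mon0 (mult_monoid R)"
proof -
  interpret cring R by fact
  have "comm_monoid (mult_monoid R)" by (rule comm_monoidI) (auto simp: m_ac)
  then show ?thesis using absorbing_mult_monoid[OF assms] unfolding mon0_def by blast
qed

lemma mk_frac_mult_monoid [simp]: "mk_frac (mult_monoid R) = mk_frac R"
  by (simp add: mk_frac_def fun_eq_iff)

text \<open>A nonzero element of a field is a unit, so a proper ideal of the multiplicative monoid
  contains only 0.\<close>

lemma field_spec_mspec:
  assumes "field K"
  shows "field_spec K (mspec (mult_monoid K))"
proof -
  interpret field K by fact
  have m: "mon0 (mult_monoid K)" by (rule mon0_mult_monoid) (rule cring_axioms)
  have z: "mzero (mult_monoid K) = \<zero>\<^bsub>K\<^esub>"
    by (rule mzero_eq, rule absorbing_mult_monoid) (rule cring_axioms)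
  have P: "{p. mon_prime (mult_monoid K) p} = {{\<zero>\<^bsub>K\<^esub>}}"
  proof -
    have "p = {\<zero>\<^bsub>K\<^esub>}" if p: "mon_prime (mult_monoid K) p" for p
    proof -
      have sub: "p \<subseteq> carrier K" "\<zero>\<^bsub>K\<^esub> \<in> p" "p \<noteq> carrier K"
        and cl: "a \<otimes>\<^bsub>K\<^esub> x \<in> p" if "a \<in> p" "x \<in> carrier K" for a x
        using p that by (auto simp: mon_prime_def mon_ideal_def z)
      have "a = \<zero>\<^bsub>K\<^esub>" if a: "a \<in> p" for a
      proof (rule ccontr)
        assume "a \<noteq> \<zero>\<^bsub>K\<^esub>"
        then have a': "a \<in> Units K" using a p by (auto simp: field_Units mon_prime_def mon_ideal_def)
        have "x \<in> p" if x: "x \<in> carrier K" for x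
        proof -
          have "a \<otimes>\<^bsub>K\<^esub> (inv\<^bsub>K\<^esub> a \<otimes>\<^bsub>K\<^esub> x) \<in> p" using a a' x by (intro cl) auto
          also have "a \<otimes>\<^bsub>K\<^esub> (inv\<^bsub>K\<^esub> a \<otimes>\<^bsub>K\<^esub> x) = x"
            using a' x Units_closed[OF a'] by (simp add: m_assoc[symmetric])
          finally show ?thesis .
        qed
        then show False using p by (auto simp: mon_prime_def mon_ideal_def)
      qed
      then show ?thesis using p by (auto simp: mon_prime_def mon_ideal_def z)
    qed
    moreover have "mon_prime (mult_monoid K) {\<zero>\<^bsub>K\<^esub>}"
    proof -
      have "{\<zero>\<^bsub>K\<^esub>} \<noteq> carrier K" using one_not_zero one_closed by (metis singletonD)
      then show ?thesis using integral by (auto simp: mon_prime_def mon_ideal_def z)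
    qed
    ultimately show ?thesis by (rule Collect_eq_singletonI)
  qed
  interpret M: prime_spec "mult_monoid K" "{{\<zero>\<^bsub>K\<^esub>}}" "mspec (mult_monoid K)"
    using prime_spec_mspec[OF m] unfolding P .
  have ls: "loc_sections (mult_monoid K) = loc_sections K"
    by (simp add: loc_sections_def fun_eq_iff)
  have lm: "loc_mult (mult_monoid K) = loc_mult K"
    by (simp add: loc_mult_def fun_eq_iff)
  show ?thesis
    by (intro field_spec.intro assms prime_spec.intro prime_spec_axioms.intro comm_monoid_axioms)
       (use M.prime_sub M.prime_one M.prime_ideal M.prime_mult M.sp_top_eq M.sections_carrier
          M.sections_mult M.sections_one M.res_eq in \<open>simp_all add: ls lm\<close>)
qed

text \<open>A morphism from the spectrum of a field \<open>K\<close>, given by its image \<open>x\<close> and by the values \<open>v V t\<close> of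
  sections; over an open set that does not contain \<open>x\<close>, where the preimage is empty, \<open>v\<close> is irrelevant.\<close>

definition field_point :: "'a ring \<Rightarrow> ('p, 's, 'e) sheafed_space \<Rightarrow> 'p \<Rightarrow> ('p set \<Rightarrow> 's \<Rightarrow> 'a) \<Rightarrow>
    ('a set, 'a spec_section, 'p, 's) space_map" where
  "field_point K X x v = (\<lambda>p\<in>{{\<zero>\<^bsub>K\<^esub>}}. x,
     \<lambda>V\<in>opens X. \<lambda>t\<in>carrier (sections X V). \<lambda>p\<in>(if x \<in> V then {{\<zero>\<^bsub>K\<^esub>}} else {}). mk_frac K p (v V t) \<one>\<^bsub>K\<^esub>)"

lemma space_homsD:
  assumes "(f, \<phi>) \<in> space_homs H X Y"
  shows "f \<in> extensional (points X)" "continuous_map (sp_top X) (sp_top Y) f" "\<phi> \<in> extensional (opens Y)"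
    "V \<in> opens Y \<Longrightarrow> \<phi> V \<in> extensional (carrier (sections Y V))"
    "V \<in> opens Y \<Longrightarrow> \<phi> V \<in> H (sections Y V) (sections X (preim X f V))"
    "V \<in> opens Y \<Longrightarrow> W \<in> opens Y \<Longrightarrow> W \<subseteq> V \<Longrightarrow> t \<in> carrier (sections Y V) \<Longrightarrow>
       \<phi> W (res Y V W t) = res X (preim X f V) (preim X f W) (\<phi> V t)"
    "V \<in> opens Y \<Longrightarrow> x \<in> preim X f V \<Longrightarrow> t \<in> carrier (sections Y V) \<Longrightarrow>
       germ X x (preim X f V) (\<phi> V t) \<in> Units (stalk X x) \<Longrightarrow> germ Y (f x) V t \<in> Units (stalk Y (f x))"
proof -
  note c = assms[unfolded space_homs_def mem_Collect_eq split_conv]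
  note c1 = c[THEN conjunct1] and c2 = c[THEN conjunct2, THEN conjunct1]
    and c3 = c[THEN conjunct2, THEN conjunct2, THEN conjunct1]
    and c4 = c[THEN conjunct2, THEN conjunct2, THEN conjunct2, THEN conjunct1]
    and c5 = c[THEN conjunct2, THEN conjunct2, THEN conjunct2, THEN conjunct2, THEN conjunct1]
    and c6 = c[THEN conjunct2, THEN conjunct2, THEN conjunct2, THEN conjunct2, THEN conjunct2]
  show "f \<in> extensional (points X)" "continuous_map (sp_top X) (sp_top Y) f" "\<phi> \<in> extensional (opens Y)"
    by (fact c1 c2 c3)+
  show "\<phi> V \<in> extensional (carrier (sections Y V))" if "V \<in> opens Y"
    using c4[THEN bspec, OF that] by (rule conjunct1)
  show "\<phi> V \<in> H (sections Y V) (sections X (preim X f V))" if "V \<in> opens Y"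
    using c4[THEN bspec, OF that] by (rule conjunct2)
  show "\<phi> W (res Y V W t) = res X (preim X f V) (preim X f W) (\<phi> V t)"
    if "V \<in> opens Y" "W \<in> opens Y" "W \<subseteq> V" "t \<in> carrier (sections Y V)"
    using c5[THEN bspec, OF that(1), THEN bspec, OF that(2), THEN mp, OF that(3), THEN bspec, OF that(4)] .
  show "germ Y (f x) V t \<in> Units (stalk Y (f x))"
    if "V \<in> opens Y" "x \<in> preim X f V" "t \<in> carrier (sections Y V)"
      "germ X x (preim X f V) (\<phi> V t) \<in> Units (stalk X x)"
    using c6[THEN bspec, OF that(1), THEN bspec, OF that(2), THEN bspec, OF that(3), THEN mp, OF that(4)] .
qed

lemma space_homsI:
  assumes "f \<in> extensional (points X)" "continuous_map (sp_top X) (sp_top Y) f" "\<phi> \<in> extensional (opens Y)"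
    "\<And>V. V \<in> opens Y \<Longrightarrow> \<phi> V \<in> extensional (carrier (sections Y V)) \<and> \<phi> V \<in> H (sections Y V) (sections X (preim X f V))"
    "\<And>V W t. V \<in> opens Y \<Longrightarrow> W \<in> opens Y \<Longrightarrow> W \<subseteq> V \<Longrightarrow> t \<in> carrier (sections Y V) \<Longrightarrow>
       \<phi> W (res Y V W t) = res X (preim X f V) (preim X f W) (\<phi> V t)"
    "\<And>V x t. V \<in> opens Y \<Longrightarrow> x \<in> preim X f V \<Longrightarrow> t \<in> carrier (sections Y V) \<Longrightarrow>
       germ X x (preim X f V) (\<phi> V t) \<in> Units (stalk X x) \<Longrightarrow> germ Y (f x) V t \<in> Units (stalk Y (f x))"
  shows "(f, \<phi>) \<in> space_homs H X Y"
  unfolding space_homs_def mem_Collect_eq split_conv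
  by (intro conjI ballI impI assms(1-3) conjunct1[OF assms(4)] conjunct2[OF assms(4)] assms(5) assms(6)) assumption+

context field_spec
begin

abbreviation pt :: "'a set" where "pt \<equiv> {\<zero>}"

abbreviation const_section :: "'a set set \<Rightarrow> 'a \<Rightarrow> 'a spec_section" where
  "const_section V c \<equiv> frac_section V c \<one>"

lemma opens_field: "opens S = {{}, {pt}}"
proof -
  have "openin (sp_top S) {pt}" using openin_topspace[of "sp_top S"] unfolding points_spec .
  moreover have "U = {} \<or> U = {pt}" if "U \<in> opens S" for U
    using open_sub[OF that] by (rule subset_singletonD)
  ultimately show ?thesis by (intro subset_antisym subsetI) auto
qed

lemma pt_frac_eq:
  assumes "a \<in> carrier K" "f \<in> carrier K - pt"
  shows "mk_frac K pt a f = mk_frac K pt (a \<otimes> inv f) \<one>"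
proof -
  have f: "f \<in> Units K" using assms by (simp add: field_Units)
  show ?thesis
    using assms f one_not_zero
    by (intro frac_eqI[where h = \<one>]) (auto simp: m_assoc)
qed

lemma pt_frac_inj:
  assumes "c \<in> carrier K" "d \<in> carrier K" "mk_frac K pt c \<one> = mk_frac K pt d \<one>"
  shows "c = d"
proof -
  obtain h where "h \<in> carrier K - pt" "h \<otimes> (c \<otimes> \<one>) = h \<otimes> (d \<otimes> \<one>)"
    using frac_eqD[OF _ assms(2) _ assms(3)] one_not_zero by auto
  then show ?thesis using assms by (simp add: m_lcancel)
qed

lemma const_section_inj:
  assumes "c \<in> carrier K" "d \<in> carrier K" "const_section {pt} c = const_section {pt} d"
  shows "c = d"
  using fun_cong[OF assms(3), of pt] assms(1,2) by (intro pt_frac_inj) (auto simp: frac_section_def)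

lemma const_section_field_closed:
  "V \<in> opens S \<Longrightarrow> c \<in> carrier K \<Longrightarrow> const_section V c \<in> carrier (sections S V)"
  using one_not_zero by (intro frac_section_closed) (auto simp: opens_field)

lemma section_const:
  assumes V: "V \<in> opens S" and s: "s \<in> carrier (sections S V)"
  obtains c where "c \<in> carrier K" "s = const_section V c"
proof (cases "V = {}")
  case True
  have "s = const_section V \<zero>"
    by (rule extensionalityI[OF section_ext[OF s]]) (auto simp: frac_section_def True)
  then show ?thesis using that[of \<zero>] by simp
next
  case False
  then have V': "V = {pt}" using V opens_field by auto
  obtain a f where a: "a \<in> carrier K" "f \<in> carrier K - pt" "s pt = mk_frac K pt a f"
    using section_frac[OF s, of pt] V' by auto
  have "f \<in> Units K" using a by (simp add: field_Units)
  then have c: "a \<otimes> inv f \<in> carrier K" using a by simp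
  have "s = const_section V (a \<otimes> inv f)"
    by (rule extensionalityI[OF section_ext[OF s]]) (use a pt_frac_eq in \<open>auto simp: frac_section_def V'\<close>)
  then show ?thesis using that c by blast
qed

lemma const_section_field_mult:
  assumes "V \<in> opens S" "a \<in> carrier K" "b \<in> carrier K"
  shows "const_section V a \<otimes>\<^bsub>sections S V\<^esub> const_section V b = const_section V (a \<otimes> b)"
  using assms one_not_zero by (subst frac_section_mult) (auto simp: opens_field)

text \<open>This makes the locality condition on a K-valued point explicit: a section with nonzero
  value must have an invertible germ.\<close>

lemma germ_const_unit_iff:
  assumes c: "c \<in> carrier K"
  shows "germ S pt {pt} (const_section {pt} c) \<in> Units (stalk S pt) \<longleftrightarrow> c \<noteq> \<zero>"
proof
  interpret mon_presheaf S by (rule presheaf)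
  have V: "{pt} \<in> opens S" by (simp add: opens_field)
  note cl = const_section_field_closed[OF V]
  {
    assume "germ S pt {pt} (const_section {pt} c) \<in> Units (stalk S pt)"
    then obtain W t where W: "W \<in> opens S" "pt \<in> W" "W \<subseteq> {pt}" "t \<in> carrier (sections S W)"
      "res S {pt} W (const_section {pt} c) \<otimes>\<^bsub>sections S W\<^esub> t = \<one>\<^bsub>sections S W\<^esub>"
      using germ_UnitsD[OF V _ cl[OF c]] by blast
    have W': "W = {pt}" using W by auto
    obtain d where d: "d \<in> carrier K" "t = const_section {pt} d" using section_const[OF W(1,4)] W' by auto
    have "const_section {pt} (c \<otimes> d) = const_section {pt} \<one>"
      using W(5) c d cl[OF c] unfolding W' by (simp add: res_id[OF V] const_section_field_mult[OF V] sections_one_eq)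
    then have "c \<otimes> d = \<one>" using c d by (intro const_section_inj) auto
    then show "c \<noteq> \<zero>" using d one_not_zero by auto
  next
    assume "c \<noteq> \<zero>"
    then have u: "c \<in> Units K" using c by (simp add: field_Units)
    show "germ S pt {pt} (const_section {pt} c) \<in> Units (stalk S pt)"
    proof (rule germ_UnitsI[OF V cl[OF c] V])
      show "const_section {pt} (inv c) \<in> carrier (sections S {pt})" using u by (intro cl) simp
      show "res S {pt} {pt} (const_section {pt} c) \<otimes>\<^bsub>sections S {pt}\<^esub> const_section {pt} (inv c) = \<one>\<^bsub>sections S {pt}\<^esub>"
        using u c cl[OF c] by (simp add: res_id[OF V] const_section_field_mult[OF V] sections_one_eq)
    qed auto
  }
qed

lemma preim_pt:
  assumes "f pt = x"
  shows "preim S f V = (if x \<in> V then {pt} else {})"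
  using assms unfolding preim_def points_spec by auto

lemma field_point_simps:
  assumes "V \<in> opens X" "t \<in> carrier (sections X V)"
  shows "snd (field_point K X x v) V t = const_section (if x \<in> V then {pt} else {}) (v V t)"
  using assms by (simp add: field_point_def frac_section_def)

text \<open>A point x with evaluations v is a morphism once the evaluations commute with restriction
  and are local. H is left open, so monoid homomorphisms and ring homomorphisms are both
  covered.\<close>

lemma field_point_in_space_homs:
  assumes x: "x \<in> points X"
    and cl: "\<And>V t. V \<in> opens X \<Longrightarrow> x \<in> V \<Longrightarrow> t \<in> carrier (sections X V) \<Longrightarrow> v V t \<in> carrier K"
    and X: "mon_presheaf X"
    and H: "\<And>V. V \<in> opens X \<Longrightarrow> (\<lambda>t\<in>carrier (sections X V). const_section (if x \<in> V then {pt} else {}) (v V t)) \<in>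
        H (sections X V) (sections S (if x \<in> V then {pt} else {}))"
    and compat: "\<And>V W t. V \<in> opens X \<Longrightarrow> W \<in> opens X \<Longrightarrow> x \<in> W \<Longrightarrow> W \<subseteq> V \<Longrightarrow> t \<in> carrier (sections X V) \<Longrightarrow>
        v W (res X V W t) = v V t"
    and loc: "\<And>V t. V \<in> opens X \<Longrightarrow> x \<in> V \<Longrightarrow> t \<in> carrier (sections X V) \<Longrightarrow> v V t \<noteq> \<zero> \<Longrightarrow>
        germ X x V t \<in> Units (stalk X x)"
  shows "field_point K X x v \<in> space_homs H S X"
proof -
  interpret X: mon_presheaf X by fact
  let ?f = "\<lambda>p\<in>{pt}. x"
  let ?\<phi> = "snd (field_point K X x v)"
  have fp: "field_point K X x v = (?f, ?\<phi>)" by (simp add: field_point_def)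
  have pre: "preim S ?f V = (if x \<in> V then {pt} else {})" for V by (rule preim_pt) simp
  have phi: "?\<phi> V = (\<lambda>t\<in>carrier (sections X V). const_section (if x \<in> V then {pt} else {}) (v V t))" if "V \<in> opens X" for V
    using that by (simp add: field_point_def frac_section_def)
  have h1: "continuous_map (sp_top S) (sp_top X) ?f"
    unfolding continuous_map
  proof (intro conjI allI impI)
    show "?f ` points S \<subseteq> points X" using x by (simp add: points_spec)
    fix V assume "openin (sp_top X) V"
    have "{p \<in> points S. ?f p \<in> V} = preim S ?f V" by (simp add: preim_def)
    then show "openin (sp_top S) {p \<in> points S. ?f p \<in> V}" using opens_field unfolding pre by auto
  qed
  have h2: "?\<phi> W (res X V W t) = res S (preim S ?f V) (preim S ?f W) (?\<phi> V t)"
    if VW: "V \<in> opens X" "W \<in> opens X" "W \<subseteq> V" "t \<in> carrier (sections X V)" for V W t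
  proof (cases "x \<in> W")
    case True
    then have xV: "x \<in> V" using VW by auto
    show ?thesis
      unfolding pre phi[OF VW(1)] phi[OF VW(2)] res_eq
      using VW True xV compat[OF VW(1,2) True VW(3,4)] X.res_closed[OF VW] by (simp add: frac_section_def)
  next
    case False
    then show ?thesis
      unfolding pre phi[OF VW(1)] phi[OF VW(2)] res_eq
      using VW X.res_closed[OF VW] by (simp add: frac_section_def restrict_def)
  qed
  have h3: "germ X (?f p) V t \<in> Units (stalk X (?f p))"
    if V: "V \<in> opens X" "p \<in> preim S ?f V" "t \<in> carrier (sections X V)"
      "germ S p (preim S ?f V) (?\<phi> V t) \<in> Units (stalk S p)" for V p t
  proof -
    have xV: "x \<in> V" "p = pt" using V(2) unfolding pre by (auto split: if_splits)
    then have "v V t \<noteq> \<zero>"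
      using V germ_const_unit_iff[OF cl[OF V(1) xV(1) V(3)]] unfolding pre phi[OF V(1)] by simp
    then show ?thesis using loc[OF V(1) xV(1) V(3)] xV by simp
  qed
  have h4: "?\<phi> \<in> extensional (opens X)" by (simp add: field_point_def)
  have h5: "?\<phi> V \<in> extensional (carrier (sections X V)) \<and> ?\<phi> V \<in> H (sections X V) (sections S (preim S ?f V))"
    if "V \<in> opens X" for V using H[OF that] unfolding pre phi[OF that] by simp
  have h6: "?f \<in> extensional (points S)" by (simp add: points_spec)
  show ?thesis
  proof (subst fp, rule space_homsI, goal_cases)
    case 1 show ?case by (rule h6)
  next
    case 2 show ?case by (rule h1)
  next
    case 3 show ?case by (rule h4)
  next
    case (4 V) show ?case by (rule h5[OF 4])
  next
    case (5 V W t) show ?case by (rule h2[OF 5])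
  next
    case (6 V p t) show ?case by (rule h3[OF 6])
  qed
qed

text \<open>The converse: sections over the spectrum of a field are constants, so each pulled-back
  section has a value in K. Over an open set that misses x this value is an arbitrary choice, hence
  the conditions \<open>x \<in> V\<close> in the conclusion.\<close>

lemma field_point_cases:
  assumes m: "m \<in> space_homs H S X" and X: "mon_presheaf X"
    and H: "\<And>M N h. h \<in> H M N \<Longrightarrow> h \<in> carrier M \<rightarrow> carrier N"
  obtains x v where "m = field_point K X x v" "x \<in> points X"
    "\<And>V t. V \<in> opens X \<Longrightarrow> x \<in> V \<Longrightarrow> t \<in> carrier (sections X V) \<Longrightarrow> v V t \<in> carrier K"
    "\<And>V W t. V \<in> opens X \<Longrightarrow> W \<in> opens X \<Longrightarrow> x \<in> W \<Longrightarrow> W \<subseteq> V \<Longrightarrow> t \<in> carrier (sections X V) \<Longrightarrow>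
        v W (res X V W t) = v V t"
    "\<And>V t. V \<in> opens X \<Longrightarrow> x \<in> V \<Longrightarrow> t \<in> carrier (sections X V) \<Longrightarrow> v V t \<noteq> \<zero> \<Longrightarrow>
        germ X x V t \<in> Units (stalk X x)"
    "\<And>V. V \<in> opens X \<Longrightarrow> x \<in> V \<Longrightarrow> (\<lambda>t\<in>carrier (sections X V). const_section {pt} (v V t)) \<in>
        H (sections X V) (sections S {pt})"
proof -
  interpret X: mon_presheaf X by fact
  obtain f \<phi> where m': "m = (f, \<phi>)" by (cases m)
  note D = space_homsD[OF m[unfolded m']]
  define x where "x = f pt"
  have pre: "preim S f V = (if x \<in> V then {pt} else {})" for V by (rule preim_pt) (simp add: x_def)
  have x: "x \<in> points X"
    using D(2) unfolding x_def continuous_map_def by (auto simp: points_spec)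
  define v where "v V t = (SOME c. c \<in> carrier K \<and> \<phi> V t = const_section (preim S f V) c)" for V t
  have v: "v V t \<in> carrier K" "\<phi> V t = const_section (preim S f V) (v V t)"
    if "V \<in> opens X" "t \<in> carrier (sections X V)" for V t
  proof -
    have "\<phi> V \<in> carrier (sections X V) \<rightarrow> carrier (sections S (preim S f V))"
      using D(5)[OF that(1)] by (rule H)
    then have "\<phi> V t \<in> carrier (sections S (preim S f V))" using that(2) by (rule funcset_mem)
    moreover have "preim S f V \<in> opens S" unfolding pre by (simp add: opens_field)
    ultimately have "\<exists>c. c \<in> carrier K \<and> \<phi> V t = const_section (preim S f V) c"
      using section_const by metis
    from someI_ex[OF this] show "v V t \<in> carrier K" "\<phi> V t = const_section (preim S f V) (v V t)"
      unfolding v_def by auto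
  qed
  have phi: "\<phi> V = (\<lambda>t\<in>carrier (sections X V). const_section (preim S f V) (v V t))" if "V \<in> opens X" for V
    using D(4)[OF that] v(2)[OF that] by (intro extensionalityI[of _ "carrier (sections X V)"]) auto
  show ?thesis
  proof (rule that[of x v])
    show "m = field_point K X x v"
    proof -
      have "f = (\<lambda>p\<in>{pt}. x)"
        using D(1) unfolding points_spec by (intro extensionalityI[of _ "{pt}"]) (auto simp: x_def)
      moreover have "\<phi> = (\<lambda>V\<in>opens X. \<lambda>t\<in>carrier (sections X V). \<lambda>p\<in>(if x \<in> V then {pt} else {}). mk_frac K p (v V t) \<one>)"
        using D(3) by (intro extensionalityI[of _ "opens X"]) (auto simp: phi pre frac_section_def)
      ultimately show ?thesis by (simp add: m' field_point_def)
    qed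
    show "x \<in> points X" by (rule x)
    show "v V t \<in> carrier K" if "V \<in> opens X" "x \<in> V" "t \<in> carrier (sections X V)" for V t
      by (rule v(1)[OF that(1,3)])
    show "v W (res X V W t) = v V t"
      if VW: "V \<in> opens X" "W \<in> opens X" "x \<in> W" "W \<subseteq> V" "t \<in> carrier (sections X V)" for V W t
    proof (rule const_section_inj)
      have rt: "res X V W t \<in> carrier (sections X W)" using VW by (intro X.res_closed)
      show "v W (res X V W t) \<in> carrier K" "v V t \<in> carrier K" using v(1)[OF VW(2) rt] v(1)[OF VW(1,5)] .
      have "const_section {pt} (v W (res X V W t)) = \<phi> W (res X V W t)" using v(2)[OF VW(2) rt] VW by (simp add: pre)
      also have "\<dots> = res S (preim S f V) (preim S f W) (\<phi> V t)" by (rule D(6)[OF VW(1,2,4,5)])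
      also have "\<dots> = const_section {pt} (v V t)"
        using v(2)[OF VW(1,5)] VW by (auto simp: pre res_eq frac_section_def)
      finally show "const_section {pt} (v W (res X V W t)) = const_section {pt} (v V t)" .
    qed
    show "germ X x V t \<in> Units (stalk X x)"
      if V: "V \<in> opens X" "x \<in> V" "t \<in> carrier (sections X V)" "v V t \<noteq> \<zero>" for V t
    proof -
      have "pt \<in> preim S f V" using V by (simp add: pre)
      moreover have "germ S pt (preim S f V) (\<phi> V t) \<in> Units (stalk S pt)"
        using germ_const_unit_iff[OF v(1)[OF V(1,3)]] v(2)[OF V(1,3)] V by (simp add: pre)
      ultimately show ?thesis using D(7)[OF V(1) _ V(3)] unfolding x_def by blast
    qed
    show "(\<lambda>t\<in>carrier (sections X V). const_section {pt} (v V t)) \<in> H (sections X V) (sections S {pt})"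
      if "V \<in> opens X" "x \<in> V" for V
      using D(5)[OF that(1)] phi[OF that(1)] that(2) by (simp add: pre)
  qed
qed

text \<open>Values are recovered only over neighbourhoods of x, as over the empty set all constants
  coincide.\<close>

lemma field_point_inj:
  assumes "field_point K X x v = field_point K X y w"
    and v: "\<And>V t. V \<in> opens X \<Longrightarrow> x \<in> V \<Longrightarrow> t \<in> carrier (sections X V) \<Longrightarrow> v V t \<in> carrier K"
    and w: "\<And>V t. V \<in> opens X \<Longrightarrow> y \<in> V \<Longrightarrow> t \<in> carrier (sections X V) \<Longrightarrow> w V t \<in> carrier K"
  shows "x = y" "\<And>V t. V \<in> opens X \<Longrightarrow> x \<in> V \<Longrightarrow> t \<in> carrier (sections X V) \<Longrightarrow> v V t = w V t"
proof -
  have "fst (field_point K X x v) pt = fst (field_point K X y w) pt" using assms(1) by simp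
  then show xy: "x = y" by (simp add: field_point_def)
  show "v V t = w V t" if V: "V \<in> opens X" "x \<in> V" "t \<in> carrier (sections X V)" for V t
  proof (rule const_section_inj)
    show "const_section {pt} (v V t) = const_section {pt} (w V t)"
      using field_point_simps[OF V(1,3), of x v] field_point_simps[OF V(1,3), of y w] assms(1) V xy by simp
  qed (use v w V xy in auto)
qed

end

text \<open>Composing a K'-valued point with the map of spectra induced by the inclusion leaves the
  underlying data x and v unchanged. The parameters A and B allow the spectra to be taken of the
  rings themselves or of their multiplicative monoids.\<close>

lemma field_point_subfield:
  fixes K K' :: "'a ring"
  assumes K: "field_spec K S" and K': "field_spec K' S'"
    and sub: "carrier K' \<subseteq> carrier K" "mult K' = mult K" "one K' = one K" "zero K' = zero K"
    and A: "carrier A = carrier K'" "mk_frac B = mk_frac K"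
    and v: "\<And>V t. V \<in> opens X \<Longrightarrow> x \<in> V \<Longrightarrow> t \<in> carrier (sections X V) \<Longrightarrow> v V t \<in> carrier K'"
  shows "comp_morphism S S' X (field_point K' X x v) (spec_map S' S A B (\<lambda>u\<in>carrier K'. u)) = field_point K X x v"
proof -
  interpret K: field_spec K S by fact
  interpret K': field_spec K' S' by fact
  let ?pt = "{\<zero>\<^bsub>K\<^esub>}"
  define c where "c = (\<lambda>q\<in>{?pt}. {a\<in>carrier K'. (\<lambda>u\<in>carrier K'. u) a \<in> q})"
  have z': "\<zero>\<^bsub>K\<^esub> \<in> carrier K'" using K'.zero_closed sub by simp
  have c: "c = (\<lambda>q\<in>{?pt}. ?pt)"
    unfolding c_def using z' by (intro restrict_ext) auto
  have sm: "spec_map S' S A B (\<lambda>u\<in>carrier K'. u) =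
      (c, \<lambda>V\<in>opens S'. \<lambda>t\<in>carrier (sections S' V). \<lambda>q\<in>preim S c V.
           \<Union>(a, g)\<in>t (c q). mk_frac K q ((\<lambda>u\<in>carrier K'. u) a) ((\<lambda>u\<in>carrier K'. u) g))"
    by (simp add: spec_map_def c_def Let_def K.points_spec A)
  have fst: "compose (points S) (fst (field_point K' X x v)) c = fst (field_point K X x v)"
    by (rule extensionalityI[of _ "{?pt}"]) (auto simp: compose_def c K.points_spec field_point_def sub)
  have UN1: "(\<Union>z\<in>M. F z) = C" if "\<And>z. z \<in> M \<Longrightarrow> F z = C" "z0 \<in> M" for M :: "('a \<times> 'a) set" and F C z0
    using that by auto
  have snd: "(\<lambda>V\<in>opens X. \<lambda>t\<in>carrier (sections X V).
       snd (spec_map S' S A B (\<lambda>u\<in>carrier K'. u)) (preim S' (fst (field_point K' X x v)) V) (snd (field_point K' X x v) V t)) =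
      snd (field_point K X x v)"
  proof (rule extensionalityI[of _ "opens X"])
    fix V assume V: "V \<in> opens X"
    show "(\<lambda>V\<in>opens X. \<lambda>t\<in>carrier (sections X V).
       snd (spec_map S' S A B (\<lambda>u\<in>carrier K'. u)) (preim S' (fst (field_point K' X x v)) V) (snd (field_point K' X x v) V t)) V =
      snd (field_point K X x v) V"
    proof (rule extensionalityI[of _ "carrier (sections X V)"])
      fix t assume t: "t \<in> carrier (sections X V)"
      let ?V = "if x \<in> V then {?pt} else {}"
      have pre: "preim S' (fst (field_point K' X x v)) V = ?V"
        by (subst K'.preim_pt[where x = x]) (auto simp: field_point_def sub)
      have pre2: "preim S c ?V = ?V" by (subst K.preim_pt[where x = ?pt]) (auto simp: c)
      have V': "?V \<in> opens S'" using K'.opens_field sub by auto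
      have t': "snd (field_point K' X x v) V t = K'.frac_section ?V (v V t) \<one>\<^bsub>K'\<^esub>"
        using K'.field_point_simps[OF V t, of x v] sub by simp
      have t'cl: "K'.frac_section ?V (v V t) \<one>\<^bsub>K'\<^esub> \<in> carrier (sections S' ?V)"
      proof (cases "x \<in> V")
        case True
        then show ?thesis using K'.const_section_field_closed[OF V'] v[OF V True t] by auto
      next
        case False
        then show ?thesis using K'.const_section_field_closed[OF V' z'[unfolded sub(4)[symmetric]]] 
          by (simp add: K'.frac_section_def restrict_def)
      qed
      have "snd (spec_map S' S A B (\<lambda>u\<in>carrier K'. u)) ?V (K'.frac_section ?V (v V t) \<one>\<^bsub>K'\<^esub>) =
        (\<lambda>q\<in>?V. \<Union>(a, g)\<in>K'.frac_section ?V (v V t) \<one>\<^bsub>K'\<^esub> (c q).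
            mk_frac K q ((\<lambda>u\<in>carrier K'. u) a) ((\<lambda>u\<in>carrier K'. u) g))"
        unfolding sm using V' t'cl pre2 by simp
      also have "\<dots> = (\<lambda>q\<in>?V. mk_frac K q (v V t) \<one>\<^bsub>K\<^esub>)"
      proof (rule restrict_ext)
        fix q assume q: "q \<in> ?V"
        then have xV: "x \<in> V" "q = ?pt" by (auto split: if_splits)
        have vK: "v V t \<in> carrier K'" by (rule v[OF V xV(1) t])
        have one: "\<one>\<^bsub>K'\<^esub> \<in> carrier K' - {\<zero>\<^bsub>K'\<^esub>}" by simp
        have fr: "K'.frac_section ?V (v V t) \<one>\<^bsub>K'\<^esub> (c q) = mk_frac K' ?pt (v V t) \<one>\<^bsub>K'\<^esub>"
          using xV by (simp add: K'.frac_section_def c)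
        \<comment> \<open>Representatives over K' of the fraction v / 1 represent the same fraction
          over K, so the union in \<open>spec_map\<close> collapses.\<close>
        have "mk_frac K ?pt ((\<lambda>u\<in>carrier K'. u) a) ((\<lambda>u\<in>carrier K'. u) g) = mk_frac K ?pt (v V t) \<one>\<^bsub>K\<^esub>"
          if ag: "(a, g) \<in> mk_frac K' ?pt (v V t) \<one>\<^bsub>K'\<^esub>" for a g
        proof -
          obtain h where h: "a \<in> carrier K'" "g \<in> carrier K' - ?pt" "h \<in> carrier K' - ?pt"
            "h \<otimes>\<^bsub>K\<^esub> (v V t \<otimes>\<^bsub>K\<^esub> g) = h \<otimes>\<^bsub>K\<^esub> (a \<otimes>\<^bsub>K\<^esub> \<one>\<^bsub>K\<^esub>)"
            using ag by (auto simp: mk_frac_def sub)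
          have "mk_frac K ?pt (v V t) \<one>\<^bsub>K\<^esub> = mk_frac K ?pt a g"
            using h vK sub(1) K.one_not_zero by (intro K.frac_eqI[where h = h]) auto
          then show ?thesis using h by simp
        qed
        moreover have "(v V t, \<one>\<^bsub>K'\<^esub>) \<in> mk_frac K' ?pt (v V t) \<one>\<^bsub>K'\<^esub>"
          using K'.mem_frac_self[OF _ vK one] sub by simp
        ultimately show "(\<Union>(a, g)\<in>K'.frac_section ?V (v V t) \<one>\<^bsub>K'\<^esub> (c q).
            mk_frac K q ((\<lambda>u\<in>carrier K'. u) a) ((\<lambda>u\<in>carrier K'. u) g)) = mk_frac K q (v V t) \<one>\<^bsub>K\<^esub>"
          unfolding fr unfolding xV(2) by (intro UN1) auto
      qed
      also have "\<dots> = snd (field_point K X x v) V t"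
        using K.field_point_simps[OF V t, of x v] by (simp add: K.frac_section_def)
      finally show "(\<lambda>V\<in>opens X. \<lambda>t\<in>carrier (sections X V).
         snd (spec_map S' S A B (\<lambda>u\<in>carrier K'. u)) (preim S' (fst (field_point K' X x v)) V) (snd (field_point K' X x v) V t)) V t =
        snd (field_point K X x v) V t"
        using V t by (simp add: pre t')
    qed (use V in \<open>auto simp: field_point_def\<close>)
  qed (auto simp: field_point_def)
  show ?thesis
    unfolding comp_morphism_def using fst snd by (simp add: sm)
qed

text \<open>An inverse b/g of a/1 at p yields h a b = h g with h and g outside p; if a were in p,
  only the left side would be in p.\<close>

lemma (in prime_spec) germ_const_unitD:
  assumes V: "V \<in> opens S" "p \<in> V" and a: "a \<in> carrier A"
    and unit: "germ S p V (frac_section V a \<one>) \<in> Units (stalk S p)"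
  shows "a \<notin> p"
proof
  assume ap: "a \<in> p"
  interpret mon_presheaf S by (rule presheaf)
  have p: "p \<in> P" using open_sub[OF V(1)] V(2) by (rule subsetD)
  have one: "\<one> \<in> carrier A - p" using prime_one[OF p] by simp
  have cl: "frac_section V a \<one> \<in> carrier (sections S V)"
    using open_sub[OF V(1)] prime_one by (intro frac_section_closed[OF V(1) a]) (auto simp: subset_iff)
  obtain W t where W: "W \<in> opens S" "p \<in> W" "W \<subseteq> V" "t \<in> carrier (sections S W)"
    "res S V W (frac_section V a \<one>) \<otimes>\<^bsub>sections S W\<^esub> t = \<one>\<^bsub>sections S W\<^esub>"
    by (rule germ_UnitsD[OF V cl unit])
  obtain b g where b: "b \<in> carrier A" "g \<in> carrier A - p" "t p = mk_frac A p b g"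
    by (rule section_frac[OF W(4,2)])
  have "(res S V W (frac_section V a \<one>) \<otimes>\<^bsub>sections S W\<^esub> t) p = loc_mult A p (mk_frac A p a \<one>) (mk_frac A p b g)"
    using W(2) V(2) b(3) by (simp add: sections_mult res_eq frac_section_def)
  also have "\<dots> = mk_frac A p (a \<otimes> b) (\<one> \<otimes> g)" by (rule loc_mult_frac[OF p a one b(1,2)])
  finally have "mk_frac A p (a \<otimes> b) (\<one> \<otimes> g) = mk_frac A p \<one> \<one>"
    using W(2) unfolding W(5) by (simp add: sections_one)
  then obtain h where h: "h \<in> carrier A - p" "h \<otimes> ((a \<otimes> b) \<otimes> \<one>) = h \<otimes> (\<one> \<otimes> (\<one> \<otimes> g))"
    using frac_eqD[OF p _ one] by (metis one_closed)
  have "a \<otimes> b \<in> p" by (rule prime_ideal[OF p ap b(1)])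
  then have "h \<otimes> ((a \<otimes> b) \<otimes> \<one>) \<in> p" using h(1) a b(1) prime_mult_iff[OF p] by simp
  moreover have "h \<otimes> (\<one> \<otimes> (\<one> \<otimes> g)) \<notin> p" using h(1) b(2) prime_mult[OF p] by simp
  ultimately show False unfolding h(2) by simp
qed

lemma is_sheaf_obj: "is_sheaf obj H X \<Longrightarrow> U \<in> opens X \<Longrightarrow> obj (sections X U)"
  unfolding is_sheaf_def by (drule conjunct1) (erule bspec)

lemma is_sheaf_res:
  "is_sheaf obj H X \<Longrightarrow> U \<in> opens X \<Longrightarrow> V \<in> opens X \<Longrightarrow> V \<subseteq> U \<Longrightarrow> res X U V \<in> H (sections X U) (sections X V)"
  unfolding is_sheaf_def by (drule conjunct2, drule conjunct1, drule bspec, assumption, drule bspec, assumption, erule mp)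

lemma preim_points:
  assumes "continuous_map (sp_top X) (sp_top Y) f"
  shows "preim X f (points Y) = points X"
  using assms by (auto simp: preim_def continuous_map_def)

lemma points_restrict: "U \<in> opens X \<Longrightarrow> points (restrict_space_to X U) = U"
  by (simp add: restrict_space_to_def topspace_subtopology openin_subset inf.absorb2)

text \<open>Were the zero germ invertible, 0 = 1 would hold near x. By locality of an affine chart
  the zero of M would then lie outside the prime at x, but ideals contain it. Extending a character
  by 0 relies on this to preserve zero.\<close>

lemma mzero_germ_not_unit:
  assumes X: "mon_scheme X" and V: "V \<in> opens X" "x \<in> V"
  shows "germ X x V (mzero (sections X V)) \<notin> Units (stalk X x)"
proof
  assume unit: "germ X x V (mzero (sections X V)) \<in> Units (stalk X x)"
  interpret X: mon_presheaf X by (rule mon_scheme_mon_presheaf[OF X])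
  have sh: "is_sheaf mon0 mon0_hom X" using X by (simp add: mon_scheme_def)
  have z: "absorbing (sections X W) (mzero (sections X W))" if "W \<in> opens X" for W
    by (rule absorbing_mzero[OF is_sheaf_obj[OF sh that]])
  have zc: "mzero (sections X W) \<in> carrier (sections X W)" if "W \<in> opens X" for W
    using z[OF that] by (simp add: absorbing_def)
  have zr: "res X W W' (mzero (sections X W)) = mzero (sections X W')"
    if "W \<in> opens X" "W' \<in> opens X" "W' \<subseteq> W" for W W'
    using is_sheaf_res[OF sh that] by (simp add: mon0_hom_def)
  have "x \<in> points X" using openin_subset[of "sp_top X" V] V by auto
  then have "\<exists>U M. x \<in> U \<and> mon_affine X U M"
    by (rule X[unfolded mon_scheme_def, THEN conjunct2, THEN bspec])
  then obtain U where "\<exists>M. x \<in> U \<and> mon_affine X U M" by (rule exE)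
  then obtain M where UM: "x \<in> U \<and> mon_affine X U M" by (rule exE)
  then have U: "x \<in> U" "U \<in> opens X" "mon0 M" and iso: "isomorphic_spaces mon0_hom (restrict_space_to X U) (mspec M)"
    by simp_all
  obtain f \<phi> where f: "(f, \<phi>) \<in> space_homs mon0_hom (restrict_space_to X U) (mspec M)"
    using iso unfolding isomorphic_spaces_def by auto
  interpret M: prime_spec M "{p. mon_prime M p}" "mspec M" by (rule prime_spec_mspec[OF U(3)])
  interpret XU: mon_presheaf "restrict_space_to X U" by (rule mon_presheaf_restrict[OF X.mon_presheaf_axioms U(2)])
  let ?P = "points (mspec M)"
  have P: "?P \<in> opens (mspec M)" by simp
  have pre: "preim (restrict_space_to X U) f ?P = U"
    using preim_points[OF space_homsD(2)[OF f]] points_restrict[OF U(2)] by simp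
  obtain W t where W: "W \<in> opens X" "x \<in> W" "W \<subseteq> V" "t \<in> carrier (sections X W)"
    "res X V W (mzero (sections X V)) \<otimes>\<^bsub>sections X W\<^esub> t = \<one>\<^bsub>sections X W\<^esub>"
    by (rule X.germ_UnitsD[OF V zc[OF V(1)] unit])
  have zW: "mzero (sections X W) = \<one>\<^bsub>sections X W\<^esub>"
    using W(5) z[OF W(1)] W(4) unfolding zr[OF V(1) W(1,3)] absorbing_def by simp
  let ?W = "W \<inter> U"
  have W': "?W \<in> opens X" "x \<in> ?W" using W(1,2) U(1,2) by auto
  have zW': "mzero (sections X ?W) = \<one>\<^bsub>sections X ?W\<^esub>"
    using zr[OF W(1) W'(1)] X.res_one[OF W(1) W'(1)] zW by simp
  have eq: "sections (restrict_space_to X U) = sections X" "res (restrict_space_to X U) = res X"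
    by (simp_all add: restrict_space_to_def)
  \<comment> \<open>Over \<open>?W\<close>, where 0 = 1, the zero section is inverse to 1.\<close>
  have "germ (restrict_space_to X U) x U (mzero (sections X U)) \<in> Units (stalk (restrict_space_to X U) x)"
  proof (rule XU.germ_UnitsI)
    show "U \<in> opens (restrict_space_to X U)" "?W \<in> opens (restrict_space_to X U)"
      unfolding opens_restrict_iff[OF U(2)] using U(2) W'(1) by auto
    show "mzero (sections X U) \<in> carrier (sections (restrict_space_to X U) U)" unfolding eq by (rule zc[OF U(2)])
    show "x \<in> ?W" "?W \<subseteq> U" using W'(2) by auto
    show "\<one>\<^bsub>sections X ?W\<^esub> \<in> carrier (sections (restrict_space_to X U) ?W)" unfolding eq by (rule X.sections_one_closed[OF W'(1)])
    show "res (restrict_space_to X U) U ?W (mzero (sections X U)) \<otimes>\<^bsub>sections (restrict_space_to X U) ?W\<^esub> \<one>\<^bsub>sections X ?W\<^esub> =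
        \<one>\<^bsub>sections (restrict_space_to X U) ?W\<^esub>"
      unfolding eq using zr[OF U(2) W'(1)] zW' z[OF W'(1)] X.sections_one_closed[OF W'(1)] by (simp add: absorbing_def)
  qed
  moreover have "absorbing (sections (mspec M) ?P) (M.frac_section ?P (mzero M) \<one>\<^bsub>M\<^esub>)"
  proof -
    have z0: "mzero M \<in> carrier M" "\<And>a. a \<in> carrier M \<Longrightarrow> mzero M \<otimes>\<^bsub>M\<^esub> a = mzero M" "\<And>a. a \<in> carrier M \<Longrightarrow> a \<otimes>\<^bsub>M\<^esub> mzero M = mzero M"
      using absorbing_mzero[OF U(3)] by (simp_all add: absorbing_def)
    have one: "\<And>q. q \<in> ?P \<Longrightarrow> \<one>\<^bsub>M\<^esub> \<notin> q" unfolding M.points_spec by (rule M.prime_one)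
    have cl: "M.frac_section ?P (mzero M) \<one>\<^bsub>M\<^esub> \<in> carrier (sections (mspec M) ?P)"
      by (rule M.frac_section_closed[OF P z0(1) M.one_closed one])
    interpret SP: comm_monoid "sections (mspec M) ?P" by (rule M.sections_comm_monoid[OF P])
    have l: "M.frac_section ?P (mzero M) \<one>\<^bsub>M\<^esub> \<otimes>\<^bsub>sections (mspec M) ?P\<^esub> s = M.frac_section ?P (mzero M) \<one>\<^bsub>M\<^esub>"
      if s: "s \<in> carrier (sections (mspec M) ?P)" for s
      unfolding M.sections_mult M.frac_section_def
    proof (rule restrict_ext)
      fix p assume p: "p \<in> ?P"
      then have p': "p \<in> {p. mon_prime M p}" unfolding M.points_spec .
      obtain a g where a: "a \<in> carrier M" "g \<in> carrier M - p" "s p = mk_frac M p a g" by (rule M.section_frac[OF s p])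
      have one': "\<one>\<^bsub>M\<^esub> \<in> carrier M - p" using one[OF p] by simp
      have "loc_mult M p (mk_frac M p (mzero M) \<one>\<^bsub>M\<^esub>) (s p) = mk_frac M p (mzero M \<otimes>\<^bsub>M\<^esub> a) (\<one>\<^bsub>M\<^esub> \<otimes>\<^bsub>M\<^esub> g)"
        unfolding a(3) by (rule M.loc_mult_frac[OF p' z0(1) one' a(1,2)])
      also have "\<dots> = mk_frac M p (mzero M) \<one>\<^bsub>M\<^esub>"
        using a z0 one' by (intro M.frac_eqI[OF p', where h = "\<one>\<^bsub>M\<^esub>"]) simp_all
      finally show "loc_mult M p ((\<lambda>p\<in>?P. mk_frac M p (mzero M) \<one>\<^bsub>M\<^esub>) p) (s p) = mk_frac M p (mzero M) \<one>\<^bsub>M\<^esub>"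
        using p by simp
    qed
    show ?thesis
      unfolding absorbing_def using cl l SP.m_comm[OF cl] by simp
  qed
  then have mz: "mzero (sections (mspec M) ?P) = M.frac_section ?P (mzero M) \<one>\<^bsub>M\<^esub>" by (rule mzero_eq)
  have "\<phi> ?P (mzero (sections (mspec M) ?P)) = mzero (sections X U)"
    using space_homsD(5)[OF f P] unfolding pre eq by (simp add: mon0_hom_def)
  ultimately have "germ (restrict_space_to X U) x (preim (restrict_space_to X U) f ?P) (\<phi> ?P (mzero (sections (mspec M) ?P))) \<in> Units (stalk (restrict_space_to X U) x)"
    unfolding pre by simp
  moreover have "mzero (sections (mspec M) ?P) \<in> carrier (sections (mspec M) ?P)"
    using \<open>absorbing (sections (mspec M) ?P) (M.frac_section ?P (mzero M) \<one>\<^bsub>M\<^esub>)\<close> unfolding mz by (simp add: absorbing_def)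
  ultimately have un: "germ (mspec M) (f x) ?P (mzero (sections (mspec M) ?P)) \<in> Units (stalk (mspec M) (f x))"
    using U(1) by (intro space_homsD(7)[OF f P]) (simp_all add: pre)
  have "f x \<in> ?P" using U(1) pre by (auto simp: preim_def)
  have "mzero M \<in> carrier M" using absorbing_mzero[OF U(3)] by (simp add: absorbing_def)
  from M.germ_const_unitD[OF P \<open>f x \<in> ?P\<close> this un[unfolded mz]] have "mzero M \<notin> f x" .
  moreover have "mon_prime M (f x)" using \<open>f x \<in> ?P\<close> unfolding M.points_spec by (rule CollectD)
  then have "mzero M \<in> f x" unfolding mon_prime_def mon_ideal_def by (elim conjE)
  ultimately show False by (rule notE)
qed

text \<open>A character of the units of the stalk, extended by 0 to the non-units, is a K-valued
  point at x; locality is built into the definition.\<close>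

lemma character_field_point:
  fixes K :: "'a ring"
  assumes X: "mon_scheme X" and x: "x \<in> points X" and K: "field K"
    and \<xi>: "\<And>g. g \<in> Units (stalk X x) \<Longrightarrow> \<xi> g \<in> carrier K" "\<xi> \<one>\<^bsub>stalk X x\<^esub> = \<one>\<^bsub>K\<^esub>"
      "\<And>g h. g \<in> Units (stalk X x) \<Longrightarrow> h \<in> Units (stalk X x) \<Longrightarrow> \<xi> (g \<otimes>\<^bsub>stalk X x\<^esub> h) = \<xi> g \<otimes>\<^bsub>K\<^esub> \<xi> h"
  shows "field_point K X x (\<lambda>V t. if germ X x V t \<in> Units (stalk X x) then \<xi> (germ X x V t) else \<zero>\<^bsub>K\<^esub>)
    \<in> space_homs mon0_hom (mspec (mult_monoid K)) X"
proof -
  interpret X: mon_presheaf X by (rule mon_scheme_mon_presheaf[OF X])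
  interpret St: comm_monoid "stalk X x" by (rule X.stalk_comm_monoid[OF x])
  interpret K: field_spec K "mspec (mult_monoid K)" by (rule field_spec_mspec[OF K])
  let ?S = "mspec (mult_monoid K)"
  define v where "v V t = (if germ X x V t \<in> Units (stalk X x) then \<xi> (germ X x V t) else \<zero>\<^bsub>K\<^esub>)" for V t
  have cl: "v V t \<in> carrier K" for V t using \<xi>(1) by (simp add: v_def)
  have vm: "v V (s \<otimes>\<^bsub>sections X V\<^esub> t) = v V s \<otimes>\<^bsub>K\<^esub> v V t"
    if V: "V \<in> opens X" "x \<in> V" "s \<in> carrier (sections X V)" "t \<in> carrier (sections X V)" for V s t
  proof -
    have g: "germ X x V (s \<otimes>\<^bsub>sections X V\<^esub> t) = germ X x V s \<otimes>\<^bsub>stalk X x\<^esub> germ X x V t"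
      using X.germ_mult[OF V] by simp
    have c: "germ X x V s \<in> carrier (stalk X x)" "germ X x V t \<in> carrier (stalk X x)"
      using X.germ_closed V by auto
    \<comment> \<open>In a commutative monoid a product is a unit only if both factors are, so the
      extension by 0 stays multiplicative.\<close>
    have "germ X x V s \<otimes>\<^bsub>stalk X x\<^esub> germ X x V t \<in> Units (stalk X x) \<longleftrightarrow>
        germ X x V s \<in> Units (stalk X x) \<and> germ X x V t \<in> Units (stalk X x)"
      using St.unit_factor[OF _ c] St.unit_factor[OF _ c(2,1)] St.m_comm[OF c] St.Units_m_closed by auto
    then show ?thesis
      unfolding v_def g using \<xi>(3) \<xi>(1) by auto
  qed
  have v1: "v V \<one>\<^bsub>sections X V\<^esub> = \<one>\<^bsub>K\<^esub>" if "V \<in> opens X" "x \<in> V" for V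
    using X.germ_one[OF that] \<xi>(2) by (simp add: v_def)
  have v0: "v V (mzero (sections X V)) = \<zero>\<^bsub>K\<^esub>" if "V \<in> opens X" "x \<in> V" for V
    using mzero_germ_not_unit[OF X that] by (simp add: v_def)
  have sh: "is_sheaf mon0 mon0_hom X" using X by (simp add: mon_scheme_def)
  have "field_point K X x v \<in> space_homs mon0_hom ?S X"
  proof (rule K.field_point_in_space_homs[OF x cl X.mon_presheaf_axioms])
    fix V assume V: "V \<in> opens X"
    let ?W = "if x \<in> V then {{\<zero>\<^bsub>K\<^esub>}} else {}"
    have W: "?W \<in> opens ?S" unfolding K.opens_field by simp
    have mz: "mzero (sections ?S ?W) = K.const_section ?W \<zero>\<^bsub>K\<^esub>"
    proof (rule mzero_eq, unfold absorbing_def, intro conjI ballI)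
      show "K.const_section ?W \<zero>\<^bsub>K\<^esub> \<in> carrier (sections ?S ?W)" by (rule K.const_section_field_closed[OF W K.zero_closed])
      fix s assume "s \<in> carrier (sections ?S ?W)"
      then obtain c where c: "c \<in> carrier K" "s = K.const_section ?W c" by (rule K.section_const[OF W])
      show "K.const_section ?W \<zero>\<^bsub>K\<^esub> \<otimes>\<^bsub>sections ?S ?W\<^esub> s = K.const_section ?W \<zero>\<^bsub>K\<^esub>"
        "s \<otimes>\<^bsub>sections ?S ?W\<^esub> K.const_section ?W \<zero>\<^bsub>K\<^esub> = K.const_section ?W \<zero>\<^bsub>K\<^esub>"
        unfolding c(2) using c(1) by (simp_all only: K.const_section_field_mult[OF W] K.zero_closed K.l_null K.r_null)
    qed
    \<comment> \<open>If V misses x, its preimage is empty and all constants are the same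
      section.\<close>
    have em: "K.const_section ?W c = K.const_section ?W d" if "x \<notin> V" for c d
      using that by (simp add: K.frac_section_def restrict_def)
    interpret SV: comm_monoid "sections X V" by (rule X.sections_monoid[OF V])
    have zc: "mzero (sections X V) \<in> carrier (sections X V)"
      using absorbing_mzero[OF is_sheaf_obj[OF sh V]] by (simp add: absorbing_def)
    have "(\<lambda>t\<in>carrier (sections X V). K.const_section ?W (v V t)) \<in> hom (sections X V) (sections ?S ?W)"
    proof (rule homI)
      fix t assume "t \<in> carrier (sections X V)"
      then show "(\<lambda>t\<in>carrier (sections X V). K.const_section ?W (v V t)) t \<in> carrier (sections ?S ?W)"
        using K.const_section_field_closed[OF W cl] by simp
    next
      fix s t assume st: "s \<in> carrier (sections X V)" "t \<in> carrier (sections X V)"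
      have "K.const_section ?W (v V (s \<otimes>\<^bsub>sections X V\<^esub> t)) = K.const_section ?W (v V s \<otimes>\<^bsub>K\<^esub> v V t)"
        using em vm[OF V _ st] by (cases "x \<in> V") simp_all
      also have "\<dots> = K.const_section ?W (v V s) \<otimes>\<^bsub>sections ?S ?W\<^esub> K.const_section ?W (v V t)"
        by (rule K.const_section_field_mult[OF W cl cl, symmetric])
      finally show "(\<lambda>t\<in>carrier (sections X V). K.const_section ?W (v V t)) (s \<otimes>\<^bsub>sections X V\<^esub> t) =
        (\<lambda>t\<in>carrier (sections X V). K.const_section ?W (v V t)) s \<otimes>\<^bsub>sections ?S ?W\<^esub>
        (\<lambda>t\<in>carrier (sections X V). K.const_section ?W (v V t)) t"
        using st SV.m_closed[OF st] by (simp only: restrict_apply' if_True)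
    qed
    moreover have "K.const_section ?W (v V \<one>\<^bsub>sections X V\<^esub>) = \<one>\<^bsub>sections ?S ?W\<^esub>"
      unfolding K.sections_one_eq using em v1[OF V] by (cases "x \<in> V") simp_all
    moreover have "K.const_section ?W (v V (mzero (sections X V))) = mzero (sections ?S ?W)"
      unfolding mz using em v0[OF V] by (cases "x \<in> V") simp_all
    ultimately show "(\<lambda>t\<in>carrier (sections X V). K.const_section ?W (v V t)) \<in> mon0_hom (sections X V) (sections ?S ?W)"
      unfolding mon0_hom_def using SV.one_closed zc by (simp only: mem_Collect_eq restrict_apply' simp_thms)
  next
    fix V W t assume VW: "V \<in> opens X" "W \<in> opens X" "x \<in> W" "W \<subseteq> V" "t \<in> carrier (sections X V)"
    show "v W (res X V W t) = v V t" unfolding v_def X.germ_res[OF VW] ..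
  next
    fix V t assume "v V t \<noteq> \<zero>\<^bsub>K\<^esub>"
    then show "germ X x V t \<in> Units (stalk X x)" unfolding v_def by presburger
  qed
  then show ?thesis unfolding v_def[abs_def] .
qed

lemma ring_hom_const_section_iff:
  fixes K :: "'a ring"
  assumes K: "field K" and v: "\<And>t. t \<in> carrier M \<Longrightarrow> v t \<in> carrier K" and M: "ring M"
  shows "(\<lambda>t\<in>carrier M. prime_spec.frac_section K {{\<zero>\<^bsub>K\<^esub>}} (v t) \<one>\<^bsub>K\<^esub>) \<in> ring_hom M (sections (rspec K) {{\<zero>\<^bsub>K\<^esub>}})
     \<longleftrightarrow> v \<in> ring_hom M K" (is "?h \<in> _ \<longleftrightarrow> _")
proof -
  interpret K: field_spec K "rspec K" by (rule field_spec_rspec[OF K])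
  interpret R: ring_spec K by (rule ring_spec.intro[OF K.cring_axioms])
  interpret M: ring M by (rule M)
  let ?V = "{{\<zero>\<^bsub>K\<^esub>}}"
  have V: "?V \<in> opens (rspec K)" unfolding K.opens_field by simp
  have inj: "K.const_section ?V a = K.const_section ?V b \<longleftrightarrow> a = b" if "a \<in> carrier K" "b \<in> carrier K" for a b
    using K.const_section_inj[OF that] by auto
  have 1: "?h t \<in> carrier (sections (rspec K) ?V)" if "t \<in> carrier M" for t
    using K.const_section_field_closed[OF V v[OF that]] that by simp
  have 2: "?h (s \<otimes>\<^bsub>M\<^esub> t) = ?h s \<otimes>\<^bsub>sections (rspec K) ?V\<^esub> ?h t \<longleftrightarrow> v (s \<otimes>\<^bsub>M\<^esub> t) = v s \<otimes>\<^bsub>K\<^esub> v t"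
    if "s \<in> carrier M" "t \<in> carrier M" for s t
    using that v by (simp add: K.const_section_field_mult[OF V] inj)
  have 3: "?h (s \<oplus>\<^bsub>M\<^esub> t) = ?h s \<oplus>\<^bsub>sections (rspec K) ?V\<^esub> ?h t \<longleftrightarrow> v (s \<oplus>\<^bsub>M\<^esub> t) = v s \<oplus>\<^bsub>K\<^esub> v t"
    if "s \<in> carrier M" "t \<in> carrier M" for s t
    using that v by (simp add: R.const_section_add[OF V] inj)
  have 4: "?h \<one>\<^bsub>M\<^esub> = \<one>\<^bsub>sections (rspec K) ?V\<^esub> \<longleftrightarrow> v \<one>\<^bsub>M\<^esub> = \<one>\<^bsub>K\<^esub>"
    using v by (simp add: K.sections_one_eq inj)
  show ?thesis
    unfolding ring_hom_def mem_Collect_eq using 1 2 3 4 v by (simp add: Pi_iff del: restrict_apply)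
qed

lemma ring_field_point:
  fixes K :: "'a ring"
  assumes X: "scheme X" and x: "x \<in> points X" and K: "field K"
    and v: "\<And>V. V \<in> opens X \<Longrightarrow> x \<in> V \<Longrightarrow> v V \<in> ring_hom (sections X V) K"
    and compat: "\<And>V W t. V \<in> opens X \<Longrightarrow> W \<in> opens X \<Longrightarrow> x \<in> W \<Longrightarrow> W \<subseteq> V \<Longrightarrow> t \<in> carrier (sections X V) \<Longrightarrow>
        v W (res X V W t) = v V t"
    and loc: "\<And>V t. V \<in> opens X \<Longrightarrow> x \<in> V \<Longrightarrow> t \<in> carrier (sections X V) \<Longrightarrow> v V t \<noteq> \<zero>\<^bsub>K\<^esub> \<Longrightarrow>
        germ X x V t \<in> Units (stalk X x)"
  shows "field_point K X x v \<in> space_homs ring_hom (rspec K) X"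
proof -
  interpret K: field_spec K "rspec K" by (rule field_spec_rspec[OF K])
  have sh: "is_sheaf cring ring_hom X" using X by (simp add: scheme_def)
  have cl: "v V t \<in> carrier K" if "V \<in> opens X" "x \<in> V" "t \<in> carrier (sections X V)" for V t
    using ring_hom_closed[OF v[OF that(1,2)] that(3)] .
  show ?thesis
  proof (rule K.field_point_in_space_homs[OF x cl scheme_mon_presheaf[OF X] _ compat loc])
    fix V assume V: "V \<in> opens X"
    have R: "ring (sections X V)" using is_sheaf_obj[OF sh V] by (rule cring.axioms(1))
    show "(\<lambda>t\<in>carrier (sections X V). K.const_section (if x \<in> V then {{\<zero>\<^bsub>K\<^esub>}} else {}) (v V t)) \<in>
        ring_hom (sections X V) (sections (rspec K) (if x \<in> V then {{\<zero>\<^bsub>K\<^esub>}} else {}))"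
    proof (cases "x \<in> V")
      case True
      show ?thesis
        using ring_hom_const_section_iff[OF K cl[OF V True] R] v[OF V True] True by simp
    next
      case False
      interpret ring "sections X V" by (rule R)
      \<comment> \<open>Over the empty set the only section is the function that is undefined
        everywhere; it is at once the zero and the unit of the ring of sections.\<close>
      have e: "K.const_section {} c = (\<lambda>_. undefined)" for c by (simp add: K.frac_section_def restrict_def)
      have "K.const_section {} \<zero>\<^bsub>K\<^esub> \<in> carrier (sections (rspec K) {})"
        by (rule K.const_section_field_closed) (simp_all add: K.opens_field)
      then have c: "(\<lambda>_. undefined) \<in> carrier (sections (rspec K) {})" unfolding e .
      have ops: "s \<otimes>\<^bsub>sections (rspec K) {}\<^esub> t = (\<lambda>_. undefined)" "s \<oplus>\<^bsub>sections (rspec K) {}\<^esub> t = (\<lambda>_. undefined)"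
        "\<one>\<^bsub>sections (rspec K) {}\<^esub> = (\<lambda>_. undefined)" for s t
        by (simp_all add: rspec_def Let_def restrict_def)
      show ?thesis
        using False c by (simp add: ring_hom_def e ops Pi_iff)
    qed
  qed
qed

section \<open>Affine charts\<close>

locale affine_chart =
  fixes X :: "('q, 'u) ring_space" and U :: "'q set" and R :: "'u ring" and f \<phi>
  assumes X: "scheme X" and U: "U \<in> opens X" and R: "cring R"
    and chart: "(f, \<phi>) \<in> space_homs ring_hom (restrict_space_to X U) (rspec R)"
    and homeo: "homeomorphic_map (sp_top (restrict_space_to X U)) (sp_top (rspec R)) f"
    and chart_bij: "\<And>V. V \<in> opens (rspec R) \<Longrightarrow> bij_betw (\<phi> V) (carrier (sections (rspec R) V))
        (carrier (sections X (preim (restrict_space_to X U) f V)))"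

lemma ring_affine_chart:
  assumes "scheme X" "ring_affine X U R"
  obtains f \<phi> where "affine_chart X U R f \<phi>"
proof -
  obtain f \<phi> where f: "(f, \<phi>) \<in> space_homs ring_hom (restrict_space_to X U) (rspec R)"
    "homeomorphic_map (sp_top (restrict_space_to X U)) (sp_top (rspec R)) f"
    "\<forall>V\<in>opens (rspec R). bij_betw (\<phi> V) (carrier (sections (rspec R) V))
       (carrier (sections (restrict_space_to X U) (preim (restrict_space_to X U) f V)))"
    using assms unfolding isomorphic_spaces_def by blast
  have "affine_chart X U R f \<phi>"
    by (rule affine_chart.intro) (use assms f in \<open>simp_all add: restrict_space_to_def\<close>)
  then show ?thesis by (rule that)
qed

context affine_chart
begin

sublocale X: mon_presheaf X
  by (rule scheme_mon_presheaf[OF X])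

sublocale R: ring_spec R
  by (rule ring_spec.intro[OF R])

abbreviation chart_preim :: "'u set set \<Rightarrow> 'q set" where
  "chart_preim V \<equiv> preim (restrict_space_to X U) f V"

lemma X_sheaf: "is_sheaf cring ring_hom X"
  using X by (simp add: scheme_def)

lemma X_cring: "V \<in> opens X \<Longrightarrow> cring (sections X V)"
  by (rule is_sheaf_obj[OF X_sheaf])

lemma chart_preim_iff: "x \<in> chart_preim V \<longleftrightarrow> x \<in> U \<and> f x \<in> V"
  unfolding preim_def points_restrict[OF U] by simp

lemma chart_preim_open:
  assumes "V \<in> opens (rspec R)"
  shows "chart_preim V \<in> opens X" "chart_preim V \<subseteq> U"
proof -
  have "chart_preim V \<in> opens (restrict_space_to X U)"
    using space_homsD(2)[OF chart] assms by (simp add: preim_def continuous_map)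
  then show "chart_preim V \<in> opens X" "chart_preim V \<subseteq> U" unfolding opens_restrict_iff[OF U] by auto
qed

lemma chart_hom:
  assumes "V \<in> opens (rspec R)"
  shows "\<phi> V \<in> ring_hom (sections (rspec R) V) (sections X (chart_preim V))"
  using space_homsD(5)[OF chart assms] by (simp add: restrict_space_to_def)

lemma chart_res:
  assumes "V \<in> opens (rspec R)" "W \<in> opens (rspec R)" "W \<subseteq> V" "t \<in> carrier (sections (rspec R) V)"
  shows "\<phi> W (restrict t W) = res X (chart_preim V) (chart_preim W) (\<phi> V t)"
  using space_homsD(6)[OF chart assms] by (simp add: restrict_space_to_def R.res_eq)

lemma chart_bij_points: "bij_betw f U (points (rspec R))"
  using homeomorphic_imp_injective_map[OF homeo] homeomorphic_imp_surjective_map[OF homeo]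
  unfolding points_restrict[OF U] bij_betw_def by (rule conjI)

lemma chart_image_open:
  assumes "G \<in> opens X"
  shows "f ` (G \<inter> U) \<in> opens (rspec R)" "chart_preim (f ` (G \<inter> U)) = G \<inter> U"
proof -
  have "G \<inter> U \<in> opens (restrict_space_to X U)" unfolding opens_restrict_iff[OF U] using assms U by auto
  then show "f ` (G \<inter> U) \<in> opens (rspec R)"
    using homeomorphic_imp_open_map[OF homeo] by (simp add: open_map_def)
  have "inj_on f U" using chart_bij_points by (rule bij_betw_imp_inj_on)
  then have "x \<in> U \<and> f x \<in> f ` (G \<inter> U) \<longleftrightarrow> x \<in> G \<inter> U" for x
    using inj_on_image_mem_iff[of f U x "G \<inter> U"] by blast
  then show "chart_preim (f ` (G \<inter> U)) = G \<inter> U"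
    unfolding preim_def points_restrict[OF U] by (simp add: Int_def)
qed

text \<open>The constant sections r/1 are evaluated at the point to give \<rho>. Near the point
  every section is a fraction a/g, so its value is determined by \<rho>; thus all values lie in the
  field of quotients of the image of R.\<close>

lemma point_coordinate_hom:
  fixes K :: "'u ring"
  assumes K: "field K" and z: "z \<in> U"
    and w: "\<And>V. V \<in> opens X \<Longrightarrow> z \<in> V \<Longrightarrow> w V \<in> ring_hom (sections X V) K"
    and compat: "\<And>V W t. V \<in> opens X \<Longrightarrow> W \<in> opens X \<Longrightarrow> z \<in> W \<Longrightarrow> W \<subseteq> V \<Longrightarrow> t \<in> carrier (sections X V) \<Longrightarrow>
        w W (res X V W t) = w V t"
  obtains \<rho> where "\<rho> \<in> ring_hom R K"
    "\<forall>V t. V \<in> opens X \<and> z \<in> V \<and> t \<in> carrier (sections X V) \<longrightarrow>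
      (\<exists>a\<in>carrier R. \<exists>g\<in>carrier R. \<rho> g \<noteq> \<zero>\<^bsub>K\<^esub> \<and> w V t \<otimes>\<^bsub>K\<^esub> \<rho> g = \<rho> a)"
proof -
  interpret K: field K by fact
  let ?P = "points (rspec R)"
  have P: "?P \<in> opens (rspec R)" by simp
  define \<tau> where "\<tau> V s = w (chart_preim V) (\<phi> V s)" for V s
  have \<tau>: "\<tau> V \<in> ring_hom (sections (rspec R) V) K" if V: "V \<in> opens (rspec R)" "f z \<in> V" for V
  proof -
    have "z \<in> chart_preim V" using z V by (simp add: chart_preim_iff)
    then have "w (chart_preim V) \<in> ring_hom (sections X (chart_preim V)) K" by (rule w[OF chart_preim_open(1)[OF V(1)]])
    from ring_hom_trans[OF chart_hom[OF V(1)] this] show ?thesis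
      by (simp add: \<tau>_def[abs_def] comp_def)
  qed
  have fz: "f z \<in> ?P" using chart_bij_points z by (rule bij_betw_apply)
  define \<rho> where "\<rho> r = \<tau> ?P (R.frac_section ?P r \<one>\<^bsub>R\<^esub>)" for r
  have \<tau>res: "\<tau> W (restrict t W) = \<tau> V t"
    if V: "V \<in> opens (rspec R)" "W \<in> opens (rspec R)" "W \<subseteq> V" "f z \<in> W" "t \<in> carrier (sections (rspec R) V)" for V W t
  proof -
    have "\<phi> V t \<in> carrier (sections X (chart_preim V))" by (rule ring_hom_closed[OF chart_hom[OF V(1)] V(5)])
    moreover have "z \<in> chart_preim W" "chart_preim W \<subseteq> chart_preim V" using z V(3,4) by (auto simp: chart_preim_iff)
    ultimately show ?thesis
      unfolding \<tau>_def chart_res[OF V(1,2,3,5)]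
      by (intro compat chart_preim_open(1) V)
  qed
  have \<rho>V: "\<tau> V (R.frac_section V r \<one>\<^bsub>R\<^esub>) = \<rho> r" if V: "V \<in> opens (rspec R)" "f z \<in> V" "r \<in> carrier R" for V r
  proof -
    have VP: "V \<subseteq> ?P" using V(1) openin_subset by auto
    have "R.frac_section V r \<one>\<^bsub>R\<^esub> = restrict (R.frac_section ?P r \<one>\<^bsub>R\<^esub>) V"
      using VP by (simp add: R.frac_section_def Int_absorb1)
    then show ?thesis
      unfolding \<rho>_def using \<tau>res[OF P V(1) VP V(2) R.const_section_closed[OF P V(3)]] by simp
  qed
  note tP = \<tau>[OF P fz]
  have "\<rho> \<in> ring_hom R K"
  proof (rule ring_hom_memI)
    fix a assume a: "a \<in> carrier R"
    show "\<rho> a \<in> carrier K" unfolding \<rho>_def by (rule ring_hom_closed[OF tP R.const_section_closed[OF P a]])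
    fix b assume b: "b \<in> carrier R"
    show "\<rho> (a \<otimes>\<^bsub>R\<^esub> b) = \<rho> a \<otimes>\<^bsub>K\<^esub> \<rho> b"
      unfolding \<rho>_def R.const_section_mult[OF P a b, symmetric]
      by (rule ring_hom_mult[OF tP R.const_section_closed[OF P a] R.const_section_closed[OF P b]])
    show "\<rho> (a \<oplus>\<^bsub>R\<^esub> b) = \<rho> a \<oplus>\<^bsub>K\<^esub> \<rho> b"
      unfolding \<rho>_def R.const_section_add[OF P a b, symmetric]
      by (rule ring_hom_add[OF tP R.const_section_closed[OF P a] R.const_section_closed[OF P b]])
  next
    show "\<rho> \<one>\<^bsub>R\<^esub> = \<one>\<^bsub>K\<^esub>"
      unfolding \<rho>_def R.sections_one_eq[symmetric] by (rule ring_hom_one[OF tP])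
  qed
  moreover have "\<exists>a\<in>carrier R. \<exists>g\<in>carrier R. \<rho> g \<noteq> \<zero>\<^bsub>K\<^esub> \<and> w V t \<otimes>\<^bsub>K\<^esub> \<rho> g = \<rho> a"
    if V: "V \<in> opens X" "z \<in> V" "t \<in> carrier (sections X V)" for V t
  proof -
    \<comment> \<open>The section is cut down to the chart, carried over to the spectrum of R, and
      restricted to a neighbourhood where it is a single fraction.\<close>
    let ?V1 = "V \<inter> U" and ?V' = "f ` (V \<inter> U)"
    have V1: "?V1 \<in> opens X" "z \<in> ?V1" using V(1,2) U z by auto
    note V' = chart_image_open[OF V(1)]
    have fz': "f z \<in> ?V'" using V1(2) by (rule imageI)
    have rt: "res X V ?V1 t \<in> carrier (sections X ?V1)" using V V1 by (intro X.res_closed) auto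
    have "bij_betw (\<phi> ?V') (carrier (sections (rspec R) ?V')) (carrier (sections X ?V1))"
      using chart_bij[OF V'(1)] unfolding V'(2) .
    then have "res X V ?V1 t \<in> \<phi> ?V' ` carrier (sections (rspec R) ?V')"
      using rt unfolding bij_betw_def by simp
    then obtain t' where t': "t' \<in> carrier (sections (rspec R) ?V')" "\<phi> ?V' t' = res X V ?V1 t" by auto
    obtain W a g where W: "W \<in> opens (rspec R)" "f z \<in> W" "W \<subseteq> ?V'" "a \<in> carrier R" "g \<in> carrier R"
      and Wg: "\<forall>q\<in>W. g \<notin> q \<and> t' q = mk_frac R q a g"
      by (rule R.section_local[OF t'(1) fz'])
    have gW: "g \<notin> q" if "q \<in> W" for q using Wg that by blast
    have eq: "restrict t' W = R.frac_section W a g"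
      unfolding R.frac_section_def by (rule restrict_ext) (use Wg in blast)
    have cl: "R.frac_section W a g \<in> carrier (sections (rspec R) W)" "R.frac_section W \<one>\<^bsub>R\<^esub> g \<in> carrier (sections (rspec R) W)"
      using R.frac_section_closed[OF W(1) W(4,5) gW] R.frac_section_closed[OF W(1) R.one_closed W(5) gW] by blast+
    have gc: "R.frac_section W g \<one>\<^bsub>R\<^esub> \<in> carrier (sections (rspec R) W)" by (rule R.const_section_closed[OF W(1,5)])
    note tW = \<tau>[OF W(1,2)]
    have cancel: "R.frac_section W b g \<otimes>\<^bsub>sections (rspec R) W\<^esub> R.frac_section W g \<one>\<^bsub>R\<^esub> = R.frac_section W b \<one>\<^bsub>R\<^esub>"
      if "b \<in> carrier R" for b by (rule R.frac_section_cancel[OF W(1,5) _ that]) (rule gW)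
    have "\<tau> W (R.frac_section W a g) = \<tau> ?V' t'"
      unfolding eq[symmetric] by (rule \<tau>res[OF V'(1) W(1,3,2) t'(1)])
    also have "\<dots> = w V t"
      unfolding \<tau>_def V'(2) t'(2) by (rule compat[OF V(1) V1(1,2) _ V(3)]) simp
    finally have wt: "\<tau> W (R.frac_section W a g) = w V t" .
    have "w V t \<otimes>\<^bsub>K\<^esub> \<rho> g = \<tau> W (R.frac_section W a g \<otimes>\<^bsub>sections (rspec R) W\<^esub> R.frac_section W g \<one>\<^bsub>R\<^esub>)"
      unfolding wt[symmetric] \<rho>V[OF W(1,2,5), symmetric] by (rule ring_hom_mult[OF tW cl(1) gc, symmetric])
    also have "\<dots> = \<rho> a"
      unfolding cancel[OF W(4)] by (rule \<rho>V[OF W(1,2,4)])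
    finally have 1: "w V t \<otimes>\<^bsub>K\<^esub> \<rho> g = \<rho> a" .
    \<comment> \<open>The value of 1/g is inverse to \<open>\<rho> g\<close>, which therefore is not
      0.\<close>
    have "\<tau> W (R.frac_section W \<one>\<^bsub>R\<^esub> g) \<otimes>\<^bsub>K\<^esub> \<rho> g =
        \<tau> W (R.frac_section W \<one>\<^bsub>R\<^esub> g \<otimes>\<^bsub>sections (rspec R) W\<^esub> R.frac_section W g \<one>\<^bsub>R\<^esub>)"
      unfolding \<rho>V[OF W(1,2,5), symmetric] by (rule ring_hom_mult[OF tW cl(2) gc, symmetric])
    also have "\<dots> = \<tau> W \<one>\<^bsub>sections (rspec R) W\<^esub>"
      unfolding cancel[OF R.one_closed] R.sections_one_eq ..
    also have "\<dots> = \<one>\<^bsub>K\<^esub>" by (rule ring_hom_one[OF tW])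
    finally have "\<tau> W (R.frac_section W \<one>\<^bsub>R\<^esub> g) \<otimes>\<^bsub>K\<^esub> \<rho> g = \<one>\<^bsub>K\<^esub>" .
    moreover have "\<tau> W (R.frac_section W \<one>\<^bsub>R\<^esub> g) \<in> carrier K" by (rule ring_hom_closed[OF tW cl(2)])
    ultimately have "\<rho> g \<noteq> \<zero>\<^bsub>K\<^esub>" using K.one_not_zero K.r_null by metis
    with 1 W(4,5) show ?thesis by blast
  qed
  ultimately show ?thesis using that by blast
qed

lemma unit_multiple_closed: "cring M \<Longrightarrow> unit_multiple M n \<in> carrier M"
proof (induction n)
  case 0
  then show ?case by (simp add: cring.cring_simprules)
next
  case (Suc n)
  then show ?case by (simp add: cring.cring_simprules)
qed

text \<open>If every positive integer is invertible at x, then by locality of the structure morphism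
  it is invertible at the image of x, that is, outside that prime; the only such prime of the
  integers is 0.\<close>

lemma char_zero_point_image:
  assumes \<pi>: "(\<pi>, \<psi>) \<in> space_homs ring_hom X (rspec int_ring)" and x: "x \<in> U"
    and char: "\<And>n. unit_multiple R n \<notin> f x"
  shows "\<pi> x = {0}"
proof -
  let ?Z = "rspec int_ring"
  have Zcr: "cring int_ring" by (rule int_is_cring)
  interpret Z: ring_spec int_ring by (rule ring_spec.intro[OF Zcr])
  let ?P = "points ?Z"
  have P: "?P \<in> opens ?Z" by simp
  have pre: "preim X \<pi> ?P = points X" by (rule preim_points[OF space_homsD(2)[OF \<pi>]])
  have xX: "x \<in> points X" using openin_subset[of "sp_top X" U] U x by auto
  then have px: "\<pi> x \<in> ?P" using pre by (auto simp: preim_def)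
  then have prime: "\<pi> x \<in> {p. primeideal p int_ring}" unfolding Z.points_spec .
  have um: "unit_multiple int_ring n = int (Suc n)" for n by (induction n) simp_all
  have notin: "int (Suc n) \<notin> \<pi> x" for n
  proof -
    let ?c = "unit_multiple (sections ?Z ?P) n"
    have c: "?c = Z.frac_section ?P (unit_multiple int_ring n) \<one>\<^bsub>int_ring\<^esub>" "unit_multiple int_ring n \<in> carrier int_ring"
      using Z.unit_multiple_sections[OF P, of n] by simp_all
    have cc: "unit_multiple (sections ?Z ?P) k \<in> carrier (sections ?Z ?P)" for k
      using Z.unit_multiple_sections[OF P, of k] Z.const_section_closed[OF P, of "unit_multiple int_ring k"] by simp
    have one: "\<one>\<^bsub>sections ?Z ?P\<^esub> \<in> carrier (sections ?Z ?P)" using cc[of 0] by simp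
    have top: "points X \<in> opens X" by simp
    have \<psi>c: "\<psi> ?P ?c = unit_multiple (sections X (points X)) n"
      using ring_hom_unit_multiple[OF space_homsD(5)[OF \<pi> P] cc one, of n] unfolding pre .
    let ?g = "unit_multiple R n"
    have g: "?g \<in> carrier R" by (rule unit_multiple_closed[OF R])
    \<comment> \<open>The basic open set where n + 1 is invertible; it contains \<open>f x\<close>
      by assumption \<open>char\<close>.\<close>
    let ?V = "{p \<in> {p. primeideal p R}. ?g \<notin> p}"
    have V: "?V \<in> opens (rspec R)" using R.basic_open[OF g] by simp
    have gV: "\<And>q. q \<in> ?V \<Longrightarrow> ?g \<notin> q" by simp
    have "f x \<in> points (rspec R)" using chart_bij_points x by (rule bij_betw_apply)
    then have "f x \<in> ?V" using char unfolding R.points_spec by simp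
    then have xW: "x \<in> chart_preim ?V" using x by (simp add: chart_preim_iff)
    note W = chart_preim_open[OF V]
    have WX: "chart_preim ?V \<subseteq> points X" using openin_subset[of "sp_top X" "chart_preim ?V"] W(1) by simp
    have ucl: "unit_multiple (sections X G) k \<in> carrier (sections X G)" if "G \<in> opens X" for G k
      by (rule unit_multiple_closed[OF X_cring[OF that]])
    have Rcl: "unit_multiple (sections (rspec R) ?V) k \<in> carrier (sections (rspec R) ?V)" for k
      using R.unit_multiple_sections[OF V, of k] R.const_section_closed[OF V, of "unit_multiple R k"] by simp
    have "res X (points X) (chart_preim ?V) (unit_multiple (sections X (points X)) n) = unit_multiple (sections X (chart_preim ?V)) n"
      by (rule ring_hom_unit_multiple[OF is_sheaf_res[OF X_sheaf top W(1) WX] ucl[OF top] X.sections_one_closed[OF top]])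
    also have "\<dots> = \<phi> ?V (unit_multiple (sections (rspec R) ?V) n)"
      using ring_hom_unit_multiple[OF chart_hom[OF V] Rcl, of n] Rcl[of 0] by simp
    also have "\<dots> = \<phi> ?V (R.frac_section ?V ?g \<one>\<^bsub>R\<^esub>)" using R.unit_multiple_sections[OF V, of n] by simp
    finally have rs: "res X (points X) (chart_preim ?V) (unit_multiple (sections X (points X)) n) = \<phi> ?V (R.frac_section ?V ?g \<one>\<^bsub>R\<^esub>)" .
    have i: "R.frac_section ?V \<one>\<^bsub>R\<^esub> ?g \<in> carrier (sections (rspec R) ?V)"
      by (rule R.frac_section_closed[OF V R.one_closed g]) (rule gV)
    have gs: "R.frac_section ?V ?g \<one>\<^bsub>R\<^esub> \<in> carrier (sections (rspec R) ?V)" by (rule R.const_section_closed[OF V g])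
    have cancel: "R.frac_section ?V \<one>\<^bsub>R\<^esub> ?g \<otimes>\<^bsub>sections (rspec R) ?V\<^esub> R.frac_section ?V ?g \<one>\<^bsub>R\<^esub> = R.frac_section ?V \<one>\<^bsub>R\<^esub> \<one>\<^bsub>R\<^esub>"
      by (rule R.frac_section_cancel[OF V g _ R.one_closed]) (rule gV)
    interpret SV: comm_monoid "sections (rspec R) ?V" by (rule R.sections_comm_monoid[OF V])
    have "germ X x (points X) (unit_multiple (sections X (points X)) n) \<in> Units (stalk X x)"
    proof (rule X.germ_UnitsI[OF top ucl[OF top] W(1) xW WX])
      show "\<phi> ?V (R.frac_section ?V \<one>\<^bsub>R\<^esub> ?g) \<in> carrier (sections X (chart_preim ?V))"
        by (rule ring_hom_closed[OF chart_hom[OF V] i])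
      have "\<phi> ?V (R.frac_section ?V ?g \<one>\<^bsub>R\<^esub>) \<otimes>\<^bsub>sections X (chart_preim ?V)\<^esub> \<phi> ?V (R.frac_section ?V \<one>\<^bsub>R\<^esub> ?g) =
          \<phi> ?V (R.frac_section ?V \<one>\<^bsub>R\<^esub> ?g \<otimes>\<^bsub>sections (rspec R) ?V\<^esub> R.frac_section ?V ?g \<one>\<^bsub>R\<^esub>)"
        unfolding SV.m_comm[OF i gs] by (rule ring_hom_mult[OF chart_hom[OF V] gs i, symmetric])
      also have "\<dots> = \<phi> ?V \<one>\<^bsub>sections (rspec R) ?V\<^esub>"
        unfolding cancel R.sections_one_eq ..
      also have "\<dots> = \<one>\<^bsub>sections X (chart_preim ?V)\<^esub>" by (rule ring_hom_one[OF chart_hom[OF V]])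
      finally show "res X (points X) (chart_preim ?V) (unit_multiple (sections X (points X)) n) \<otimes>\<^bsub>sections X (chart_preim ?V)\<^esub>
          \<phi> ?V (R.frac_section ?V \<one>\<^bsub>R\<^esub> ?g) = \<one>\<^bsub>sections X (chart_preim ?V)\<^esub>"
        unfolding rs .
    qed
    then have "germ X x (preim X \<pi> ?P) (\<psi> ?P ?c) \<in> Units (stalk X x)" unfolding pre \<psi>c .
    moreover have "x \<in> preim X \<pi> ?P" unfolding pre by (rule xX)
    ultimately have "germ ?Z (\<pi> x) ?P ?c \<in> Units (stalk ?Z (\<pi> x))"
      using space_homsD(7)[OF \<pi> P _ cc] by blast
    then have "germ ?Z (\<pi> x) ?P (Z.frac_section ?P (unit_multiple int_ring n) \<one>\<^bsub>int_ring\<^esub>) \<in> Units (stalk ?Z (\<pi> x))"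
      by (simp only: c(1))
    then have "unit_multiple int_ring n \<notin> \<pi> x"
      by (intro Z.germ_const_unitD[OF P px]) simp_all
    then show ?thesis unfolding um .
  qed
  interpret p: primeideal "\<pi> x" int_ring using prime by simp
  have "k = 0" if k: "k \<in> \<pi> x" for k
  proof (rule ccontr)
    assume "k \<noteq> 0"
    have "k * sgn k \<in> \<pi> x" using p.I_r_closed[OF k, of "sgn k"] by simp
    then have "\<bar>k\<bar> \<in> \<pi> x" by (simp add: abs_sgn)
    moreover have "\<bar>k\<bar> = int (Suc (nat \<bar>k\<bar> - 1))" using \<open>k \<noteq> 0\<close> by simp
    ultimately show False using notin by metis
  qed
  moreover have "0 \<in> \<pi> x" using p.zero_closed by simp
  ultimately show ?thesis by (intro subset_antisym subsetI) auto
qed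

text \<open>The primes are turned into points of X, all of them over the zero ideal, and the
  closures of these points in the fibre are irreducible. A larger prime is a specialisation of a
  smaller one, so its closure is smaller.\<close>

lemma krull_dim_fibre_ge:
  assumes \<pi>: "(\<pi>, \<psi>) \<in> space_homs ring_hom X (rspec int_ring)"
    and Q: "\<And>i. i \<le> r \<Longrightarrow> primeideal (Q i) R" "\<And>i. i < r \<Longrightarrow> Q i \<subset> Q (Suc i)"
    and char: "\<And>i n. i \<le> r \<Longrightarrow> unit_multiple R n \<notin> Q i"
  shows "ereal (real r) \<le> rel_dim X (rspec int_ring) (\<pi>, \<psi>)"
proof -
  define w where "w i = inv_into U f (Q i)" for i
  have w: "w i \<in> U" "f (w i) = Q i" if "i \<le> r" for i
  proof -
    have "Q i \<in> f ` U" using chart_bij_points Q(1)[OF that] unfolding bij_betw_def R.points_spec by simp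
    then show "w i \<in> U" "f (w i) = Q i" unfolding w_def by (rule inv_into_into, rule f_inv_into_f)
  qed
  have pw: "\<pi> (w i) = {0}" if "i \<le> r" for i
    by (rule char_zero_point_image[OF \<pi> w(1)[OF that]]) (use char[OF that] w(2)[OF that] in simp)
  let ?T = "subtopology (sp_top X) (preim X \<pi> {{0}})"
  have UX: "U \<subseteq> points X" using openin_subset[of "sp_top X" U] U by simp
  have wT: "w i \<in> topspace ?T" if "i \<le> r" for i
    using w(1)[OF that] pw[OF that] UX by (auto simp: preim_def topspace_subtopology)
  \<comment> \<open>The index is reversed because closures decrease as primes grow.\<close>
  define Y where "Y i = ?T closure_of {w (r - i)}" for i
  have irr: "irreducible_closed ?T (?T closure_of {x})" if "x \<in> topspace ?T" for x
    unfolding irreducible_closed_def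
  proof (intro conjI allI impI)
    have self: "x \<in> ?T closure_of {x}" using closure_of_subset[of "{x}" ?T] that by blast
    show "closedin ?T (?T closure_of {x})" by (rule closedin_closure_of)
    show "?T closure_of {x} \<noteq> {}" using self by blast
    fix A B assume AB: "closedin ?T A \<and> closedin ?T B \<and> ?T closure_of {x} = A \<union> B"
    then have "x \<in> A \<or> x \<in> B" using self by blast
    then have "?T closure_of {x} \<subseteq> A \<or> ?T closure_of {x} \<subseteq> B"
      using AB closure_of_minimal[of "{x}"] by blast
    then show "?T closure_of {x} = A \<or> ?T closure_of {x} = B" using AB by blast
  qed
  have step: "?T closure_of {w (Suc k)} \<subset> ?T closure_of {w k}" if k: "Suc k \<le> r" for k
  proof -
    have k': "k \<le> r" "k < r" using k by auto
    \<comment> \<open>An open set of the spectrum that contains a prime contains every smaller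
      prime.\<close>
    have "w (Suc k) \<in> ?T closure_of {w k}"
      unfolding in_closure_of
    proof (intro conjI allI impI)
      show "w (Suc k) \<in> topspace ?T" by (rule wT[OF k])
      fix G' assume G': "w (Suc k) \<in> G' \<and> openin ?T G'"
      then obtain G where G: "openin (sp_top X) G" "G' = G \<inter> preim X \<pi> {{0}}" by (auto simp: openin_subtopology)
      have GX: "G \<in> opens X" using G by simp
      have "w (Suc k) \<in> G \<inter> U" using G' G w(1)[OF k] by blast
      then have "Q (Suc k) \<in> f ` (G \<inter> U)" using w(2)[OF k] by (metis imageI)
      moreover obtain E where E: "f ` (G \<inter> U) = {p. primeideal p R} - {p \<in> {p. primeideal p R}. E \<subseteq> p}"
        using chart_image_open(1)[OF GX] unfolding mem_Collect_eq R.openin_spec by blast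
      ultimately have "\<not> E \<subseteq> Q (Suc k)" by simp
      then have "\<not> E \<subseteq> Q k" using Q(2)[OF k'(2)] by blast
      then have "Q k \<in> f ` (G \<inter> U)" unfolding E using Q(1)[OF k'(1)] by simp
      then have "w k \<in> chart_preim (f ` (G \<inter> U))" using w[OF k'(1)] by (simp add: chart_preim_iff)
      then have "w k \<in> G" unfolding chart_image_open(2)[OF GX] by simp
      then show "\<exists>y. y \<in> {w k} \<and> y \<in> G'" using G(2) wT[OF k'(1)] by (simp add: topspace_subtopology)
    qed
    then have "?T closure_of {w (Suc k)} \<subseteq> ?T closure_of {w k}"
      by (intro closure_of_minimal closedin_closure_of) simp
    \<comment> \<open>An element of the larger prime outside the smaller one gives a basic open set
      that separates the two points.\<close>
    moreover have "w k \<notin> ?T closure_of {w (Suc k)}"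
    proof
      assume cl: "w k \<in> ?T closure_of {w (Suc k)}"
      obtain g where g: "g \<in> Q (Suc k)" "g \<notin> Q k" using Q(2)[OF k'(2)] by blast
      have gR: "g \<in> carrier R" using g(1) R.prime_sub[of "Q (Suc k)"] Q(1)[OF k] by blast
      let ?V = "{p \<in> {p. primeideal p R}. g \<notin> p}"
      have V: "?V \<in> opens (rspec R)" using R.basic_open[OF gR] by simp
      have "openin ?T (chart_preim ?V \<inter> preim X \<pi> {{0}})"
        using chart_preim_open(1)[OF V] by (auto simp: openin_subtopology)
      moreover have "w k \<in> chart_preim ?V \<inter> preim X \<pi> {{0}}"
        using w[OF k'(1)] g(2) Q(1)[OF k'(1)] wT[OF k'(1)] by (simp add: chart_preim_iff topspace_subtopology)
      ultimately have "w (Suc k) \<in> chart_preim ?V"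
        using cl unfolding in_closure_of by blast
      then show False using w(2)[OF k] g(1) by (simp add: chart_preim_iff)
    qed
    moreover have "w k \<in> ?T closure_of {w k}" using closure_of_subset[of "{w k}" ?T] wT[OF k'(1)] by blast
    ultimately show ?thesis by blast
  qed
  have "Y i \<subset> Y (Suc i)" if "i < r" for i
  proof -
    have "r - i = Suc (r - Suc i)" using that by simp
    then show ?thesis using step[of "r - Suc i"] that by (simp add: Y_def)
  qed
  moreover have "irreducible_closed ?T (Y i)" if "i \<le> r" for i
    unfolding Y_def by (intro irr wT) simp
  ultimately have "ereal (real r) \<le> krull_dim ?T"
    unfolding krull_dim_def by (intro Sup_upper) blast
  also have "\<dots> \<le> rel_dim X (rspec int_ring) (\<pi>, \<psi>)"
  proof -
    have "{0} \<in> points (rspec int_ring)"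
    proof -
      have "w 0 \<in> preim X \<pi> (points (rspec int_ring))"
        unfolding preim_points[OF space_homsD(2)[OF \<pi>]] using UX w(1)[of 0] by (simp add: subset_iff)
      then show ?thesis using pw[of 0] by (simp add: preim_def)
    qed
    then show ?thesis unfolding rel_dim_def by (intro SUP_upper2[of "{0}"]) simp_all
  qed
  finally show ?thesis .
qed

end

section \<open>Chains of prime ideals\<close>

text \<open>Connects rings given by a carrier with the fields of the type class, in which
  polynomials and specialisations live.\<close>

definition hom_to_field :: "('a, 'e) ring_scheme \<Rightarrow> ('a \<Rightarrow> 'k::field) \<Rightarrow> bool" where
  "hom_to_field R h \<longleftrightarrow> h \<one>\<^bsub>R\<^esub> = 1 \<and> (\<forall>a\<in>carrier R. \<forall>b\<in>carrier R.
     h (a \<oplus>\<^bsub>R\<^esub> b) = h a + h b \<and> h (a \<otimes>\<^bsub>R\<^esub> b) = h a * h b)"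

lemma hom_to_fieldD:
  assumes "hom_to_field R h" "cring R"
  shows "h \<one>\<^bsub>R\<^esub> = 1" "h \<zero>\<^bsub>R\<^esub> = 0"
    "a \<in> carrier R \<Longrightarrow> b \<in> carrier R \<Longrightarrow> h (a \<oplus>\<^bsub>R\<^esub> b) = h a + h b"
    "a \<in> carrier R \<Longrightarrow> b \<in> carrier R \<Longrightarrow> h (a \<otimes>\<^bsub>R\<^esub> b) = h a * h b"
    "a \<in> carrier R \<Longrightarrow> h (\<ominus>\<^bsub>R\<^esub> a) = - h a"
proof -
  interpret cring R by fact
  show 1: "h \<one>\<^bsub>R\<^esub> = 1" using assms by (simp add: hom_to_field_def)
  show add: "h (a \<oplus>\<^bsub>R\<^esub> b) = h a + h b" if "a \<in> carrier R" "b \<in> carrier R" for a b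
    using assms that by (simp add: hom_to_field_def)
  show "h (a \<otimes>\<^bsub>R\<^esub> b) = h a * h b" if "a \<in> carrier R" "b \<in> carrier R" for a b
    using assms that by (simp add: hom_to_field_def)
  show 0: "h \<zero>\<^bsub>R\<^esub> = 0"
    using add[OF zero_closed zero_closed, unfolded l_zero[OF zero_closed]] by (simp only: add_cancel_right_right)
  show "h (\<ominus>\<^bsub>R\<^esub> a) = - h a" if "a \<in> carrier R"
    using add[of "\<ominus>\<^bsub>R\<^esub> a" a] that 0 by (simp add: l_neg add_eq_0_iff2)
qed

lemma primeideal_kernel:
  fixes h :: "'a \<Rightarrow> 'k::field"
  assumes h: "hom_to_field R h" and R: "cring R"
  shows "primeideal {a \<in> carrier R. h a = 0} R"
proof -
  interpret cring R by fact
  note D = hom_to_fieldD[OF h R]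
  have "ideal {a \<in> carrier R. h a = 0} R"
  proof (rule idealI)
    show "ring R" by (rule ring_axioms)
    show "subgroup {a \<in> carrier R. h a = 0} (add_monoid R)"
    proof (rule subgroup.intro)
      show "inv\<^bsub>add_monoid R\<^esub> a \<in> {a \<in> carrier R. h a = 0}" if "a \<in> {a \<in> carrier R. h a = 0}" for a
        using that D(5)[of a] by (simp flip: a_inv_def)
    qed (auto simp: D)
  qed (auto simp: D)
  then show ?thesis
  proof (rule primeidealI)
    show "cring R" by fact
    show "carrier R \<noteq> {a \<in> carrier R. h a = 0}"
    proof
      assume "carrier R = {a \<in> carrier R. h a = 0}"
      then have "\<one>\<^bsub>R\<^esub> \<in> {a \<in> carrier R. h a = 0}" using one_closed by simp
      then show False using D(1) by simp
    qed
    show "a \<in> {a \<in> carrier R. h a = 0} \<or> b \<in> {a \<in> carrier R. h a = 0}"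
      if "a \<in> carrier R" "b \<in> carrier R" "a \<otimes>\<^bsub>R\<^esub> b \<in> {a \<in> carrier R. h a = 0}" for a b
      using that D(4)[of a b] by simp
  qed
qed

lemma hom_to_field_unit_multiple:
  fixes h :: "'a \<Rightarrow> 'k::field"
  assumes "hom_to_field R h" "cring R"
  shows "h (unit_multiple R n) = of_nat (Suc n) \<and> unit_multiple R n \<in> carrier R"
proof -
  interpret cring R by fact
  show ?thesis by (induction n) (auto simp: hom_to_fieldD[OF assms])
qed

text \<open>The t i are only quotients of elements of \<sigma>(R), so the chain of kernels is built
  in the ring obtained by inverting a common denominator d, and is then pulled back to R. It remains
  strict because d stays a unit: multiplying by powers of d moves witnesses into \<sigma>(R) without
  changing whether they are killed.\<close>

lemma chain_of_primes:
  fixes \<sigma> :: "'a \<Rightarrow> 'k::{alg_closed_field, field_char_0}" and t :: "nat \<Rightarrow> 'k"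
  assumes R: "cring R" "ring_fin_gen R" and \<sigma>: "hom_to_field R \<sigma>"
    and indep: "\<And>i. i < r \<Longrightarrow> transcendental_over (ring_gen (t ` {..<i})) (t i)"
    and quot: "\<And>i. i < r \<Longrightarrow> \<exists>a\<in>carrier R. \<exists>g\<in>carrier R. \<sigma> g \<noteq> 0 \<and> t i = \<sigma> a / \<sigma> g"
  obtains Q where "\<And>i. i \<le> r \<Longrightarrow> primeideal (Q i) R" "\<And>i. i < r \<Longrightarrow> Q i \<subset> Q (Suc i)"
    "\<And>i n. i \<le> r \<Longrightarrow> unit_multiple R n \<notin> Q i"
proof -
  interpret cring R by (rule R)
  note D = hom_to_fieldD[OF \<sigma> R(1)]
  let ?A = "\<sigma> ` carrier R"
  have A: "subring_set ?A"
    unfolding subring_set_def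
  proof (intro conjI ballI)
    show "1 \<in> ?A" using D(1) one_closed by (metis imageI)
    fix x y assume "x \<in> ?A" "y \<in> ?A"
    then obtain a b where ab: "a \<in> carrier R" "b \<in> carrier R" "x = \<sigma> a" "y = \<sigma> b" by auto
    have "x - y = \<sigma> (a \<oplus>\<^bsub>R\<^esub> \<ominus>\<^bsub>R\<^esub> b)" using ab D by simp
    then show "x - y \<in> ?A" using ab by simp
    have "x * y = \<sigma> (a \<otimes>\<^bsub>R\<^esub> b)" using ab D by simp
    then show "x * y \<in> ?A" using ab by simp
  qed
  obtain H where H: "finite H" "H \<subseteq> carrier R" "generate_ring R H = carrier R"
    using R(2) by (auto simp: ring_fin_gen_def)
  obtain a g where ag: "\<And>i. i < r \<Longrightarrow> a i \<in> carrier R" "\<And>i. i < r \<Longrightarrow> g i \<in> carrier R"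
    "\<And>i. i < r \<Longrightarrow> \<sigma> (g i) \<noteq> 0" "\<And>i. i < r \<Longrightarrow> t i = \<sigma> (a i) / \<sigma> (g i)"
    using quot by metis
  \<comment> \<open>One common denominator suffices, so a single additional generator, its inverse,
    keeps the ring finitely generated.\<close>
  define d where "d = (\<Prod>i<r. \<sigma> (g i))"
  have d0: "d \<noteq> 0" using ag(3) by (simp add: d_def)
  have Aprod: "(\<Prod>i\<in>I. \<sigma> (g i)) \<in> ?A" if "I \<subseteq> {..<r}" for I
  proof -
    have "finite I" using that by (rule finite_subset) simp
    then show ?thesis using that
      by (induction rule: finite_induct) (auto intro!: subring_setD(4)[OF A] subring_setD(1)[OF A] simp: ag(2))
  qed
  define B where "B = insert (inverse d) (\<sigma> ` H)"
  note G = subring_set_ring_gen[of B]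
  have BG: "B \<subseteq> ring_gen B" by (rule ring_gen_superset)
  have AG: "\<sigma> x \<in> ring_gen B" if "x \<in> carrier R" for x
  proof -
    have "x \<in> generate_ring R H" using that H(3) by simp
    then show ?thesis
    proof (induction rule: generate_ring.induct)
      case one
      then show ?case using D(1) subring_setD(1)[OF G] by simp
    next
      case (incl h)
      then show ?case using BG by (auto simp: B_def)
    next
      case (a_inv h)
      then have "h \<in> carrier R" using H(3) by simp
      then show ?case using a_inv.IH D(5) subring_setD(5)[OF G] by simp
    next
      case (eng_add h1 h2)
      then have "h1 \<in> carrier R" "h2 \<in> carrier R" using H(3) by simp_all
      then show ?case using eng_add.IH D(3) subring_setD(6)[OF G] by simp
    next
      case (eng_mult h1 h2)
      then have "h1 \<in> carrier R" "h2 \<in> carrier R" using H(3) by simp_all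
      then show ?case using eng_mult.IH D(4) subring_setD(4)[OF G] by simp
    qed
  qed
  have "t ` {..<r} \<subseteq> ring_gen B"
  proof clarify
    fix i assume i: "i < r"
    have "d = \<sigma> (g i) * (\<Prod>j\<in>{..<r} - {i}. \<sigma> (g j))"
      unfolding d_def using i by (subst prod.remove[of _ i]) auto
    then have "t i = \<sigma> (a i) * (\<Prod>j\<in>{..<r} - {i}. \<sigma> (g j)) * inverse d"
      using ag(3,4)[OF i] d0 by (simp add: field_simps)
    moreover have "(\<Prod>j\<in>{..<r} - {i}. \<sigma> (g j)) \<in> ring_gen B" using Aprod[of "{..<r} - {i}"] AG by auto
    moreover have "inverse d \<in> ring_gen B" using BG by (auto simp: B_def)
    ultimately show "t i \<in> ring_gen B" using AG[OF ag(1)[OF i]] subring_setD(4)[OF G] by simp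
  qed
  moreover have "finite B" using H(1) by (simp add: B_def)
  ultimately obtain \<psi> :: "nat \<Rightarrow> 'k \<Rightarrow> 'k" where \<psi>: "\<forall>i\<le>r. hom_on (ring_gen B) (\<psi> i)"
    "\<forall>i<r. (\<forall>a\<in>ring_gen B. \<psi> i a = 0 \<longrightarrow> \<psi> (Suc i) a = 0) \<and>
           (\<exists>a\<in>ring_gen B. \<psi> i a \<noteq> 0 \<and> \<psi> (Suc i) a = 0)"
    using hom_chain[of r t B] indep by blast
  \<comment> \<open>The elements that some power of d carries into \<open>?A\<close> form a subring,
    and this subring contains the generators.\<close>
  have clear: "\<exists>k. y * d ^ k \<in> ?A" if "y \<in> ring_gen B" for y
  proof -
    have dA: "d ^ k \<in> ?A" for k using subring_set_power[OF A Aprod[of "{..<r}"]] by (simp add: d_def)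
    have "subring_set {y. \<exists>k. y * d ^ k \<in> ?A}"
      unfolding subring_set_def
    proof (intro conjI ballI)
      show "1 \<in> {y. \<exists>k. y * d ^ k \<in> ?A}" using dA by auto
      fix x y assume "x \<in> {y. \<exists>k. y * d ^ k \<in> ?A}" "y \<in> {y. \<exists>k. y * d ^ k \<in> ?A}"
      then obtain k l where kl: "x * d ^ k \<in> ?A" "y * d ^ l \<in> ?A" by auto
      have "(x - y) * d ^ (k + l) = (x * d ^ k) * d ^ l - (y * d ^ l) * d ^ k"
        by (simp add: algebra_simps power_add)
      moreover have "(x * d ^ k) * d ^ l - (y * d ^ l) * d ^ k \<in> ?A"
        by (intro subring_setD(3)[OF A] subring_setD(4)[OF A kl(1) dA] subring_setD(4)[OF A kl(2) dA])
      ultimately have "(x - y) * d ^ (k + l) \<in> ?A" by (simp only:)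
      then show "x - y \<in> {y. \<exists>k. y * d ^ k \<in> ?A}" by blast
      have "x * y * d ^ (k + l) = (x * d ^ k) * (y * d ^ l)" by (simp add: power_add)
      moreover have "(x * d ^ k) * (y * d ^ l) \<in> ?A" by (rule subring_setD(4)[OF A kl])
      ultimately have "x * y * d ^ (k + l) \<in> ?A" by (simp only:)
      then show "x * y \<in> {y. \<exists>k. y * d ^ k \<in> ?A}" by blast
    qed
    moreover have "B \<subseteq> {y. \<exists>k. y * d ^ k \<in> ?A}"
    proof
      fix b assume "b \<in> B"
      then consider "b = inverse d" | "b \<in> \<sigma> ` H" by (auto simp: B_def)
      then show "b \<in> {y. \<exists>k. y * d ^ k \<in> ?A}"
      proof cases
        case 1
        then have "b * d ^ 1 = 1" using d0 by simp
        then have "b * d ^ 1 \<in> ?A" using subring_setD(1)[OF A] by (simp only:)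
        then show ?thesis by blast
      next
        case 2
        then have "b * d ^ 0 \<in> ?A" using H(2) by auto
        then show ?thesis by blast
      qed
    qed
    ultimately have "ring_gen B \<subseteq> {y. \<exists>k. y * d ^ k \<in> ?A}" by (rule ring_gen_least)
    then show ?thesis using that by blast
  qed
  define Q where "Q i = {x \<in> carrier R. \<psi> i (\<sigma> x) = 0}" for i
  have hom: "hom_to_field R (\<lambda>x. \<psi> i (\<sigma> x))" if "i \<le> r" for i
  proof -
    have h: "hom_on (ring_gen B) (\<psi> i)" using \<psi>(1) that by blast
    show ?thesis using hom_onD[OF h G] AG D by (auto simp: hom_to_field_def)
  qed
  show ?thesis
  proof (rule that[of Q])
    show "primeideal (Q i) R" if "i \<le> r" for i
      unfolding Q_def by (rule primeideal_kernel[OF hom[OF that] R(1)])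
    show "unit_multiple R n \<notin> Q i" if "i \<le> r" for i n
      using hom_to_field_unit_multiple[OF hom[OF that] R(1), of n] by (simp add: Q_def del: of_nat_Suc)
    show "Q i \<subset> Q (Suc i)" if i: "i < r" for i
    proof -
      have sub: "Q i \<subseteq> Q (Suc i)" using \<psi>(2) i AG by (auto simp: Q_def)
      obtain y where y: "y \<in> ring_gen B" "\<psi> i y \<noteq> 0" "\<psi> (Suc i) y = 0" using \<psi>(2) i by blast
      obtain k where "y * d ^ k \<in> ?A" using clear[OF y(1)] by blast
      then obtain x where x: "x \<in> carrier R" "\<sigma> x = y * d ^ k" by (metis imageE)
      have dG: "d \<in> ring_gen B" "inverse d \<in> ring_gen B"
        using Aprod[of "{..<r}"] AG BG by (auto simp: d_def B_def)
      have hi: "hom_on (ring_gen B) (\<psi> i)" "hom_on (ring_gen B) (\<psi> (Suc i))" using \<psi>(1) i by auto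
      \<comment> \<open>A homomorphism sends the unit d to a unit, so a witness y that is not killed
        by \<open>\<psi> i\<close> gives an element of R that is not killed either.\<close>
      have "\<psi> i d * \<psi> i (inverse d) = 1"
        using hom_onD(4)[OF hi(1) G dG] hom_onD(1)[OF hi(1) G] d0 by simp
      then have "\<psi> i d \<noteq> 0" by auto
      have dk: "d ^ k \<in> ring_gen B" by (rule subring_set_power[OF G dG(1)])
      have "\<psi> i (\<sigma> x) = \<psi> i y * \<psi> i d ^ k"
        using x(2) hom_onD(4)[OF hi(1) G y(1) dk] hom_on_power[OF hi(1) G dG(1)] by simp
      then have "x \<notin> Q i" using y(2) \<open>\<psi> i d \<noteq> 0\<close> by (simp add: Q_def)
      moreover have "\<psi> (Suc i) (\<sigma> x) = 0"
        using x(2) hom_onD(4)[OF hi(2) G y(1) dk] y(3) by simp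
      then have "x \<in> Q (Suc i)" using x(1) by (simp add: Q_def)
      ultimately show ?thesis using sub by blast
    qed
  qed
qed

section \<open>Fields inside the universe\<close>

text \<open>The operations are transported from \<open>M\<close>, so that they are the same for all subfields \<open>L\<close> of \<open>M\<close>.\<close>

definition transport_field :: "('k::field \<Rightarrow> 'a) \<Rightarrow> 'k set \<Rightarrow> 'k set \<Rightarrow> 'a ring" where
  "transport_field e M L =
     \<lparr>carrier = e ` L, mult = (\<lambda>x y. e (inv_into M e x * inv_into M e y)), one = e 1, zero = e 0,
      add = (\<lambda>x y. e (inv_into M e x + inv_into M e y))\<rparr>"

lemma transport_field_simps:
  "carrier (transport_field e M L) = e ` L" "\<one>\<^bsub>transport_field e M L\<^esub> = e 1" "\<zero>\<^bsub>transport_field e M L\<^esub> = e 0"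
  "mult (transport_field e M L) = (\<lambda>x y. e (inv_into M e x * inv_into M e y))"
  "add (transport_field e M L) = (\<lambda>x y. e (inv_into M e x + inv_into M e y))"
  by (simp_all add: transport_field_def)

lemma transport_field_ops:
  assumes "inj_on e M" "x \<in> M" "y \<in> M"
  shows "e x \<otimes>\<^bsub>transport_field e M L\<^esub> e y = e (x * y)" "e x \<oplus>\<^bsub>transport_field e M L\<^esub> e y = e (x + y)"
  using assms by (simp_all add: transport_field_simps)

lemma field_transport_field:
  assumes e: "inj_on e M" and L: "subfield_set L" "L \<subseteq> M"
  shows "field (transport_field e M L)"
proof -
  let ?K = "transport_field e M L"
  note S = subring_setD[OF L(1)[unfolded subfield_set_def, THEN conjunct1]]
  have M: "x \<in> M" if "x \<in> L" for x using L(2) that by blast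
  note ops = transport_field_ops[OF e M M, of _ _ L]
  have cr: "cring ?K"
  proof (rule cringI)
    show "abelian_group ?K"
    proof (rule abelian_groupI)
      fix x assume "x \<in> carrier ?K"
      then obtain a where a: "a \<in> L" "x = e a" by (auto simp: transport_field_simps)
      show "\<zero>\<^bsub>?K\<^esub> \<oplus>\<^bsub>?K\<^esub> x = x" using a S ops(2)[of 0 a] by (simp add: transport_field_simps(3))
      show "\<exists>y\<in>carrier ?K. y \<oplus>\<^bsub>?K\<^esub> x = \<zero>\<^bsub>?K\<^esub>"
        using a S(5)[OF a(1)] ops(2)[of "- a" a] by (auto simp: transport_field_simps(1,3))
      fix y assume "y \<in> carrier ?K"
      then obtain b where b: "b \<in> L" "y = e b" by (auto simp: transport_field_simps)
      show "x \<oplus>\<^bsub>?K\<^esub> y \<in> carrier ?K" using a b S(6) by (simp add: ops transport_field_simps(1))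
      show "x \<oplus>\<^bsub>?K\<^esub> y = y \<oplus>\<^bsub>?K\<^esub> x" using a b by (simp add: ops add.commute)
      fix z assume "z \<in> carrier ?K"
      then obtain c where c: "c \<in> L" "z = e c" by (auto simp: transport_field_simps)
      show "x \<oplus>\<^bsub>?K\<^esub> y \<oplus>\<^bsub>?K\<^esub> z = x \<oplus>\<^bsub>?K\<^esub> (y \<oplus>\<^bsub>?K\<^esub> z)"
        using a b c S(6) by (simp add: ops add.assoc)
    qed (use S(2) in \<open>simp add: transport_field_simps\<close>)
    show "comm_monoid ?K"
    proof (rule comm_monoidI)
      fix x assume "x \<in> carrier ?K"
      then obtain a where a: "a \<in> L" "x = e a" by (auto simp: transport_field_simps)
      show "\<one>\<^bsub>?K\<^esub> \<otimes>\<^bsub>?K\<^esub> x = x" using a S ops(1)[of 1 a] by (simp add: transport_field_simps(2))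
      fix y assume "y \<in> carrier ?K"
      then obtain b where b: "b \<in> L" "y = e b" by (auto simp: transport_field_simps)
      show "x \<otimes>\<^bsub>?K\<^esub> y \<in> carrier ?K" using a b S(4) by (simp add: ops transport_field_simps(1))
      show "x \<otimes>\<^bsub>?K\<^esub> y = y \<otimes>\<^bsub>?K\<^esub> x" using a b by (simp add: ops mult.commute)
      fix z assume "z \<in> carrier ?K"
      then obtain c where c: "c \<in> L" "z = e c" by (auto simp: transport_field_simps)
      show "x \<otimes>\<^bsub>?K\<^esub> y \<otimes>\<^bsub>?K\<^esub> z = x \<otimes>\<^bsub>?K\<^esub> (y \<otimes>\<^bsub>?K\<^esub> z)"
        using a b c S(4) by (simp add: ops mult.assoc)
    qed (use S(1) in \<open>simp add: transport_field_simps\<close>)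
    fix x y z assume "x \<in> carrier ?K" "y \<in> carrier ?K" "z \<in> carrier ?K"
    then obtain a b c where abc: "a \<in> L" "x = e a" "b \<in> L" "y = e b" "c \<in> L" "z = e c"
      by (auto simp: transport_field_simps)
    show "(x \<oplus>\<^bsub>?K\<^esub> y) \<otimes>\<^bsub>?K\<^esub> z = x \<otimes>\<^bsub>?K\<^esub> z \<oplus>\<^bsub>?K\<^esub> y \<otimes>\<^bsub>?K\<^esub> z"
      using abc S(4,6) by (simp add: ops distrib_right)
  qed
  interpret cring ?K by (rule cr)
  show ?thesis
  proof (rule cring_fieldI)
    have z1: "e 0 \<noteq> e 1" using e M[OF S(1)] M[OF S(2)] by (auto dest: inj_onD)
    have "x \<in> Units ?K \<longleftrightarrow> x \<in> carrier ?K - {\<zero>\<^bsub>?K\<^esub>}" for x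
    proof
      assume x: "x \<in> Units ?K"
      have "x \<noteq> \<zero>\<^bsub>?K\<^esub>"
      proof
        assume "x = \<zero>\<^bsub>?K\<^esub>"
        then have "x \<otimes>\<^bsub>?K\<^esub> y = \<zero>\<^bsub>?K\<^esub>" if "y \<in> carrier ?K" for y using l_null[OF that] by (simp only:)
        then have "\<zero>\<^bsub>?K\<^esub> = \<one>\<^bsub>?K\<^esub>" using Units_r_inv[OF x] Units_inv_closed[OF x] by metis
        then show False using z1 by (simp add: transport_field_simps)
      qed
      then show "x \<in> carrier ?K - {\<zero>\<^bsub>?K\<^esub>}" using Units_closed[OF x] by simp
    next
      assume x: "x \<in> carrier ?K - {\<zero>\<^bsub>?K\<^esub>}"
      then obtain a where a: "a \<in> L" "x = e a" "a \<noteq> 0" by (auto simp: transport_field_simps)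
      have ia: "inverse a \<in> L" using L(1) a(1) by (simp add: subfield_set_def)
      have "e (inverse a) \<otimes>\<^bsub>?K\<^esub> x = \<one>\<^bsub>?K\<^esub>" "x \<otimes>\<^bsub>?K\<^esub> e (inverse a) = \<one>\<^bsub>?K\<^esub>"
        using a ia by (simp_all add: ops transport_field_simps(2))
      moreover have "e (inverse a) \<in> carrier ?K" using ia by (simp add: transport_field_simps)
      ultimately show "x \<in> Units ?K" using x unfolding Units_def by blast
    qed
    then show "Units ?K = carrier ?K - {\<zero>\<^bsub>?K\<^esub>}" by (intro subset_antisym subsetI) simp_all
  qed
qed

section \<open>The relative dimension\<close>

lemma subfield_set_quotients:
  fixes \<sigma> :: "'a \<Rightarrow> 'k::field"
  assumes \<sigma>: "hom_to_field R \<sigma>" and R: "cring R"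
  shows "subfield_set {\<sigma> a / \<sigma> g | a g. a \<in> carrier R \<and> g \<in> carrier R \<and> \<sigma> g \<noteq> 0}" (is "subfield_set ?L")
proof -
  interpret cring R by fact
  note D = hom_to_fieldD[OF \<sigma> R]
  have I: "\<sigma> a / \<sigma> g \<in> ?L" if "a \<in> carrier R" "g \<in> carrier R" "\<sigma> g \<noteq> 0" for a g using that by blast
  have "1 \<in> ?L" using I[of "\<one>\<^bsub>R\<^esub>" "\<one>\<^bsub>R\<^esub>"] D(1) by simp
  moreover have "x - y \<in> ?L \<and> x * y \<in> ?L" if xy: "x \<in> ?L" "y \<in> ?L" for x y
  proof -
    obtain a g where a: "a \<in> carrier R" "g \<in> carrier R" "\<sigma> g \<noteq> 0" "x = \<sigma> a / \<sigma> g" using xy(1) by blast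
    obtain b h where b: "b \<in> carrier R" "h \<in> carrier R" "\<sigma> h \<noteq> 0" "y = \<sigma> b / \<sigma> h" using xy(2) by blast
    have "x - y = \<sigma> (a \<otimes>\<^bsub>R\<^esub> h \<oplus>\<^bsub>R\<^esub> \<ominus>\<^bsub>R\<^esub> (b \<otimes>\<^bsub>R\<^esub> g)) / \<sigma> (g \<otimes>\<^bsub>R\<^esub> h)"
      unfolding a(4) b(4) using a(1-3) b(1-3) by (simp add: D field_simps)
    moreover have "x * y = \<sigma> (a \<otimes>\<^bsub>R\<^esub> b) / \<sigma> (g \<otimes>\<^bsub>R\<^esub> h)" using a b by (simp add: D)
    moreover have "\<sigma> (g \<otimes>\<^bsub>R\<^esub> h) \<noteq> 0" using a b by (simp add: D)
    ultimately show ?thesis using I[of _ "g \<otimes>\<^bsub>R\<^esub> h"] a b by simp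
  qed
  moreover have "inverse x \<in> ?L" if x: "x \<in> ?L" for x
  proof -
    obtain a g where a: "a \<in> carrier R" "g \<in> carrier R" "\<sigma> g \<noteq> 0" "x = \<sigma> a / \<sigma> g" using x by blast
    show ?thesis
    proof (cases "\<sigma> a = 0")
      case True
      then have "inverse x = x" using a by simp
      then show ?thesis using x by simp
    next
      case False
      then show ?thesis using I[of g a] a by simp
    qed
  qed
  ultimately show ?thesis unfolding subfield_set_def subring_set_def by blast
qed

text \<open>The kinds of arrows in the square that compares K' and K, as monoids and as rings; the
  diagonal of the square is the third one.\<close>

lemma mr_hom_inclusions:
  fixes K K' :: "'u ring"
  assumes K: "cring K" and K': "cring K'"
    and sub: "carrier K' \<subseteq> carrier K" "mult K' = mult K" "one K' = one K" "zero K' = zero K" "add K' = add K"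
  shows "(\<lambda>u\<in>carrier K'. u) \<in> mr_hom (Rng K') (Rng K)"
    "(\<lambda>u\<in>carrier K'. u) \<in> mr_hom (Mon (mult_monoid K')) (Mon (mult_monoid K))"
    "(\<lambda>u\<in>carrier K'. u) \<in> mr_hom (Mon (mult_monoid K')) (Rng K)"
proof -
  interpret K': cring K' by fact
  have z: "mzero (mult_monoid K') = \<zero>\<^bsub>K'\<^esub>" "mzero (mult_monoid K) = \<zero>\<^bsub>K\<^esub>"
    using mzero_eq[OF absorbing_mult_monoid[OF K']] mzero_eq[OF absorbing_mult_monoid[OF K]] by simp_all
  have z': "mzero K = \<zero>\<^bsub>K\<^esub>"
    using absorbing_mult_monoid[OF K] by (intro mzero_eq) (simp add: absorbing_def)
  have cl: "u \<in> carrier K" if "u \<in> carrier K'" for u using sub(1) that by blast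
  have m: "x \<otimes>\<^bsub>K\<^esub> y \<in> carrier K'" "x \<oplus>\<^bsub>K\<^esub> y \<in> carrier K'" if "x \<in> carrier K'" "y \<in> carrier K'" for x y
    using K'.m_closed[OF that] K'.a_closed[OF that] unfolding sub .
  have o: "\<one>\<^bsub>K\<^esub> \<in> carrier K'" "\<zero>\<^bsub>K\<^esub> \<in> carrier K'" using K'.one_closed K'.zero_closed unfolding sub .
  show "(\<lambda>u\<in>carrier K'. u) \<in> mr_hom (Rng K') (Rng K)"
    by (simp add: ring_hom_def sub cl m o Pi_iff)
  show "(\<lambda>u\<in>carrier K'. u) \<in> mr_hom (Mon (mult_monoid K')) (Mon (mult_monoid K))"
    by (simp add: mon0_hom_def hom_def z sub cl m o Pi_iff)
  show "(\<lambda>u\<in>carrier K'. u) \<in> mr_hom (Mon (mult_monoid K')) (Rng K)"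
    by (simp add: mon0_hom_def hom_def z z' sub cl m o Pi_iff)
qed

text \<open>If a point of \<open>XM\<close> with values in \<open>K\<close> gives a point of \<open>XZ\<close> whose values lie in a subfield \<open>K'\<close>,
  then its own values lie in \<open>K'\<close>: compare the bijections for \<open>K\<close> and \<open>K'\<close>.\<close>

lemma F1_scheme_descent:
  fixes F :: "('u, 'v) mr_functor" and XM :: "('p, 'u) mon_space" and XZ :: "('q, 'u) ring_space" and K :: "'u ring"
  assumes F: "F1_scheme F XM XZ" and K: "field K" and pt: "field_point K XM x v \<in> space_homs mon0_hom (mspec (mult_monoid K)) XM"
    and v: "\<And>V t. V \<in> opens XM \<Longrightarrow> x \<in> V \<Longrightarrow> t \<in> carrier (sections XM V) \<Longrightarrow> v V t \<in> carrier K"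
  obtains z w where "z \<in> points XZ"
    "\<And>V. V \<in> opens XZ \<Longrightarrow> z \<in> V \<Longrightarrow> w V \<in> ring_hom (sections XZ V) K"
    "\<And>V W t. V \<in> opens XZ \<Longrightarrow> W \<in> opens XZ \<Longrightarrow> z \<in> W \<Longrightarrow> W \<subseteq> V \<Longrightarrow> t \<in> carrier (sections XZ V) \<Longrightarrow>
        w W (res XZ V W t) = w V t"
    "\<And>(K' :: 'u ring) V t. field K' \<Longrightarrow> carrier K' \<subseteq> carrier K \<Longrightarrow> mult K' = mult K \<Longrightarrow> one K' = one K \<Longrightarrow>
        zero K' = zero K \<Longrightarrow> add K' = add K \<Longrightarrow>
        (\<And>V t. V \<in> opens XZ \<Longrightarrow> z \<in> V \<Longrightarrow> t \<in> carrier (sections XZ V) \<Longrightarrow> w V t \<in> carrier K') \<Longrightarrow>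
        V \<in> opens XM \<Longrightarrow> x \<in> V \<Longrightarrow> t \<in> carrier (sections XM V) \<Longrightarrow> v V t \<in> carrier K'"
proof -
  have fct: "is_functor F" and XM: "mon_scheme XM" and mr: "mon_realisation F XM" and XZ: "scheme XZ"
    and rr: "ring_realisation F XZ"
    and bij: "\<And>K. field K \<Longrightarrow> bij_betw (fmap F (Mon (mult_monoid K)) (Rng K) (\<lambda>u\<in>carrier K. u))
          (fobj F (Mon (mult_monoid K))) (fobj F (Rng K))"
    using F by (simp_all add: F1_scheme_def)
  obtain \<eta> where \<eta>: "\<And>M. mon0 M \<Longrightarrow> bij_betw (\<eta> M) (fobj F (Mon M)) (space_homs mon0_hom (mspec M) XM)"
    and \<eta>nat: "\<And>M N f a. mon0 M \<Longrightarrow> mon0 N \<Longrightarrow> f \<in> mr_hom (Mon M) (Mon N) \<Longrightarrow> a \<in> fobj F (Mon M) \<Longrightarrow>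
        \<eta> N (fmap F (Mon M) (Mon N) f a) =
          comp_morphism (mspec N) (mspec M) XM (\<eta> M a) (spec_map (mspec M) (mspec N) M N f)"
  proof -
    from mr obtain \<eta> where e: "(\<forall>M. mon0 M \<longrightarrow> bij_betw (\<eta> M) (fobj F (Mon M)) (space_homs mon0_hom (mspec M) XM)) \<and>
     (\<forall>M N. mon0 M \<and> mon0 N \<longrightarrow> (\<forall>f\<in>mr_hom (Mon M) (Mon N). \<forall>a\<in>fobj F (Mon M).
        \<eta> N (fmap F (Mon M) (Mon N) f a) =
          comp_morphism (mspec N) (mspec M) XM (\<eta> M a) (spec_map (mspec M) (mspec N) M N f)))"
      unfolding mon_realisation_def by (rule exE)
    show thesis
    proof (rule that[of \<eta>])
      show "bij_betw (\<eta> M) (fobj F (Mon M)) (space_homs mon0_hom (mspec M) XM)" if "mon0 M" for M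
        using e[THEN conjunct1, rule_format, OF that] .
      show "\<eta> N (fmap F (Mon M) (Mon N) f a) =
          comp_morphism (mspec N) (mspec M) XM (\<eta> M a) (spec_map (mspec M) (mspec N) M N f)"
        if "mon0 M" "mon0 N" "f \<in> mr_hom (Mon M) (Mon N)" "a \<in> fobj F (Mon M)" for M N f a
        using e[THEN conjunct2, THEN spec, THEN spec, THEN mp, OF conjI[OF that(1,2)], THEN bspec, OF that(3), THEN bspec, OF that(4)] .
    qed
  qed
  obtain \<theta> where \<theta>: "\<And>R. cring R \<Longrightarrow> bij_betw (\<theta> R) (fobj F (Rng R)) (space_homs ring_hom (rspec R) XZ)"
    and \<theta>nat: "\<And>R S f a. cring R \<Longrightarrow> cring S \<Longrightarrow> f \<in> mr_hom (Rng R) (Rng S) \<Longrightarrow> a \<in> fobj F (Rng R) \<Longrightarrow>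
        \<theta> S (fmap F (Rng R) (Rng S) f a) =
          comp_morphism (rspec S) (rspec R) XZ (\<theta> R a) (spec_map (rspec R) (rspec S) R S f)"
  proof -
    from rr obtain \<theta> where e: "(\<forall>R. cring R \<longrightarrow> bij_betw (\<theta> R) (fobj F (Rng R)) (space_homs ring_hom (rspec R) XZ)) \<and>
     (\<forall>R S. cring R \<and> cring S \<longrightarrow> (\<forall>f\<in>mr_hom (Rng R) (Rng S). \<forall>a\<in>fobj F (Rng R).
        \<theta> S (fmap F (Rng R) (Rng S) f a) =
          comp_morphism (rspec S) (rspec R) XZ (\<theta> R a) (spec_map (rspec R) (rspec S) R S f)))"
      unfolding ring_realisation_def by (rule exE)
    show thesis
    proof (rule that[of \<theta>])
      show "bij_betw (\<theta> R) (fobj F (Rng R)) (space_homs ring_hom (rspec R) XZ)" if "cring R" for R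
        using e[THEN conjunct1, rule_format, OF that] .
      show "\<theta> S (fmap F (Rng R) (Rng S) f a) =
          comp_morphism (rspec S) (rspec R) XZ (\<theta> R a) (spec_map (rspec R) (rspec S) R S f)"
        if "cring R" "cring S" "f \<in> mr_hom (Rng R) (Rng S)" "a \<in> fobj F (Rng R)" for R S f a
        using e[THEN conjunct2, THEN spec, THEN spec, THEN mp, OF conjI[OF that(1,2)], THEN bspec, OF that(3), THEN bspec, OF that(4)] .
    qed
  qed
  have fcl: "fmap F A B f a \<in> fobj F B" if "mr_obj A" "mr_obj B" "f \<in> mr_hom A B" "a \<in> fobj F A" for A B f a
    using fct[unfolded is_functor_def, THEN conjunct1, THEN spec, THEN spec, THEN mp, OF conjI[OF that(1,2)], THEN bspec, OF that(3)] that(4)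
    by (rule funcset_mem)
  have fcomp: "fmap F A C (compose (mr_carrier A) g f) a = fmap F B C g (fmap F A B f a)"
    if "mr_obj A" "mr_obj B" "mr_obj C" "f \<in> mr_hom A B" "g \<in> mr_hom B C" "a \<in> fobj F A" for A B C f g a
    using fct[unfolded is_functor_def, THEN conjunct2, THEN conjunct2, THEN spec, THEN spec, THEN spec, THEN mp,
        OF conjI[OF that(1) conjI[OF that(2,3)]], THEN bspec, OF that(4), THEN bspec, OF that(5), THEN bspec, OF that(6)] .
  let ?m = mult_monoid
  have Kcr: "cring K" by (rule domain.axioms(1)[OF field.axioms(1)[OF K]])
  interpret KM: field_spec K "mspec (?m K)" by (rule field_spec_mspec[OF K])
  interpret KR: field_spec K "rspec K" by (rule field_spec_rspec[OF K])
  have mK: "mon0 (?m K)" by (rule mon0_mult_monoid[OF Kcr])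
  have hom_carrier: "h \<in> carrier M \<rightarrow> carrier N" if "h \<in> mon0_hom M N" for h :: "'u \<Rightarrow> 'b" and M :: "'u monoid" and N :: "'b monoid"
    using that by (simp add: mon0_hom_def hom_def)
  have rhom_carrier: "h \<in> carrier M \<rightarrow> carrier N" if "h \<in> ring_hom M N" for h :: "'u \<Rightarrow> 'b" and M :: "'u ring" and N :: "'b ring"
    using that by (simp add: ring_hom_def)
  obtain a where a: "a \<in> fobj F (Mon (?m K))" "\<eta> (?m K) a = field_point K XM x v"
    using pt bij_betw_imp_surj_on[OF \<eta>[OF mK]] by (metis imageE)
  define b where "b = fmap F (Mon (?m K)) (Rng K) (\<lambda>u\<in>carrier K. u) a"
  have b: "b \<in> fobj F (Rng K)" unfolding b_def using bij[OF K] a(1) by (rule bij_betw_apply)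
  have \<theta>b: "\<theta> K b \<in> space_homs ring_hom (rspec K) XZ" using \<theta>[OF Kcr] b by (rule bij_betw_apply)
  obtain z w where zw: "\<theta> K b = field_point K XZ z w" "z \<in> points XZ"
    and wcl: "\<And>V t. V \<in> opens XZ \<Longrightarrow> z \<in> V \<Longrightarrow> t \<in> carrier (sections XZ V) \<Longrightarrow> w V t \<in> carrier K"
    and wc: "\<And>V W t. V \<in> opens XZ \<Longrightarrow> W \<in> opens XZ \<Longrightarrow> z \<in> W \<Longrightarrow> W \<subseteq> V \<Longrightarrow> t \<in> carrier (sections XZ V) \<Longrightarrow>
        w W (res XZ V W t) = w V t"
    and wl: "\<And>V t. V \<in> opens XZ \<Longrightarrow> z \<in> V \<Longrightarrow> t \<in> carrier (sections XZ V) \<Longrightarrow> w V t \<noteq> \<zero>\<^bsub>K\<^esub> \<Longrightarrow>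
        germ XZ z V t \<in> Units (stalk XZ z)"
    and wH: "\<And>V. V \<in> opens XZ \<Longrightarrow> z \<in> V \<Longrightarrow> (\<lambda>t\<in>carrier (sections XZ V). KR.const_section {{\<zero>\<^bsub>K\<^esub>}} (w V t)) \<in>
        ring_hom (sections XZ V) (sections (rspec K) {{\<zero>\<^bsub>K\<^esub>}})"
  proof (rule KR.field_point_cases[OF \<theta>b scheme_mon_presheaf[OF XZ]], goal_cases)
    case (1 M N h)
    show ?case by (rule rhom_carrier[OF 1(2)])
  next
    case (2 z w)
    show ?case by (rule 2(1)[OF 2(2-)])
  qed
  have sh: "is_sheaf cring ring_hom XZ" using XZ by (simp add: scheme_def)
  have wr: "w V \<in> ring_hom (sections XZ V) K" if V: "V \<in> opens XZ" "z \<in> V" for V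
    using ring_hom_const_section_iff[OF K wcl[OF V] cring.axioms(1)[OF is_sheaf_obj[OF sh V(1)]]] wH[OF V] by simp
  have descent: "v V t \<in> carrier K'"
    if K': "field K'" and s1: "carrier K' \<subseteq> carrier K" and s2: "mult K' = mult K" and s3: "one K' = one K"
      and s4: "zero K' = zero K" and s5: "add K' = add K"
      and w': "\<And>V t. V \<in> opens XZ \<Longrightarrow> z \<in> V \<Longrightarrow> t \<in> carrier (sections XZ V) \<Longrightarrow> w V t \<in> carrier K'"
      and V: "V \<in> opens XM" "x \<in> V" "t \<in> carrier (sections XM V)" for K' :: "'u ring" and V t
  proof -
    have K'cr: "cring K'" by (rule domain.axioms(1)[OF field.axioms(1)[OF K']])
    interpret K'M: field_spec K' "mspec (?m K')" by (rule field_spec_mspec[OF K'])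
    interpret K'R: field_spec K' "rspec K'" by (rule field_spec_rspec[OF K'])
    have mK': "mon0 (?m K')" by (rule mon0_mult_monoid[OF K'cr])
    let ?i = "\<lambda>u\<in>carrier K'. u"
    note inc = mr_hom_inclusions[OF Kcr K'cr s1 s2 s3 s4 s5]
    note idK' = mr_hom_inclusions(3)[OF K'cr K'cr subset_refl refl refl refl refl]
    note idK = mr_hom_inclusions(3)[OF Kcr Kcr subset_refl refl refl refl refl]
    have wr': "w V \<in> ring_hom (sections XZ V) K'" if V: "V \<in> opens XZ" "z \<in> V" for V
      using wr[OF V] w'[OF V] by (simp add: ring_hom_def Pi_iff s2 s3 s5)
    \<comment> \<open>The evaluations w take values in K', so the same data define a point over K',
      whose image over K is b.\<close>
    have "field_point K' XZ z w \<in> space_homs ring_hom (rspec K') XZ"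
      by (rule ring_field_point[OF XZ zw(2) K' wr' wc wl]) (simp_all add: s4)
    then obtain b' where b': "b' \<in> fobj F (Rng K')" "\<theta> K' b' = field_point K' XZ z w"
      using bij_betw_imp_surj_on[OF \<theta>[OF K'cr]] by (metis imageE)
    have "\<theta> K (fmap F (Rng K') (Rng K) ?i b') =
        comp_morphism (rspec K) (rspec K') XZ (field_point K' XZ z w) (spec_map (rspec K') (rspec K) K' K ?i)"
      using \<theta>nat[OF K'cr Kcr inc(1) b'(1)] unfolding b'(2) .
    also have "\<dots> = field_point K XZ z w"
      by (rule field_point_subfield[OF KR.field_spec_axioms K'R.field_spec_axioms s1 s2 s3 s4 refl refl w'])
    finally have "\<theta> K (fmap F (Rng K') (Rng K) ?i b') = \<theta> K b" unfolding zw(1) .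
    moreover have "fmap F (Rng K') (Rng K) ?i b' \<in> fobj F (Rng K)"
      using K'cr Kcr by (intro fcl inc b') simp_all
    ultimately have bb: "fmap F (Rng K') (Rng K) ?i b' = b"
      using bij_betw_imp_inj_on[OF \<theta>[OF Kcr]] b by (simp add: inj_on_def)
    \<comment> \<open>Bijectivity over K' lifts this point to the monoid side.\<close>
    obtain a' where a': "a' \<in> fobj F (Mon (?m K'))" "fmap F (Mon (?m K')) (Rng K') ?i a' = b'"
      using bij_betw_imp_surj_on[OF bij[OF K']] b'(1) by (metis imageE)
    let ?a = "fmap F (Mon (?m K')) (Mon (?m K)) ?i a'"
    have aa: "?a \<in> fobj F (Mon (?m K))" using mK mK' by (intro fcl inc a') simp_all
    \<comment> \<open>Both ways around the square, from K' as a monoid to K as a ring, are the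
      inclusion; so the image of a' over K and the original a have the same image b.\<close>
    have c1: "compose (carrier K') (\<lambda>u\<in>carrier K. u) ?i = ?i"
      using s1 by (intro extensionalityI[of _ "carrier K'"]) (auto simp: compose_def)
    have c2: "compose (carrier K') ?i ?i = ?i"
      by (intro extensionalityI[of _ "carrier K'"]) (auto simp: compose_def)
    have "fmap F (Mon (?m K)) (Rng K) (\<lambda>u\<in>carrier K. u) ?a = fmap F (Mon (?m K')) (Rng K) ?i a'"
      using fcomp[of "Mon (?m K')" "Mon (?m K)" "Rng K", OF _ _ _ inc(2) idK a'(1)] mK mK' Kcr c1 by simp
    also have "\<dots> = fmap F (Rng K') (Rng K) ?i b'"
      using fcomp[of "Mon (?m K')" "Rng K'" "Rng K", OF _ _ _ idK' inc(1) a'(1)] mK' K'cr Kcr c2 a'(2) by simp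
    finally have "fmap F (Mon (?m K)) (Rng K) (\<lambda>u\<in>carrier K. u) ?a = fmap F (Mon (?m K)) (Rng K) (\<lambda>u\<in>carrier K. u) a"
      unfolding bb b_def .
    \<comment> \<open>Injectivity over K shows that the original point comes from K', and comparing
      the data of the two points gives the claim about v.\<close>
    then have eqa: "?a = a"
      using bij_betw_imp_inj_on[OF bij[OF K]] aa a(1) by (simp add: inj_on_def)
    have \<eta>a': "\<eta> (?m K') a' \<in> space_homs mon0_hom (mspec (?m K')) XM" using \<eta>[OF mK'] a'(1) by (rule bij_betw_apply)
    obtain x' v' where xv': "\<eta> (?m K') a' = field_point K' XM x' v'"
      and v': "\<And>V t. V \<in> opens XM \<Longrightarrow> x' \<in> V \<Longrightarrow> t \<in> carrier (sections XM V) \<Longrightarrow> v' V t \<in> carrier K'"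
    proof (rule K'M.field_point_cases[OF \<eta>a' mon_scheme_mon_presheaf[OF XM]], goal_cases)
      case (1 M N h)
      show ?case by (rule hom_carrier[OF 1(2)])
    next
      case (2 x' v')
      show ?case by (rule 2(1)[OF 2(2,4)])
    qed
    have "\<eta> (?m K) ?a = comp_morphism (mspec (?m K)) (mspec (?m K')) XM (field_point K' XM x' v')
        (spec_map (mspec (?m K')) (mspec (?m K)) (?m K') (?m K) ?i)"
      using \<eta>nat[OF mK' mK inc(2) a'(1)] unfolding xv' .
    also have "\<dots> = field_point K XM x' v'"
      by (rule field_point_subfield[OF KM.field_spec_axioms K'M.field_spec_axioms s1 s2 s3 s4 _ _ v']) simp_all
    finally have eq: "field_point K XM x v = field_point K XM x' v'" unfolding eqa a(2) .
    have v'K: "v' V t \<in> carrier K" if "V \<in> opens XM" "x' \<in> V" "t \<in> carrier (sections XM V)" for V t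
      using v'[OF that] s1 by blast
    note inj = KM.field_point_inj[OF eq v v'K]
    have xx: "x = x'" by (rule inj(1))
    have "v V t = v' V t" by (rule inj(2)[OF _ _ _ _ _ _ V])
    then show ?thesis using v'[OF V(1) _ V(3)] V(2) xx by simp
  qed
  show ?thesis by (rule that[OF zw(2) wr wc descent])
qed

lemma transcendental_over_nonzero:
  assumes "transcendental_over D (t :: 'a::comm_ring_1)" "subring_set D"
  shows "t \<noteq> 0"
proof
  assume "t = 0"
  then have "poly [:0, 1:] t = 0" by simp
  moreover have "[:0, 1:] \<in> poly_over D" using assms(2) by (intro poly_over_closed subring_setD)
  ultimately have "[:0, 1 :: 'a:] = 0" using assms(1) unfolding transcendental_over_def by blast
  then show False by simp
qed

lemma exists_inj_on_countable:
  assumes "infinite (UNIV :: 'u set)" "countable A"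
  obtains e :: "'a \<Rightarrow> 'u" where "inj_on e A"
proof -
  obtain g :: "nat \<Rightarrow> 'u" where g: "inj g" using infinite_countable_subset[OF assms(1)] by blast
  have "inj_on (\<lambda>a. g (to_nat_on A a)) A"
    using inj_on_to_nat_on[OF assms(2)] g by (auto simp: inj_on_def)
  then show ?thesis by (rule that)
qed

text \<open>Stated for a single independent family instead of the rank, so that finiteness of the
  rank is not presupposed.\<close>

lemma rel_dim_ge_independent:
  fixes F :: "('u, 'v) mr_functor" and XM :: "('p, 'u) mon_space" and XZ :: "('q, 'u) ring_space"
  assumes inf: "infinite (UNIV :: 'u set)" and F: "F1_scheme F XM XZ" and ft: "finite_type_over_int XZ"
    and \<pi>: "\<pi> \<in> space_homs ring_hom XZ (rspec int_ring)"
    and x: "x \<in> points XM" and S: "int_independent (units_of (stalk XM x)) S"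
  shows "ereal (real (card S)) \<le> rel_dim XZ (rspec int_ring) \<pi>"
proof -
  have XM: "mon_scheme XM" and XZ: "scheme XZ" using F by (simp_all add: F1_scheme_def)
  interpret XM: mon_presheaf XM by (rule mon_scheme_mon_presheaf[OF XM])
  obtain t :: "nat \<Rightarrow> complex" where t: "\<And>i. transcendental_over (ring_gen (t ` {..<i})) (t i)"
    using exists_algebraically_independent by blast
  have t0: "t i \<noteq> 0" for i by (rule transcendental_over_nonzero[OF t subring_set_ring_gen])
  obtain L where L: "subfield_set L" "countable L" "range t \<subseteq> L"
    and Ldiv: "\<forall>z n. z \<in> L \<longrightarrow> z \<noteq> 0 \<longrightarrow> n > 0 \<longrightarrow> (\<exists>w\<in>L. w \<noteq> 0 \<and> w ^ n = z)"
  proof (rule exists_countable_divisible_subfield[of t], goal_cases)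
    case 1
    show ?case by (rule t0)
  next
    case (2 L)
    show ?case by (rule 2(1)[of L]) (use 2(2-) in \<open>simp_all\<close>)
  qed
  \<comment> \<open>An injection suffices to realise L in the universe, as the field operations are
    transported along it.\<close>
  obtain e :: "complex \<Rightarrow> 'u" where e: "inj_on e L" using exists_inj_on_countable[OF inf L(2)] by blast
  interpret G: comm_group "units_of (stalk XM x)"
    by (rule comm_monoid.units_comm_group[OF XM.stalk_comm_monoid[OF x]])
  have fin: "finite S" using S by (simp add: int_independent_def)
  \<comment> \<open>An enumeration of S, so that its members can be matched with the independent
    numbers.\<close>
  obtain h where h: "bij_betw h S {0..<card S}" using ex_bij_betw_finite_nat[OF fin] by blast
  have tS: "t (h g) \<in> L \<and> t (h g) \<noteq> 0" if "g \<in> S" for g using L(3) t0 by auto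
  have Ldiv': "\<exists>w\<in>L. w \<noteq> 0 \<and> w ^ n = z" if "z \<in> L" "z \<noteq> 0" "n > 0" for z n using Ldiv that by blast
  obtain \<xi> where \<xi>: "\<And>g. g \<in> Units (stalk XM x) \<Longrightarrow> \<xi> g \<in> L \<and> \<xi> g \<noteq> 0" "\<xi> \<one>\<^bsub>stalk XM x\<^esub> = 1"
    "\<And>g k. g \<in> Units (stalk XM x) \<Longrightarrow> k \<in> Units (stalk XM x) \<Longrightarrow> \<xi> (g \<otimes>\<^bsub>stalk XM x\<^esub> k) = \<xi> g * \<xi> k"
    "\<And>g. g \<in> S \<Longrightarrow> \<xi> g = t (h g)"
  proof (rule G.character_extension[OF L(1) _ S, of "\<lambda>g. t (h g)"], goal_cases)
    case 1
    show ?case by (rule Ldiv'[OF 1(2-)])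
  next
    case 2
    show ?case by (rule tS[OF 2(2)])
  next
    case (3 \<xi>)
    show ?case by (rule 3(1)[OF 3(2-)[unfolded units_of_carrier units_of_mult units_of_one]])
  qed
  let ?K = "\<lambda>L'. transport_field e L L'"
  have K: "field (?K L)" by (rule field_transport_field[OF e L(1) subset_refl])
  have eL: "e a = e b \<longleftrightarrow> a = b" if "a \<in> L" "b \<in> L" for a b using e that by (auto dest: inj_onD)
  have L01: "0 \<in> L" "1 \<in> L" using L(1) subring_setD(1,2) unfolding subfield_set_def by blast+
  define v where "v V s = (if germ XM x V s \<in> Units (stalk XM x) then e (\<xi> (germ XM x V s)) else \<zero>\<^bsub>?K L\<^esub>)" for V s
  have vpt: "field_point (?K L) XM x v \<in> space_homs mon0_hom (mspec (mult_monoid (?K L))) XM"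
    unfolding v_def[abs_def]
  proof (rule character_field_point[OF XM x K])
    show "e (\<xi> g) \<in> carrier (?K L)" if "g \<in> Units (stalk XM x)" for g
      using \<xi>(1)[OF that] by (simp add: transport_field_simps)
    show "e (\<xi> \<one>\<^bsub>stalk XM x\<^esub>) = \<one>\<^bsub>?K L\<^esub>" using \<xi>(2) by (simp add: transport_field_simps)
    show "e (\<xi> (g \<otimes>\<^bsub>stalk XM x\<^esub> k)) = e (\<xi> g) \<otimes>\<^bsub>?K L\<^esub> e (\<xi> k)"
      if "g \<in> Units (stalk XM x)" "k \<in> Units (stalk XM x)" for g k
      using \<xi>(3)[OF that] \<xi>(1)[OF that(1)] \<xi>(1)[OF that(2)] transport_field_ops(1)[OF e] by simp
  qed
  have vcl: "v V s \<in> carrier (?K L)" for V s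
    using \<xi>(1) L01 by (auto simp: v_def transport_field_simps)
  obtain z w where z: "z \<in> points XZ"
    and w: "\<And>V. V \<in> opens XZ \<Longrightarrow> z \<in> V \<Longrightarrow> w V \<in> ring_hom (sections XZ V) (?K L)"
    and wc: "\<And>V W t. V \<in> opens XZ \<Longrightarrow> W \<in> opens XZ \<Longrightarrow> z \<in> W \<Longrightarrow> W \<subseteq> V \<Longrightarrow> t \<in> carrier (sections XZ V) \<Longrightarrow>
        w W (res XZ V W t) = w V t"
    and descent: "\<And>(K' :: 'u ring) V t. field K' \<Longrightarrow> carrier K' \<subseteq> carrier (?K L) \<Longrightarrow> mult K' = mult (?K L) \<Longrightarrow> one K' = one (?K L) \<Longrightarrow>
        zero K' = zero (?K L) \<Longrightarrow> add K' = add (?K L) \<Longrightarrow>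
        (\<And>V t. V \<in> opens XZ \<Longrightarrow> z \<in> V \<Longrightarrow> t \<in> carrier (sections XZ V) \<Longrightarrow> w V t \<in> carrier K') \<Longrightarrow>
        V \<in> opens XM \<Longrightarrow> x \<in> V \<Longrightarrow> t \<in> carrier (sections XM V) \<Longrightarrow> v V t \<in> carrier K'"
  proof (rule F1_scheme_descent[OF F K vpt], goal_cases)
    case 1
    show ?case by (rule vcl)
  next
    case (2 z w)
    show ?case by (rule 2(1)[OF 2(2-)])
  qed
  obtain U R where zU: "z \<in> U" and aff: "ring_affine XZ U R" and fg: "ring_fin_gen R"
    using ft z unfolding finite_type_over_int_def by blast
  obtain f \<phi> where "affine_chart XZ U R f \<phi>" by (rule ring_affine_chart[OF XZ aff])
  then interpret C: affine_chart XZ U R f \<phi> .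
  obtain \<rho> where \<rho>: "\<rho> \<in> ring_hom R (?K L)"
    "\<forall>V t. V \<in> opens XZ \<and> z \<in> V \<and> t \<in> carrier (sections XZ V) \<longrightarrow>
      (\<exists>a\<in>carrier R. \<exists>g\<in>carrier R. \<rho> g \<noteq> \<zero>\<^bsub>?K L\<^esub> \<and> w V t \<otimes>\<^bsub>?K L\<^esub> \<rho> g = \<rho> a)"
    by (rule C.point_coordinate_hom[OF K zU w wc])
  define \<sigma> where "\<sigma> a = inv_into L e (\<rho> a)" for a
  have \<sigma>L: "\<sigma> a \<in> L" "\<rho> a = e (\<sigma> a)" if "a \<in> carrier R" for a
  proof -
    have "\<rho> a \<in> e ` L" using ring_hom_closed[OF \<rho>(1) that] by (simp add: transport_field_simps)
    then show "\<sigma> a \<in> L" "\<rho> a = e (\<sigma> a)" unfolding \<sigma>_def by (simp_all add: inv_into_into f_inv_into_f)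
  qed
  have \<sigma>: "hom_to_field R \<sigma>"
    unfolding hom_to_field_def
  proof (intro conjI ballI)
    have "e (\<sigma> \<one>\<^bsub>R\<^esub>) = e 1"
      using ring_hom_one[OF \<rho>(1)] \<sigma>L(2)[OF C.R.one_closed] by (simp add: transport_field_simps)
    then show "\<sigma> \<one>\<^bsub>R\<^esub> = 1" using eL[OF \<sigma>L(1)[OF C.R.one_closed] L01(2)] by simp
    fix a b assume ab: "a \<in> carrier R" "b \<in> carrier R"
    note LD = subring_setD[OF L(1)[unfolded subfield_set_def, THEN conjunct1]]
    have "e (\<sigma> (a \<oplus>\<^bsub>R\<^esub> b)) = e (\<sigma> a + \<sigma> b)"
      using ring_hom_add[OF \<rho>(1) ab] \<sigma>L ab C.R.a_closed[OF ab] transport_field_ops(2)[OF e] by simp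
    then show "\<sigma> (a \<oplus>\<^bsub>R\<^esub> b) = \<sigma> a + \<sigma> b"
      using eL[OF \<sigma>L(1)[OF C.R.a_closed[OF ab]] LD(6)[OF \<sigma>L(1)[OF ab(1)] \<sigma>L(1)[OF ab(2)]]] by simp
    have "e (\<sigma> (a \<otimes>\<^bsub>R\<^esub> b)) = e (\<sigma> a * \<sigma> b)"
      using ring_hom_mult[OF \<rho>(1) ab] \<sigma>L ab C.R.m_closed[OF ab] transport_field_ops(1)[OF e] by simp
    then show "\<sigma> (a \<otimes>\<^bsub>R\<^esub> b) = \<sigma> a * \<sigma> b"
      using eL[OF \<sigma>L(1)[OF C.R.m_closed[OF ab]] LD(4)[OF \<sigma>L(1)[OF ab(1)] \<sigma>L(1)[OF ab(2)]]] by simp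
  qed
  \<comment> \<open>The field of quotients of the image of R; by \<open>point_coordinate_hom\<close>
    all evaluations at the point of \<open>XZ\<close> lie in it.\<close>
  let ?L' = "{\<sigma> a / \<sigma> g | a g. a \<in> carrier R \<and> g \<in> carrier R \<and> \<sigma> g \<noteq> 0}"
  note LD = subring_setD[OF L(1)[unfolded subfield_set_def, THEN conjunct1]]
  have L': "subfield_set ?L'" by (rule subfield_set_quotients[OF \<sigma> C.R])
  have L'L: "?L' \<subseteq> L"
  proof clarify
    fix a g assume ag: "a \<in> carrier R" "g \<in> carrier R"
    have "inverse (\<sigma> g) \<in> L" using L(1) \<sigma>L(1)[OF ag(2)] by (simp add: subfield_set_def)
    then show "\<sigma> a / \<sigma> g \<in> L" unfolding divide_inverse by (rule LD(4)[OF \<sigma>L(1)[OF ag(1)]])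
  qed
  have K': "field (?K ?L')" by (rule field_transport_field[OF e L' L'L])
  have wK': "w V s \<in> carrier (?K ?L')" if V: "V \<in> opens XZ" "z \<in> V" "s \<in> carrier (sections XZ V)" for V s
  proof -
    obtain a g where ag: "a \<in> carrier R" "g \<in> carrier R" "\<rho> g \<noteq> \<zero>\<^bsub>?K L\<^esub>" "w V s \<otimes>\<^bsub>?K L\<^esub> \<rho> g = \<rho> a"
      using \<rho>(2) V by blast
    have "w V s \<in> e ` L" using ring_hom_closed[OF w[OF V(1,2)] V(3)] by (simp add: transport_field_simps)
    then obtain y where y: "y \<in> L" "w V s = e y" by blast
    have g0: "\<sigma> g \<noteq> 0" using ag(3) \<sigma>L(2)[OF ag(2)] by (auto simp: transport_field_simps)
    have "e (y * \<sigma> g) = e (\<sigma> a)"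
      using ag(4) \<sigma>L ag(1,2) y transport_field_ops(1)[OF e] by simp
    then have "y * \<sigma> g = \<sigma> a" using eL[OF LD(4)[OF y(1) \<sigma>L(1)[OF ag(2)]] \<sigma>L(1)[OF ag(1)]] by simp
    then have "y = \<sigma> a / \<sigma> g" using g0 by (simp add: field_simps)
    then have "y \<in> ?L'" using ag(1,2) g0 by blast
    then show ?thesis unfolding transport_field_simps y(2) by (rule imageI)
  qed
  have vK': "v V s \<in> carrier (?K ?L')" if "V \<in> opens XM" "x \<in> V" "s \<in> carrier (sections XM V)" for V s
    by (rule descent[OF K' _ _ _ _ _ wK' that]) (use L'L in \<open>auto simp: transport_field_simps\<close>)
  \<comment> \<open>Each t i is the value of the monoid point at a germ in S; descent puts that
    value into \<open>?L'\<close>.\<close>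
  have quot: "\<exists>a\<in>carrier R. \<exists>g\<in>carrier R. \<sigma> g \<noteq> 0 \<and> t i = \<sigma> a / \<sigma> g" if i: "i < card S" for i
  proof -
    have "i \<in> h ` S" using h i by (simp add: bij_betw_def)
    then obtain g where g: "g \<in> S" "h g = i" by blast
    have gU: "g \<in> Units (stalk XM x)" using S g(1) by (auto simp: int_independent_def units_of_carrier)
    then have "g \<in> carrier (stalk XM x)" by (simp add: Units_def)
    then obtain V s where V: "V \<in> opens XM" "x \<in> V" "s \<in> carrier (sections XM V)" "g = germ XM x V s"
      by (rule XM.stalk_cases)
    have "v V s = e (t i)" using gU V(4) \<xi>(4)[OF g(1)] g(2) by (simp add: v_def)
    then have "e (t i) \<in> e ` ?L'" using vK'[OF V(1-3)] by (simp add: transport_field_simps)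
    then obtain y where y: "y \<in> ?L'" "e (t i) = e y" by blast
    have "t i \<in> L" using L(3) by blast
    moreover have "y \<in> L" using L'L y(1) by blast
    ultimately have "t i = y" using eL y(2) by blast
    then show ?thesis using y(1) by blast
  qed
  obtain Q where Q: "\<And>i. i \<le> card S \<Longrightarrow> primeideal (Q i) R" "\<And>i. i < card S \<Longrightarrow> Q i \<subset> Q (Suc i)"
    "\<And>i n. i \<le> card S \<Longrightarrow> unit_multiple R n \<notin> Q i"
  proof (rule chain_of_primes[OF C.R fg \<sigma>, where r = "card S" and t = t], goal_cases)
    case (1 i)
    show ?case by (rule t)
  next
    case (2 i)
    show ?case by (rule quot[OF 2(2)])
  next
    case (3 Q)
    show ?case by (rule 3(1)[of Q, OF 3(2-)])
  qed
  obtain p \<psi> where p: "\<pi> = (p, \<psi>)" by (cases \<pi>)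
  show ?thesis
    unfolding p by (rule C.krull_dim_fibre_ge[where Q = Q, OF \<pi>[unfolded p] Q])
qed

lemma pt_rank_le_rel_dim:
  fixes F :: "('u, 'v) mr_functor" and XM :: "('p, 'u) mon_space" and XZ :: "('q, 'u) ring_space"
  assumes "infinite (UNIV :: 'u set)" "F1_scheme F XM XZ" "finite_type_over_int XZ"
    and "\<pi> \<in> space_homs ring_hom XZ (rspec int_ring)" and x: "x \<in> points XM"
  shows "ereal (real (pt_rank XM x)) \<le> rel_dim XZ (rspec int_ring) \<pi>"
proof -
  let ?P = "\<lambda>n. \<exists>S. int_independent (units_of (stalk XM x)) S \<and> card S = n"
  have le: "ereal (real n) \<le> rel_dim XZ (rspec int_ring) \<pi>" if "?P n" for n
    using rel_dim_ge_independent[OF assms(1-5)] that by blast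
  \<comment> \<open>The empty family ensures that a greatest cardinality exists as soon as the
    cardinalities are bounded.\<close>
  have P0: "?P 0"
    by (intro exI[of _ "{}"]) (simp add: int_independent_def)
  show ?thesis
  proof (cases "\<exists>b. \<forall>n. ?P n \<longrightarrow> n \<le> b")
    case True
    then obtain b where b: "\<forall>n. ?P n \<longrightarrow> n \<le> b" by blast
    have "?P (GREATEST n. ?P n)" by (rule GreatestI_nat[of ?P 0 b]) (use P0 b in blast)+
    then show ?thesis unfolding pt_rank_def group_rank_def by (rule le)
  next
    case False
    \<comment> \<open>With unbounded rank, \<open>GREATEST\<close> is unspecified, but then the relative dimension is infinite.\<close>
    have "ereal (real n) \<le> rel_dim XZ (rspec int_ring) \<pi>" for n
    proof -
      obtain m where "?P m" "\<not> m \<le> n" using False by blast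
      then have "ereal (real n) \<le> ereal (real m)" by simp
      also have "\<dots> \<le> rel_dim XZ (rspec int_ring) \<pi>" by (rule le) fact
      finally show ?thesis .
    qed
    then show ?thesis by blast
  qed
qed

text \<open>Both parts rest on \<open>zeta_product\<close>, which asks that |s| exceed every rank;
  in the second part \<open>pt_rank_le_rel_dim\<close> derives this from the bound by the relative
  dimension.\<close>

theorem theorem3p11:
  fixes F :: "('u, 'v) mr_functor"
    and XM :: "('p, 'u) mon_space"
    and XZ :: "('q, 'u) ring_space"
  assumes "infinite (UNIV :: 'u set)"
    and "F1_scheme F XM XZ"
    and "F1_noetherian F XZ"
    and "F1_torsion_free XM"
  shows "(\<forall>s. (\<forall>x\<in>points XM. cmod s > real (pt_rank XM x)) \<longrightarrow>
            convergent_prod (zeta_factor XM s) \<and>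
            absolute_zeta (counting_function XM) s =
              (1 / s) powi poly (counting_function XM) 1 * (\<Prod>i. zeta_factor XM s i)) \<and>
         (finite_type_over_int XZ \<longrightarrow>
            (\<forall>\<pi>\<in>space_homs ring_hom XZ (rspec int_ring). \<forall>s.
               ereal (cmod s) > rel_dim XZ (rspec int_ring) \<pi> \<longrightarrow>
               abs_convergent_prod (zeta_factor XM s)))"
proof (intro conjI allI impI ballI)
  fix s :: complex
  assume s: "\<forall>x\<in>points XM. cmod s > real (pt_rank XM x)"
  show "convergent_prod (zeta_factor XM s)"
    using zeta_product(2)[of XM s] s by (intro abs_convergent_prod_imp_convergent_prod) blast
  show "absolute_zeta (counting_function XM) s =
      (1 / s) powi poly (counting_function XM) 1 * (\<Prod>i. zeta_factor XM s i)"
    using s by (intro zeta_product(1)) blast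
next
  fix \<pi> and s :: complex
  assume ft: "finite_type_over_int XZ" and \<pi>: "\<pi> \<in> space_homs ring_hom XZ (rspec int_ring)"
    and s: "ereal (cmod s) > rel_dim XZ (rspec int_ring) \<pi>"
  have "real (pt_rank XM x) < cmod s" if "x \<in> points XM" for x
    using le_less_trans[OF pt_rank_le_rel_dim[OF assms(1,2) ft \<pi> that] s] by simp
  then show "abs_convergent_prod (zeta_factor XM s)" by (rule zeta_product(2))
qed

end
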